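(* Let $n\in\mathbb{N}$ be a positive integer, and let $s>0$ with $s\neq 1$. Define $$ m_s= \begin{cases} -\dfrac{ns}{2}-ns(1-s), & \text{if } 0<s<1,\\[4pt] -\dfrac{ns}{2}, & \text{if } 1<s\le 2,\\[4pt] -n(s-1), & \text{if } 2<s<\infty . \end{cases} $$ Let $m<m_s$. Then for every $\sigma\in S^m_{1,0}(\mathbb{R}^{2n})$ the function $$ e^{i(|\xi|^s+|\eta|^s+|\xi+\eta|^s)}\,\sigma(\xi,\eta),\qquad (\xi,\eta)\in\mathbb{R}^n\times\mathbb{R}^n, $$ is a bilinear Fourier multiplier for $L^\infty\times L^\infty\to L^\infty$, for $L^1\times L^\infty\to L^1$, and for $L^\infty\times L^1\to L^1$ (all spaces being on $\mathbb{R}^n$).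
   Context: Symbol class: for $d\in\mathbb{N}$ and $m\in\mathbb{R}$, $S^m_{1,0}(\mathbb{R}^d)$ is the set of all $\sigma\in C^\infty(\mathbb{R}^d)$ such that for every multi-index $\alpha\in\{0,1,2,\dots\}^d$ there is a constant $C_\alpha$ with $|\partial^\alpha_\zeta\sigma(\zeta)|\le C_\alpha(1+|\zeta|)^{m-|\alpha|}$ for all $\zeta\in\mathbb{R}^d$. Fourier transform: $\widehat f(\xi)=\int_{\mathbb{R}^n}e^{-i\xi\cdot x}f(x)\,dx$. Bilinear Fourier multipliers: for a measurable function $\tau=\tau(\xi,\eta)$ on $\mathbb{R}^n\times\mathbb{R}^n$ with $|\tau(\xi,\eta)|\le c(1+|\xi|+|\eta|)^L$ for some $c>0$, $L\in\mathbb{R}$, define for $f,g$ in the Schwartz class $\mathcal{S}(\mathbb{R}^n)$ $$ T_\tau(f,g)(x)=\frac{1}{(2\pi)^{2n}}\iint_{\mathbb{R}^n\times\mathbb{R}^n}e^{ix\cdot(\xi+\eta)}\tau(\xi,\eta)\widehat f(\xi)\widehat g(\eta)\,d\xi\,d\eta . $$ For function spaces $X,Y,Z$ on $\mathbb{R}^n$, $\tau$ is a bilinear Fourier multiplier for $X\times Y\to Z$ if there is a constant $A>0$ such that $\|T_\tau(f,g)\|_Z\le A\|f\|_X\|g\|_Y$ for all $f\in\mathcal{S}\cap X$ and $g\in\mathcal{S}\cap Y$. *)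

theory Defs
  imports "HOL-Analysis.Analysis" "HOL-Probability.Essential_Supremum"
begin

section \<open>Smooth functions and multi-index derivatives\<close>

definition partial_deriv :: "'a \<Rightarrow> ('a::euclidean_space \<Rightarrow> 'b::real_normed_vector) \<Rightarrow> 'a \<Rightarrow> 'b"
  where "partial_deriv b f x = frechet_derivative f (at x) b"

primrec Ck_fun :: "nat \<Rightarrow> ('a::euclidean_space \<Rightarrow> 'b::real_normed_vector) \<Rightarrow> bool"
  where
    "Ck_fun 0 f \<longleftrightarrow> continuous_on UNIV f"
  | "Ck_fun (Suc k) f \<longleftrightarrow>
       (\<forall>x. f differentiable (at x)) \<and> (\<forall>v. Ck_fun k (partial_deriv v f))"

definition smooth_fun :: "('a::euclidean_space \<Rightarrow> 'b::real_normed_vector) \<Rightarrow> bool"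
  where "smooth_fun f \<longleftrightarrow> (\<forall>k. Ck_fun k f)"

text \<open>
  A multi-index is a map \<open>\<alpha>\<close> giving the order of differentiation in each coordinate direction
  \<open>b \<in> Basis\<close>; its values outside \<open>Basis\<close> are irrelevant. The coordinates are processed in an
  arbitrary but fixed order, which does not matter for smooth functions.
\<close>

definition basis_list :: "'a::euclidean_space list"
  where "basis_list = (SOME bs. distinct bs \<and> set bs = Basis)"

definition multi_deriv ::
    "('a \<Rightarrow> nat) \<Rightarrow> ('a::euclidean_space \<Rightarrow> 'b::real_normed_vector) \<Rightarrow> 'a \<Rightarrow> 'b"
  where "multi_deriv \<alpha> f = foldr (\<lambda>b. partial_deriv b ^^ \<alpha> b) basis_list f"

definition multi_order :: "('a::euclidean_space \<Rightarrow> nat) \<Rightarrow> nat"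
  where "multi_order \<alpha> = (\<Sum>b\<in>Basis. \<alpha> b)"

definition symbol_class :: "real \<Rightarrow> ('a::euclidean_space \<Rightarrow> complex) set"
  where "symbol_class m = {\<sigma>. smooth_fun \<sigma> \<and>
    (\<forall>\<alpha>. \<exists>C. \<forall>\<zeta>. norm (multi_deriv \<alpha> \<sigma> \<zeta>) \<le> C * (1 + norm \<zeta>) powr (m - real (multi_order \<alpha>)))}"

definition schwartz_class :: "('a::euclidean_space \<Rightarrow> complex) set"
  where "schwartz_class = {f. smooth_fun f \<and>
    (\<forall>\<alpha> (N::nat). \<exists>C. \<forall>x. (1 + norm x) ^ N * norm (multi_deriv \<alpha> f x) \<le> C)}"

section \<open>Bilinear Fourier multipliers\<close>

definition fourier :: "('a::euclidean_space \<Rightarrow> complex) \<Rightarrow> 'a \<Rightarrow> complex"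
  where "fourier f \<xi> = (LINT x|lebesgue. cis (- (\<xi> \<bullet> x)) * f x)"

definition bilinear_op ::
    "('a \<times> 'a \<Rightarrow> complex) \<Rightarrow> ('a::euclidean_space \<Rightarrow> complex) \<Rightarrow> ('a \<Rightarrow> complex) \<Rightarrow> 'a \<Rightarrow> complex"
  where "bilinear_op \<tau> f g x = (1 / (2 * pi) ^ (2 * DIM('a))) *\<^sub>R
    (LINT (\<xi>, \<eta>)|lebesgue. cis (x \<bullet> (\<xi> + \<eta>)) * \<tau> (\<xi>, \<eta>) * fourier f \<xi> * fourier g \<eta>)"

definition L1_norm :: "('a::euclidean_space \<Rightarrow> complex) \<Rightarrow> ennreal"
  where "L1_norm f = (\<integral>\<^sup>+x. ennreal (norm (f x)) \<partial>lebesgue)"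

definition Linf_norm :: "('a::euclidean_space \<Rightarrow> complex) \<Rightarrow> ennreal"
  where "Linf_norm f = esssup lebesgue (\<lambda>x. ennreal (norm (f x)))"

text \<open>
  Function spaces enter through their extended norms: the space belonging to \<open>N\<close> consists of the
  measurable functions on which \<open>N\<close> is finite.
\<close>

definition space_of_norm ::
    "(('a::euclidean_space \<Rightarrow> complex) \<Rightarrow> ennreal) \<Rightarrow> ('a \<Rightarrow> complex) set"
  where "space_of_norm N = {f \<in> borel_measurable lebesgue. N f < \<infinity>}"

text \<open>
  The first two conjuncts are the standing assumptions under which \<open>bilinear_op \<tau>\<close> is given by an
  absolutely convergent integral; without them the Bochner integral would silently be \<open>0\<close>.
\<close>

definition bilinear_multiplier ::
    "(('a::euclidean_space \<Rightarrow> complex) \<Rightarrow> ennreal) \<Rightarrow> (('a \<Rightarrow> complex) \<Rightarrow> ennreal) \<Rightarrow>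
     (('a \<Rightarrow> complex) \<Rightarrow> ennreal) \<Rightarrow> ('a \<times> 'a \<Rightarrow> complex) \<Rightarrow> bool"
  where "bilinear_multiplier X Y Z \<tau> \<longleftrightarrow>
    \<tau> \<in> borel_measurable lebesgue \<and>
    (\<exists>c>0. \<exists>L. \<forall>\<xi> \<eta>. norm (\<tau> (\<xi>, \<eta>)) \<le> c * (1 + norm \<xi> + norm \<eta>) powr L) \<and>
    (\<exists>A>0. \<forall>f \<in> schwartz_class \<inter> space_of_norm X. \<forall>g \<in> schwartz_class \<inter> space_of_norm Y.
       Z (bilinear_op \<tau> f g) \<le> ennreal A * X f * Y g)"

definition crit_order :: "nat \<Rightarrow> real \<Rightarrow> real"
  where "crit_order n s =
    (if s < 1 then - (real n * s / 2) - real n * s * (1 - s)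
     else if s \<le> 2 then - (real n * s / 2)
     else - (real n * (s - 1)))"

end

theory Submission
  imports Defs "HOL-Probability.Characteristic_Functions"
begin

text \<open>
  Cut the symbol off dyadically in the joint frequency and in each of \<open>\<xi>\<close>, \<open>\<eta>\<close> and \<open>\<xi> + \<eta>\<close>, and let
  \<open>K\<^sub>k\<close> be the inverse Fourier transform of \<open>cis (norm \<xi> powr s)\<close> cut off to \<open>norm \<xi> \<sim> 2 ^ k\<close>. On each
  dyadic block \<open>\<sigma>\<close> is a superposition of exponentials with total mass \<open>O(2 powr (j * m))\<close>; exponentials
  only translate the factors, so everything reduces to the form
  \<open>\<integral> K\<^bsub>k0\<^esub>(x - y) (K\<^bsub>k1\<^esub> * f)(y) (K\<^bsub>k2\<^esub> * g)(y) dy\<close>. The kernel \<open>K\<^bsub>k0\<^esub>\<close> is bounded by the dispersive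
  estimate and concentrated on a ball of radius \<open>R\<close>, about \<open>2 powr (k * (s - 1))\<close>. For bounded \<open>f\<close> the
  functions \<open>K\<^sub>k * f\<close> are bounded in the mean square over such balls without any loss, by Plancherel
  inside and kernel decay outside. Cauchy--Schwarz then gives the supremum bound; as the form is
  symmetric in its three factors, duality lets the factor in \<open>L\<^sup>1\<close> take over the role of \<open>K\<^bsub>k0\<^esub>\<close>. For
  \<open>s < 1\<close> the low frequencies have the larger radius, and a factor whose radius exceeds \<open>R\<close> too much
  is estimated in the supremum norm. The blocks lose \<open>- crit_order n s\<close> up to \<open>\<epsilon>\<close>, so the sum over
  them converges for \<open>m < crit_order n s\<close>.
\<close>

section \<open>Integration on Euclidean space\<close>

text \<open>The kernel at frequency 2^k has L^1 norm about 2^(k n s/2), so three separate bounds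
  would lose 3 n s/2. Mean squares over a ball of radius R cost nothing, and only the supremum of
  the outer kernel times R^n remains. For s > 1 the common radius is that of the top frequency 2^J,
  and the exponent is n (k0 (1 - s/2) + J (s - 1)). The coefficient of k0 changes sign at s = 2: the
  worst k0 is J below and 0 above, whence n s/2 and n (s - 1). For s < 1 a factor of low frequency
  2^k1 forces a choice: enlarge R to its radius, or pay 2^(k1 n s/2). The switch at k1 = (1 - s) k0
  keeps the cost of enlarging at n k0 (s/2 + s (1 - s)), the critical order. Smoothness is recorded
  only by iterated derivatives along one vector whose length carries the scale: decay of a transform
  in the largest coordinate is decay in norm, so no mixed derivatives occur. The phase is not smooth
  at the origin; the kernel of the lowest block decays only with exponents below n + s, and sums
  over dyadic balls must get by with that.\<close>

lemma nn_integral_lborel_affine: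
  fixes f :: "'a::euclidean_space \<Rightarrow> ennreal"
  assumes [measurable]: "f \<in> borel_measurable borel" and c: "c \<noteq> 0"
  shows "(\<integral>\<^sup>+x. f x \<partial>lborel) = ennreal (\<bar>c\<bar> ^ DIM('a)) * (\<integral>\<^sup>+x. f (t + c *\<^sub>R x) \<partial>lborel)"
  by (subst lborel_affine[OF c, of t])
     (simp add: nn_integral_density nn_integral_distr nn_integral_cmult)

lemma integrable_lborel_affine_iff:
  fixes f :: "'a::euclidean_space \<Rightarrow> 'b::{banach, second_countable_topology}"
  assumes [measurable]: "f \<in> borel_measurable borel" and c: "c \<noteq> 0"
  shows "integrable lborel (\<lambda>x. f (t + c *\<^sub>R x)) \<longleftrightarrow> integrable lborel f"
proof -
  have "(\<integral>\<^sup>+x. ennreal (norm (f x)) \<partial>lborel)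
     = ennreal (\<bar>c\<bar> ^ DIM('a)) * (\<integral>\<^sup>+x. norm (f (t + c *\<^sub>R x)) \<partial>lborel)"
    by (rule nn_integral_lborel_affine[OF _ c]) auto
  moreover have "\<bar>c\<bar> ^ DIM('a) > 0" using c by simp
  ultimately show ?thesis
    unfolding integrable_iff_bounded
    by (auto simp: ennreal_mult_less_top ennreal_mult_eq_top_iff less_top[symmetric])
qed

lemma integral_lborel_affine:
  fixes f :: "'a::euclidean_space \<Rightarrow> 'b::{banach, second_countable_topology}"
  assumes [measurable]: "f \<in> borel_measurable borel" and c: "c \<noteq> 0"
  shows "(LINT x|lborel. f x) = (\<bar>c\<bar> ^ DIM('a)) *\<^sub>R (LINT x|lborel. f (t + c *\<^sub>R x))"
  by (subst lborel_affine[OF c, of t])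
     (simp add: integral_density integral_distr)

text \<open>Lebesgue measure is the image of the product of one-dimensional Lebesgue measures under
  the coordinate map, so product functions integrate factor by factor. Used for Gaussians and for
  products of functions 1 / (1 + t^2), which serve as majorants.\<close>

lemma
  fixes f :: "'a::euclidean_space \<Rightarrow> real \<Rightarrow> complex"
  assumes int: "\<And>b. b \<in> Basis \<Longrightarrow> integrable lborel (f b)"
  shows integrable_lborel_prod_Basis: "integrable lborel (\<lambda>x. \<Prod>b\<in>Basis. f b (x \<bullet> b))"
    and integral_lborel_prod_Basis:
      "(LINT x|lborel. (\<Prod>b\<in>Basis. f b (x \<bullet> b))) = (\<Prod>b\<in>Basis. LINT x|lborel. f b x)"
proof -
  interpret product_sigma_finite "\<lambda>b::'a. lborel :: real measure" ..
  have m: "f b \<in> borel_measurable borel" if "b \<in> Basis" for b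
    using int[OF that] by (simp add: borel_measurable_integrable)
  have m1: "(\<lambda>x. f b (x \<bullet> b)) \<in> borel_measurable borel" if "b \<in> Basis" for b
    using m[OF that] by measurable
  have [measurable]: "(\<lambda>x. \<Prod>b\<in>Basis. f b (x \<bullet> b)) \<in> borel_measurable borel"
    by (intro borel_measurable_prod m1)
  have T[measurable]: "(\<lambda>g. \<Sum>b\<in>Basis. g b *\<^sub>R b) \<in> measurable (\<Pi>\<^sub>M b\<in>(Basis::'a set). lborel) borel"
    by measurable
  have c: "(\<Prod>b\<in>Basis. f b ((\<Sum>i\<in>Basis. g i *\<^sub>R i) \<bullet> b)) = (\<Prod>b\<in>Basis. f b (g b))" for g
    by (intro prod.cong) (auto simp: inner_sum_left inner_Basis if_distrib sum.delta cong: if_cong)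
  have *: "integrable (\<Pi>\<^sub>M b\<in>Basis. lborel) (\<lambda>g. \<Prod>b\<in>(Basis::'a set). f b (g b))"
    by (intro product_integrable_prod int) auto
  show "integrable lborel (\<lambda>x. \<Prod>b\<in>Basis. f b (x \<bullet> b))"
    unfolding lborel_eq[where 'a='a] by (subst integrable_distr_eq) (use * in \<open>simp_all add: c\<close>)
  show "(LINT x|lborel. (\<Prod>b\<in>Basis. f b (x \<bullet> b))) = (\<Prod>b\<in>Basis. LINT x|lborel. f b x)"
    unfolding lborel_eq[where 'a='a]
    by (subst integral_distr) (use int in \<open>simp_all add: c product_integral_prod\<close>)
qed

section \<open>Gaussians\<close>

text \<open>This is the characteristic function of the standard normal distribution with the
  normalising constant removed. Inversion and Plancherel both rest on this one explicit
  transform.\<close>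

lemma
  shows integrable_cis_gauss_real: "integrable lborel (\<lambda>x::real. cis (t * x) * complex_of_real (exp (- x\<^sup>2 / 2)))" (is ?A)
    and integral_cis_gauss_real: "(LINT x|lborel. cis (t * x) * complex_of_real (exp (- x\<^sup>2 / 2))) =
       complex_of_real (sqrt (2 * pi) * exp (- t\<^sup>2 / 2))" (is ?B)
proof -
  have e: "complex_of_real (exp (- x\<^sup>2 / 2)) = complex_of_real (sqrt (2 * pi)) * complex_of_real (std_normal_density x)" for x
    by (simp add: std_normal_density_def flip: of_real_mult of_real_divide)
  have i: "integrable lborel (\<lambda>x. complex_of_real (std_normal_density x) * cis (t * x))"
  proof (rule Bochner_Integration.integrable_bound)
    show "integrable lborel (\<lambda>x. std_normal_density x)" by simp
    show "(\<lambda>x. complex_of_real (std_normal_density x) * cis (t * x)) \<in> borel_measurable lborel"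
      by (auto intro!: borel_measurable_times borel_measurable_continuous_onI continuous_intros simp: normal_density_def)
  qed (auto simp: norm_mult)
  have "char std_normal_distribution t = exp (-(t\<^sup>2)/2)" by (rule char_std_normal_distribution[THEN fun_cong])
  moreover have "char std_normal_distribution t = (LINT x|lborel. complex_of_real (std_normal_density x) * cis (t * x))"
    unfolding char_def by (subst integral_density)
      (auto simp: scaleR_conv_of_real cis_conv_exp intro!: borel_measurable_continuous_onI continuous_intros)
  ultimately have v: "(LINT x|lborel. complex_of_real (std_normal_density x) * cis (t * x)) = complex_of_real (exp (-(t\<^sup>2)/2))" by simp
  have eq: "cis (t * x) * complex_of_real (exp (- x\<^sup>2 / 2)) = complex_of_real (sqrt (2 * pi)) * (complex_of_real (std_normal_density x) * cis (t * x))" for x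
    by (subst e) (simp add: algebra_simps)
  show ?A unfolding eq using i by simp
  show ?B unfolding eq by (simp only: integral_mult_right_zero v of_real_mult)
qed

text \<open>A convergence factor: as e tends to 0 it tends to 1 pointwise, and its transform is a
  multiple of \<open>gauss (1/e)\<close>, which concentrates at the origin. The scaling inside the
  norm makes the dilation rule definitional.\<close>

definition gauss :: "real \<Rightarrow> 'a::euclidean_space \<Rightarrow> real"
  where "gauss e x = exp (- (norm (e *\<^sub>R x))\<^sup>2 / 2)"

lemma gauss_measurable[measurable]: "gauss e \<in> borel_measurable borel"
  unfolding gauss_def by measurable

lemma gauss_pos[simp]: "gauss e x > 0" and gauss_le_1[simp]: "gauss e x \<le> 1"
  by (auto simp: gauss_def)

lemma gauss_nonneg[simp]: "gauss e x \<ge> 0" by (simp add: less_imp_le)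

lemma cis_sum: "cis (sum f A) = (\<Prod>b\<in>A. cis (f b))"
  by (induction A rule: infinite_finite_induct) (auto simp flip: cis_mult)

lemma gauss_1_prod:
  "cis (x \<bullet> t) * complex_of_real (gauss 1 (x::'a::euclidean_space)) =
   (\<Prod>b\<in>Basis. cis ((t \<bullet> b) * (x \<bullet> b)) * complex_of_real (exp (- (x \<bullet> b)\<^sup>2 / 2)))"
proof -
  have "cis (x \<bullet> t) = (\<Prod>b\<in>Basis. cis ((t \<bullet> b) * (x \<bullet> b)))"
    by (subst euclidean_inner) (simp add: cis_sum mult.commute)
  moreover have "exp (- (norm x)\<^sup>2 / 2) = (\<Prod>b\<in>Basis. exp (- (x \<bullet> b)\<^sup>2 / 2))"
  proof -
    have "(norm x)\<^sup>2 = (\<Sum>b\<in>Basis. (x \<bullet> b)\<^sup>2)"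
      unfolding power2_norm_eq_inner by (subst euclidean_inner) (simp add: power2_eq_square)
    then show ?thesis by (simp add: sum_negf sum_divide_distrib flip: exp_sum)
  qed
  ultimately show ?thesis by (simp add: gauss_def prod.distrib)
qed

lemma
  fixes t :: "'a::euclidean_space"
  shows integrable_cis_gauss_1: "integrable lborel (\<lambda>x. cis (x \<bullet> t) * complex_of_real (gauss 1 x))"
    and integral_cis_gauss_1: "(LINT x|lborel. cis (x \<bullet> t) * complex_of_real (gauss 1 x)) =
      complex_of_real (sqrt (2 * pi) ^ DIM('a) * gauss 1 t)"
proof -
  show "integrable lborel (\<lambda>x. cis (x \<bullet> t) * complex_of_real (gauss 1 x))"
    unfolding gauss_1_prod by (rule integrable_lborel_prod_Basis[OF integrable_cis_gauss_real])
  have "(LINT x|lborel. cis (x \<bullet> t) * complex_of_real (gauss 1 x)) =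
     (\<Prod>b\<in>(Basis::'a set). complex_of_real (sqrt (2 * pi) * exp (- (t \<bullet> b)\<^sup>2 / 2)))"
    unfolding gauss_1_prod by (subst integral_lborel_prod_Basis[OF integrable_cis_gauss_real])
      (simp only: integral_cis_gauss_real)
  also have "\<dots> = complex_of_real (sqrt (2 * pi)) ^ DIM('a) * complex_of_real (gauss 1 t)"
    using gauss_1_prod[of t 0] by (simp add: prod.distrib)
  finally show "(LINT x|lborel. cis (x \<bullet> t) * complex_of_real (gauss 1 x)) =
      complex_of_real (sqrt (2 * pi) ^ DIM('a) * gauss 1 t)" by simp
qed

lemma
  fixes t :: "'a::euclidean_space"
  assumes e: "e > 0"
  shows integrable_cis_gauss: "integrable lborel (\<lambda>x. cis (x \<bullet> t) * complex_of_real (gauss e x))"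
    and integral_cis_gauss: "(LINT x|lborel. cis (x \<bullet> t) * complex_of_real (gauss e x)) =
      complex_of_real ((sqrt (2 * pi) / e) ^ DIM('a) * gauss (1/e) t)"
proof -
  have eq: "cis (x \<bullet> t) * complex_of_real (gauss e x) =
    cis ((0 + e *\<^sub>R x) \<bullet> ((1/e) *\<^sub>R t)) * complex_of_real (gauss 1 (0 + e *\<^sub>R x))" for x
    using e by (simp add: gauss_def)
  have m[measurable]: "(\<lambda>x::'a. cis (x \<bullet> ((1/e) *\<^sub>R t)) * complex_of_real (gauss 1 x)) \<in> borel_measurable borel"
    using integrable_cis_gauss_1[of "(1/e) *\<^sub>R t"] borel_measurable_integrable by force
  show "integrable lborel (\<lambda>x. cis (x \<bullet> t) * complex_of_real (gauss e x))"
    unfolding eq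
    using integrable_cis_gauss_1[of "(1/e) *\<^sub>R t"] e by (subst integrable_lborel_affine_iff[OF m]) auto
  have "complex_of_real (sqrt (2 * pi) ^ DIM('a) * gauss 1 ((1/e) *\<^sub>R t)) =
     (\<bar>e\<bar> ^ DIM('a)) *\<^sub>R (LINT x|lborel. cis (x \<bullet> t) * complex_of_real (gauss e x))"
    unfolding eq integral_cis_gauss_1[symmetric]
    by (rule integral_lborel_affine[OF m]) (use e in auto)
  moreover have "gauss 1 ((1/e) *\<^sub>R t) = gauss (1/e) t" by (simp add: gauss_def)
  ultimately show "(LINT x|lborel. cis (x \<bullet> t) * complex_of_real (gauss e x)) =
      complex_of_real ((sqrt (2 * pi) / e) ^ DIM('a) * gauss (1/e) t)"
    using e by (simp add: scaleR_conv_of_real field_simps)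
qed

lemma
  assumes e: "e > 0"
  shows integrable_gauss: "integrable lborel (gauss e :: 'a::euclidean_space \<Rightarrow> real)"
    and integral_gauss: "(LINT x|lborel. gauss e (x::'a)) = (sqrt (2 * pi) / e) ^ DIM('a)"
proof -
  have i: "integrable lborel (\<lambda>x::'a. complex_of_real (gauss e x))"
    using integrable_cis_gauss[OF e, of 0] by simp
  then show "integrable lborel (gauss e :: 'a \<Rightarrow> real)" by (simp add: complex_of_real_integrable_eq)
  have "complex_of_real (LINT x|lborel. gauss e (x::'a)) = complex_of_real ((sqrt (2 * pi) / e) ^ DIM('a))"
    using integral_cis_gauss[OF e, of "0::'a"] by (simp add: gauss_def integral_complex_of_real)
  then show "(LINT x|lborel. gauss e (x::'a)) = (sqrt (2 * pi) / e) ^ DIM('a)"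
    using of_real_eq_iff by blast
qed

section \<open>The Fourier transform\<close>

text \<open>The sign is that of the inverse transform and no power of 2 pi is attached, because the
  kernels below are \<open>ft\<close> of their multipliers. The forward transform of g at \<xi> is
  \<open>ft g (- \<xi>)\<close>, the origin of the reflected arguments throughout.\<close>

definition ft :: "('a::euclidean_space \<Rightarrow> complex) \<Rightarrow> 'a \<Rightarrow> complex"
  where "ft u x = (LINT \<xi>|lborel. cis (x \<bullet> \<xi>) * u \<xi>)"

lemma cis_measurable[measurable]: "cis \<in> borel_measurable borel"
  by (intro borel_measurable_continuous_onI continuous_intros)

lemma cnj_measurable[measurable]: "cnj \<in> borel_measurable borel"
  by (intro borel_measurable_continuous_onI continuous_intros)

lemma ft_measurable[measurable]:
  assumes [measurable]: "u \<in> borel_measurable borel"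
  shows "ft u \<in> borel_measurable borel"
  unfolding ft_def[abs_def] by measurable

lemma integrable_cis_mult:
  assumes "integrable M u" and [measurable]: "f \<in> borel_measurable M"
  shows "integrable M (\<lambda>x. cis (f x) * u x)"
  by (rule Bochner_Integration.integrable_bound[OF assms(1)])
     (use assms(1) in \<open>auto simp: norm_mult\<close>)

lemma norm_ft_le:
  assumes "integrable lborel u"
  shows "norm (ft u x) \<le> (LINT \<xi>|lborel. norm (u \<xi>))"
proof -
  have "norm (ft u x) \<le> (LINT \<xi>|lborel. norm (cis (x \<bullet> \<xi>) * u \<xi>))"
    unfolding ft_def by (rule integral_norm_bound)
  then show ?thesis by (simp add: norm_mult)
qed

lemma integrable_lborel_pair_mult:
  fixes u :: "'a::euclidean_space \<Rightarrow> complex" and v :: "'b::euclidean_space \<Rightarrow> complex"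
  assumes u: "integrable lborel u" and v: "integrable lborel v"
  shows "integrable (lborel \<Otimes>\<^sub>M lborel) (\<lambda>(x, y). u x * v y)"
proof -
  have [measurable]: "u \<in> borel_measurable borel" "v \<in> borel_measurable borel"
    using u v by auto
  show ?thesis
    by (rule lborel_pair.Fubini_integrable) (use u v in \<open>auto simp: norm_mult\<close>)
qed

lemma ft_mult_formula:
  assumes u: "integrable lborel u" and v: "integrable lborel v"
  shows "(LINT x|lborel. ft u x * v x) = (LINT \<xi>|lborel. u \<xi> * ft v \<xi>)"
proof -
  have [measurable]: "u \<in> borel_measurable borel" "v \<in> borel_measurable borel"
    using u v by auto
  have "integrable (lborel \<Otimes>\<^sub>M lborel) (\<lambda>p. cis (fst p \<bullet> snd p) * (case p of (x, \<xi>) \<Rightarrow> v x * u \<xi>))"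
    by (intro integrable_cis_mult integrable_lborel_pair_mult u v) measurable
  then have i: "integrable (lborel \<Otimes>\<^sub>M lborel) (\<lambda>(x, \<xi>). cis (x \<bullet> \<xi>) * (v x * u \<xi>))"
    by (simp add: split_beta')
  have "(LINT x|lborel. ft u x * v x) = (LINT x|lborel. (LINT \<xi>|lborel. cis (x \<bullet> \<xi>) * (v x * u \<xi>)))"
    unfolding ft_def by (simp flip: integral_mult_left_zero integral_mult_right_zero add: mult_ac)
  also have "\<dots> = (LINT \<xi>|lborel. (LINT x|lborel. cis (x \<bullet> \<xi>) * (v x * u \<xi>)))"
    by (rule lborel_pair.Fubini_integral[OF i, symmetric])
  also have "\<dots> = (LINT \<xi>|lborel. u \<xi> * ft v \<xi>)"
    unfolding ft_def by (simp flip: integral_mult_left_zero integral_mult_right_zero add: mult_ac inner_commute)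
  finally show ?thesis .
qed

lemma ft_cis_gauss:
  fixes x y :: "'a::euclidean_space"
  assumes "e > 0"
  shows "ft (\<lambda>\<xi>. cis (\<xi> \<bullet> y) * complex_of_real (gauss e \<xi>)) x =
    complex_of_real ((sqrt (2 * pi) / e) ^ DIM('a) * gauss (1/e) (x + y))"
proof -
  have "cis (x \<bullet> \<xi>) * (cis (\<xi> \<bullet> y) * complex_of_real (gauss e \<xi>))
     = cis (\<xi> \<bullet> (x + y)) * complex_of_real (gauss e \<xi>)" for \<xi>
    by (simp add: inner_add_right inner_commute mult.assoc[symmetric] del: mult_cancel_right) (simp add: cis_mult inner_commute)
  then show ?thesis unfolding ft_def by (simp only: integral_cis_gauss[OF assms])
qed

text \<open>A Gaussian factor on one side becomes on the other an average against a Gaussian of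
  width e centred at -y. Inversion and Plancherel both start from this identity and let e tend to 0
  afterwards.\<close>

lemma ft_gauss_damped:
  fixes u :: "'a::euclidean_space \<Rightarrow> complex"
  assumes e: "e > 0" and u: "integrable lborel u"
  shows "(LINT x|lborel. ft u x * (cis (x \<bullet> y) * complex_of_real (gauss e x))) =
    (LINT \<xi>|lborel. u \<xi> * complex_of_real ((sqrt (2 * pi) / e) ^ DIM('a) * gauss (1/e) (\<xi> + y)))"
  by (subst ft_mult_formula[OF u integrable_cis_gauss[OF e]]) (simp only: ft_cis_gauss[OF e])

text \<open>Integrability of \<open>ft u\<close> allows the Gaussian factor to be removed by
  dominated convergence; on the other side continuity and boundedness of u turn the Gaussian
  averages into the point value. The constant is the square of the Gaussian integral
  \<open>sqrt (2 * pi) ^ DIM('a)\<close>.\<close>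

theorem fourier_inversion:
  fixes u :: "'a::euclidean_space \<Rightarrow> complex"
  assumes u: "integrable lborel u" and fu: "integrable lborel (ft u)"
    and cont: "continuous_on UNIV u" and bd: "\<And>x. norm (u x) \<le> B"
  shows "(LINT x|lborel. cis (- (x \<bullet> \<xi>)) * ft u x) = (2 * pi) ^ DIM('a) * u \<xi>"
proof -
  define c where "c = sqrt (2 * pi) ^ DIM('a)"
  define e where "e m = inverse (real (Suc m))" for m
  have e0: "e m > 0" for m by (simp add: e_def)
  have elim: "e \<longlonglongrightarrow> 0" unfolding e_def by (rule LIMSEQ_inverse_real_of_nat)
  have [measurable]: "u \<in> borel_measurable borel" using u by auto
  have B: "B \<ge> 0" using bd[of 0] norm_ge_zero order_trans by blast
  have l1: "(\<lambda>m. LINT x|lborel. ft u x * (cis (x \<bullet> (-\<xi>)) * complex_of_real (gauss (e m) x)))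
      \<longlonglongrightarrow> (LINT x|lborel. ft u x * (cis (x \<bullet> (-\<xi>)) * complex_of_real 1))"
  proof (rule integral_dominated_convergence[where w="\<lambda>x. norm (ft u x)"])
    show "AE x in lborel. (\<lambda>m. ft u x * (cis (x \<bullet> (-\<xi>)) * complex_of_real (gauss (e m) x)))
        \<longlonglongrightarrow> ft u x * (cis (x \<bullet> (-\<xi>)) * complex_of_real 1)"
    proof (rule AE_I2)
      fix x :: 'a
      have "(\<lambda>m. exp (- (norm (e m *\<^sub>R x))\<^sup>2 / 2)) \<longlonglongrightarrow> exp (- (norm (0 *\<^sub>R x))\<^sup>2 / 2)"
        by (intro tendsto_intros elim) auto
      then have "(\<lambda>m. gauss (e m) x) \<longlonglongrightarrow> 1" by (simp add: gauss_def)
      then show "(\<lambda>m. ft u x * (cis (x \<bullet> (-\<xi>)) * complex_of_real (gauss (e m) x)))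
        \<longlonglongrightarrow> ft u x * (cis (x \<bullet> (-\<xi>)) * complex_of_real 1)" by (intro tendsto_intros)
    qed
    show "integrable lborel (\<lambda>x. norm (ft u x))" using fu by simp
    show "AE x in lborel. norm (ft u x * (cis (x \<bullet> - \<xi>) * complex_of_real (gauss (e m) x))) \<le> norm (ft u x)" for m
      by (auto simp: norm_mult mult_left_le)
  qed measurable
  \<comment> \<open>The substitution \<eta> = \<xi> + e z freezes the Gaussian at width 1 and leaves
    all dependence on m in the argument of u.\<close>
  have l2: "(LINT x|lborel. ft u x * (cis (x \<bullet> (-\<xi>)) * complex_of_real (gauss (e m) x)))
     = c * (LINT z|lborel. u (\<xi> + e m *\<^sub>R z) * gauss 1 z)" for m
  proof -
    have "(LINT x|lborel. ft u x * (cis (x \<bullet> (-\<xi>)) * complex_of_real (gauss (e m) x)))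
     = (LINT \<eta>|lborel. u \<eta> * complex_of_real ((sqrt (2 * pi) / e m) ^ DIM('a) * gauss (1/e m) (\<eta> + (-\<xi>))))"
      by (rule ft_gauss_damped[OF e0 u])
    also have "\<dots> = (\<bar>e m\<bar> ^ DIM('a)) *\<^sub>R (LINT z|lborel. u (\<xi> + e m *\<^sub>R z) * complex_of_real ((sqrt (2 * pi) / e m) ^ DIM('a) * gauss (1/e m) (\<xi> + e m *\<^sub>R z + (-\<xi>))))"
      by (rule integral_lborel_affine) (use e0[of m] in \<open>auto simp del: of_real_mult\<close>)
    also have "\<dots> = (LINT z|lborel. c * (u (\<xi> + e m *\<^sub>R z) * gauss 1 z))"
      unfolding integral_scaleR_right[symmetric] using e0[of m]
      by (intro Bochner_Integration.integral_cong)
         (auto simp: gauss_def c_def scaleR_conv_of_real power_divide)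
    finally show ?thesis by simp
  qed
  have "(\<lambda>m. LINT z|lborel. u (\<xi> + e m *\<^sub>R z) * gauss 1 z) \<longlonglongrightarrow> (LINT z|lborel. u \<xi> * complex_of_real (gauss 1 (z::'a)))"
  proof (rule integral_dominated_convergence[where w="\<lambda>z. B * gauss 1 z"])
    show "AE z in lborel. (\<lambda>m. u (\<xi> + e m *\<^sub>R z) * gauss 1 z) \<longlonglongrightarrow> u \<xi> * complex_of_real (gauss 1 z)"
    proof (rule AE_I2)
      fix z
      have "(\<lambda>m. \<xi> + e m *\<^sub>R z) \<longlonglongrightarrow> \<xi> + 0 *\<^sub>R z" by (intro tendsto_intros elim)
      then have "(\<lambda>m. u (\<xi> + e m *\<^sub>R z)) \<longlonglongrightarrow> u \<xi>"
        using continuous_on_tendsto_compose[OF cont] by force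
      then show "(\<lambda>m. u (\<xi> + e m *\<^sub>R z) * gauss 1 z) \<longlonglongrightarrow> u \<xi> * complex_of_real (gauss 1 z)"
        by (intro tendsto_intros)
    qed
    show "integrable lborel (\<lambda>z::'a. B * gauss 1 z)" using integrable_gauss[of 1, where 'a='a] by simp
    show "AE z in lborel. norm (u (\<xi> + e m *\<^sub>R z) * gauss 1 z) \<le> B * gauss 1 z" for m
      by (auto simp: norm_mult bd intro!: mult_right_mono)
  qed measurable
  then have lim: "(\<lambda>m. c * (LINT z|lborel. u (\<xi> + e m *\<^sub>R z) * gauss 1 z)) \<longlonglongrightarrow> c * (LINT z|lborel. u \<xi> * complex_of_real (gauss 1 (z::'a)))"
    by (intro tendsto_intros)
  have v: "(LINT z|lborel. u \<xi> * complex_of_real (gauss 1 (z::'a))) = u \<xi> * c"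
    using integral_gauss[of 1, where 'a='a] by (simp add: c_def integral_complex_of_real)
  have "(\<lambda>m. LINT x|lborel. ft u x * (cis (x \<bullet> (-\<xi>)) * complex_of_real (gauss (e m) x))) \<longlonglongrightarrow> c * (u \<xi> * c)"
    unfolding l2 v[symmetric] by (rule lim)
  from LIMSEQ_unique[OF l1 this]
  have "(LINT x|lborel. ft u x * (cis (x \<bullet> (-\<xi>)) * complex_of_real 1)) = c * (u \<xi> * c)" .
  moreover have "(LINT x|lborel. cis (- (x \<bullet> \<xi>)) * ft u x) = (LINT x|lborel. ft u x * (cis (x \<bullet> (-\<xi>)) * complex_of_real 1))"
    by (intro Bochner_Integration.integral_cong) (auto simp: mult.commute)
  moreover have "complex_of_real c * (u \<xi> * complex_of_real c) = complex_of_real (c * c) * u \<xi>"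
    by (simp add: mult.commute)
  moreover have "c * c = (2 * pi) ^ DIM('a)"
    by (simp only: c_def power_mult_distrib[symmetric] real_sqrt_mult_self) simp
  ultimately show ?thesis by simp
qed

section \<open>Translations, reflections and the Plancherel inequality\<close>

lemma nn_integral_lborel_translate:
  fixes f :: "'a::euclidean_space \<Rightarrow> ennreal"
  assumes [measurable]: "f \<in> borel_measurable borel"
  shows "(\<integral>\<^sup>+x. f (x + t) \<partial>lborel) = (\<integral>\<^sup>+x. f x \<partial>lborel)"
  using nn_integral_lborel_affine[OF assms, of 1 t] by (simp add: add.commute)

lemma nn_integral_lborel_reflect:
  fixes f :: "'a::euclidean_space \<Rightarrow> ennreal"
  assumes [measurable]: "f \<in> borel_measurable borel"
  shows "(\<integral>\<^sup>+x. f (t - x) \<partial>lborel) = (\<integral>\<^sup>+x. f x \<partial>lborel)"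
  using nn_integral_lborel_affine[OF assms, of "-1" t] by simp

lemma integral_lborel_reflect:
  fixes f :: "'a::euclidean_space \<Rightarrow> complex"
  assumes [measurable]: "f \<in> borel_measurable borel"
  shows "(LINT x|lborel. f (t - x)) = (LINT x|lborel. f x)"
  using integral_lborel_affine[OF assms, of "-1" t] by simp

lemma ennreal_mult_le_half_squares:
  assumes "a \<ge> 0" "b \<ge> 0" "c \<ge> 0"
  shows "ennreal (a * b * c) \<le> ennreal (1/2) * (ennreal (a\<^sup>2) * ennreal c) + ennreal (1/2) * (ennreal (b\<^sup>2) * ennreal c)"
proof -
  have "a * b \<le> 1/2 * a\<^sup>2 + 1/2 * b\<^sup>2" using sum_squares_bound[of a b] by simp
  then have "a * b * c \<le> (1/2 * a\<^sup>2 + 1/2 * b\<^sup>2) * c" using assms by (intro mult_right_mono)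
  then have "a * b * c \<le> 1/2 * (a\<^sup>2 * c) + 1/2 * (b\<^sup>2 * c)" by (simp add: algebra_simps)
  moreover have "ennreal (p * (q * r) + p * (q' * r)) = ennreal p * (ennreal q * ennreal r) + ennreal p * (ennreal q' * ennreal r)"
    if "p \<ge> 0" "q \<ge> 0" "r \<ge> 0" "q' \<ge> 0" for p q r q' :: real
    using that by (simp add: ennreal_mult)
  from this[of "1/2" "a\<^sup>2" c "b\<^sup>2"] have "ennreal (1/2 * (a\<^sup>2 * c) + 1/2 * (b\<^sup>2 * c)) =
      ennreal (1/2) * (ennreal (a\<^sup>2) * ennreal c) + ennreal (1/2) * (ennreal (b\<^sup>2) * ennreal c)"
    using assms by simp
  ultimately show ?thesis by (metis ennreal_leI)
qed

text \<open>With the factor \<open>gauss e\<close> the left side becomes a double integral of u at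
  \<xi>, its conjugate at \<eta> and a Gaussian in \<xi> - \<eta> of total mass (2 pi)^n. The
  inequality 2 a b <= a^2 + b^2 and integration in one of the variables give the bound uniformly in
  e; Fatou's lemma removes the factor.\<close>

theorem plancherel_inequality:
  fixes u :: "'a::euclidean_space \<Rightarrow> complex"
  assumes u: "integrable lborel u"
  shows "(\<integral>\<^sup>+x. ennreal ((norm (ft u x))\<^sup>2) \<partial>lborel) \<le>
    ennreal ((2 * pi) ^ DIM('a)) * (\<integral>\<^sup>+x. ennreal ((norm (u x))\<^sup>2) \<partial>lborel)"
proof -
  have um[measurable]: "u \<in> borel_measurable borel" using u by auto
  define S where "S = (\<integral>\<^sup>+x. ennreal ((norm (u x))\<^sup>2) \<partial>lborel)"
  define A where "A = (LINT \<xi>|lborel. norm (u \<xi>))"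
  have A: "norm (ft u x) \<le> A" for x unfolding A_def by (rule norm_ft_le[OF u])
  \<comment> \<open>The conjugate of \<open>ft u\<close> is again a transform, namely of w, so the
    multiplication formula applies to the squared modulus.\<close>
  define w where "w \<eta> = cnj (u (- \<eta>))" for \<eta>
  have wm[measurable]: "w \<in> borel_measurable borel" unfolding w_def by measurable
  have w: "integrable lborel w"
    using integrable_lborel_affine_iff[OF um, of "-1" 0] u unfolding w_def by simp
  have cnjft: "cnj (ft u x) = ft w x" for x
  proof -
    have "cnj (ft u x) = (LINT \<xi>|lborel. cnj (cis (x \<bullet> \<xi>) * u \<xi>))"
      unfolding ft_def by (simp only: Bochner_Integration.integral_cnj)
    also have "\<dots> = (LINT \<xi>|lborel. cnj (cis (x \<bullet> (0-\<xi>)) * u (0-\<xi>)))"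
      by (rule integral_lborel_reflect[symmetric]) measurable
    finally show ?thesis by (simp add: ft_def w_def cis_cnj)
  qed
  have key: "(\<integral>\<^sup>+x. ennreal ((norm (ft u x))\<^sup>2 * gauss e x) \<partial>lborel) \<le> ennreal ((2 * pi) ^ DIM('a)) * S" if e: "e > 0" for e
  proof -
    define \<Gamma> where "\<Gamma> x = (sqrt (2 * pi) / e) ^ DIM('a) * gauss (1/e) x" for x :: 'a
    have \<Gamma>m[measurable]: "\<Gamma> \<in> borel_measurable borel" unfolding \<Gamma>_def by measurable
    have \<Gamma>0: "\<Gamma> x \<ge> 0" for x using e by (auto simp: \<Gamma>_def)
    define K where "K = (sqrt (2 * pi) / e) ^ DIM('a)"
    have \<Gamma>K: "\<Gamma> x \<le> K" for x using e by (auto simp: \<Gamma>_def K_def intro!: mult_left_le)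
    have \<Gamma>i: "(\<integral>\<^sup>+x. ennreal (\<Gamma> x) \<partial>lborel) = ennreal ((2 * pi) ^ DIM('a))"
    proof -
      have "(\<integral>\<^sup>+x. ennreal (\<Gamma> x) \<partial>lborel) = ennreal (LINT x|lborel. \<Gamma> x)"
        using \<Gamma>0 integrable_gauss[of "1/e"] e unfolding \<Gamma>_def by (intro nn_integral_eq_integral) auto
      also have "(LINT x|lborel. \<Gamma> x) = (sqrt (2 * pi) / e) ^ DIM('a) * (sqrt (2 * pi) / (1/e)) ^ DIM('a)"
        using e unfolding \<Gamma>_def by (simp only: integral_mult_right_zero integral_gauss[of "1/e"] zero_less_divide_1_iff)
      also have "\<dots> = (sqrt (2 * pi) / e * (sqrt (2 * pi) / (1/e))) ^ DIM('a)" by (simp only: power_mult_distrib)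
      also have "sqrt (2 * pi) / e * (sqrt (2 * pi) / (1/e)) = sqrt (2 * pi) * sqrt (2 * pi)" using e by (simp add: field_simps)
      also have "\<dots> = 2 * pi" by (simp only: real_sqrt_mult_self) simp
      finally show ?thesis .
    qed
    have \<Gamma>r: "(\<integral>\<^sup>+\<eta>. ennreal (\<Gamma> (\<xi> - \<eta>)) \<partial>lborel) = ennreal ((2 * pi) ^ DIM('a))" for \<xi>
      by (subst nn_integral_lborel_reflect[of "\<lambda>x. ennreal (\<Gamma> x)"]) (measurable, rule \<Gamma>i)
    have \<Gamma>t: "(\<integral>\<^sup>+\<xi>. ennreal (\<Gamma> (\<xi> - \<eta>)) \<partial>lborel) = ennreal ((2 * pi) ^ DIM('a))" for \<eta>
      using nn_integral_lborel_translate[of "\<lambda>x. ennreal (\<Gamma> x)" "-\<eta>"] \<Gamma>i by simp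
    have half: "ennreal (1/2) + ennreal (1/2) = 1" by (subst ennreal_plus[symmetric]) auto
    define v where "v x = cnj (ft u x) * complex_of_real (gauss e x)" for x
    have vi: "integrable lborel v"
    proof (rule Bochner_Integration.integrable_bound)
      show "integrable lborel (\<lambda>x::'a. A * gauss e x)" using integrable_gauss[OF e, where 'a='a] by simp
      show "AE x in lborel. norm (v x) \<le> norm (A * gauss e x)"
        using A order_trans[OF norm_ge_zero A] by (auto simp: v_def norm_mult intro!: mult_right_mono)
    qed (unfold v_def, measurable)
    have ftv: "ft v \<xi> = (LINT \<eta>|lborel. w \<eta> * complex_of_real (\<Gamma> (\<eta> + \<xi>)))" for \<xi>
    proof -
      have "ft v \<xi> = (LINT x|lborel. ft w x * (cis (x \<bullet> \<xi>) * complex_of_real (gauss e x)))"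
        unfolding ft_def[of v] v_def cnjft by (simp add: mult_ac inner_commute)
      also have "\<dots> = (LINT \<eta>|lborel. w \<eta> * complex_of_real (\<Gamma> (\<eta> + \<xi>)))"
        unfolding \<Gamma>_def by (rule ft_gauss_damped[OF e w])
      finally show ?thesis .
    qed
    have nft: "ennreal (norm (ft v \<xi>)) \<le> (\<integral>\<^sup>+\<eta>. ennreal (norm (u \<eta>) * \<Gamma> (\<xi> - \<eta>)) \<partial>lborel)" for \<xi>
    proof -
      have "ennreal (norm (ft v \<xi>)) \<le> (\<integral>\<^sup>+\<eta>. ennreal (norm (w \<eta> * complex_of_real (\<Gamma> (\<eta> + \<xi>)))) \<partial>lborel)"
        unfolding ftv
      proof (rule integral_norm_bound_ennreal, rule Bochner_Integration.integrable_bound)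
        show "integrable lborel (\<lambda>\<eta>. K * norm (w \<eta>))" using w by simp
        show "AE \<eta> in lborel. norm (w \<eta> * complex_of_real (\<Gamma> (\<eta> + \<xi>))) \<le> norm (K * norm (w \<eta>))"
          using \<Gamma>K \<Gamma>0 order_trans[OF \<Gamma>0 \<Gamma>K] by (intro AE_I2) (auto simp: norm_mult abs_mult mult.commute[of K] intro!: mult_left_mono)
      qed measurable
      also have "\<dots> = (\<integral>\<^sup>+\<eta>. ennreal (norm (u (0-\<eta>)) * \<Gamma> (\<xi> - (0-\<eta>))) \<partial>lborel)"
        using \<Gamma>0 by (simp add: w_def norm_mult add.commute)
      also have "\<dots> = (\<integral>\<^sup>+\<eta>. ennreal (norm (u \<eta>) * \<Gamma> (\<xi> - \<eta>)) \<partial>lborel)"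
        by (rule nn_integral_lborel_reflect[of "\<lambda>\<eta>. ennreal (norm (u \<eta>) * \<Gamma> (\<xi> - \<eta>))" 0]) measurable
      finally show ?thesis .
    qed
    have i1: "integrable lborel (\<lambda>x. (norm (ft u x))\<^sup>2 * gauss e x)"
    proof (rule Bochner_Integration.integrable_bound)
      show "integrable lborel (\<lambda>x::'a. A\<^sup>2 * gauss e x)" using integrable_gauss[OF e, where 'a='a] by simp
      show "AE x in lborel. norm ((norm (ft u x))\<^sup>2 * gauss e x) \<le> norm (A\<^sup>2 * gauss e x)"
        using A by (auto intro!: mult_right_mono power_mono)
    qed measurable
    have eq: "complex_of_real ((norm (ft u x))\<^sup>2 * gauss e x) = ft u x * v x" for x
      unfolding v_def of_real_mult complex_norm_square by (simp add: mult_ac)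
    have "complex_of_real (LINT x|lborel. (norm (ft u x))\<^sup>2 * gauss e x) = (LINT x|lborel. ft u x * v x)"
      unfolding integral_complex_of_real[symmetric] eq ..
    also have "\<dots> = (LINT \<xi>|lborel. u \<xi> * ft v \<xi>)" by (rule ft_mult_formula[OF u vi])
    finally have e1: "complex_of_real (LINT x|lborel. (norm (ft u x))\<^sup>2 * gauss e x) = (LINT \<xi>|lborel. u \<xi> * ft v \<xi>)" .
    have ui: "integrable lborel (\<lambda>\<xi>. u \<xi> * ft v \<xi>)"
    proof (rule Bochner_Integration.integrable_bound)
      show "integrable lborel (\<lambda>x::'a. (LINT \<xi>|lborel. norm (v \<xi>)) * norm (u x))" using u by simp
      show "AE x in lborel. norm (u x * ft v x) \<le> norm ((LINT \<xi>|lborel. norm (v \<xi>)) * norm (u x))"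
        using norm_ft_le[OF vi] by (intro AE_I2) (auto simp: norm_mult mult.commute intro!: mult_left_mono)
    qed (use vi in measurable)
    have "(\<integral>\<^sup>+x. ennreal ((norm (ft u x))\<^sup>2 * gauss e x) \<partial>lborel) = ennreal (LINT x|lborel. (norm (ft u x))\<^sup>2 * gauss e x)"
      using i1 by (intro nn_integral_eq_integral) auto
    also have "(LINT x|lborel. (norm (ft u x))\<^sup>2 * gauss e x) = norm (LINT \<xi>|lborel. u \<xi> * ft v \<xi>)"
      unfolding e1[symmetric] by (simp add: integral_nonneg_AE)
    also have "ennreal (norm (LINT \<xi>|lborel. u \<xi> * ft v \<xi>)) \<le> (\<integral>\<^sup>+\<xi>. ennreal (norm (u \<xi> * ft v \<xi>)) \<partial>lborel)"
      by (rule integral_norm_bound_ennreal[OF ui])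
    also have "\<dots> \<le> (\<integral>\<^sup>+\<xi>. ennreal (norm (u \<xi>)) * (\<integral>\<^sup>+\<eta>. ennreal (norm (u \<eta>) * \<Gamma> (\<xi> - \<eta>)) \<partial>lborel) \<partial>lborel)"
      by (intro nn_integral_mono) (auto simp: norm_mult ennreal_mult intro!: mult_left_mono nft)
    also have "\<dots> = (\<integral>\<^sup>+\<xi>. \<integral>\<^sup>+\<eta>. ennreal (norm (u \<xi>) * norm (u \<eta>) * \<Gamma> (\<xi> - \<eta>)) \<partial>lborel \<partial>lborel)"
      by (simp add: nn_integral_cmult[symmetric] ennreal_mult[symmetric] \<Gamma>0 mult.assoc)
    also have "\<dots> \<le> (\<integral>\<^sup>+\<xi>. \<integral>\<^sup>+\<eta>. (ennreal (1/2) * (ennreal ((norm (u \<xi>))\<^sup>2) * ennreal (\<Gamma> (\<xi> - \<eta>))) +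
          ennreal (1/2) * (ennreal ((norm (u \<eta>))\<^sup>2) * ennreal (\<Gamma> (\<xi> - \<eta>)))) \<partial>lborel \<partial>lborel)"
      by (intro nn_integral_mono ennreal_mult_le_half_squares) (auto simp: \<Gamma>0)
    also have "\<dots> = ennreal (1/2) * (\<integral>\<^sup>+\<xi>. \<integral>\<^sup>+\<eta>. ennreal ((norm (u \<xi>))\<^sup>2) * ennreal (\<Gamma> (\<xi> - \<eta>)) \<partial>lborel \<partial>lborel) +
          ennreal (1/2) * (\<integral>\<^sup>+\<xi>. \<integral>\<^sup>+\<eta>. ennreal ((norm (u \<eta>))\<^sup>2) * ennreal (\<Gamma> (\<xi> - \<eta>)) \<partial>lborel \<partial>lborel)"
      by (simp add: nn_integral_add nn_integral_cmult)
    also have "(\<integral>\<^sup>+\<xi>. \<integral>\<^sup>+\<eta>. ennreal ((norm (u \<eta>))\<^sup>2) * ennreal (\<Gamma> (\<xi> - \<eta>)) \<partial>lborel \<partial>lborel) =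
       (\<integral>\<^sup>+\<eta>. \<integral>\<^sup>+\<xi>. ennreal ((norm (u \<eta>))\<^sup>2) * ennreal (\<Gamma> (\<xi> - \<eta>)) \<partial>lborel \<partial>lborel)"
      by (rule lborel_pair.Fubini') measurable
    also have "\<dots> = (\<integral>\<^sup>+\<eta>. ennreal ((norm (u \<eta>))\<^sup>2) * ennreal ((2 * pi) ^ DIM('a)) \<partial>lborel)"
      by (subst nn_integral_cmult) (measurable, simp only: \<Gamma>t)
    also have "(\<integral>\<^sup>+\<xi>. \<integral>\<^sup>+\<eta>. ennreal ((norm (u \<xi>))\<^sup>2) * ennreal (\<Gamma> (\<xi> - \<eta>)) \<partial>lborel \<partial>lborel) =
       (\<integral>\<^sup>+\<eta>. ennreal ((norm (u \<eta>))\<^sup>2) * ennreal ((2 * pi) ^ DIM('a)) \<partial>lborel)"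
      by (subst nn_integral_cmult) (measurable, simp only: \<Gamma>r)
    also have "ennreal (1/2) * (\<integral>\<^sup>+\<eta>. ennreal ((norm (u \<eta>))\<^sup>2) * ennreal ((2 * pi) ^ DIM('a)) \<partial>lborel) +
       ennreal (1/2) * (\<integral>\<^sup>+\<eta>. ennreal ((norm (u \<eta>))\<^sup>2) * ennreal ((2 * pi) ^ DIM('a)) \<partial>lborel) = ennreal ((2 * pi) ^ DIM('a)) * S"
      by (simp only: distrib_right[symmetric] half mult_1 S_def)
        (subst nn_integral_multc; simp add: mult.commute)
    finally show ?thesis .
  qed
  have "(\<integral>\<^sup>+x. ennreal ((norm (ft u x))\<^sup>2) \<partial>lborel) = (\<integral>\<^sup>+x. liminf (\<lambda>m. ennreal ((norm (ft u x))\<^sup>2 * gauss (inverse (real (Suc m))) x)) \<partial>lborel)"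
  proof (intro nn_integral_cong)
    fix x :: 'a
    have "(\<lambda>m. exp (- (norm ((inverse (real (Suc m))) *\<^sub>R x))\<^sup>2 / 2)) \<longlonglongrightarrow> exp (- (norm (0 *\<^sub>R x))\<^sup>2 / 2)"
      by (intro tendsto_intros LIMSEQ_inverse_real_of_nat) auto
    then have "(\<lambda>m. gauss (inverse (real (Suc m))) x) \<longlonglongrightarrow> 1" by (simp add: gauss_def)
    then have "(\<lambda>m. ennreal ((norm (ft u x))\<^sup>2 * gauss (inverse (real (Suc m))) x)) \<longlonglongrightarrow> ennreal ((norm (ft u x))\<^sup>2 * 1)"
      by (intro tendsto_ennrealI tendsto_intros)
    then show "ennreal ((norm (ft u x))\<^sup>2) = liminf (\<lambda>m. ennreal ((norm (ft u x))\<^sup>2 * gauss (inverse (real (Suc m))) x))"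
      using lim_imp_Liminf[OF sequentially_bot] by fastforce
  qed
  also have "\<dots> \<le> liminf (\<lambda>m. \<integral>\<^sup>+x. ennreal ((norm (ft u x))\<^sup>2 * gauss (inverse (real (Suc m))) x) \<partial>lborel)"
    by (rule nn_integral_liminf) measurable
  also have "\<dots> \<le> ennreal ((2 * pi) ^ DIM('a)) * S"
  proof -
    have "liminf (\<lambda>m. \<integral>\<^sup>+x. ennreal ((norm (ft u x))\<^sup>2 * gauss (inverse (real (Suc m))) x) \<partial>lborel)
      \<le> liminf (\<lambda>m. ennreal ((2 * pi) ^ DIM('a)) * S)"
      by (rule Liminf_mono, rule always_eventually, rule allI, rule key) simp
    then show ?thesis by (simp only: Liminf_const[OF sequentially_bot])
  qed
  finally show ?thesis by (simp add: S_def)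
qed

section \<open>Iterated derivatives along a line\<close>

text \<open>The vector v is not normalised: replacing v by d v multiplies the derivative by d. This
  is how scales enter the bounds below.\<close>

definition dder :: "'a::real_normed_vector \<Rightarrow> ('a \<Rightarrow> 'b::real_normed_vector) \<Rightarrow> 'b \<Rightarrow> 'a \<Rightarrow> bool"
  where "dder v f d x \<longleftrightarrow> ((\<lambda>t. f (x + t *\<^sub>R v)) has_vector_derivative d) (at 0)"

text \<open>One constant bounds the function and its derivatives up to order k along the single
  vector v. For v = d b this says that the i-th derivative along b is at most C / d^i. The
  derivatives are quantified existentially, so each proof may supply its own formula for
  them.\<close>

primrec jet :: "nat \<Rightarrow> 'a::real_normed_vector \<Rightarrow> 'a set \<Rightarrow> real \<Rightarrow> ('a \<Rightarrow> 'b::real_normed_vector) \<Rightarrow> bool"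
  where
    "jet 0 v S C f \<longleftrightarrow> (\<forall>x\<in>S. norm (f x) \<le> C)"
  | "jet (Suc k) v S C f \<longleftrightarrow> (\<forall>x\<in>S. norm (f x) \<le> C) \<and>
      (\<exists>f'. (\<forall>x\<in>S. dder v f (f' x) x) \<and> jet k v S C f')"

lemma jet_bound: "jet k v S C f \<Longrightarrow> x \<in> S \<Longrightarrow> norm (f x) \<le> C"
  by (cases k) auto

lemma jet_mono: "jet k v S C f \<Longrightarrow> C \<le> D \<Longrightarrow> T \<subseteq> S \<Longrightarrow> jet k v T D f"
proof (induction k arbitrary: f)
  case (Suc k)
  then obtain f' where "\<forall>x\<in>S. dder v f (f' x) x" "jet k v S C f'" by auto
  then have "\<forall>x\<in>T. dder v f (f' x) x" "jet k v T D f'" using Suc by auto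
  moreover have "\<forall>x\<in>T. norm (f x) \<le> D" using Suc.prems by (meson jet_bound order_trans subsetD)
  ultimately show ?case by auto
next
  case 0
  then show ?case using order_trans[OF _ \<open>C \<le> D\<close>] by (auto simp del: norm_le_zero_iff)
qed

lemma jet_Suc_D: "jet (Suc k) v S C f \<Longrightarrow> jet k v S C f"
proof (induction k arbitrary: f)
  case (Suc k)
  then obtain f' where "\<forall>x\<in>S. dder v f (f' x) x" "jet (Suc k) v S C f'" by auto
  then show ?case using Suc by auto
qed auto

lemma jet_le: "jet k v S C f \<Longrightarrow> l \<le> k \<Longrightarrow> jet l v S C f"
  by (induction k) (auto simp: le_Suc_eq dest: jet_Suc_D simp del: jet.simps)

lemma dder_cong_open:
  assumes "dder v f d x" and S: "open S" "x \<in> S" and eq: "\<And>y. y \<in> S \<Longrightarrow> f y = g y"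
  shows "dder v g d x"
proof -
  have o: "open ((\<lambda>t. x + t *\<^sub>R v) -` S)"
    using S(1) by (intro open_vimage continuous_intros) auto
  show ?thesis unfolding dder_def
    by (rule has_vector_derivative_transform_within_open[OF assms(1)[unfolded dder_def] o])
       (use S(2) eq in auto)
qed

lemma dder_unique: "dder v f d x \<Longrightarrow> dder v f e x \<Longrightarrow> d = e"
  unfolding dder_def by (rule vector_derivative_unique_at)

lemma dder_has_derivative:
  assumes "(f has_derivative D) (at x)"
  shows "dder v f (D v) x"
proof -
  have "((\<lambda>t. x + t *\<^sub>R v) has_derivative (\<lambda>h. h *\<^sub>R v)) (at 0)"
    by (auto intro!: derivative_eq_intros)
  then have "((\<lambda>t. f (x + t *\<^sub>R v)) has_derivative (\<lambda>h. D (h *\<^sub>R v))) (at 0)"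
    by (rule has_derivative_compose) (use assms in simp)
  moreover have "D (h *\<^sub>R v) = h *\<^sub>R D v" for h
    using has_derivative_linear[OF assms] by (rule linear_scale)
  ultimately show ?thesis by (simp add: dder_def has_vector_derivative_def)
qed

lemma jet_cong_open:
  assumes "open S" "\<And>x. x \<in> S \<Longrightarrow> f x = g x" "jet k v S C f"
  shows "jet k v S C g"
proof (cases k)
  case 0 with assms show ?thesis by auto
next
  case (Suc l)
  with assms obtain f' where "\<forall>x\<in>S. dder v f (f' x) x" "jet l v S C f'" by auto
  with assms Suc show ?thesis by (auto intro!: exI[of _ f'] dder_cong_open[of v f _ _ S g])
qed

lemma jet_const:
  fixes c :: "'b::real_normed_vector"
  shows "norm c \<le> C \<Longrightarrow> jet k v S C (\<lambda>x. c)"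
proof (induction k arbitrary: c)
  case (Suc k)
  have "0 \<le> C" using Suc.prems norm_ge_zero order_trans by blast
  then have "jet k v S C (\<lambda>x. 0::'b)" by (intro Suc.IH) simp
  then show ?case using Suc.prems by (auto simp: dder_def intro!: exI[of _ "\<lambda>x. 0"])
qed auto

lemma jet_add:
  "jet k v S C f \<Longrightarrow> jet k v S D g \<Longrightarrow> jet k v S (C + D) (\<lambda>x. f x + g x)"
proof (induction k arbitrary: f g)
  case (Suc k)
  then obtain f' g' where *: "\<forall>x\<in>S. dder v f (f' x) x" "jet k v S C f'" "\<forall>x\<in>S. dder v g (g' x) x" "jet k v S D g'" by auto
  have "\<forall>x\<in>S. dder v (\<lambda>x. f x + g x) (f' x + g' x) x"
    using * by (auto simp: dder_def intro!: has_vector_derivative_add)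
  moreover have "jet k v S (C + D) (\<lambda>x. f' x + g' x)" using * by (intro Suc.IH)
  moreover have "\<forall>x\<in>S. norm (f x + g x) \<le> C + D" using Suc.prems by (auto intro!: norm_triangle_mono)
  ultimately show ?case by (auto intro!: exI[of _ "\<lambda>x. f' x + g' x"])
qed (auto intro!: norm_triangle_mono)

text \<open>The factor 2^k counts the terms of the Leibniz rule: each derivative produces two
  products, to which the induction hypothesis applies with the same C and D.\<close>

lemma jet_bilinear:
  assumes p: "bounded_bilinear p" and np: "\<And>a b. norm (p a b) \<le> norm a * norm b"
    and C: "C \<ge> 0"
  shows "jet k v S C f \<Longrightarrow> jet k v S D g \<Longrightarrow> jet k v S (2 ^ k * C * D) (\<lambda>x. p (f x) (g x))"
proof (induction k arbitrary: f g)
  case 0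
  then show ?case using C by (auto intro!: order_trans[OF np] mult_mono)
next
  case (Suc k)
  obtain f' g' where *: "\<forall>x\<in>S. dder v f (f' x) x" "jet k v S C f'" "\<forall>x\<in>S. dder v g (g' x) x" "jet k v S D g'"
    using Suc.prems by auto
  have "\<forall>x\<in>S. dder v (\<lambda>x. p (f x) (g x)) (p (f x) (g' x) + p (f' x) (g x)) x"
  proof
    fix x assume x: "x \<in> S"
    then show "dder v (\<lambda>x. p (f x) (g x)) (p (f x) (g' x) + p (f' x) (g x)) x"
      using * bounded_bilinear.has_vector_derivative[OF p, of "\<lambda>t. f (x + t *\<^sub>R v)" "f' x" 0 UNIV "\<lambda>t. g (x + t *\<^sub>R v)" "g' x"]
      by (simp add: dder_def)
  qed
  moreover have "jet k v S (2 ^ k * C * D + 2 ^ k * C * D) (\<lambda>x. p (f x) (g' x) + p (f' x) (g x))"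
    using * Suc.prems by (intro jet_add Suc.IH) (auto dest: jet_Suc_D simp del: jet.simps)
  moreover have "2 ^ k * C * D + 2 ^ k * C * D = 2 ^ Suc k * C * D" by simp
  moreover have "\<forall>x\<in>S. norm (p (f x) (g x)) \<le> 2 ^ Suc k * C * D"
  proof
    fix x assume x: "x \<in> S"
    have f: "norm (f x) \<le> C" "norm (g x) \<le> D" using jet_bound x Suc.prems by blast+
    then have "norm (p (f x) (g x)) \<le> C * D" using C by (intro order_trans[OF np] mult_mono) auto
    also have "\<dots> \<le> 2 ^ Suc k * (C * D)"
      using mult_right_mono[of 1 "2 ^ Suc k" "C * D"] C order_trans[OF norm_ge_zero f(2)] one_le_power[of "2::real" "Suc k"] by simp
    finally show "norm (p (f x) (g x)) \<le> 2 ^ Suc k * C * D" by (simp add: mult.assoc)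
  qed
  ultimately show ?case by (auto simp del: power_Suc)
qed

lemma jet_mult:
  fixes f g :: "'a::real_normed_vector \<Rightarrow> 'b::real_normed_algebra"
  shows "C \<ge> 0 \<Longrightarrow> jet k v S C f \<Longrightarrow> jet k v S D g \<Longrightarrow> jet k v S (2 ^ k * C * D) (\<lambda>x. f x * g x)"
  by (rule jet_bilinear[OF bounded_bilinear_mult norm_mult_ineq])

lemma jet_scaleR:
  "C \<ge> 0 \<Longrightarrow> jet k v S C f \<Longrightarrow> jet k v S D g \<Longrightarrow> jet k v S (2 ^ k * C * D) (\<lambda>x. f x *\<^sub>R g x)"
  by (rule jet_bilinear[OF bounded_bilinear_scaleR]) auto

lemma jet_bounded_linear:
  assumes L: "bounded_linear L" and nL: "\<And>a. norm (L a) \<le> c * norm a" and c: "c \<ge> 0"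
  shows "jet k v S C f \<Longrightarrow> jet k v S (c * C) (\<lambda>x. L (f x))"
proof (induction k arbitrary: f)
  case 0
  then show ?case using c by (auto intro!: order_trans[OF nL] mult_left_mono)
next
  case (Suc k)
  then obtain f' where "\<forall>x\<in>S. dder v f (f' x) x" "jet k v S C f'" by auto
  with Suc show ?case using c
    by (auto intro!: order_trans[OF nL] mult_left_mono exI[of _ "\<lambda>x. L (f' x)"]
          bounded_linear.has_vector_derivative[OF L] simp: dder_def)
qed

lemma jet_of_real:
  fixes f :: "'a::real_normed_vector \<Rightarrow> real"
  shows "jet k v S C f \<Longrightarrow> jet k v S C (\<lambda>x. complex_of_real (f x))"
  using jet_bounded_linear[OF bounded_linear_of_real[where 'a=complex], of 1 k v S C f] by simp

lemma jet_minus: "jet k v S C f \<Longrightarrow> jet k v S C (\<lambda>x. - f x)"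
  using jet_bounded_linear[OF bounded_linear_minus[OF bounded_linear_ident], of 1 k v S C f] by simp

lemma jet_diff: "jet k v S C f \<Longrightarrow> jet k v S D g \<Longrightarrow> jet k v S (C + D) (\<lambda>x. f x - g x)"
  using jet_add[of k v S C f D "\<lambda>x. - g x"] jet_minus by force

lemma jet_cmult_real: "jet k v S C f \<Longrightarrow> jet k v S (\<bar>c\<bar> * C) (\<lambda>x. c *\<^sub>R f x)"
  by (rule jet_bounded_linear[OF bounded_linear_scaleR_right]) auto

lemma dder_affine:
  assumes "dder (c *\<^sub>R v) f d (a + c *\<^sub>R x)"
  shows "dder v (\<lambda>x. f (a + c *\<^sub>R x)) d x"
  using assms by (simp add: dder_def algebra_simps)

lemma jet_affine:
  "jet k (c *\<^sub>R v) S C f \<Longrightarrow> (\<And>x. x \<in> T \<Longrightarrow> a + c *\<^sub>R x \<in> S) \<Longrightarrow> jet k v T C (\<lambda>x. f (a + c *\<^sub>R x))"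
proof (induction k arbitrary: f)
  case (Suc k)
  then obtain f' where "\<forall>x\<in>S. dder (c *\<^sub>R v) f (f' x) x" "jet k (c *\<^sub>R v) S C f'" by auto
  with Suc show ?case by (auto intro!: exI[of _ "\<lambda>x. f' (a + c *\<^sub>R x)"] dder_affine)
qed auto

lemma jet_scale_dir:
  assumes r: "\<bar>r\<bar> \<le> 1" and C: "C \<ge> 0"
  shows "jet k v S C f \<Longrightarrow> jet k (r *\<^sub>R v) S C f"
proof (induction k arbitrary: f)
  case (Suc k)
  then obtain f' where *: "\<forall>x\<in>S. dder v f (f' x) x" "jet k v S C f'" by auto
  have "dder (r *\<^sub>R v) f (r *\<^sub>R f' x) x" if "x \<in> S" for x
  proof -
    have "((\<lambda>t. f (x + t *\<^sub>R v)) \<circ> (\<lambda>t. t * r) has_vector_derivative r *\<^sub>R f' x) (at 0)"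
      by (rule vector_diff_chain_at) (use that * in \<open>auto simp: dder_def intro!: derivative_eq_intros\<close>)
    then show ?thesis by (simp add: dder_def o_def)
  qed
  moreover have "jet k (r *\<^sub>R v) S C (\<lambda>x. r *\<^sub>R f' x)"
  proof (rule jet_mono[OF _ _ order_refl])
    show "jet k (r *\<^sub>R v) S (\<bar>r\<bar> * C) (\<lambda>x. r *\<^sub>R f' x)" by (rule jet_cmult_real) (rule Suc.IH[OF *(2)])
    show "\<bar>r\<bar> * C \<le> C" using r C by (simp add: mult_left_le_one_le)
  qed
  ultimately show ?case using Suc.prems by (auto intro!: exI[of _ "\<lambda>x. r *\<^sub>R f' x"])
qed auto

text \<open>Lets a function that is smooth only on S, such as a power of the norm on an annulus, be
  used on the whole space once a cut-off makes it vanish off K. Off K it is locally 0, so its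
  derivative is again 0 off K and the induction continues.\<close>

lemma jet_extend_zero:
  assumes S: "open S" and K: "closed K" "K \<subseteq> S" and C: "C \<ge> 0"
  shows "jet k v S C f \<Longrightarrow> (\<And>x. x \<notin> K \<Longrightarrow> f x = 0) \<Longrightarrow> jet k v UNIV C f"
proof (induction k arbitrary: f)
  case 0
  then show ?case using C K by (auto, metis norm_zero subsetD)
next
  case (Suc k)
  then obtain f' where *: "\<forall>x\<in>S. dder v f (f' x) x" "jet k v S C f'" by auto
  define g where "g x = (if x \<in> S then f' x else 0)" for x
  have oK: "open (- K)" using K by auto
  have z: "dder v f 0 x" if "x \<notin> K" for x
    by (rule dder_cong_open[OF _ oK, of v "\<lambda>x. 0"]) (use that Suc.prems in \<open>auto simp: dder_def\<close>)
  have g0: "g x = 0" if "x \<notin> K" for x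
    using z[OF that] * dder_unique[of v f "f' x" x 0] by (auto simp: g_def)
  have "dder v f (g x) x" for x
  proof (cases "x \<in> K")
    case True then show ?thesis using K * by (auto simp: g_def)
  next
    case False then show ?thesis using z g0 by simp
  qed
  moreover have "jet k v UNIV C g"
  proof (rule Suc.IH)
    show "jet k v S C g" by (rule jet_cong_open[OF S _ *(2)]) (auto simp: g_def)
  qed (rule g0)
  moreover have "norm (f x) \<le> C" for x
    using Suc.prems C by (cases "x \<in> S") (auto, metis K(2) norm_zero subsetD)
  ultimately show ?case by auto
qed

text \<open>The derivative of \<open>g i\<close> composed with f is f' times
  \<open>g (Suc i)\<close> composed with f, which raises the index i in the induction. Only f'
  carries a bound, so with T = UNIV the function f may be a phase of any size. E is chosen before f,
  S and v, which makes the later bounds uniform in all parameters.\<close>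

lemma jet_comp:
  fixes g :: "nat \<Rightarrow> real \<Rightarrow> 'b::real_normed_vector"
  assumes der: "\<And>i t. t \<in> T \<Longrightarrow> i < K \<Longrightarrow> (g i has_vector_derivative g (Suc i) t) (at t)"
    and bd: "\<And>i t. t \<in> T \<Longrightarrow> i \<le> K \<Longrightarrow> norm (g i t) \<le> B"
    and C: "C \<ge> 0" and B: "B \<ge> 0"
  shows "i + Suc k \<le> K \<Longrightarrow> \<exists>E\<ge>0. \<forall>f f' S v. (\<forall>x\<in>S. f x \<in> T) \<longrightarrow> (\<forall>x\<in>S. dder v f (f' x) (x::'a::real_normed_vector)) \<longrightarrow>
    jet k v S C f' \<longrightarrow> jet (Suc k) v S E (\<lambda>x. g i (f x))"
proof (induction k arbitrary: i)
  have dd: "dder v (\<lambda>x. g i (f x)) (f' x *\<^sub>R g (Suc i) (f x)) x"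
    if "x \<in> S" "\<forall>x\<in>S. f x \<in> T" "\<forall>x\<in>S. dder v f (f' x) (x::'a)" "i < K" for x S f f' v i
  proof -
    have "(g i \<circ> (\<lambda>t. f (x + t *\<^sub>R v)) has_vector_derivative f' x *\<^sub>R g (Suc i) (f x)) (at 0)"
      by (rule vector_diff_chain_at) (use that der in \<open>auto simp: dder_def\<close>)
    then show ?thesis by (simp add: dder_def o_def)
  qed
  {
    case 0
    show ?case
    proof (intro exI[of _ "max B (C * B)"] conjI allI impI)
      fix f f' S v assume a: "\<forall>x\<in>S. f x \<in> T" "\<forall>x\<in>S. dder v f (f' x) (x::'a)" "jet 0 v S C f'"
      have "\<forall>x\<in>S. norm (g i (f x)) \<le> max B (C * B)" using a 0 bd[of _ i] by (auto simp: le_max_iff_disj)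
      moreover have "\<forall>x\<in>S. norm (f' x *\<^sub>R g (Suc i) (f x)) \<le> max B (C * B)"
      proof
        fix x assume x: "x \<in> S"
        have "norm (f' x) * norm (g (Suc i) (f x)) \<le> C * B"
          using a 0 bd[of _ "Suc i"] C x by (intro mult_mono) auto
        then show "norm (f' x *\<^sub>R g (Suc i) (f x)) \<le> max B (C * B)" by simp
      qed
      ultimately show "jet (Suc 0) v S (max B (C * B)) (\<lambda>x. g i (f x))"
        using dd[OF _ a(1,2), of _ i] 0 by (auto intro!: exI[of _ "\<lambda>x. f' x *\<^sub>R g (Suc i) (f x)"])
    qed (use B in auto)
  next
    case (Suc k)
    then have "Suc i + Suc k \<le> K" by simp
    from Suc.IH[OF this] obtain E where E0: "E \<ge> 0" and E: "\<forall>f f' S v. (\<forall>x\<in>S. f x \<in> T) \<longrightarrow> (\<forall>x\<in>S. dder v f (f' x) (x::'a)) \<longrightarrow>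
        jet k v S C f' \<longrightarrow> jet (Suc k) v S E (\<lambda>x. g (Suc i) (f x))" by blast
    define E' where "E' = max B (2 ^ Suc k * C * E)"
    show ?case
    proof (intro exI[of _ E'] conjI allI impI)
      fix f f' S v assume a: "\<forall>x\<in>S. f x \<in> T" "\<forall>x\<in>S. dder v f (f' x) (x::'a)" "jet (Suc k) v S C f'"
      have "jet (Suc k) v S E (\<lambda>x. g (Suc i) (f x))" by (rule E[rule_format, OF _ _ jet_Suc_D[OF a(3)]]) (use a(1,2) in auto)
      then have "jet (Suc k) v S (2 ^ Suc k * C * E) (\<lambda>x. f' x *\<^sub>R g (Suc i) (f x))"
        by (intro jet_scaleR C a)
      then have "jet (Suc k) v S E' (\<lambda>x. f' x *\<^sub>R g (Suc i) (f x))"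
        by (rule jet_mono) (auto simp: E'_def)
      moreover have "\<forall>x\<in>S. norm (g i (f x)) \<le> E'" using a Suc bd[of _ i] by (auto simp: le_max_iff_disj E'_def)
      ultimately show "jet (Suc (Suc k)) v S E' (\<lambda>x. g i (f x))"
        using dd[OF _ a(1,2), of _ i] Suc.prems
        by (subst jet.simps(2)) (auto intro!: exI[of _ "\<lambda>x. f' x *\<^sub>R g (Suc i) (f x)"] simp del: jet.simps)
    qed (use B in \<open>auto simp: E'_def\<close>)
  }
qed

lemma jet_inner:
  assumes "norm v \<le> 1" "norm w \<le> C" "\<And>x. x \<in> S \<Longrightarrow> \<bar>x \<bullet> w\<bar> \<le> C"
  shows "jet k v S C (\<lambda>x. x \<bullet> w)"
proof (cases k)
  case (Suc l)
  have "dder v (\<lambda>x. x \<bullet> w) (v \<bullet> w) x" for x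
    by (rule dder_has_derivative) (auto intro!: derivative_eq_intros)
  moreover have "\<bar>v \<bullet> w\<bar> \<le> C"
    using Cauchy_Schwarz_ineq2[of v w] assms mult_mono[of "norm v" 1 "norm w" C] by auto
  ultimately show ?thesis using assms Suc by (auto intro!: exI[of _ "\<lambda>x. v \<bullet> w"] jet_const)
qed (use assms in auto)

lemma dder_line:
  assumes "dder v f d (x + t *\<^sub>R v)"
  shows "((\<lambda>t. f (x + t *\<^sub>R v)) has_vector_derivative d) (at t)"
proof -
  have "((\<lambda>h. f (x + t *\<^sub>R v + h *\<^sub>R v)) \<circ> (\<lambda>s. s - t) has_vector_derivative 1 *\<^sub>R d) (at t)"
    by (rule vector_diff_chain_at) (use assms in \<open>auto simp: dder_def intro!: derivative_eq_intros\<close>)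
  then show ?thesis by (simp add: o_def algebra_simps)
qed

lemma dder_diff_le:
  assumes "\<And>t. 0 \<le> t \<Longrightarrow> t \<le> h \<Longrightarrow> dder v f (f' (x + t *\<^sub>R v)) (x + t *\<^sub>R v)"
    and "\<And>t. 0 \<le> t \<Longrightarrow> t \<le> h \<Longrightarrow> norm (f' (x + t *\<^sub>R v)) \<le> C" and "h \<ge> 0"
  shows "norm (f (x + h *\<^sub>R v) - f x) \<le> C * h"
proof -
  have "norm (f (x + h *\<^sub>R v) - f (x + 0 *\<^sub>R v)) \<le> C * norm (h - 0)"
  proof (rule differentiable_bound)
    fix t assume t: "t \<in> {0..h}"
    show "((\<lambda>t. f (x + t *\<^sub>R v)) has_derivative (\<lambda>s. s *\<^sub>R f' (x + t *\<^sub>R v))) (at t within {0..h})"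
      using dder_line[OF assms(1)[of t]] t by (auto simp: has_vector_derivative_def intro: has_derivative_at_withinI)
    show "onorm (\<lambda>s. s *\<^sub>R f' (x + t *\<^sub>R v)) \<le> C"
      using assms(2)[of t] t by (simp add: onorm_scaleR_left onorm_id)
  qed (use assms in auto)
  then show ?thesis using assms by simp
qed

lemma has_vector_derivative_quotient:
  assumes "(f has_vector_derivative d) (at 0)"
  shows "((\<lambda>h. (f h - f 0) /\<^sub>R h) \<longlongrightarrow> d) (at 0)"
proof -
  have "((\<lambda>h. norm (f (0 + h) - f 0 - h *\<^sub>R d) / norm h) \<longlongrightarrow> 0) (at 0)"
    using assms unfolding has_vector_derivative_def has_derivative_at by blast
  then have "((\<lambda>h. norm ((f h - f 0) /\<^sub>R h - d)) \<longlongrightarrow> 0) (at 0)"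
  proof (rule Lim_transform_eventually)
    have "norm (f (0 + h) - f 0 - h *\<^sub>R d) / norm h = norm ((f h - f 0) /\<^sub>R h - d)" if "h \<noteq> 0" for h
    proof -
      have "(f h - f 0) /\<^sub>R h - d = (f (0 + h) - f 0 - h *\<^sub>R d) /\<^sub>R h"
        using that by (simp add: scaleR_diff_right)
      then show ?thesis by (simp add: divide_inverse_commute)
    qed
    then show "\<forall>\<^sub>F h in at 0. norm (f (0 + h) - f 0 - h *\<^sub>R d) / norm h = norm ((f h - f 0) /\<^sub>R h - d)"
      by (auto simp: eventually_at_filter)
  qed
  then show ?thesis using LIM_zero_cancel tendsto_norm_zero_iff by blast
qed

section \<open>Decay of Fourier transforms\<close>

lemma integrable_bounded_support:
  assumes [measurable]: "u \<in> borel_measurable borel" and "compact K"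
    and "\<And>x. norm (u x) \<le> C" "\<And>x. x \<notin> K \<Longrightarrow> u x = 0"
  shows "integrable lborel (u :: 'a::euclidean_space \<Rightarrow> complex)"
    and "(LINT x|lborel. norm (u x)) \<le> C * measure lborel K"
proof -
  have [measurable]: "K \<in> sets borel" using compact_imp_closed[OF assms(2)] by auto
  have e: "emeasure lborel K < \<infinity>" using emeasure_compact_finite assms by auto
  have i: "integrable lborel (\<lambda>x. C * indicator K x :: real)" using e by auto
  have le: "norm (u x) \<le> C * indicator K x" for x
    using assms by (auto simp: indicator_def)
  show u: "integrable lborel u"
    by (rule Bochner_Integration.integrable_bound[OF i]) (use le abs_ge_self order_trans in \<open>auto, blast\<close>)
  have "(LINT x|lborel. norm (u x)) \<le> (LINT x|lborel. C * indicator K x)"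
    by (rule integral_mono) (use u i le in auto)
  then show "(LINT x|lborel. norm (u x)) \<le> C * measure lborel K" by simp
qed

text \<open>Integration by parts through difference quotients along v: translation turns the
  quotient into the factor (cis (- h (x . v)) - 1) / h, and dominated convergence lets h tend to 0.
  Measurability of u' comes out on the way, as u' is a pointwise limit of quotients.\<close>

lemma ft_dder:
  fixes u :: "'a::euclidean_space \<Rightarrow> complex"
  assumes um[measurable]: "u \<in> borel_measurable borel" and K: "compact K"
    and uC: "\<And>x. norm (u x) \<le> C" and u0: "\<And>x. x \<notin> K \<Longrightarrow> u x = 0"
    and d: "\<And>x. dder v u (u' x) x" and u'C: "\<And>x. norm (u' x) \<le> C"
  shows "u' \<in> borel_measurable borel" and "ft u' x = - (\<i> * complex_of_real (x \<bullet> v) * ft u x)"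
proof -
  define h where "h m = inverse (real (Suc m))" for m
  have h0: "h m > 0" "h m \<le> 1" for m by (auto simp: h_def field_simps)
  have hl: "h \<longlonglongrightarrow> 0" unfolding h_def by (rule LIMSEQ_inverse_real_of_nat)
  have hl': "filterlim h (at 0) sequentially"
    unfolding filterlim_at using hl h0 by (auto simp: less_imp_neq[symmetric])
  define D where "D m \<xi> = complex_of_real (inverse (h m)) * (u (\<xi> + h m *\<^sub>R v) - u \<xi>)" for m \<xi>
  have Dm[measurable]: "D m \<in> borel_measurable borel" for m unfolding D_def by measurable
  have Dl: "(\<lambda>m. D m \<xi>) \<longlonglongrightarrow> u' \<xi>" for \<xi>
  proof -
    have "((\<lambda>t. (u (\<xi> + t *\<^sub>R v) - u (\<xi> + 0 *\<^sub>R v)) /\<^sub>R t) \<longlongrightarrow> u' \<xi>) (at 0)"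
      using d[of \<xi>] unfolding dder_def by (rule has_vector_derivative_quotient)
    from filterlim_compose[OF this hl'] show ?thesis by (simp add: D_def scaleR_conv_of_real)
  qed
  show [measurable]: "u' \<in> borel_measurable borel"
    by (rule borel_measurable_LIMSEQ_metric[OF Dm]) (rule Dl)
  obtain \<rho> where \<rho>: "K \<subseteq> cball 0 \<rho>" using compact_imp_bounded[OF K] unfolding bounded_iff by (auto simp: subset_iff)
  have DC: "norm (D m \<xi>) \<le> C" for m \<xi>
  proof -
    have "norm (u (\<xi> + h m *\<^sub>R v) - u \<xi>) \<le> C * h m"
      by (rule dder_diff_le[where f'=u']) (use d u'C h0[of m] in auto)
    then have "inverse (h m) * norm (u (\<xi> + h m *\<^sub>R v) - u \<xi>) \<le> inverse (h m) * (C * h m)"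
      using h0[of m] by (intro mult_left_mono) auto
    also have "\<dots> = C" using h0[of m] by simp
    finally show ?thesis using h0[of m] by (simp add: D_def norm_mult norm_inverse)
  qed
  \<comment> \<open>The shift has length at most norm v because h m <= 1; this gives one compact set
    containing the supports of all quotients.\<close>
  have D0: "D m \<xi> = 0" if "\<xi> \<notin> cball 0 (\<rho> + norm v)" for m \<xi>
  proof -
    have nK: "y \<notin> K" if "norm y > \<rho>" for y using subsetD[OF \<rho>, of y] that by auto
    have n: "norm \<xi> > \<rho> + norm v" using that by simp
    have "norm \<xi> \<le> norm (\<xi> + h m *\<^sub>R v) + h m * norm v"
      using norm_triangle_ineq4[of "\<xi> + h m *\<^sub>R v" "h m *\<^sub>R v"] h0[of m] by simp
    moreover have "h m * norm v \<le> norm v" using h0[of m] by (simp add: mult_left_le_one_le)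
    ultimately have "\<xi> + h m *\<^sub>R v \<notin> K" using n by (intro nK) linarith
    moreover have "\<xi> \<notin> K" using n norm_ge_zero[of v] by (intro nK) linarith
    ultimately show ?thesis by (simp add: D_def u0)
  qed
  have cK: "compact (cball (0::'a) (\<rho> + norm v))" by simp
  have ui: "integrable lborel u" by (rule integrable_bounded_support[OF um K uC u0])
  have ftD: "ft (D m) x = complex_of_real (inverse (h m)) * (cis (- h m * (x \<bullet> v)) - 1) * ft u x" for m
  proof -
    have i: "integrable lborel (\<lambda>\<xi>. cis (x \<bullet> \<xi>) * u \<xi>)" by (rule integrable_cis_mult[OF ui]) auto
    have [measurable]: "(\<lambda>\<xi>. cis (x \<bullet> \<xi>) * u \<xi>) \<in> borel_measurable borel" by measurable
    have i2: "integrable lborel (\<lambda>\<xi>. cis (- h m * (x \<bullet> v)) * (cis (x \<bullet> (h m *\<^sub>R v + 1 *\<^sub>R \<xi>)) * u (h m *\<^sub>R v + 1 *\<^sub>R \<xi>)))"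
      by (rule integrable_mult_right) (subst integrable_lborel_affine_iff[where f="\<lambda>\<xi>. cis (x \<bullet> \<xi>) * u \<xi>"], use i in auto)
    have eq: "cis (x \<bullet> \<xi>) * D m \<xi> = complex_of_real (inverse (h m)) *
       (cis (- h m * (x \<bullet> v)) * (cis (x \<bullet> (h m *\<^sub>R v + 1 *\<^sub>R \<xi>)) * u (h m *\<^sub>R v + 1 *\<^sub>R \<xi>)) - cis (x \<bullet> \<xi>) * u \<xi>)" for \<xi>
    proof -
      have "cis (x \<bullet> \<xi>) = cis (- h m * (x \<bullet> v)) * cis (x \<bullet> (h m *\<^sub>R v + 1 *\<^sub>R \<xi>))"
        by (simp add: cis_mult inner_add_right)
      then have "cis (x \<bullet> \<xi>) * D m \<xi> = complex_of_real (inverse (h m)) *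
       ((cis (- h m * (x \<bullet> v)) * cis (x \<bullet> (h m *\<^sub>R v + 1 *\<^sub>R \<xi>))) * u (h m *\<^sub>R v + 1 *\<^sub>R \<xi>) - cis (x \<bullet> \<xi>) * u \<xi>)"
        unfolding D_def by (simp add: right_diff_distrib add.commute mult.left_commute)
      then show ?thesis by (simp only: mult.assoc)
    qed
    have "(LINT \<xi>|lborel. cis (x \<bullet> (h m *\<^sub>R v + 1 *\<^sub>R \<xi>)) * u (h m *\<^sub>R v + 1 *\<^sub>R \<xi>)) = ft u x"
      using integral_lborel_affine[of "\<lambda>\<xi>. cis (x \<bullet> \<xi>) * u \<xi>" 1 "h m *\<^sub>R v"] by (simp add: ft_def)
    moreover have "(LINT \<xi>|lborel. cis (x \<bullet> \<xi>) * u \<xi>) = ft u x" by (simp add: ft_def)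
    moreover have "ft (D m) x = complex_of_real (inverse (h m)) * (cis (- h m * (x \<bullet> v)) * (LINT \<xi>|lborel. cis (x \<bullet> (h m *\<^sub>R v + 1 *\<^sub>R \<xi>)) * u (h m *\<^sub>R v + 1 *\<^sub>R \<xi>)) - (LINT \<xi>|lborel. cis (x \<bullet> \<xi>) * u \<xi>))"
      unfolding ft_def[of "D m"] eq
      by (subst integral_mult_right_zero, subst Bochner_Integration.integral_diff[OF i2 i], subst integral_mult_right_zero) (rule refl)
    ultimately show ?thesis by (simp only:) (simp add: algebra_simps)
  qed
  have l1: "(\<lambda>m. ft (D m) x) \<longlonglongrightarrow> ft u' x"
    unfolding ft_def
  proof (rule integral_dominated_convergence[where w="\<lambda>\<xi>. C * indicator (cball 0 (\<rho> + norm v)) \<xi>"])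
    show "integrable lborel (\<lambda>\<xi>. C * indicator (cball (0::'a) (\<rho> + norm v)) \<xi>)"
      using emeasure_compact_finite[OF cK] by (intro integrable_mult_right) auto
    show "AE \<xi> in lborel. norm (cis (x \<bullet> \<xi>) * D m \<xi>) \<le> C * indicator (cball 0 (\<rho> + norm v)) \<xi>" for m
      by (intro AE_I2) (use DC D0 in \<open>auto simp: norm_mult indicator_def\<close>)
    show "AE \<xi> in lborel. (\<lambda>m. cis (x \<bullet> \<xi>) * D m \<xi>) \<longlonglongrightarrow> cis (x \<bullet> \<xi>) * u' \<xi>"
      by (intro AE_I2 tendsto_intros Dl)
  qed measurable
  have "((\<lambda>t. cis (- t * (x \<bullet> v))) has_vector_derivative (- (x \<bullet> v)) *\<^sub>R (\<i> * cis 0)) (at 0)"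
    unfolding has_vector_derivative_def by (auto intro!: derivative_eq_intros simp: scaleR_conv_of_real)
  then have "((\<lambda>t. (cis (- t * (x \<bullet> v)) - cis (- 0 * (x \<bullet> v))) /\<^sub>R t) \<longlongrightarrow> (- (x \<bullet> v)) *\<^sub>R (\<i> * cis 0)) (at 0)"
    by (rule has_vector_derivative_quotient)
  from filterlim_compose[OF this hl']
  have "(\<lambda>m. complex_of_real (inverse (h m)) * (cis (- h m * (x \<bullet> v)) - 1)) \<longlonglongrightarrow> - (\<i> * complex_of_real (x \<bullet> v))"
    by (simp add: scaleR_conv_of_real mult.commute)
  then have "(\<lambda>m. complex_of_real (inverse (h m)) * (cis (- h m * (x \<bullet> v)) - 1) * ft u x) \<longlonglongrightarrow> - (\<i> * complex_of_real (x \<bullet> v)) * ft u x"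
    by (intro tendsto_intros)
  then have "(\<lambda>m. ft (D m) x) \<longlonglongrightarrow> - (\<i> * complex_of_real (x \<bullet> v)) * ft u x" by (simp only: ftD)
  from LIMSEQ_unique[OF l1 this] show "ft u' x = - (\<i> * complex_of_real (x \<bullet> v) * ft u x)" by simp
qed

lemma ft_decay_dir:
  fixes u :: "'a::euclidean_space \<Rightarrow> complex"
  assumes K: "compact K"
  shows "u \<in> borel_measurable borel \<Longrightarrow> jet k v UNIV C u \<Longrightarrow> (\<And>x. x \<notin> K \<Longrightarrow> u x = 0) \<Longrightarrow>
    \<bar>x \<bullet> v\<bar> ^ k * norm (ft u x) \<le> C * measure lborel K"
proof (induction k arbitrary: u)
  case 0
  then have b: "norm (u x) \<le> C" for x by auto
  show ?case
    using norm_ft_le[OF integrable_bounded_support(1)[OF 0(1) K b 0(3)], of x]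
      integrable_bounded_support(2)[OF 0(1) K b 0(3)] by simp
next
  case (Suc k)
  then obtain u' where u': "\<And>x. dder v u (u' x) x" "jet k v UNIV C u'" by auto
  have b: "norm (u x) \<le> C" for x using Suc.prems by auto
  have b': "norm (u' x) \<le> C" for x using jet_bound[OF u'(2)] by auto
  have u'0: "u' x = 0" if "x \<notin> K" for x
  proof (rule dder_unique[OF u'(1)])
    have oK: "open (- K)" using compact_imp_closed[OF K] by auto
    show "dder v u 0 x"
      by (rule dder_cong_open[OF _ oK, of v "\<lambda>x. 0"]) (use that Suc.prems in \<open>auto simp: dder_def\<close>)
  qed
  note d = ft_dder[OF Suc.prems(1) K b Suc.prems(3) u'(1) b']
  have "\<bar>x \<bullet> v\<bar> ^ k * norm (ft u' x) \<le> C * measure lborel K"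
    by (rule Suc.IH[OF d(1) u'(2) u'0])
  then show ?case by (simp add: d(2) norm_mult mult_ac)
qed

text \<open>Some coordinate of x has absolute value at least norm x / n, and k derivatives in that
  direction alone give the decay; when \<mu> times that coordinate is at most 1, the plain L^1 bound
  suffices. Hence pure derivatives along basis vectors are all that has to be estimated.\<close>

lemma ft_decay:
  fixes u :: "'a::euclidean_space \<Rightarrow> complex"
  assumes um: "u \<in> borel_measurable borel" and K: "compact K" and u0: "\<And>x. x \<notin> K \<Longrightarrow> u x = 0"
    and j: "\<And>b. b \<in> Basis \<Longrightarrow> jet k (\<mu> *\<^sub>R b) UNIV C u" and \<mu>: "\<mu> \<ge> 0"
  shows "(1 + \<mu> * norm x) ^ k * norm (ft u x) \<le> (2 * real DIM('a)) ^ k * (C * measure lborel K)"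
proof -
  let ?M = "Max ((\<lambda>b. \<bar>x \<bullet> b\<bar>) ` Basis)"
  have "?M \<in> (\<lambda>b. \<bar>x \<bullet> b\<bar>) ` Basis" by (rule Max_in) auto
  then obtain b where b: "b \<in> Basis" "?M = \<bar>x \<bullet> b\<bar>" by (rule imageE)
  have "norm x \<le> (\<Sum>b\<in>Basis. \<bar>x \<bullet> b\<bar>)" by (rule norm_le_l1)
  also have "\<dots> \<le> (\<Sum>b\<in>(Basis::'a set). ?M)" by (intro sum_mono) auto
  finally have nx: "norm x \<le> real DIM('a) * \<bar>x \<bullet> b\<bar>" by (simp add: b)
  have k0: "norm (ft u x) \<le> C * measure lborel K"
    using ft_decay_dir[OF K um jet_le[OF j[OF b(1)], of 0] u0, of x] by simp
  have kk: "(\<mu> * \<bar>x \<bullet> b\<bar>) ^ k * norm (ft u x) \<le> C * measure lborel K"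
    using ft_decay_dir[OF K um j[OF b(1)] u0, of x] \<mu> by (simp add: abs_mult)
  show ?thesis
  proof (cases "\<mu> * \<bar>x \<bullet> b\<bar> \<le> 1")
    case True
    have d1: "real DIM('a) \<ge> 1" using DIM_positive[where 'a='a] by linarith
    have "\<mu> * norm x \<le> real DIM('a) * (\<mu> * \<bar>x \<bullet> b\<bar>)" using mult_left_mono[OF nx \<mu>] by (simp add: mult_ac)
    also have "\<dots> \<le> real DIM('a) * 1" by (intro mult_left_mono True) auto
    finally have "1 + \<mu> * norm x \<le> 2 * real DIM('a)" using d1 by linarith
    then have "(1 + \<mu> * norm x) ^ k \<le> (2 * real DIM('a)) ^ k" using \<mu> by (intro power_mono) auto
    then show ?thesis using k0 by (intro mult_mono) auto
  next
    case False
    have d1: "real DIM('a) \<ge> 1" using DIM_positive[where 'a='a] by linarith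
    have "\<mu> * norm x \<le> real DIM('a) * (\<mu> * \<bar>x \<bullet> b\<bar>)" using mult_left_mono[OF nx \<mu>] by (simp add: mult_ac)
    moreover have "1 \<le> real DIM('a) * (\<mu> * \<bar>x \<bullet> b\<bar>)" using False d1 mult_mono[of 1 "real DIM('a)" 1 "\<mu> * \<bar>x \<bullet> b\<bar>"] by auto
    ultimately have "1 + \<mu> * norm x \<le> 2 * real DIM('a) * (\<mu> * \<bar>x \<bullet> b\<bar>)" by linarith
    then have "(1 + \<mu> * norm x) ^ k \<le> (2 * real DIM('a) * (\<mu> * \<bar>x \<bullet> b\<bar>)) ^ k" using \<mu> by (intro power_mono) auto
    then have "(1 + \<mu> * norm x) ^ k * norm (ft u x) \<le> (2 * real DIM('a)) ^ k * ((\<mu> * \<bar>x \<bullet> b\<bar>) ^ k * norm (ft u x))"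
      by (simp add: power_mult_distrib mult_right_mono mult.assoc[symmetric])
    also have "\<dots> \<le> (2 * real DIM('a)) ^ k * (C * measure lborel K)" using kk by (intro mult_left_mono) auto
    finally show ?thesis .
  qed
qed

section \<open>Derivatives of composite functions\<close>

lemma jet_comp_same:
  fixes g :: "nat \<Rightarrow> real \<Rightarrow> 'b::real_normed_vector"
  assumes der: "\<And>i t. t \<in> T \<Longrightarrow> i < K \<Longrightarrow> (g i has_vector_derivative g (Suc i) t) (at t)"
    and bd: "\<And>i t. t \<in> T \<Longrightarrow> i \<le> K \<Longrightarrow> norm (g i t) \<le> B"
    and C: "C \<ge> 0" and B: "B \<ge> 0"
  shows "\<exists>E\<ge>0. \<forall>f S v. (\<forall>x\<in>S. f x \<in> T) \<longrightarrow> jet K v S C f \<longrightarrow> jet K v S E (\<lambda>x::'a::real_normed_vector. g 0 (f x))"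
proof (cases K)
  case 0
  then show ?thesis using bd[of _ 0] B by (intro exI[of _ B]) auto
next
  case (Suc k)
  then have K: "0 + Suc k \<le> K" by simp
  have "\<exists>E\<ge>0. \<forall>f f' S v. (\<forall>x\<in>S. f x \<in> T) \<longrightarrow> (\<forall>x\<in>S. dder v f (f' x) (x::'a)) \<longrightarrow>
    jet k v S C f' \<longrightarrow> jet (Suc k) v S E (\<lambda>x. g 0 (f x))"
    by (rule jet_comp[where K=K and B=B]) (use der bd C B K in auto)
  then obtain E where "E \<ge> 0" and E: "\<forall>f f' S v. (\<forall>x\<in>S. f x \<in> T) \<longrightarrow> (\<forall>x\<in>S. dder v f (f' x) (x::'a)) \<longrightarrow>
    jet k v S C f' \<longrightarrow> jet (Suc k) v S E (\<lambda>x. g 0 (f x))" by blast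
  show ?thesis
  proof (intro exI[of _ E] conjI allI impI \<open>E \<ge> 0\<close>)
    fix f S v assume a: "\<forall>x\<in>S. f x \<in> T" "jet K v S C (f::'a \<Rightarrow> real)"
    then obtain f' where "\<forall>x\<in>S. dder v f (f' x) (x::'a)" "jet k v S C f'" unfolding Suc by auto
    with a(1) show "jet K v S E (\<lambda>x. g 0 (f x))" unfolding Suc by (intro E[rule_format]) auto
  qed
qed

lemma jet_comp_interval:
  fixes g :: "nat \<Rightarrow> real \<Rightarrow> 'b::real_normed_vector"
  assumes der: "\<And>i t. a < t \<Longrightarrow> t < b \<Longrightarrow> i < K \<Longrightarrow> (g i has_vector_derivative g (Suc i) t) (at t)"
    and cont: "\<And>i. i \<le> K \<Longrightarrow> continuous_on {a..b} (g i)" and C: "C \<ge> 0"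
  shows "\<exists>E\<ge>0. \<forall>f S v. (\<forall>x\<in>S. f x \<in> {a<..<b}) \<longrightarrow> jet K v S C f \<longrightarrow> jet K v S E (\<lambda>x::'a::real_normed_vector. g 0 (f x))"
proof -
  have "bounded (\<Union>i\<in>{..K}. g i ` {a..b})"
    using cont by (intro bounded_UN) (auto intro!: compact_imp_bounded compact_continuous_image)
  then obtain B where "\<forall>y\<in>(\<Union>i\<in>{..K}. g i ` {a..b}). norm y \<le> B"
    unfolding bounded_iff by (rule exE)
  then have B: "\<And>i t. i \<le> K \<Longrightarrow> t \<in> {a..b} \<Longrightarrow> norm (g i t) \<le> B" by auto
  show ?thesis
    by (rule jet_comp_same[where B="max B 0"]) (use der B C in \<open>auto simp: le_max_iff_disj\<close>)
qed

text \<open>All derivatives of cis have norm 1 at every point, so the phase f may be arbitrarily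
  large and only its derivative is bounded.\<close>

lemma jet_cis:
  assumes C: "C \<ge> 0"
  shows "\<exists>E\<ge>0. \<forall>f f' S v. (\<forall>x\<in>S. dder v f (f' x) (x::'a::real_normed_vector)) \<longrightarrow>
    jet k v S C f' \<longrightarrow> jet (Suc k) v S E (\<lambda>x. cis (f x))"
proof -
  let ?g = "\<lambda>i t. \<i> ^ i * cis t"
  have *: "(?g i has_vector_derivative ?g (Suc i) t) (at t)" for i t
    unfolding has_vector_derivative_def by (auto intro!: derivative_eq_intros simp: mult_ac scaleR_conv_of_real)
  have **: "norm (?g i t) \<le> 1" for i t by (simp add: norm_mult norm_power)
  show ?thesis
    using jet_comp[where T=UNIV and K="Suc k" and g="?g" and k=k and i=0 and C=C and B=1, where 'a='a] * ** C by simp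
qed

text \<open>One constant serves the value R^2, the derivative 2 (x . v) and the second derivative.
  It is 10 for R = 2 and 26 for R = 4, the numbers that appear in the applications.\<close>

lemma jet_norm_square:
  assumes "norm v \<le> 1" "R \<ge> 0"
  shows "jet k v (ball 0 R) (R\<^sup>2 + 2 * R + 2) (\<lambda>x::'a::real_inner. (norm x)\<^sup>2)"
proof -
  have a: "(norm x)\<^sup>2 \<le> R\<^sup>2 + 2 * R + 2" if "norm x < R" for x :: 'a
    proof -
    have "(norm x)\<^sup>2 \<le> R\<^sup>2" using that by (intro power_mono) auto
    then show ?thesis using assms by linarith
  qed
  show ?thesis
  proof (cases k)
    case (Suc l)
    have d: "dder v (\<lambda>x. (norm x)\<^sup>2) (2 * (x \<bullet> v)) x" for x :: 'a
      unfolding power2_norm_eq_inner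
      by (rule dder_has_derivative[where D="\<lambda>h. 2 * (x \<bullet> h)", simplified])
         (auto intro!: derivative_eq_intros simp: inner_commute)
    have "jet l v (ball 0 R) (\<bar>2\<bar> * (R + 1)) (\<lambda>x. 2 *\<^sub>R (x \<bullet> v))"
    proof (intro jet_cmult_real jet_inner)
      fix x :: 'a assume "x \<in> ball 0 R"
      then show "\<bar>x \<bullet> v\<bar> \<le> R + 1"
        using Cauchy_Schwarz_ineq2[of x v] assms mult_mono[of "norm x" R "norm v" 1] by auto
    qed (use assms in auto)
    then have "jet l v (ball 0 R) (R\<^sup>2 + 2 * R + 2) (\<lambda>x. 2 * (x \<bullet> v))"
      by (auto elim!: jet_mono)
    then show ?thesis using a d unfolding Suc by (auto intro!: exI[of _ "\<lambda>x. 2 * (x \<bullet> v)"])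
  qed (use a in auto)
qed

section \<open>Finitely smooth cut-off functions\<close>

text \<open>Bumps that are only \<open>K\<close> times differentiable suffice, and stay algebraic: \<open>chi K\<close> equals \<open>1\<close> for
  \<open>norm \<xi> \<le> 1\<close> and vanishes for \<open>(norm \<xi>)\<^sup>2 \<ge> 2\<close>.\<close>

definition ppow :: "nat \<Rightarrow> real \<Rightarrow> real"
  where "ppow m t = (max 0 t) ^ m"

lemma ppow_cont: "continuous_on S (ppow m)"
  unfolding ppow_def by (intro continuous_intros)

lemma ppow_deriv: "(ppow (Suc (Suc m)) has_real_derivative real (Suc (Suc m)) * ppow (Suc m) t) (at t)"
proof -
  consider "t > 0" | "t < 0" | "t = 0" by linarith
  then show ?thesis
  proof cases
    case 1
    have "((\<lambda>t. t ^ Suc (Suc m)) has_real_derivative real (Suc (Suc m)) * t ^ Suc m) (at t)"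
      by (auto intro!: derivative_eq_intros simp: power_Suc[symmetric] simp del: power_Suc)
    then have "(ppow (Suc (Suc m)) has_real_derivative real (Suc (Suc m)) * t ^ Suc m) (at t)"
      by (rule DERIV_cong_ev[THEN iffD1, rotated 3])
         (use 1 in \<open>auto simp: ppow_def max_def eventually_nhds intro!: exI[of _ "{0<..}"]\<close>)
    then show ?thesis using 1 by (simp add: ppow_def max_def)
  next
    case 2
    have "((\<lambda>t. 0) has_real_derivative 0) (at t)" by simp
    then have "(ppow (Suc (Suc m)) has_real_derivative 0) (at t)"
      by (rule DERIV_cong_ev[THEN iffD1, rotated 3])
         (use 2 in \<open>auto simp: ppow_def max_def eventually_nhds intro!: exI[of _ "{..<0}"]\<close>)
    then show ?thesis using 2 by (simp add: ppow_def max_def)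
  next
    case 3
    have "((\<lambda>y. (ppow (Suc (Suc m)) y - ppow (Suc (Suc m)) 0) / (y - 0)) \<longlongrightarrow> 0) (at 0)"
    proof (rule Lim_null_comparison)
      show "\<forall>\<^sub>F y in at 0. norm ((ppow (Suc (Suc m)) y - ppow (Suc (Suc m)) 0) / (y - 0)) \<le> \<bar>y\<bar> ^ Suc m"
      proof (intro always_eventually allI)
        fix y :: real
        show "norm ((ppow (Suc (Suc m)) y - ppow (Suc (Suc m)) 0) / (y - 0)) \<le> \<bar>y\<bar> ^ Suc m"
        proof (cases "y \<ge> 0")
          case False
          then have "ppow (Suc (Suc m)) y - ppow (Suc (Suc m)) 0 = 0" by (simp add: ppow_def max_def)
          then show ?thesis by (simp only:) simp
        qed (simp add: ppow_def max_def)
      qed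
      show "((\<lambda>y::real. \<bar>y\<bar> ^ Suc m) \<longlongrightarrow> 0) (at 0)"
        by (rule tendsto_eq_intros refl)+ auto
    qed
    then show ?thesis using 3 by (simp add: has_field_derivative_iff ppow_def)
  qed
qed

lemma jet_ppow:
  assumes C: "C \<ge> 0"
  shows "\<exists>E\<ge>0. \<forall>f S v. jet K v S C f \<longrightarrow> jet K v S E (\<lambda>x::'a::real_normed_vector. ppow (Suc K) (f x))"
proof -
  \<comment> \<open>The i-th derivative of the truncated power with exponent \<open>Suc K\<close>.
    Up to i = K the exponent stays at least 1, so the chain is continuous and stops exactly at order
    K.\<close>
  define g where "g i t = (\<Prod>l<i. real (Suc K - l)) * ppow (Suc K - i) t" for i t
  have "\<exists>E\<ge>0. \<forall>f S v. (\<forall>x\<in>S. f x \<in> {-C-1<..<C+1}) \<longrightarrow> jet K v S C f \<longrightarrow> jet K v S E (\<lambda>x::'a. g 0 (f x))"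
  proof (rule jet_comp_interval)
    fix i t assume "i < K"
    define m where "m = K - Suc i"
    have m: "Suc K - i = Suc (Suc m)" using \<open>i < K\<close> by (simp add: m_def)
    then have m': "Suc K - Suc i = Suc m" by simp
    have "(g i has_real_derivative g (Suc i) t) (at t)"
      unfolding g_def m m' prod.lessThan_Suc
      by (rule derivative_eq_intros ppow_deriv refl)+ (simp add: m)
    then show "(g i has_vector_derivative g (Suc i) t) (at t)"
      by (simp add: has_real_derivative_iff_has_vector_derivative)
  next
    show "continuous_on {-C-1..C+1} (g i)" for i
      unfolding g_def by (intro continuous_intros ppow_cont)
  qed (fact C)
  then obtain E where "E \<ge> 0" and E: "\<forall>f S v. (\<forall>x\<in>S. f x \<in> {-C-1<..<C+1}) \<longrightarrow> jet K v S C f \<longrightarrow> jet K v S E (\<lambda>x::'a. g 0 (f x))" by blast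
  show ?thesis
  proof (intro exI[of _ E] conjI allI impI \<open>E \<ge> 0\<close>)
    fix f S v assume j: "jet K v S C (f :: 'a \<Rightarrow> real)"
    have "f x \<in> {-C-1<..<C+1}" if "x \<in> S" for x using jet_bound[OF j that] by auto
    then have "jet K v S E (\<lambda>x. g 0 (f x))" using j by (intro E[rule_format]) auto
    then show "jet K v S E (\<lambda>x. ppow (Suc K) (f x))" by (simp add: g_def)
  qed
qed

definition chi :: "nat \<Rightarrow> 'a::euclidean_space \<Rightarrow> real"
  where "chi K \<xi> = ppow (Suc K) (1 - ppow (Suc K) ((norm \<xi>)\<^sup>2 - 1))"

text \<open>A difference of two dilates, so that sums over dyadic scales telescope exactly. It lives
  where 1/2 <= norm \<xi> <= sqrt 2.\<close>

definition psi :: "nat \<Rightarrow> 'a::euclidean_space \<Rightarrow> real"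
  where "psi K \<xi> = chi K \<xi> - chi K (2 *\<^sub>R \<xi>)"

lemma chi_cont: "continuous_on S (chi K)"
  unfolding chi_def ppow_def by (intro continuous_intros)

lemma psi_cont: "continuous_on S (psi K)"
  unfolding psi_def chi_def ppow_def by (intro continuous_intros)

lemma chi_measurable[measurable]: "chi K \<in> borel_measurable borel"
  by (intro borel_measurable_continuous_onI chi_cont)

lemma psi_measurable[measurable]: "psi K \<in> borel_measurable borel"
  by (intro borel_measurable_continuous_onI psi_cont)

lemma ppow_nonneg: "ppow m t \<ge> 0" and ppow_le_1: "t \<le> 1 \<Longrightarrow> ppow m t \<le> 1"
  by (auto simp: ppow_def intro!: power_le_one)

lemma chi_nonneg: "chi K \<xi> \<ge> 0" and chi_le_1: "chi K \<xi> \<le> 1"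
  unfolding chi_def by (auto intro!: ppow_nonneg ppow_le_1)

lemma chi_eq_1:
  assumes "norm \<xi> \<le> 1" shows "chi K \<xi> = 1"
proof -
  have "(norm \<xi>)\<^sup>2 \<le> 1" using assms by (simp add: power_le_one)
  then show ?thesis by (simp add: chi_def ppow_def)
qed

lemma chi_eq_0:
  assumes "(norm \<xi>)\<^sup>2 \<ge> 2" shows "chi K \<xi> = 0"
proof -
  have "((norm \<xi>)\<^sup>2 - 1) ^ Suc K \<ge> 1" using assms by (intro one_le_power) auto
  then have "ppow (Suc K) ((norm \<xi>)\<^sup>2 - 1) \<ge> 1" using assms by (simp add: ppow_def max_def)
  then show ?thesis by (simp add: chi_def ppow_def[of _ "1 - _"])
qed

lemma psi_bound: "\<bar>psi K \<xi>\<bar> \<le> 1"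
  unfolding psi_def using chi_nonneg[of K \<xi>] chi_le_1[of K \<xi>] chi_nonneg[of K "2 *\<^sub>R \<xi>"] chi_le_1[of K "2 *\<^sub>R \<xi>"] by linarith

lemma psi_eq_0:
  assumes "norm \<xi> \<le> 1/2 \<or> (norm \<xi>)\<^sup>2 \<ge> 2" shows "psi K \<xi> = 0"
  using assms
proof
  assume "norm \<xi> \<le> 1/2" then show ?thesis by (simp add: psi_def chi_eq_1)
next
  assume a: "(norm \<xi>)\<^sup>2 \<ge> 2"
  then have "(norm (2 *\<^sub>R \<xi>))\<^sup>2 \<ge> 2" by (simp add: power_mult_distrib)
  with a show ?thesis by (simp add: psi_def chi_eq_0)
qed

lemma chi_psi_sum:
  "chi K \<xi> + (\<Sum>k=1..m. psi K ((1 / 2 ^ k) *\<^sub>R \<xi>)) = chi K ((1 / 2 ^ m) *\<^sub>R \<xi>)"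
proof (induction m)
  case (Suc m)
  have "psi K ((1 / 2 ^ Suc m) *\<^sub>R \<xi>) = chi K ((1 / 2 ^ Suc m) *\<^sub>R \<xi>) - chi K ((1 / 2 ^ m) *\<^sub>R \<xi>)"
    by (simp add: psi_def)
  with Suc show ?case by simp
qed simp

lemma chi_jet_ball:
  "\<exists>E\<ge>0. \<forall>v. norm v \<le> 1 \<longrightarrow> jet K v (ball 0 2) E (chi K :: 'a::euclidean_space \<Rightarrow> real)"
proof -
  obtain E1 where "E1 \<ge> 0" and E1: "\<forall>f S v. jet K v S 11 f \<longrightarrow> jet K v S E1 (\<lambda>x::'a. ppow (Suc K) (f x))"
    using jet_ppow[of 11 K, where 'a='a] by auto
  obtain E2 where "E2 \<ge> 0" and E2: "\<forall>f S v. jet K v S (1 + E1) f \<longrightarrow> jet K v S E2 (\<lambda>x::'a. ppow (Suc K) (f x))"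
    using jet_ppow[of "1 + E1" K, where 'a='a] \<open>E1 \<ge> 0\<close> by auto
  show ?thesis
  proof (intro exI[of _ E2] conjI allI impI \<open>E2 \<ge> 0\<close>)
    fix v :: 'a assume v: "norm v \<le> 1"
    have "jet K v (ball 0 2) (10 + 1) (\<lambda>x::'a. (norm x)\<^sup>2 - 1)"
      using jet_norm_square[OF v, of 2 K] by (intro jet_diff jet_const) auto
    then have "jet K v (ball 0 2) E1 (\<lambda>x::'a. ppow (Suc K) ((norm x)\<^sup>2 - 1))"
      using E1 by simp
    then have "jet K v (ball 0 2) (1 + E1) (\<lambda>x::'a. 1 - ppow (Suc K) ((norm x)\<^sup>2 - 1))"
      by (intro jet_diff jet_const) auto
    then show "jet K v (ball 0 2) E2 (chi K)" using E2 unfolding chi_def by blast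
  qed
qed

lemma chi_jet:
  "\<exists>E\<ge>0. \<forall>v. norm v \<le> 1 \<longrightarrow> jet K v UNIV E (chi K :: 'a::euclidean_space \<Rightarrow> real)"
proof -
  obtain E where "E \<ge> 0" and E: "\<forall>v. norm v \<le> 1 \<longrightarrow> jet K v (ball 0 2) E (chi K :: 'a \<Rightarrow> real)"
    using chi_jet_ball by blast
  have "jet K v UNIV E (chi K)" if "norm v \<le> 1" for v :: 'a
  \<comment> \<open>The radius 3/2 lies between sqrt 2, where \<open>chi\<close> ends, and 2. It is
    the rational outer radius used for all dyadic blocks below.\<close>
  proof (rule jet_extend_zero[where S="ball 0 2" and K="cball 0 (3/2)"])
    fix x :: 'a assume "x \<notin> cball 0 (3/2)"
    then have "(norm x)\<^sup>2 \<ge> (3/2)\<^sup>2" by (intro power_mono) auto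
    then show "chi K x = 0" by (intro chi_eq_0) (auto simp: power2_eq_square)
  next
    show "jet K v (ball 0 2) E (chi K)" using E that by blast
  qed (use \<open>E \<ge> 0\<close> in auto)
  then show ?thesis using \<open>E \<ge> 0\<close> by (intro exI[of _ E]) auto
qed

text \<open>Dilation by 2 doubles the direction vector, hence the bound 1/2 on norm v and the halved
  basis vectors in the applications.\<close>

lemma psi_jet:
  "\<exists>E\<ge>0. \<forall>v. norm v \<le> 1/2 \<longrightarrow> jet K v UNIV E (psi K :: 'a::euclidean_space \<Rightarrow> real)"
proof -
  obtain E where "E \<ge> 0" and E: "\<forall>v. norm v \<le> 1 \<longrightarrow> jet K v UNIV E (chi K :: 'a \<Rightarrow> real)"
    using chi_jet by blast
  have "jet K v UNIV (E + E) (psi K)" if v: "norm v \<le> 1/2" for v :: 'a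
    unfolding psi_def
  proof (rule jet_diff)
    have "jet K v UNIV E (\<lambda>x. chi K (0 + 2 *\<^sub>R x :: 'a))"
      by (rule jet_affine[where S=UNIV]) (use E v in auto)
    then show "jet K v UNIV E (\<lambda>x. chi K (2 *\<^sub>R x :: 'a))" by simp
  qed (use E v in auto)
  then show ?thesis using \<open>E \<ge> 0\<close> by (intro exI[of _ "E + E"]) auto
qed

section \<open>Oscillating factors on an annulus\<close>

definition annulus :: "real \<Rightarrow> real \<Rightarrow> 'a::euclidean_space set"
  where "annulus a b = {\<xi>. a < norm \<xi> \<and> norm \<xi> < b}"

lemma open_annulus: "open (annulus a b)"
  unfolding annulus_def by (intro open_Collect_conj open_Collect_less continuous_intros)

text \<open>The square of the norm is a polynomial, and the function is its power s/2; on the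
  annulus the square ranges over (1/16, 16), where all derivatives of the power are bounded.\<close>

lemma norm_powr_jet:
  "\<exists>E\<ge>0. \<forall>v. norm v \<le> 1 \<longrightarrow> jet K v (annulus (1/4) 4) E (\<lambda>\<xi>::'a::euclidean_space. norm \<xi> powr s)"
proof -
  define g where "g i t = (\<Prod>l<i. s/2 - real l) * t powr (s/2 - real i)" for i and t :: real
  have "\<exists>E\<ge>0. \<forall>f S v. (\<forall>x\<in>S. f x \<in> {1/16<..<16}) \<longrightarrow> jet K v S 26 f \<longrightarrow> jet K v S E (\<lambda>x::'a. g 0 (f x))"
  proof (rule jet_comp_interval)
    fix i and t :: real assume t: "1/16 < t"
    have "((\<lambda>t. (\<Prod>l<i. s/2 - real l) * t powr (s/2 - real i)) has_real_derivative
        (\<Prod>l<i. s/2 - real l) * ((s/2 - real i) * t powr (s/2 - real i - 1))) (at t)"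
      using t by (intro DERIV_cmult has_real_derivative_powr) simp
    moreover have "g i = (\<lambda>t. (\<Prod>l<i. s/2 - real l) * t powr (s/2 - real i))" by (simp add: g_def fun_eq_iff)
    moreover have "g (Suc i) t = (\<Prod>l<i. s/2 - real l) * ((s/2 - real i) * t powr (s/2 - real i - 1))"
      by (simp add: g_def mult.assoc diff_diff_eq add.commute)
    ultimately have "(g i has_real_derivative g (Suc i) t) (at t)" by simp
    then show "(g i has_vector_derivative g (Suc i) t) (at t)"
      by (simp add: has_real_derivative_iff_has_vector_derivative)
  next
    show "continuous_on {1/16..16} (g i)" for i
      unfolding g_def by (intro continuous_intros) auto
  qed simp
  then obtain E where "E \<ge> 0" and E: "\<forall>f S v. (\<forall>x\<in>S. f x \<in> {1/16<..<16}) \<longrightarrow> jet K v S 26 f \<longrightarrow> jet K v S E (\<lambda>x::'a. g 0 (f x))" by blast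
  show ?thesis
  proof (intro exI[of _ E] conjI allI impI \<open>E \<ge> 0\<close>)
    fix v :: 'a assume v: "norm v \<le> 1"
    have "jet K v (ball 0 4) 26 (\<lambda>x::'a. (norm x)\<^sup>2)" using jet_norm_square[OF v, of 4 K] by simp
    then have "jet K v (annulus (1/4) 4) 26 (\<lambda>x::'a. (norm x)\<^sup>2)" by (rule jet_mono) (auto simp: annulus_def)
    moreover have "(norm x)\<^sup>2 \<in> {1/16<..<16}" if "x \<in> annulus (1/4) 4" for x :: 'a
      using that power_strict_mono[of "1/4" "norm x" 2] power_strict_mono[of "norm x" 4 2]
      by (auto simp: annulus_def power2_eq_square)
    ultimately have "jet K v (annulus (1/4) 4) E (\<lambda>x::'a. g 0 ((norm x)\<^sup>2))"
      by (intro E[rule_format]) auto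
    then show "jet K v (annulus (1/4) 4) E (\<lambda>\<xi>. norm \<xi> powr s)"
    proof (rule jet_cong_open[OF open_annulus, rotated])
      fix x :: 'a assume "x \<in> annulus (1/4) 4"
      then have "norm x > 0" by (auto simp: annulus_def)
      then have "((norm x)\<^sup>2) powr (s/2) = norm x powr s" by (simp add: powr_powr flip: powr_numeral)
      then show "g 0 ((norm x)\<^sup>2) = norm x powr s" by (simp add: g_def)
    qed
  qed
qed

lemma dder_scaled:
  assumes "dder v f d x" shows "dder (r *\<^sub>R v) f (r *\<^sub>R d) x"
proof -
  have "((\<lambda>t. f (x + t *\<^sub>R v)) \<circ> (\<lambda>t. t * r) has_vector_derivative r *\<^sub>R d) (at 0)"
    by (rule vector_diff_chain_at) (use assms in \<open>auto simp: dder_def intro!: derivative_eq_intros\<close>)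
  then show ?thesis by (simp add: dder_def o_def)
qed

lemma dder_cmult: "dder v f d x \<Longrightarrow> dder v (\<lambda>x. c * f x) (c * d) (x::'a::real_normed_vector)" for c :: real
  unfolding dder_def by (rule has_vector_derivative_mult_right)

abbreviation psi_supp :: "'a::euclidean_space set"
  where "psi_supp \<equiv> cball 0 (3/2) - ball 0 (1/2)"

lemma psi_supp: "compact (psi_supp :: 'a::euclidean_space set)" "closed (psi_supp :: 'a set)" "psi_supp \<subseteq> annulus (1/4) 4"
  "\<xi> \<notin> psi_supp \<Longrightarrow> psi K \<xi> = 0"
proof -
  show "compact (psi_supp :: 'a set)" by (intro compact_diff) auto
  then show "closed (psi_supp :: 'a set)" by (rule compact_imp_closed)
  show "psi_supp \<subseteq> annulus (1/4) 4" by (auto simp: annulus_def)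
  assume "\<xi> \<notin> psi_supp"
  then consider "norm \<xi> < 1/2" | "norm \<xi> > 3/2" by force
  then show "psi K \<xi> = 0"
  proof cases
    case 2
    then have "(norm \<xi>)\<^sup>2 \<ge> (3/2)\<^sup>2" by (intro power_mono) auto
    then show ?thesis by (intro psi_eq_0) (auto simp: power2_eq_square)
  qed (intro psi_eq_0, auto)
qed

text \<open>The phase has size L, so its natural scale is 1/L: shortening v by L gives L * norm
  \<xi> powr s the first derivative of the unscaled phase, and further derivatives only become
  smaller.\<close>

lemma osc_jet_high:
  "\<exists>E\<ge>0. \<forall>L v. L \<ge> 1 \<longrightarrow> norm v \<le> 1/2 \<longrightarrow>
    jet K ((1/L) *\<^sub>R v) UNIV E (\<lambda>\<xi>::'a::euclidean_space. cis (L * norm \<xi> powr s) * complex_of_real (psi K \<xi>))"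
proof -
  obtain E1 where E1: "E1 \<ge> 0" "\<And>v. norm v \<le> 1 \<Longrightarrow> jet (Suc K) v (annulus (1/4) 4) E1 (\<lambda>\<xi>::'a. norm \<xi> powr s)"
    using norm_powr_jet by blast
  obtain E2 where E2: "E2 \<ge> 0" "\<And>f f' S v. (\<forall>x\<in>S. dder v f (f' x) (x::'a)) \<Longrightarrow>
    jet K v S E1 f' \<Longrightarrow> jet (Suc K) v S E2 (\<lambda>x. cis (f x))" using jet_cis[OF E1(1), of K, where 'a='a] by blast
  obtain E3 where E3: "E3 \<ge> 0" "\<And>v. norm v \<le> 1/2 \<Longrightarrow> jet K v UNIV E3 (psi K :: 'a \<Rightarrow> real)"
    using psi_jet by blast
  show ?thesis
  proof (intro exI[of _ "2 ^ K * E2 * E3"] conjI allI impI)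
    fix L :: real and v :: 'a assume L: "L \<ge> 1" and v: "norm v \<le> 1/2"
    obtain f' where f': "\<forall>x\<in>annulus (1/4) 4. dder v (\<lambda>\<xi>::'a. norm \<xi> powr s) (f' x) x" "jet K v (annulus (1/4) 4) E1 f'"
      using E1(2)[of v] v by auto
    have a: "jet K ((1/L) *\<^sub>R v) (annulus (1/4) 4) E1 f'"
      by (rule jet_scale_dir) (use L E1 f' in auto)
    have "dder ((1/L) *\<^sub>R v) (\<lambda>\<xi>::'a. L * norm \<xi> powr s) (f' x) x" if "x \<in> annulus (1/4) 4" for x
      using dder_cmult[OF dder_scaled[of v _ "f' x" x "1/L"], of "\<lambda>\<xi>. norm \<xi> powr s" L] f'(1) that L by simp
    with a have c: "jet (Suc K) ((1/L) *\<^sub>R v) (annulus (1/4) 4) E2 (\<lambda>x::'a. cis (L * norm x powr s))"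
      by (intro E2) auto
    have "jet K ((1/L) *\<^sub>R v) UNIV E3 (psi K :: 'a \<Rightarrow> real)"
      by (rule jet_scale_dir) (use L E3 v in auto)
    then have p: "jet K ((1/L) *\<^sub>R v) (annulus (1/4) 4) E3 (\<lambda>\<xi>::'a. complex_of_real (psi K \<xi>))"
      by (intro jet_of_real) (auto elim: jet_mono)
    show "jet K ((1/L) *\<^sub>R v) UNIV (2 ^ K * E2 * E3) (\<lambda>\<xi>. cis (L * norm \<xi> powr s) * complex_of_real (psi K \<xi>))"
      by (rule jet_extend_zero[OF open_annulus psi_supp(2,3)])
         (use jet_mult[OF E2(1) jet_Suc_D[OF c] p] E2 E3 in \<open>auto simp: psi_supp(4)\<close>)
  qed (use E2 E3 in auto)
qed

lemma norm_cis_minus_1: "norm (cis t - 1) \<le> \<bar>t\<bar>"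
proof -
  have "norm (cis t - cis 0) \<le> 1 * norm (t - 0)"
    by (rule differentiable_bound[where S=UNIV and f'="\<lambda>x h. h *\<^sub>R (\<i> * cis x)"])
       (auto intro!: derivative_eq_intros simp: onorm_scaleR_left onorm_id norm_mult)
  then show ?thesis by simp
qed

text \<open>For a small phase, cis - 1 and all its derivatives are O(L). This gain makes the shells
  around the origin summable in \<open>kernel_low\<close>.\<close>

lemma osc_jet_low:
  "\<exists>E\<ge>0. \<forall>L v. 0 \<le> L \<longrightarrow> L \<le> 1 \<longrightarrow> norm v \<le> 1/2 \<longrightarrow>
    jet K v UNIV (E * L) (\<lambda>\<xi>::'a::euclidean_space. (cis (L * norm \<xi> powr s) - 1) * complex_of_real (psi K \<xi>))"
proof -
  obtain E1 where E1: "E1 \<ge> 0" "\<And>v. norm v \<le> 1 \<Longrightarrow> jet (Suc K) v (annulus (1/4) 4) E1 (\<lambda>\<xi>::'a. norm \<xi> powr s)"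
    using norm_powr_jet by blast
  obtain E2 where E2: "E2 \<ge> 0" "\<And>f f' S v. (\<forall>x\<in>S. dder v f (f' x) (x::'a)) \<Longrightarrow>
    jet K v S E1 f' \<Longrightarrow> jet (Suc K) v S E2 (\<lambda>x. cis (f x))" using jet_cis[OF E1(1), of K, where 'a='a] by blast
  obtain E3 where E3: "E3 \<ge> 0" "\<And>v. norm v \<le> 1/2 \<Longrightarrow> jet K v UNIV E3 (psi K :: 'a \<Rightarrow> real)"
    using psi_jet by blast
  \<comment> \<open>The summand E1 bounds cis - 1 by the size of its argument; the other one bounds
    the derivative, a product of L f' and i times the exponential.\<close>
  define D where "D = E1 + 2 ^ K * E1 * E2"
  have D: "D \<ge> 0" using E1 E2 by (auto simp: D_def)
  show ?thesis
  proof (intro exI[of _ "2 ^ K * D * E3"] conjI allI impI)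
    fix L :: real and v :: 'a assume L: "0 \<le> L" "L \<le> 1" and v: "norm v \<le> 1/2"
    let ?A = "annulus (1/4) 4 :: 'a set"
    obtain f' where f': "\<forall>x\<in>?A. dder v (\<lambda>\<xi>::'a. norm \<xi> powr s) (f' x) x" "jet K v ?A E1 f'"
      using E1(2)[of v] v by auto
    have d: "dder v (\<lambda>\<xi>::'a. L * norm \<xi> powr s) (L * f' x) x" if "x \<in> ?A" for x
      using dder_cmult f'(1) that by blast
    have jf: "jet K v ?A (\<bar>L\<bar> * E1) (\<lambda>x. L *\<^sub>R f' x)" by (rule jet_cmult_real[OF f'(2)])
    have jf1: "jet K v ?A E1 (\<lambda>x. L * f' x)"
      by (rule jet_mono[OF jf[unfolded real_scaleR_def]]) (use L E1 in \<open>auto intro: mult_left_le_one_le\<close>)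
    have c: "jet (Suc K) v ?A E2 (\<lambda>x::'a. cis (L * norm x powr s))"
      by (rule E2(2)[OF _ jf1]) (use d in auto)
    have "jet K v ?A (2 ^ K * (\<bar>L\<bar> * E1) * E2) (\<lambda>x. (L *\<^sub>R f' x) *\<^sub>R (\<i> * cis (L * norm x powr s)))"
      using jet_bounded_linear[OF bounded_linear_mult_right[of \<i>], of 1 K v ?A E2 "\<lambda>x. cis (L * norm x powr s)"] jet_Suc_D[OF c]
      by (intro jet_scaleR jf) (use E1 in \<open>auto simp: norm_mult\<close>)
    then have j0: "jet K v ?A (2 ^ K * (\<bar>L\<bar> * E1) * E2) (\<lambda>x. (L * f' x) *\<^sub>R (\<i> * cis (L * norm x powr s)))"
      by (simp only: real_scaleR_def)
    have j1: "jet K v ?A (D * L) (\<lambda>x. (L * f' x) *\<^sub>R (\<i> * cis (L * norm x powr s)))"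
      by (rule jet_mono[OF j0]) (use L E1 in \<open>auto simp: D_def algebra_simps\<close>)
    have dc: "dder v (\<lambda>x. cis (L * norm x powr s) - 1) ((L * f' x) *\<^sub>R (\<i> * cis (L * norm x powr s))) x" if "x \<in> ?A" for x
    proof -
      have "((\<lambda>t. cis (L * norm (x + t *\<^sub>R v) powr s) - 1) has_derivative
          (\<lambda>h. (h *\<^sub>R (L * f' x)) *\<^sub>R (\<i> * cis (L * norm (x + 0 *\<^sub>R v) powr s)) - 0)) (at 0)"
        by (intro has_derivative_diff has_derivative_cis has_derivative_const)
           (use d[OF that] in \<open>simp only: dder_def has_vector_derivative_def\<close>)
      then show ?thesis by (simp add: dder_def has_vector_derivative_def)
    qed
    have b: "norm (cis (L * norm x powr s) - 1) \<le> D * L" if "x \<in> ?A" for x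
    proof -
      have "norm (cis (L * norm x powr s) - 1) \<le> L * \<bar>norm x powr s\<bar>"
        using norm_cis_minus_1[of "L * norm x powr s"] L by (simp add: abs_mult)
      also have "\<dots> \<le> L * E1" using jet_bound[OF E1(2)[of v] that] v L by (intro mult_left_mono) auto
      also have "\<dots> \<le> D * L" using L E1 E2 by (auto simp: D_def algebra_simps)
      finally show ?thesis .
    qed
    have "jet (Suc K) v ?A (D * L) (\<lambda>x. cis (L * norm x powr s) - 1)"
      using b j1 dc by (subst jet.simps) (auto intro!: exI[of _ "\<lambda>x. (L * f' x) *\<^sub>R (\<i> * cis (L * norm x powr s))"] simp del: jet.simps)
    then have c: "jet K v ?A (D * L) (\<lambda>x. cis (L * norm x powr s) - 1)" by (rule jet_Suc_D)
    have p: "jet K v ?A E3 (\<lambda>\<xi>::'a. complex_of_real (psi K \<xi>))"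
      using E3(2)[OF v] by (intro jet_of_real) (auto elim: jet_mono)
    have "jet K v ?A (2 ^ K * (D * L) * E3) (\<lambda>\<xi>. (cis (L * norm \<xi> powr s) - 1) * complex_of_real (psi K \<xi>))"
      by (rule jet_mult[OF _ c p]) (use D L in auto)
    moreover have "2 ^ K * (D * L) * E3 = 2 ^ K * D * E3 * L" by simp
    ultimately show "jet K v UNIV (2 ^ K * D * E3 * L) (\<lambda>\<xi>. (cis (L * norm \<xi> powr s) - 1) * complex_of_real (psi K \<xi>))"
      by (intro jet_extend_zero[OF open_annulus psi_supp(2,3)])
         (use D E3 L in \<open>auto simp: psi_supp(4)\<close>)
  qed (use D E3 in auto)
qed

section \<open>Integrable weights\<close>

lemma integrable_cauchy: "integrable lborel (\<lambda>x::real. 1 / (1 + x\<^sup>2))"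
proof -
  have "set_integrable lborel (einterval (-\<infinity>) \<infinity>) (\<lambda>x::real. 1 / (1 + x\<^sup>2))"
  proof (rule interval_integral_FTC_nonneg)
    show "DERIV arctan x :> 1 / (1 + x\<^sup>2)" for x :: real
      by (auto intro!: derivative_eq_intros simp: field_simps)
    show "isCont (\<lambda>x::real. 1 / (1 + x\<^sup>2)) x" for x
      by (intro continuous_intros) (smt (verit) zero_le_power2)
    show "((arctan \<circ> real_of_ereal) \<longlongrightarrow> - (pi/2)) (at_right (- \<infinity>))"
      unfolding ereal_tendsto_simps1 by (rule tendsto_arctan_at_bot)
    show "((arctan \<circ> real_of_ereal) \<longlongrightarrow> pi/2) (at_left \<infinity>)"
      unfolding ereal_tendsto_simps1 by (rule tendsto_arctan_at_top)
  qed auto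
  then show ?thesis by (simp add: set_integrable_def)
qed

text \<open>The product of the factors 1 + (x . b)^2 is at most (1 + norm x)^(2 n), so the weight
  lies below a product of integrable functions of one variable. This is the origin of the exponent 2
  n in the requirements on K.\<close>

lemma integrable_weight: "integrable lborel (\<lambda>x::'a::euclidean_space. 1 / (1 + norm x) ^ (2 * DIM('a)))"
proof (rule Bochner_Integration.integrable_bound)
  show "integrable lborel (\<lambda>x::'a. \<Prod>b\<in>Basis. complex_of_real (1 / (1 + (x \<bullet> b)\<^sup>2)))"
    using integrable_lborel_prod_Basis[where f="\<lambda>b::'a. \<lambda>t. complex_of_real (1 / (1 + t\<^sup>2))"]
      integrable_of_real[OF integrable_cauchy] by blast
  show "AE x in lborel. norm (1 / (1 + norm x) ^ (2 * DIM('a))) \<le> norm (\<Prod>b\<in>Basis. complex_of_real (1 / (1 + ((x::'a) \<bullet> b)\<^sup>2)))"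
  proof (rule AE_I2)
    fix x :: 'a
    have "(\<Prod>b\<in>(Basis::'a set). 1 + (x \<bullet> b)\<^sup>2) \<le> (\<Prod>b\<in>(Basis::'a set). (1 + norm x)\<^sup>2)"
    proof (intro prod_mono conjI)
      fix b :: 'a assume "b \<in> Basis"
      then have "\<bar>x \<bullet> b\<bar> \<le> norm x" by (rule Basis_le_norm)
      then have "(x \<bullet> b)\<^sup>2 \<le> (norm x)\<^sup>2" by (metis abs_norm_cancel abs_le_square_iff)
      moreover have "(1 + norm x)\<^sup>2 = 1 + 2 * norm x + (norm x)\<^sup>2" by (simp add: power2_eq_square algebra_simps)
      ultimately show "1 + (x \<bullet> b)\<^sup>2 \<le> (1 + norm x)\<^sup>2" using norm_ge_zero[of x] by linarith
    qed (auto intro: add_nonneg_nonneg)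
    also have "\<dots> = (1 + norm x) ^ (2 * DIM('a))" by (simp add: power_mult)
    finally have le: "(\<Prod>b\<in>(Basis::'a set). 1 + (x \<bullet> b)\<^sup>2) \<le> (1 + norm x) ^ (2 * DIM('a))" .
    have pos: "(\<Prod>b\<in>(Basis::'a set). 1 + (x \<bullet> b)\<^sup>2) > 0" by (intro prod_pos) (auto intro: add_pos_nonneg)
    have "norm (\<Prod>b\<in>Basis. complex_of_real (1 / (1 + (x \<bullet> b)\<^sup>2))) = 1 / (\<Prod>b\<in>(Basis::'a set). 1 + (x \<bullet> b)\<^sup>2)"
      unfolding of_real_prod[symmetric] norm_of_real
      by (subst abs_of_nonneg) (auto intro!: prod_nonneg add_nonneg_nonneg simp: prod_dividef)
    moreover have "1 / (1 + norm x) ^ (2 * DIM('a)) \<le> 1 / (\<Prod>b\<in>(Basis::'a set). 1 + (x \<bullet> b)\<^sup>2)"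
      using le pos by (intro divide_left_mono) (auto intro!: mult_pos_pos zero_less_power add_pos_nonneg)
    ultimately show "norm (1 / (1 + norm x) ^ (2 * DIM('a))) \<le> norm (\<Prod>b\<in>Basis. complex_of_real (1 / (1 + (x \<bullet> b)\<^sup>2)))" by simp
  qed
qed measurable

lemma nn_integral_weight:
  "\<exists>W\<ge>0. \<forall>N c \<mu>. 2 * DIM('a) \<le> N \<longrightarrow> \<mu> > 0 \<longrightarrow>
    (\<integral>\<^sup>+x. ennreal (1 / (1 + \<mu> * norm (x - c :: 'a::euclidean_space)) ^ N) \<partial>lborel) \<le> ennreal (W / \<mu> ^ DIM('a))"
proof -
  define w where "w x = 1 / (1 + norm x) ^ (2 * DIM('a))" for x :: 'a
  have w0: "w x \<ge> 0" for x by (simp add: w_def)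
  have [measurable]: "w \<in> borel_measurable borel" unfolding w_def by measurable
  define W where "W = (LINT x|lborel. w x)"
  have W: "(\<integral>\<^sup>+x. ennreal (w x) \<partial>lborel) = ennreal W"
    unfolding W_def using integrable_weight w0 by (intro nn_integral_eq_integral) (auto simp: w_def)
  have W0: "W \<ge> 0" unfolding W_def by (simp add: w0 integral_nonneg_AE)
  show ?thesis
  proof (intro exI[of _ W] conjI allI impI W0)
    fix N c and \<mu> :: real assume N: "2 * DIM('a) \<le> N" and \<mu>: "\<mu> > 0"
    have "(\<integral>\<^sup>+x. ennreal (1 / (1 + \<mu> * norm (x - c)) ^ N) \<partial>lborel) \<le> (\<integral>\<^sup>+x. ennreal (w (- \<mu> *\<^sub>R c + \<mu> *\<^sub>R x)) \<partial>lborel)"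
    proof (intro nn_integral_mono ennreal_leI)
      fix x
      have "norm (- \<mu> *\<^sub>R c + \<mu> *\<^sub>R x) = \<mu> * norm (x - c)"
      proof -
        have "- \<mu> *\<^sub>R c + \<mu> *\<^sub>R x = \<mu> *\<^sub>R (x - c)" by (simp add: scaleR_diff_right)
        then show ?thesis using \<mu> by simp
      qed
      then have "w (- \<mu> *\<^sub>R c + \<mu> *\<^sub>R x) = 1 / (1 + \<mu> * norm (x - c)) ^ (2 * DIM('a))" by (simp add: w_def)
      moreover have "(1 + \<mu> * norm (x - c)) ^ (2 * DIM('a)) \<le> (1 + \<mu> * norm (x - c)) ^ N"
        using N \<mu> by (intro power_increasing) auto
      ultimately show "1 / (1 + \<mu> * norm (x - c)) ^ N \<le> w (- \<mu> *\<^sub>R c + \<mu> *\<^sub>R x)"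
        using \<mu> by (auto intro!: divide_left_mono mult_pos_pos zero_less_power add_pos_nonneg)
    qed
    moreover have "ennreal (\<mu> ^ DIM('a)) * (\<integral>\<^sup>+x. ennreal (w (- \<mu> *\<^sub>R c + \<mu> *\<^sub>R x)) \<partial>lborel) = ennreal W"
      using nn_integral_lborel_affine[of "\<lambda>x. ennreal (w x)" \<mu> "- \<mu> *\<^sub>R c"] \<mu> W by simp
    then have "(\<integral>\<^sup>+x. ennreal (w (- \<mu> *\<^sub>R c + \<mu> *\<^sub>R x)) \<partial>lborel) = ennreal (W / \<mu> ^ DIM('a))"
    proof -
      assume a: "ennreal (\<mu> ^ DIM('a)) * (\<integral>\<^sup>+x. ennreal (w (- \<mu> *\<^sub>R c + \<mu> *\<^sub>R x)) \<partial>lborel) = ennreal W"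
      have "ennreal (1 / \<mu> ^ DIM('a)) * (ennreal (\<mu> ^ DIM('a)) * (\<integral>\<^sup>+x. ennreal (w (- \<mu> *\<^sub>R c + \<mu> *\<^sub>R x)) \<partial>lborel)) = ennreal (1 / \<mu> ^ DIM('a)) * ennreal W"
        by (simp only: a)
      moreover have "ennreal (1 / \<mu> ^ DIM('a)) * ennreal (\<mu> ^ DIM('a)) = 1"
        using \<mu> by (subst ennreal_mult[symmetric]) auto
      moreover have "ennreal (1 / \<mu> ^ DIM('a)) * ennreal W = ennreal (W / \<mu> ^ DIM('a))"
        using \<mu> W0 by (subst ennreal_mult[symmetric]) auto
      ultimately show ?thesis by (simp only: mult.assoc[symmetric]) simp
    qed
    ultimately show "(\<integral>\<^sup>+x. ennreal (1 / (1 + \<mu> * norm (x - c)) ^ N) \<partial>lborel) \<le> ennreal (W / \<mu> ^ DIM('a))" by simp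
  qed
qed

section \<open>The gradient of the phase\<close>

definition grad :: "real \<Rightarrow> 'a::euclidean_space \<Rightarrow> 'a"
  where "grad s \<xi> = (s * norm \<xi> powr (s - 2)) *\<^sub>R \<xi>"

lemma dder_norm_powr:
  assumes "\<xi> \<noteq> 0"
  shows "dder v (\<lambda>\<xi>. norm \<xi> powr s) (grad s \<xi> \<bullet> v) \<xi>"
proof -
  have n: "norm \<xi> > 0" using assms by simp
  have "((\<lambda>t. t powr s) has_derivative (\<lambda>h. h * (s * norm \<xi> powr (s - 1)))) (at (norm \<xi>))"
    using has_real_derivative_powr[OF n, of s] unfolding has_field_derivative_def by (simp add: mult_commute_abs)
  from has_derivative_compose[OF has_derivative_norm[OF assms] this]
  have "((\<lambda>\<xi>. norm \<xi> powr s) has_derivative (\<lambda>h. (h \<bullet> sgn \<xi>) * (s * norm \<xi> powr (s - 1)))) (at \<xi>)" .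
  from dder_has_derivative[OF this, of v] show ?thesis
    using n by (simp add: grad_def powr_diff power2_eq_square field_simps sgn_div_norm inner_commute)
qed

text \<open>Mean value theorem: on [1/4, 4] the power with exponent p - 1 lies between 4 to the -|p
  - 1| and 4 to the |p - 1|.\<close>

lemma powr_bilip:
  fixes p :: real
  assumes p: "p \<noteq> 0"
  shows "\<exists>c>0. \<exists>L>0. \<forall>r\<in>{1/4..4}. \<forall>q\<in>{1/4..4}.
    c * \<bar>r - q\<bar> \<le> \<bar>r powr p - q powr p\<bar> \<and> \<bar>r powr p - q powr p\<bar> \<le> L * \<bar>r - q\<bar>"
proof -
  have a: "\<bar>p\<bar> * (4::real) powr (- \<bar>p - 1\<bar>) * \<bar>r - q\<bar> \<le> \<bar>r powr p - q powr p\<bar> \<and> \<bar>r powr p - q powr p\<bar> \<le> \<bar>p\<bar> * (4::real) powr \<bar>p - 1\<bar> * \<bar>r - q\<bar>"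
    if r: "1/4 \<le> q" "q < r" "r \<le> 4" for r q :: real
  proof -
    have "((\<lambda>t. t powr p) has_real_derivative p * x powr (p - 1)) (at x)" if "q \<le> x" for x
      using r that by (intro has_real_derivative_powr) auto
    then obtain z where z: "q < z" "z < r" "r powr p - q powr p = (r - q) * (p * z powr (p - 1))"
      using MVT2[OF r(2), of "\<lambda>t. t powr p" "\<lambda>t. p * t powr (p - 1)"] by metis
    have "\<bar>ln z\<bar> \<le> ln 4"
    proof -
      have "ln z \<le> ln 4" using z r by simp
      moreover have "ln (1/4) \<le> ln z" using z r by simp
      ultimately show ?thesis by (simp add: ln_div)
    qed
    then have "\<bar>(p - 1) * ln z\<bar> \<le> \<bar>p - 1\<bar> * ln 4" by (simp add: abs_mult mult_left_mono)
    then have "(4::real) powr (- \<bar>p - 1\<bar>) \<le> z powr (p - 1)" "z powr (p - 1) \<le> (4::real) powr \<bar>p - 1\<bar>"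
      using z r by (auto simp: powr_def)
    then show ?thesis using z r
      by (auto simp: abs_mult mult.commute[of "r - q"] intro!: mult_right_mono mult_left_mono)
  qed
  show ?thesis
  proof (rule exI[of _ "\<bar>p\<bar> * (4::real) powr (- \<bar>p - 1\<bar>)"], rule conjI[rotated], rule exI[of _ "\<bar>p\<bar> * (4::real) powr \<bar>p - 1\<bar>"], intro conjI ballI)
    fix r q :: real assume rq: "r \<in> {1/4..4}" "q \<in> {1/4..4}"
    have "\<bar>p\<bar> * (4::real) powr (- \<bar>p - 1\<bar>) * \<bar>r - q\<bar> \<le> \<bar>r powr p - q powr p\<bar> \<and> \<bar>r powr p - q powr p\<bar> \<le> \<bar>p\<bar> * (4::real) powr \<bar>p - 1\<bar> * \<bar>r - q\<bar>"
      using a[of q r] a[of r q] rq by (cases r q rule: linorder_cases) (auto simp: abs_minus_commute)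
    then show "\<bar>p\<bar> * (4::real) powr (- \<bar>p - 1\<bar>) * \<bar>r - q\<bar> \<le> \<bar>r powr p - q powr p\<bar>" "\<bar>r powr p - q powr p\<bar> \<le> \<bar>p\<bar> * (4::real) powr \<bar>p - 1\<bar> * \<bar>r - q\<bar>" by auto
  qed (use p in auto)
qed

text \<open>Nondegeneracy of the phase in global form. The Hessian would give the lower bound only
  locally, and the annulus is not convex, so the difference is split: up to the factor s, its square
  is a radial part, governed by the power r^(s - 1) of the norm, plus a positive multiple of the
  angular part. The radial part is where s = 1 would fail.\<close>

lemma grad_bilip:
  assumes s: "s > 0" "s \<noteq> 1"
  shows "\<exists>c>0. \<exists>L>0. \<forall>\<xi>\<in>annulus (1/4) 4. \<forall>\<nu>\<in>annulus (1/4) (4::real).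
    c * norm (\<xi> - \<nu>) \<le> norm (grad s \<xi> - grad s \<nu>) \<and> norm (grad s \<xi> - grad s (\<nu>::'a::euclidean_space)) \<le> L * norm (\<xi> - \<nu>)"
proof -
  obtain c L where c: "c > 0" and L: "L > 0" and cL: "\<And>r q::real. r \<in> {1/4..4} \<Longrightarrow> q \<in> {1/4..4} \<Longrightarrow>
    c * \<bar>r - q\<bar> \<le> \<bar>r powr (s - 1) - q powr (s - 1)\<bar> \<and> \<bar>r powr (s - 1) - q powr (s - 1)\<bar> \<le> L * \<bar>r - q\<bar>"
    using powr_bilip[of "s - 1"] s by force
  define m M where "m = min c ((4::real) powr (- \<bar>s - 2\<bar>))" and "M = max L ((4::real) powr \<bar>s - 2\<bar>)"
  have m: "m > 0" and M: "M > 0" using c L by (auto simp: m_def M_def)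
  have key: "m * norm (\<xi> - \<nu>) \<le> norm (norm \<xi> powr (s - 2) *\<^sub>R \<xi> - norm \<nu> powr (s - 2) *\<^sub>R \<nu>) \<and>
     norm (norm \<xi> powr (s - 2) *\<^sub>R \<xi> - norm \<nu> powr (s - 2) *\<^sub>R \<nu>) \<le> M * norm (\<xi> - \<nu>)"
    if "\<xi> \<in> annulus (1/4) 4" "\<nu> \<in> annulus (1/4) 4" for \<xi> \<nu> :: 'a
  proof -
    define r q where "r = norm \<xi>" and "q = norm \<nu>"
    have r: "1/4 < r" "r < 4" "1/4 < q" "q < 4" using that by (auto simp: annulus_def r_def q_def)
    define a b where "a = r powr (s - 2)" and "b = q powr (s - 2)"
    have ln4: "\<bar>ln t\<bar> \<le> ln 4" if "1/4 < t" "t < 4" for t :: real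
    proof -
      have "ln t \<le> ln 4" using that by simp
      moreover have "ln (1/4) \<le> ln t" using that by simp
      ultimately show ?thesis by (simp add: ln_div)
    qed
    have bd: "(4::real) powr (- \<bar>s - 2\<bar>) \<le> t powr (s - 2) \<and> t powr (s - 2) \<le> (4::real) powr \<bar>s - 2\<bar>" if t: "1/4 < t" "t < 4" for t :: real
    proof -
      have "\<bar>(s - 2) * ln t\<bar> \<le> \<bar>s - 2\<bar> * ln 4" using ln4[OF t] by (simp add: abs_mult mult_left_mono)
      then show ?thesis using t by (auto simp: powr_def)
    qed
    have a: "m \<le> a" "a \<le> M" "m \<le> b" "b \<le> M" using bd[of r] bd[of q] r by (auto simp: a_def b_def m_def M_def min_def max_def)
    have ar: "a * r = r powr (s - 1)" "b * q = q powr (s - 1)"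
      using r by (auto simp: a_def b_def powr_mult_base[symmetric] mult.commute powr_diff power2_eq_square)
    \<comment> \<open>The angular part 2 (r q - \<xi> . \<nu>), which vanishes when \<xi> and \<nu>
      point in the same direction.\<close>
    define X where "X = (norm (\<xi> - \<nu>))\<^sup>2 - (r - q)\<^sup>2"
    have X: "X \<ge> 0"
    proof -
      have "\<bar>r - q\<bar> \<le> norm (\<xi> - \<nu>)" unfolding r_def q_def by (rule norm_triangle_ineq3)
      then show ?thesis by (simp add: X_def abs_le_square_iff[symmetric])
    qed
    have id: "(norm (a *\<^sub>R \<xi> - b *\<^sub>R \<nu>))\<^sup>2 = (a * r - b * q)\<^sup>2 + a * b * X"
    proof -
      have n: "(norm (a *\<^sub>R \<xi> - b *\<^sub>R \<nu>))\<^sup>2 = a\<^sup>2 * r\<^sup>2 + b\<^sup>2 * q\<^sup>2 - 2 * a * b * (\<xi> \<bullet> \<nu>)" for a b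
        unfolding r_def q_def power2_norm_eq_inner
        by (simp add: inner_diff inner_commute power2_eq_square algebra_simps)
      have "(norm (\<xi> - \<nu>))\<^sup>2 = r\<^sup>2 + q\<^sup>2 - 2 * (\<xi> \<bullet> \<nu>)" using n[of 1 1] by simp
      then have X2: "X = 2 * r * q - 2 * (\<xi> \<bullet> \<nu>)" by (simp add: X_def power2_eq_square algebra_simps)
      show ?thesis unfolding X2 n by (simp add: power2_eq_square algebra_simps)
    qed
    have cc: "m * \<bar>r - q\<bar> \<le> \<bar>a * r - b * q\<bar>" "\<bar>a * r - b * q\<bar> \<le> M * \<bar>r - q\<bar>"
      using cL[of r q] r mult_right_mono[of m c "\<bar>r - q\<bar>"] mult_right_mono[of L M "\<bar>r - q\<bar>"]
      unfolding ar by (auto simp: m_def M_def)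
    have "m\<^sup>2 * (r - q)\<^sup>2 \<le> (a * r - b * q)\<^sup>2" "(a * r - b * q)\<^sup>2 \<le> M\<^sup>2 * (r - q)\<^sup>2"
      using power_mono[OF cc(1), of 2] power_mono[OF cc(2), of 2] m by (auto simp: power_mult_distrib)
    moreover have "m\<^sup>2 * X \<le> a * b * X" "a * b * X \<le> M\<^sup>2 * X"
      using a m X by (auto simp: power2_eq_square intro!: mult_right_mono mult_mono)
    ultimately have "m\<^sup>2 * (norm (\<xi> - \<nu>))\<^sup>2 \<le> (norm (a *\<^sub>R \<xi> - b *\<^sub>R \<nu>))\<^sup>2" "(norm (a *\<^sub>R \<xi> - b *\<^sub>R \<nu>))\<^sup>2 \<le> M\<^sup>2 * (norm (\<xi> - \<nu>))\<^sup>2"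
      unfolding id by (auto simp: X_def algebra_simps)
    then have "(m * norm (\<xi> - \<nu>))\<^sup>2 \<le> (norm (a *\<^sub>R \<xi> - b *\<^sub>R \<nu>))\<^sup>2" "(norm (a *\<^sub>R \<xi> - b *\<^sub>R \<nu>))\<^sup>2 \<le> (M * norm (\<xi> - \<nu>))\<^sup>2"
      by (auto simp: power_mult_distrib)
    then show ?thesis using m M
      by (auto simp: a_def b_def r_def q_def intro!: power2_le_imp_le[of _ "norm (_ - _ :: 'a)"] dest!: power2_le_imp_le)
  qed
  have g: "grad s \<xi> - grad s \<nu> = s *\<^sub>R (norm \<xi> powr (s - 2) *\<^sub>R \<xi> - norm \<nu> powr (s - 2) *\<^sub>R \<nu>)" for \<xi> \<nu> :: 'a
    by (simp add: grad_def scaleR_diff_right)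
  show ?thesis
  proof (rule exI[of _ "s * m"], rule conjI[rotated], rule exI[of _ "s * M"], intro conjI ballI)
    fix \<xi> \<nu> :: 'a assume "\<xi> \<in> annulus (1/4) 4" "\<nu> \<in> annulus (1/4) 4"
    from key[OF this] show "s * m * norm (\<xi> - \<nu>) \<le> norm (grad s \<xi> - grad s \<nu>)" "norm (grad s \<xi> - grad s \<nu>) \<le> s * M * norm (\<xi> - \<nu>)"
      using s unfolding g by (auto simp: mult.assoc intro!: mult_left_mono)
  qed (use s m M in auto)
qed

section \<open>Wave packets and the dispersive_estimate estimate\<close>

text \<open>The linear part of the phase at \<open>\<nu>\<close> is removed from the packet. At width \<open>d\<close> of order \<open>l powr (-1/2)\<close>
  the remaining phase is quadratic of size \<open>l * d\<^sup>2\<close>, hence has bounded derivatives at scale \<open>d\<close>, and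
  the packet is transformed into a bump at scale \<open>1/d\<close>.\<close>

definition packet :: "nat \<Rightarrow> real \<Rightarrow> real \<Rightarrow> real \<Rightarrow> 'a::euclidean_space \<Rightarrow> 'a \<Rightarrow> complex"
  where "packet K s l d \<nu> \<xi> = complex_of_real (chi K ((1/d) *\<^sub>R (\<xi> - \<nu>))) *
    (cis (l * norm \<xi> powr s - (l *\<^sub>R grad s \<nu>) \<bullet> \<xi>) * complex_of_real (psi K \<xi>))"

lemma packet_measurable[measurable]: "packet K s l d \<nu> \<in> borel_measurable borel"
  unfolding packet_def by measurable

lemma packet_eq_0:
  assumes "d > 0" "\<xi> \<notin> cball \<nu> (3/2 * d)" shows "packet K s l d \<nu> \<xi> = 0"
proof -
  have "norm (\<xi> - \<nu>) > 3/2 * d" using assms by (auto simp: dist_norm norm_minus_commute)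
  then have "norm (\<xi> - \<nu>) / d \<ge> 3/2" using assms(1) by (simp add: field_simps)
  moreover have e: "norm ((1/d) *\<^sub>R (\<xi> - \<nu>)) = norm (\<xi> - \<nu>) / d" using assms(1) by (simp only: norm_scaleR) simp
  ultimately have "norm ((1/d) *\<^sub>R (\<xi> - \<nu>)) \<ge> 3/2" by (simp only: e)
  then have "(norm ((1/d) *\<^sub>R (\<xi> - \<nu>)))\<^sup>2 \<ge> (3/2)\<^sup>2" by (intro power_mono) auto
  moreover have "(2::real) \<le> (3/2)\<^sup>2" by (simp add: power2_eq_square)
  ultimately have "(norm ((1/d) *\<^sub>R (\<xi> - \<nu>)))\<^sup>2 \<ge> 2" by (rule order_trans[rotated])
  then have "chi K ((1/d) *\<^sub>R (\<xi> - \<nu>)) = 0" by (rule chi_eq_0)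
  then show ?thesis by (simp add: packet_def)
qed

text \<open>Chosen with l d^2 = 1/256, so that the quadratic remainder of the phase is bounded. For
  l >= 1 also 2 d <= 1/8, which keeps a packet with 3/8 <= norm \<nu> <= 2 inside the annulus from
  1/4 to 4.\<close>

definition wave_scale :: "real \<Rightarrow> real" where "wave_scale l = 1 / (16 * sqrt l)"

text \<open>At scale d the first derivative of the reduced phase is l d (grad \<xi> - grad \<nu>) .
  v, which the Lipschitz bound on the gradient makes at most a multiple of l d^2. From the second
  derivative on the linear term is gone and the factor l d^2 appears by itself.\<close>

lemma packet_jet:
  assumes s: "s > 0" "s \<noteq> 1"
  shows "\<exists>E\<ge>0. \<forall>l \<nu> v. l \<ge> 1 \<longrightarrow> 3/8 \<le> norm \<nu> \<longrightarrow> norm \<nu> \<le> 2 \<longrightarrow> norm v \<le> 1/2 \<longrightarrow>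
    jet K (wave_scale l *\<^sub>R v) UNIV E (packet K s l (wave_scale l) (\<nu>::'a::euclidean_space))"
proof -
  obtain E1 where E1: "E1 \<ge> 0" "\<And>v. norm v \<le> 1 \<Longrightarrow> jet (Suc (Suc K)) v (annulus (1/4) 4) E1 (\<lambda>\<xi>::'a. norm \<xi> powr s)"
    using norm_powr_jet by blast
  obtain L where L: "L > 0" "\<And>\<xi> \<nu>::'a. \<xi> \<in> annulus (1/4) 4 \<Longrightarrow> \<nu> \<in> annulus (1/4) 4 \<Longrightarrow> norm (grad s \<xi> - grad s \<nu>) \<le> L * norm (\<xi> - \<nu>)"
    using grad_bilip[OF s, where 'a='a] by blast
  define C where "C = max L E1"
  have C: "C \<ge> 0" using E1 by (auto simp: C_def)
  obtain E2 where E2: "E2 \<ge> 0" "\<And>f f' S v. (\<forall>x\<in>S. dder v f (f' x) (x::'a)) \<Longrightarrow>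
    jet K v S C f' \<Longrightarrow> jet (Suc K) v S E2 (\<lambda>x. cis (f x))" using jet_cis[OF C, of K, where 'a='a] by blast
  obtain E3 where E3: "E3 \<ge> 0" "\<And>v. norm v \<le> 1/2 \<Longrightarrow> jet K v UNIV E3 (psi K :: 'a \<Rightarrow> real)"
    using psi_jet by blast
  obtain E4 where E4: "E4 \<ge> 0" "\<And>v. norm v \<le> 1 \<Longrightarrow> jet K v UNIV E4 (chi K :: 'a \<Rightarrow> real)"
    using chi_jet by blast
  show ?thesis
  proof (intro exI[of _ "2 ^ K * E4 * (2 ^ K * E2 * E3)"] conjI allI impI)
    fix l :: real and \<nu> v :: 'a assume l: "l \<ge> 1" and \<nu>: "3/8 \<le> norm \<nu>" "norm \<nu> \<le> 2" and v: "norm v \<le> 1/2"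
    define d where "d = wave_scale l"
    have d: "0 < d" "d \<le> 1/16" "l * d * d = 1/256"
      using l by (auto simp: d_def wave_scale_def field_simps)
    let ?A = "annulus (1/4) 4 :: 'a set" and ?S = "ball \<nu> (2 * d)"
    have SA: "?S \<subseteq> ?A"
    proof
      fix \<xi> assume "\<xi> \<in> ?S"
      then have "norm (\<xi> - \<nu>) < 1/8" using d by (auto simp: dist_norm norm_minus_commute)
      then show "\<xi> \<in> ?A" using \<nu> norm_triangle_ineq2[of \<xi> \<nu>] norm_triangle_ineq2[of \<nu> \<xi>]
        by (auto simp: annulus_def norm_minus_commute)
    qed
    have \<nu>A: "\<nu> \<in> ?A" using \<nu> by (auto simp: annulus_def)
    have nz: "\<xi> \<noteq> 0" if "\<xi> \<in> ?A" for \<xi> using that by (auto simp: annulus_def)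
    obtain f' where f': "\<forall>x\<in>?A. dder v (\<lambda>\<xi>::'a. norm \<xi> powr s) (f' x) x" "jet (Suc K) v ?A E1 f'"
      using E1(2)[of v] v unfolding jet.simps(2)[of "Suc K"] by auto
    have f'g: "f' \<xi> = grad s \<xi> \<bullet> v" if "\<xi> \<in> ?A" for \<xi>
      using dder_unique[OF f'(1)[rule_format, OF that] dder_norm_powr[OF nz[OF that]]] .
    obtain f'' where f'': "\<forall>x\<in>?A. dder v f' (f'' x) x" "jet K v ?A E1 f''"
      using f'(2) by auto
    define D where "D \<xi> = l * d * (f' \<xi> - grad s \<nu> \<bullet> v)" for \<xi>
    have dD: "dder (d *\<^sub>R v) (\<lambda>\<xi>. l * norm \<xi> powr s - (l *\<^sub>R grad s \<nu>) \<bullet> \<xi>) (D \<xi>) \<xi>" if "\<xi> \<in> ?A" for \<xi>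
    proof -
      have "dder (d *\<^sub>R v) (\<lambda>\<xi>. l * norm \<xi> powr s) (l * (d *\<^sub>R f' \<xi>)) \<xi>"
        by (intro dder_cmult dder_scaled) (use f'(1) that in auto)
      moreover have "dder (d *\<^sub>R v) (\<lambda>\<xi>. (l *\<^sub>R grad s \<nu>) \<bullet> \<xi>) ((l *\<^sub>R grad s \<nu>) \<bullet> (d *\<^sub>R v)) \<xi>"
        by (rule dder_has_derivative) (auto intro!: derivative_eq_intros)
      ultimately have "dder (d *\<^sub>R v) (\<lambda>\<xi>. l * norm \<xi> powr s - (l *\<^sub>R grad s \<nu>) \<bullet> \<xi>) (l * (d *\<^sub>R f' \<xi>) - (l *\<^sub>R grad s \<nu>) \<bullet> (d *\<^sub>R v)) \<xi>"
        unfolding dder_def by (rule has_vector_derivative_diff)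
      moreover have "l * (d *\<^sub>R f' \<xi>) - (l *\<^sub>R grad s \<nu>) \<bullet> (d *\<^sub>R v) = D \<xi>" by (simp add: D_def algebra_simps)
      ultimately show ?thesis by simp
    qed
    have Db: "norm (D \<xi>) \<le> C" if \<xi>: "\<xi> \<in> ?S" for \<xi>
    proof -
      have "\<xi> \<in> ?A" using SA \<xi> by auto
      have "\<bar>(grad s \<xi> - grad s \<nu>) \<bullet> v\<bar> \<le> norm (grad s \<xi> - grad s \<nu>) * norm v" by (rule Cauchy_Schwarz_ineq2)
      also have "\<dots> \<le> (L * norm (\<xi> - \<nu>)) * 1" using L v \<open>\<xi> \<in> ?A\<close> \<nu>A by (intro mult_mono) auto
      also have "\<dots> \<le> (L * (2 * d)) * 1" using \<xi> L by (intro mult_right_mono mult_left_mono) (auto simp: dist_norm norm_minus_commute)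
      finally have "l * d * \<bar>(grad s \<xi> - grad s \<nu>) \<bullet> v\<bar> \<le> l * d * (L * (2 * d))" using l d by (intro mult_left_mono) auto
      also have "\<dots> = L * (2 * (l * d * d))" by simp
      also have "\<dots> \<le> L * 1" using L by (intro mult_left_mono) (auto simp: d(3))
      finally have "l * d * \<bar>(grad s \<xi> - grad s \<nu>) \<bullet> v\<bar> \<le> C" by (simp add: C_def)
      then show ?thesis using l d f'g[OF \<open>\<xi> \<in> ?A\<close>] by (simp add: D_def abs_mult inner_diff_left)
    qed
    have "jet K (d *\<^sub>R v) ?S C (\<lambda>x. (1/256) *\<^sub>R f'' x)"
    proof (rule jet_mono[OF jet_cmult_real[OF jet_scale_dir[OF _ _ f''(2)]] _ SA])
      show "\<bar>1/256\<bar> * E1 \<le> C" using E1 by (auto simp: C_def)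
    qed (use d E1 in auto)
    moreover have "dder (d *\<^sub>R v) D ((1/256) *\<^sub>R f'' \<xi>) \<xi>" if "\<xi> \<in> ?S" for \<xi>
    proof -
      have "dder (d *\<^sub>R v) (\<lambda>\<xi>. f' \<xi> - grad s \<nu> \<bullet> v) (d *\<^sub>R f'' \<xi>) \<xi>"
        using dder_scaled[of v f' "f'' \<xi>" \<xi> d] f''(1) SA that by (auto simp: dder_def has_vector_derivative_diff_const)
      then have "dder (d *\<^sub>R v) D (l * d * (d *\<^sub>R f'' \<xi>)) \<xi>" unfolding D_def by (rule dder_cmult)
      moreover have "l * d * (d *\<^sub>R f'' \<xi>) = (1/256) *\<^sub>R f'' \<xi>" by (simp only: d(3) mult.assoc[symmetric] real_scaleR_def)
      ultimately show ?thesis by (simp only:)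
    qed
    ultimately have "jet (Suc K) (d *\<^sub>R v) ?S C D"
      using Db by (subst jet.simps) (auto intro!: exI[of _ "\<lambda>x. (1/256) *\<^sub>R f'' x"] simp del: jet.simps)
    then have "jet K (d *\<^sub>R v) ?S C D" by (rule jet_Suc_D)
    then have "jet (Suc K) (d *\<^sub>R v) ?S E2 (\<lambda>\<xi>. cis (l * norm \<xi> powr s - (l *\<^sub>R grad s \<nu>) \<bullet> \<xi>))"
      using dD SA by (intro E2(2)[where f'=D]) auto
    then have c: "jet K (d *\<^sub>R v) ?S E2 (\<lambda>\<xi>. cis (l * norm \<xi> powr s - (l *\<^sub>R grad s \<nu>) \<bullet> \<xi>))" by (rule jet_Suc_D)
    have "jet K (d *\<^sub>R v) UNIV E3 (psi K :: 'a \<Rightarrow> real)"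
      by (rule jet_scale_dir) (use d E3 v in auto)
    then have p: "jet K (d *\<^sub>R v) ?S E3 (\<lambda>\<xi>::'a. complex_of_real (psi K \<xi>))"
      by (intro jet_of_real) (auto elim: jet_mono)
    have "jet K (d *\<^sub>R v) ?S E4 (\<lambda>\<xi>. chi K ((- (1/d)) *\<^sub>R \<nu> + (1/d) *\<^sub>R \<xi>))"
      by (rule jet_affine[where S=UNIV]) (use d E4 v in auto)
    moreover have "(- (1/d)) *\<^sub>R \<nu> + (1/d) *\<^sub>R \<xi> = (1/d) *\<^sub>R (\<xi> - \<nu>)" for \<xi> by (simp add: scaleR_diff_right)
    ultimately have w: "jet K (d *\<^sub>R v) ?S E4 (\<lambda>\<xi>. complex_of_real (chi K ((1/d) *\<^sub>R (\<xi> - \<nu>))))"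
      by (intro jet_of_real) simp
    have "jet K (d *\<^sub>R v) ?S (2 ^ K * E4 * (2 ^ K * E2 * E3)) (packet K s l d \<nu>)"
      unfolding packet_def by (intro jet_mult w c p E4 E2)
    then show "jet K (wave_scale l *\<^sub>R v) UNIV (2 ^ K * E4 * (2 ^ K * E2 * E3)) (packet K s l (wave_scale l) \<nu>)"
      unfolding d_def[symmetric]
      by (intro jet_extend_zero[where S="?S" and K="cball \<nu> (3/2 * d)"])
         (use d E2 E3 E4 in \<open>auto intro!: packet_eq_0 simp: subset_iff\<close>)
  qed (use E2 E3 E4 in auto)
qed

text \<open>The integral of a nonintegrable function is 0 by convention, so the bound holds for
  every f and sizes can be estimated among nonnegative integrals throughout.\<close>

lemma norm_integral_le_nn_integral:
  fixes f :: "'a \<Rightarrow> complex"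
  shows "ennreal (norm (LINT x|M. f x)) \<le> (\<integral>\<^sup>+x. ennreal (norm (f x)) \<partial>M)"
  by (cases "integrable M f") (auto simp: integral_norm_bound_ennreal not_integrable_integral_eq)

lemma chi_integral_pos: "(LINT h|lborel. chi K (h::'a::euclidean_space)) > 0"
  and chi_integrable: "integrable lborel (chi K :: 'a \<Rightarrow> real)"
proof -
  have c: "compact (cball (0::'a) 2)" by simp
  have i1: "integrable lborel (\<lambda>x. indicator (cball (0::'a) 2) x :: real)"
    using emeasure_compact_finite[OF c] by auto
  have i2: "integrable lborel (\<lambda>x. indicator (cball (0::'a) 1) x :: real)"
    using emeasure_compact_finite[of "cball (0::'a) 1"] by auto
  have le: "chi K x \<le> indicator (cball (0::'a) 2) x" for x
    using chi_eq_0[of x K] chi_le_1[of K x] power_mono[of 2 "norm x" 2] by (auto simp: indicator_def)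
  show i: "integrable lborel (chi K :: 'a \<Rightarrow> real)"
    by (rule Bochner_Integration.integrable_bound[OF i1])
       (auto intro!: AE_I2 simp: abs_of_nonneg chi_nonneg le)
  have "0 < measure lborel (cball (0::'a) 1)" using content_cball_gt_0_iff[of "0::'a" 1] by simp
  also have "\<dots> = (LINT x|lborel. indicator (cball (0::'a) 1) x)" by simp
  also have "\<dots> \<le> (LINT h|lborel. chi K (h::'a))"
    by (rule integral_mono[OF i2 i]) (auto simp: indicator_def chi_eq_1 chi_nonneg)
  finally show "(LINT h|lborel. chi K (h::'a)) > 0" .
qed

lemma psi_integrable: "integrable lborel (\<lambda>\<xi>::'a::euclidean_space. cis (f \<xi>) * complex_of_real (psi K \<xi>))"
  if [measurable]: "f \<in> borel_measurable borel"
  by (rule integrable_bounded_support(1)[OF _ psi_supp(1), where C=1])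
     (auto simp: norm_mult psi_bound psi_supp(4))

text \<open>Removing the linear phase translates the transform by l grad s \<nu>, the displacement
  at the group velocity of frequency \<nu>.\<close>

lemma ft_packet:
  assumes "d > 0"
  shows "ft (\<lambda>\<xi>. complex_of_real (chi K ((1/d) *\<^sub>R (\<xi> - \<nu>))) * (cis (l * norm \<xi> powr s) * complex_of_real (psi K \<xi>))) x
    = ft (packet K s l d \<nu>) (x + l *\<^sub>R grad s \<nu>)"
  unfolding ft_def packet_def
proof (intro Bochner_Integration.integral_cong refl)
  fix \<xi>
  have e: "cis (l * norm \<xi> powr s) * cis (x \<bullet> \<xi>) = cis (l * norm \<xi> powr s - (l *\<^sub>R grad s \<nu>) \<bullet> \<xi>) * cis ((x + l *\<^sub>R grad s \<nu>) \<bullet> \<xi>)"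
    by (simp add: cis_mult inner_add_left algebra_simps)
  have r: "z * (A * (y * p)) = A * ((y * z) * p)" for z A y p :: complex by (simp add: mult_ac)
  show "cis (x \<bullet> \<xi>) * (complex_of_real (chi K ((1/d) *\<^sub>R (\<xi> - \<nu>))) * (cis (l * norm \<xi> powr s) * complex_of_real (psi K \<xi>))) =
    cis ((x + l *\<^sub>R grad s \<nu>) \<bullet> \<xi>) * (complex_of_real (chi K ((1/d) *\<^sub>R (\<xi> - \<nu>))) * (cis (l * norm \<xi> powr s - (l *\<^sub>R grad s \<nu>) \<bullet> \<xi>) * complex_of_real (psi K \<xi>)))"
    by (simp only: r e)
qed

text \<open>Translates of a bump, integrated over all centres \<nu>, give the constant d^n times the
  integral of \<open>chi\<close>. This continuous superposition takes the place of a partition of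
  unity on a lattice of mesh d.\<close>

lemma packet_decomposition:
  fixes x :: "'a::euclidean_space" and K :: nat and s l d :: real
  assumes d: "d > 0"
  defines "v \<equiv> \<lambda>\<xi>::'a. cis (l * norm \<xi> powr s) * complex_of_real (psi K \<xi>)"
  shows "complex_of_real (d ^ DIM('a) * (LINT h|lborel. chi K (h::'a))) * ft v x =
    (LINT \<nu>|lborel. ft (packet K s l d \<nu>) (x + l *\<^sub>R grad s \<nu>))"
proof -
  have [measurable]: "v \<in> borel_measurable borel" unfolding v_def by measurable
  have vi: "integrable lborel v" unfolding v_def by (rule psi_integrable) measurable
  define c where "c = d ^ DIM('a) * (LINT h|lborel. chi K (h::'a))"
  have chi_shift: "integrable lborel (\<lambda>\<nu>. complex_of_real (chi K ((1/d) *\<^sub>R (\<xi> - \<nu>))))"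
    "(LINT \<nu>|lborel. complex_of_real (chi K ((1/d) *\<^sub>R (\<xi> - \<nu>)))) = complex_of_real c" for \<xi> :: 'a
  proof -
    have e: "(1/d) *\<^sub>R (\<xi> - \<nu>) = (1/d) *\<^sub>R \<xi> + (- (1/d)) *\<^sub>R \<nu>" for \<nu> by (simp add: scaleR_diff_right)
    have i: "integrable lborel (\<lambda>\<nu>. chi K ((1/d) *\<^sub>R (\<xi> - \<nu>)))"
      unfolding e using chi_integrable d by (subst integrable_lborel_affine_iff) auto
    then show "integrable lborel (\<lambda>\<nu>. complex_of_real (chi K ((1/d) *\<^sub>R (\<xi> - \<nu>))))" by simp
    have "(LINT h|lborel. chi K (h::'a)) = \<bar>- (1/d)\<bar> ^ DIM('a) *\<^sub>R (LINT \<nu>|lborel. chi K ((1/d) *\<^sub>R (\<xi> - \<nu>)))"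
      unfolding e by (rule integral_lborel_affine) (use d in auto)
    then have "(LINT \<nu>|lborel. chi K ((1/d) *\<^sub>R (\<xi> - \<nu>))) = c"
      using d by (simp add: c_def power_one_over)
    then show "(LINT \<nu>|lborel. complex_of_real (chi K ((1/d) *\<^sub>R (\<xi> - \<nu>)))) = complex_of_real c"
      by (simp only: integral_complex_of_real)
  qed
  define F where "F \<xi> \<nu> = cis (x \<bullet> \<xi>) * (complex_of_real (chi K ((1/d) *\<^sub>R (\<xi> - \<nu>))) * v \<xi>)" for \<xi> \<nu>
  have [measurable]: "(\<lambda>(\<xi>, \<nu>). F \<xi> \<nu>) \<in> borel_measurable (lborel \<Otimes>\<^sub>M lborel)" unfolding F_def by measurable
  have Fi: "integrable (lborel \<Otimes>\<^sub>M lborel) (\<lambda>(\<xi>, \<nu>). F \<xi> \<nu>)"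
  proof (rule lborel_pair.Fubini_integrable)
    have "(LINT \<nu>|lborel. norm (F \<xi> \<nu>)) = c * norm (v \<xi>)" for \<xi>
    proof -
      have "(LINT \<nu>|lborel. norm (F \<xi> \<nu>)) = (LINT \<nu>|lborel. chi K ((1/d) *\<^sub>R (\<xi> - \<nu>)) * norm (v \<xi>))"
        by (simp add: F_def norm_mult chi_nonneg)
      also have "\<dots> = (LINT \<nu>|lborel. chi K ((1/d) *\<^sub>R (\<xi> - \<nu>))) * norm (v \<xi>)" by simp
      also have "(LINT \<nu>|lborel. chi K ((1/d) *\<^sub>R (\<xi> - \<nu>))) = c"
        using chi_shift(2)[of \<xi>] by (simp only: integral_complex_of_real of_real_eq_iff)
      finally show ?thesis .
    qed
    then show "integrable lborel (\<lambda>\<xi>. LINT \<nu>|lborel. norm (case (\<xi>, \<nu>) of (\<xi>, \<nu>) \<Rightarrow> F \<xi> \<nu>))" using vi by simp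
    show "AE \<xi> in lborel. integrable lborel (\<lambda>\<nu>. case (\<xi>, \<nu>) of (\<xi>, \<nu>) \<Rightarrow> F \<xi> \<nu>)"
      using chi_shift(1) by (auto simp: F_def)
  qed measurable
  have "complex_of_real c * ft v x = (LINT \<xi>|lborel. LINT \<nu>|lborel. F \<xi> \<nu>)"
  proof -
    have "(LINT \<nu>|lborel. F \<xi> \<nu>) = complex_of_real c * (cis (x \<bullet> \<xi>) * v \<xi>)" for \<xi>
      unfolding F_def using chi_shift(2)[of \<xi>] by (simp add: mult_ac)
    then show ?thesis by (simp add: ft_def)
  qed
  also have "\<dots> = (LINT \<nu>|lborel. LINT \<xi>|lborel. F \<xi> \<nu>)"
    by (rule lborel_pair.Fubini_integral[OF Fi, symmetric])
  also have "\<dots> = (LINT \<nu>|lborel. ft (packet K s l d \<nu>) (x + l *\<^sub>R grad s \<nu>))"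
    unfolding ft_packet[OF d, symmetric] by (simp add: ft_def F_def v_def)
  finally show ?thesis by (simp add: c_def)
qed

text \<open>Every packet contributes O(d^n), and for fixed x essentially only centres within O(d) of
  one point \<nu>0 matter, so the integral over \<nu> is O(d^n d^n). Division by the constant d^n of
  \<open>packet_decomposition\<close> leaves d^n, which is of order l^(-n/2).\<close>

theorem dispersive_estimate:
  assumes s: "s > 0" "s \<noteq> 1" and K: "2 * DIM('a) \<le> K"
  shows "\<exists>C\<ge>0. \<forall>l x. l \<ge> 1 \<longrightarrow>
    norm (ft (\<lambda>\<xi>::'a::euclidean_space. cis (l * norm \<xi> powr s) * complex_of_real (psi K \<xi>)) x) \<le> C / sqrt l ^ DIM('a)"
proof -
  obtain E where E: "E \<ge> 0" "\<And>l v. \<And>\<nu>::'a. l \<ge> 1 \<Longrightarrow> 3/8 \<le> norm \<nu> \<Longrightarrow> norm \<nu> \<le> 2 \<Longrightarrow> norm v \<le> 1/2 \<Longrightarrow>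
    jet K (wave_scale l *\<^sub>R v) UNIV E (packet K s l (wave_scale l) \<nu>)" using packet_jet[OF s, where 'a='a] by blast
  obtain c0 where c0: "c0 > 0" "\<And>\<xi> \<nu>::'a. \<xi> \<in> annulus (1/4) 4 \<Longrightarrow> \<nu> \<in> annulus (1/4) 4 \<Longrightarrow> c0 * norm (\<xi> - \<nu>) \<le> norm (grad s \<xi> - grad s \<nu>)"
    using grad_bilip[OF s, where 'a='a] by blast
  obtain W where W: "W \<ge> 0" "\<And>N c \<mu>. 2 * DIM('a) \<le> N \<Longrightarrow> \<mu> > 0 \<Longrightarrow>
    (\<integral>\<^sup>+x. ennreal (1 / (1 + \<mu> * norm (x - c :: 'a)) ^ N) \<partial>lborel) \<le> ennreal (W / \<mu> ^ DIM('a))"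
    using nn_integral_weight[where 'a='a] by blast
  define I where "I = (LINT h|lborel. chi K (h::'a))"
  have I: "I > 0" unfolding I_def by (rule chi_integral_pos)
  define n where "n = DIM('a)"
  define V where "V = unit_ball_vol (real n) * (3/2) ^ n"
  have V: "V \<ge> 0" by (simp add: V_def)
  define B where "B = (2 * real n) ^ K * (E * V)"
  have B: "B \<ge> 0" using E V by (simp add: B_def)
  define C where "C = B * W * (1024 / c0) ^ n / I"
  have C: "C \<ge> 0" using B W I c0 by (simp add: C_def)
  define A0 where "A0 = {\<nu>::'a. 3/8 \<le> norm \<nu> \<and> norm \<nu> \<le> 2}"
  have A0A: "A0 \<subseteq> annulus (1/4) 4" by (auto simp: A0_def annulus_def)
  have cA0: "compact A0"
  proof -
    have "A0 = cball 0 2 - ball 0 (3/8)" by (auto simp: A0_def)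
    then show ?thesis by (simp add: compact_diff)
  qed
  have [measurable]: "A0 \<in> sets borel" using compact_imp_closed[OF cA0] by auto
  obtain b0 :: 'a where "b0 \<in> Basis" using nonempty_Basis by blast
  then have ne: "A0 \<noteq> {}" by (auto simp: A0_def intro!: exI[of _ b0])
  show ?thesis
  proof (intro exI[of _ C] conjI allI impI C)
    fix l :: real and x :: 'a assume l: "l \<ge> 1"
    define d where "d = wave_scale l"
    have d: "0 < d" "d \<le> 1/16" "l * d * d = 1/256"
      using l by (auto simp: d_def wave_scale_def field_simps)
    define v where "v = (\<lambda>\<xi>::'a. cis (l * norm \<xi> powr s) * complex_of_real (psi K \<xi>))"
    have "continuous_on A0 (\<lambda>\<nu>. norm (x + l *\<^sub>R grad s \<nu>))"
      unfolding grad_def by (intro continuous_intros) (auto simp: A0_def)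
    \<comment> \<open>Minimality gives \<open>norm (x + l *\<^sub>R grad s \<nu>) \<ge> l / 2 * norm (grad s \<nu> - grad s \<nu>0)\<close>, so the packet
      at \<open>\<nu>\<close> is small away from \<open>\<nu>0\<close> whether or not a stationary point exists.\<close>
    then obtain \<nu>0 where \<nu>0: "\<nu>0 \<in> A0" "\<And>\<nu>. \<nu> \<in> A0 \<Longrightarrow> norm (x + l *\<^sub>R grad s \<nu>0) \<le> norm (x + l *\<^sub>R grad s \<nu>)"
      using continuous_attains_inf[OF cA0 ne] by blast
    \<comment> \<open>From d/4 * c0 * l with l = 1 / (256 d^2), hence 1024 = 4 * 256.\<close>
    define \<mu> where "\<mu> = c0 / (1024 * d)"
    have \<mu>: "\<mu> > 0" using c0 d by (simp add: \<mu>_def)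
    have pk: "norm (ft (packet K s l d \<nu>) (x + l *\<^sub>R grad s \<nu>)) \<le> B * d ^ n * (1 / (1 + \<mu> * norm (\<nu> - \<nu>0)) ^ K)" for \<nu>
    proof (cases "\<nu> \<in> A0")
      case True
      let ?y = "x + l *\<^sub>R grad s \<nu>"
      have m: "measure lborel (cball \<nu> (3/2 * d)) = V * d ^ n"
      proof -
        have "measure lborel (cball \<nu> (3/2 * d)) = unit_ball_vol (real DIM('a)) * (3/2 * d) ^ DIM('a)"
          by (rule content_cball) (use d in auto)
        then show ?thesis by (simp only: V_def n_def power_mult_distrib mult.assoc)
      qed
      have j: "jet K ((d/2) *\<^sub>R b) UNIV E (packet K s l d \<nu>)" if "b \<in> Basis" for b
        using E(2)[of l \<nu> "(1/2) *\<^sub>R b"] l True that by (simp add: A0_def d_def)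
      have "(1 + d/2 * norm ?y) ^ K * norm (ft (packet K s l d \<nu>) ?y) \<le> (2 * real DIM('a)) ^ K * (E * measure lborel (cball \<nu> (3/2 * d)))"
        by (rule ft_decay[OF _ _ _ j]) (use d packet_eq_0 in auto)
      then have 1: "(1 + d/2 * norm ?y) ^ K * norm (ft (packet K s l d \<nu>) ?y) \<le> B * d ^ n"
        unfolding m by (simp add: B_def n_def mult_ac)
      have "c0 * l * norm (\<nu> - \<nu>0) \<le> norm (l *\<^sub>R (grad s \<nu> - grad s \<nu>0))"
        using c0(2)[of \<nu> \<nu>0] A0A True \<nu>0(1) l by (auto simp: mult.left_commute intro!: mult_left_mono)
      also have "l *\<^sub>R (grad s \<nu> - grad s \<nu>0) = ?y - (x + l *\<^sub>R grad s \<nu>0)" by (simp add: scaleR_diff_right)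
      also have "norm \<dots> \<le> norm ?y + norm (x + l *\<^sub>R grad s \<nu>0)" by (rule norm_triangle_ineq4)
      also have "\<dots> \<le> 2 * norm ?y" using \<nu>0(2)[OF True] by simp
      finally have h1: "d/4 * (c0 * l * norm (\<nu> - \<nu>0)) \<le> d/4 * (2 * norm ?y)" using d by (intro mult_left_mono) auto
      have h2: "d/4 * (c0 * l * norm (\<nu> - \<nu>0)) = \<mu> * norm (\<nu> - \<nu>0)"
      proof -
        have "d/4 * (c0 * l * norm (\<nu> - \<nu>0)) = c0 * norm (\<nu> - \<nu>0) / (4 * d) * (l * d * d)" using d by (simp add: field_simps)
        then show ?thesis unfolding d(3) by (simp add: \<mu>_def)
      qed
      from h1[unfolded h2] have "1 + \<mu> * norm (\<nu> - \<nu>0) \<le> 1 + d/2 * norm ?y" by simp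
      then have "(1 + \<mu> * norm (\<nu> - \<nu>0)) ^ K \<le> (1 + d/2 * norm ?y) ^ K" using \<mu> by (intro power_mono) auto
      then have "(1 + \<mu> * norm (\<nu> - \<nu>0)) ^ K * norm (ft (packet K s l d \<nu>) ?y) \<le> B * d ^ n"
        using 1 by (meson mult_right_mono norm_ge_zero order_trans)
      moreover have "(1 + \<mu> * norm (\<nu> - \<nu>0)) ^ K > 0" using \<mu> by (intro zero_less_power add_pos_nonneg) auto
      ultimately show ?thesis by (simp add: pos_le_divide_eq mult.commute)
    next
      case False
      \<comment> \<open>A centre outside A0 has distance at least 1/8 from the support of
        \<open>psi\<close>, more than the packet radius 3/2 d.\<close>
      have "packet K s l d \<nu> = (\<lambda>\<xi>. 0)"
      proof
        fix \<xi>
        show "packet K s l d \<nu> \<xi> = 0"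
        proof (cases "\<xi> \<in> cball \<nu> (3/2 * d)")
          case True
          then have "norm (\<xi> - \<nu>) < 1/8" using d by (auto simp: dist_norm norm_minus_commute)
          then have "norm \<xi> < 1/2 \<or> norm \<xi> > 3/2"
            using False norm_triangle_ineq2[of \<xi> \<nu>] norm_triangle_ineq2[of \<nu> \<xi>]
            by (auto simp: A0_def norm_minus_commute)
          then have "psi K \<xi> = 0" by (intro psi_supp(4)) auto
          then show ?thesis by (simp add: packet_def)
        qed (use d packet_eq_0 in auto)
      qed
      then show ?thesis using B d \<mu> by (simp add: ft_def)
    qed
    have "norm (complex_of_real (d ^ n * I) * ft v x) \<le> B * d ^ n * (W / \<mu> ^ n)"
    proof -
      have "ennreal (norm (complex_of_real (d ^ n * I) * ft v x)) \<le> (\<integral>\<^sup>+\<nu>. ennreal (norm (ft (packet K s l d \<nu>) (x + l *\<^sub>R grad s \<nu>))) \<partial>lborel)"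
        unfolding I_def n_def v_def packet_decomposition[OF d(1)]
        by (rule norm_integral_le_nn_integral)
      also have "\<dots> \<le> (\<integral>\<^sup>+\<nu>. ennreal (B * d ^ n) * ennreal (1 / (1 + \<mu> * norm (\<nu> - \<nu>0)) ^ K) \<partial>lborel)"
        using pk B d \<mu> by (intro nn_integral_mono) (auto simp: ennreal_mult[symmetric] intro!: ennreal_leI)
      also have "\<dots> = ennreal (B * d ^ n) * (\<integral>\<^sup>+\<nu>. ennreal (1 / (1 + \<mu> * norm (\<nu> - \<nu>0)) ^ K) \<partial>lborel)"
        by (rule nn_integral_cmult) measurable
      also have "\<dots> \<le> ennreal (B * d ^ n) * ennreal (W / \<mu> ^ n)"
        unfolding n_def by (intro mult_left_mono W K \<mu>) auto
      also have "\<dots> = ennreal (B * d ^ n * (W / \<mu> ^ n))"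
        using B d W \<mu> by (intro ennreal_mult[symmetric]) auto
      finally show ?thesis using B d W \<mu> by (subst (asm) ennreal_le_iff) auto
    qed
    moreover have "norm (complex_of_real (d ^ n * I) * ft v x) = d ^ n * (I * norm (ft v x))"
      using d I by (simp add: norm_mult norm_power)
    ultimately have "d ^ n * (I * norm (ft v x)) \<le> d ^ n * (B * (W / \<mu> ^ n))" by (simp only: mult_ac)
    then have "I * norm (ft v x) \<le> B * (W / \<mu> ^ n)"
      by (rule mult_left_le_imp_le) (use d in auto)
    then have "norm (ft v x) \<le> B * (W / \<mu> ^ n) / I"
      by (subst pos_le_divide_eq[OF I]) (simp only: mult.commute)
    also have "\<dots> = C * d ^ n"
      using c0 d by (simp add: C_def \<mu>_def power_divide power_mult_distrib)
    also have "\<dots> \<le> C * (1 / sqrt l) ^ n"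
      using C l d by (intro mult_left_mono power_mono) (auto simp: d_def wave_scale_def field_simps)
    also have "\<dots> = C / sqrt l ^ n" by (simp add: power_one_over)
    finally show "norm (ft (\<lambda>\<xi>::'a. cis (l * norm \<xi> powr s) * complex_of_real (psi K \<xi>)) x) \<le> C / sqrt l ^ DIM('a)"
      by (simp add: v_def n_def)
  qed
qed

section \<open>Kernels of the dyadic pieces\<close>

definition osc :: "nat \<Rightarrow> real \<Rightarrow> nat \<Rightarrow> 'a::euclidean_space \<Rightarrow> complex"
  where "osc K s k \<xi> = cis (norm \<xi> powr s) * complex_of_real (if k = 0 then chi K \<xi> else psi K ((1 / 2 ^ k) *\<^sub>R \<xi>))"

lemma osc_measurable[measurable]: "osc K s k \<in> borel_measurable borel"
  unfolding osc_def by (cases "k = 0") simp_all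

lemma norm_osc_le: "norm (osc K s k \<xi>) \<le> 1"
  by (auto simp: osc_def norm_mult psi_bound chi_le_1 chi_nonneg)

lemma osc_cont: "s > 0 \<Longrightarrow> continuous_on UNIV (osc K s k)"
  unfolding osc_def
  by (cases "k = 0")
     (auto intro!: continuous_intros continuous_on_powr' continuous_on_compose2[OF chi_cont[of UNIV]]
        continuous_on_compose2[OF psi_cont[of UNIV]])

lemma osc_sum: "(\<Sum>k\<le>m. osc K s k \<xi>) = cis (norm \<xi> powr s) * complex_of_real (chi K ((1 / 2 ^ m) *\<^sub>R \<xi>))"
proof -
  have "(\<Sum>k\<le>m. osc K s k \<xi>) = osc K s 0 \<xi> + (\<Sum>k=1..m. osc K s k \<xi>)"
    by (simp add: atMost_atLeast0 sum.atLeast_Suc_atMost)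
  also have "\<dots> = cis (norm \<xi> powr s) * complex_of_real (chi K \<xi> + (\<Sum>k=1..m. psi K ((1 / 2 ^ k) *\<^sub>R \<xi>)))"
    by (simp add: osc_def distrib_left sum_distrib_left)
  finally show ?thesis by (simp only: chi_psi_sum)
qed

lemma osc_eq_0_high: "norm \<xi> \<ge> 3/2 * 2 ^ k \<Longrightarrow> osc K s k \<xi> = 0"
proof -
  assume a: "norm \<xi> \<ge> 3/2 * 2 ^ k"
  then have "3/2 \<le> norm \<xi> / 2 ^ k" by (simp add: field_simps)
  then have "(3/2)\<^sup>2 \<le> (norm \<xi> / 2 ^ k)\<^sup>2" by (intro power_mono) auto
  moreover have "(2::real) \<le> (3/2)\<^sup>2" by (simp add: power2_eq_square)
  ultimately have "(norm \<xi> / 2 ^ k)\<^sup>2 \<ge> 2" by (rule order_trans[rotated])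
  then show ?thesis
    by (cases "k = 0") (auto simp: osc_def chi_eq_0 intro!: psi_eq_0)
qed

lemma osc_eq_0_low: "k > 0 \<Longrightarrow> norm \<xi> \<le> 2 ^ k / 2 \<Longrightarrow> osc K s k \<xi> = 0"
  by (auto simp: osc_def field_simps intro!: psi_eq_0)

lemma osc_integrable: "integrable lborel (osc K s k :: 'a::euclidean_space \<Rightarrow> complex)"
  by (rule integrable_bounded_support(1)[where K="cball 0 (3/2 * 2 ^ k)" and C=1])
     (auto intro!: norm_osc_le osc_eq_0_high)

lemma ft_scale:
  fixes u :: "'a::euclidean_space \<Rightarrow> complex"
  assumes [measurable]: "u \<in> borel_measurable borel" and r: "r > 0"
  shows "ft (\<lambda>\<xi>. u ((1/r) *\<^sub>R \<xi>)) y = complex_of_real (r ^ DIM('a)) * ft u (r *\<^sub>R y)"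
proof -
  have "(LINT \<xi>|lborel. cis (y \<bullet> \<xi>) * u ((1/r) *\<^sub>R \<xi>)) =
    (\<bar>r\<bar> ^ DIM('a)) *\<^sub>R (LINT \<xi>|lborel. cis (y \<bullet> (0 + r *\<^sub>R \<xi>)) * u ((1/r) *\<^sub>R (0 + r *\<^sub>R \<xi>)))"
    by (rule integral_lborel_affine) (use r in auto)
  then show ?thesis using r by (simp add: ft_def scaleR_conv_of_real)
qed

lemma ft_add:
  assumes "integrable lborel u" "integrable lborel v"
  shows "ft (\<lambda>\<xi>. u \<xi> + v \<xi>) x = ft u x + ft v x"
proof -
  have "integrable lborel (\<lambda>\<xi>. cis (x \<bullet> \<xi>) * u \<xi>)" "integrable lborel (\<lambda>\<xi>. cis (x \<bullet> \<xi>) * v \<xi>)"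
    by (intro integrable_cis_mult assms; measurable)+
  then show ?thesis by (simp add: ft_def distrib_left)
qed

lemma ft_sum:
  assumes "\<And>i. i \<in> A \<Longrightarrow> integrable lborel (u i)"
  shows "ft (\<lambda>\<xi>. \<Sum>i\<in>A. u i \<xi>) x = (\<Sum>i\<in>A. ft (u i) x)"
proof -
  have "integrable lborel (\<lambda>\<xi>. cis (x \<bullet> \<xi>) * u i \<xi>)" if "i \<in> A" for i
    by (intro integrable_cis_mult assms that; measurable)
  then show ?thesis by (simp add: ft_def sum_distrib_left)
qed

text \<open>Rescaled to frequency 1 the phase has size l = 2^(k s). The dispersive bound gives 2^(k
  n) l^(-n/2) everywhere. Integration by parts at scale 1/l gives decay beyond distance 2^(k (s -
  1)); outside the slightly larger radius each order gains a further 2^(-k e), so K orders with e K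
  >= n (s + e) outweigh the volume factor and leave the radius to the power -n.\<close>

lemma kernel_high:
  assumes s: "s > 0" "s \<noteq> 1" and e: "e > 0" and K: "2 * DIM('a) \<le> K" "real DIM('a) * (s + e) \<le> e * real K"
    and p: "0 \<le> p" "p \<le> real K"
  shows "\<exists>C\<ge>0. \<forall>k y. k \<ge> 1 \<longrightarrow>
    norm (ft (osc K s k :: 'a::euclidean_space \<Rightarrow> complex) y) \<le>
      C * 2 powr (real k * (real DIM('a) * (1 - s/2))) * (1 + norm y / 2 powr (real k * (s - 1 + e))) powr (- p) \<and>
    (norm y > 2 powr (real k * (s - 1 + e)) \<longrightarrow> norm (ft (osc K s k) y) \<le>
      C / (2 powr (real k * (s - 1 + e))) ^ DIM('a) * (1 / (1 + norm y / 2 powr (real k * (s - 1 + e))) ^ (2 * DIM('a))))"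
proof -
  define n where "n = DIM('a)"
  obtain C1 where C1: "C1 \<ge> 0" "\<And>l x. l \<ge> 1 \<Longrightarrow>
    norm (ft (\<lambda>\<xi>::'a. cis (l * norm \<xi> powr s) * complex_of_real (psi K \<xi>)) x) \<le> C1 / sqrt l ^ n"
    using dispersive_estimate[OF s K(1)] unfolding n_def by blast
  obtain E where E: "E \<ge> 0" "\<And>l v. l \<ge> 1 \<Longrightarrow> norm v \<le> 1/2 \<Longrightarrow>
    jet K ((1/l) *\<^sub>R v) UNIV E (\<lambda>\<xi>::'a. cis (l * norm \<xi> powr s) * complex_of_real (psi K \<xi>))"
    using osc_jet_high[of K s, where 'a='a] by blast
  define D where "D = (2 * real n) ^ K * (E * measure lborel (psi_supp :: 'a set))"
  have D: "D \<ge> 0" using E by (simp add: D_def)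
  define C where "C = C1 * 2 powr p + D * 4 ^ K"
  have C: "C \<ge> 0" using C1 D by (simp add: C_def)
  show ?thesis
  proof (intro exI[of _ C] conjI allI impI C)
    fix k :: nat and y :: 'a assume k: "k \<ge> 1"
    define l where "l = 2 powr (real k * s)"
    have l: "l \<ge> 1" using s by (simp add: l_def ge_one_powr_ge_zero)
    define v where "v = (\<lambda>\<xi>::'a. cis (l * norm \<xi> powr s) * complex_of_real (psi K \<xi>))"
    have vm[measurable]: "v \<in> borel_measurable borel" unfolding v_def by measurable
    have oscv: "osc K s k = (\<lambda>\<xi>. v ((1 / 2 ^ k) *\<^sub>R \<xi>))"
    proof
      fix \<xi> :: 'a
      have "l * norm ((1 / 2 ^ k) *\<^sub>R \<xi>) powr s = l * (norm \<xi> powr s / (2 ^ k) powr s)"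
        by (simp add: powr_divide)
      also have "(2 ^ k) powr s = l" by (simp add: l_def powr_powr flip: powr_realpow)
      also have "l * (norm \<xi> powr s / l) = norm \<xi> powr s" using l by simp
      finally show "osc K s k \<xi> = v ((1 / 2 ^ k) *\<^sub>R \<xi>)" using k by (simp add: osc_def v_def)
    qed
    have ftk: "norm (ft (osc K s k) y) = (2 ^ k) ^ n * norm (ft v (2 ^ k *\<^sub>R y))"
      unfolding oscv using ft_scale[OF vm, of "2 ^ k" y] by (simp add: norm_mult norm_power n_def)
    define R where "R = 2 powr (real k * (s - 1 + e))"
    define M where "M = 2 powr (real k * (real n * (1 - s/2)))"
    have R: "R > 0" and M: "M > 0" by (auto simp: R_def M_def)
    define t where "t = norm y / R"
    have t: "t \<ge> 0" using R by (simp add: t_def)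
    have pw: "(2 ^ k) ^ n = 2 powr (real k * real n)" by (simp add: powr_powr powr_realpow[symmetric])
    have b1: "norm (ft (osc K s k) y) \<le> C1 * M"
    proof -
      have "norm (ft v (2 ^ k *\<^sub>R y)) \<le> C1 / sqrt l ^ n" unfolding v_def by (rule C1(2)[OF l])
      then have "norm (ft (osc K s k) y) \<le> (2 ^ k) ^ n * (C1 / sqrt l ^ n)" unfolding ftk by (intro mult_left_mono) auto
      also have "sqrt l ^ n = 2 powr (real k * s / 2 * real n)"
        by (simp add: l_def powr_half_sqrt[symmetric] powr_powr powr_realpow[symmetric])
      also have "(2 ^ k) ^ n * (C1 / 2 powr (real k * s / 2 * real n)) = C1 * M"
      proof -
        have "(2 ^ k) ^ n / 2 powr (real k * s / 2 * real n) = M"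
          unfolding pw M_def powr_diff[symmetric] by (simp add: algebra_simps)
        moreover have "(2 ^ k) ^ n * (C1 / 2 powr (real k * s / 2 * real n)) = C1 * ((2 ^ k) ^ n / 2 powr (real k * s / 2 * real n))" by simp
        ultimately show ?thesis by (simp only:)
      qed
      finally show ?thesis .
    qed
    have b2: "norm (ft (osc K s k) y) \<le> D * 4 ^ K / R ^ n * (1 / (1 + t) ^ K)" if "t > 1"
    proof -
      have j: "jet K ((1/(2*l)) *\<^sub>R b) UNIV E v" if "b \<in> Basis" for b
        using E(2)[OF l, of "(1/2) *\<^sub>R b"] that by (simp add: v_def mult.commute)
      have "(1 + 1/(2*l) * norm (2 ^ k *\<^sub>R y)) ^ K * norm (ft v (2 ^ k *\<^sub>R y)) \<le> (2 * real DIM('a)) ^ K * (E * measure lborel (psi_supp :: 'a set))"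
        by (rule ft_decay[OF vm psi_supp(1) _ j]) (use l in \<open>auto simp: v_def psi_supp(4)\<close>)
      then have dec: "(1 + 1/(2*l) * norm (2 ^ k *\<^sub>R y)) ^ K * norm (ft v (2 ^ k *\<^sub>R y)) \<le> D" by (simp add: D_def n_def)
      define q where "q = 2 powr (real k * e)"
      have q: "q > 0" by (simp add: q_def)
      \<comment> \<open>After rescaling, the distance in units of l is t times q = 2^(k e): the
        excess e in the exponent of R becomes a gain in every order of decay.\<close>
      have eq: "1/(2*l) * norm (2 ^ k *\<^sub>R y) = t * q / 2"
      proof -
        have "1/(2*l) * norm (2 ^ k *\<^sub>R y) = norm y * (2 powr real k / l) / 2" by (simp add: powr_realpow mult_ac)
        also have "2 powr real k / l = q / R"
          by (simp add: l_def q_def R_def powr_diff[symmetric] algebra_simps)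
        finally show ?thesis by (simp add: t_def)
      qed
      have "q * ((1 + t) / 4) \<le> q * (t / 2)" using that q by (intro mult_left_mono) auto
      also have "\<dots> = t * q / 2" by simp
      finally have "q * ((1 + t) / 4) \<le> 1 + 1/(2*l) * norm (2 ^ k *\<^sub>R y)" unfolding eq by linarith
      then have "(q * ((1 + t) / 4)) ^ K \<le> (1 + 1/(2*l) * norm (2 ^ k *\<^sub>R y)) ^ K" using q t by (intro power_mono) auto
      then have "(q * ((1 + t) / 4)) ^ K * norm (ft v (2 ^ k *\<^sub>R y)) \<le> D"
        using dec by (meson mult_right_mono norm_ge_zero order_trans)
      then have "norm (ft v (2 ^ k *\<^sub>R y)) \<le> D / (q * ((1 + t) / 4)) ^ K"
        using q t by (subst pos_le_divide_eq) (auto simp: mult.commute)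
      also have "\<dots> = D * 4 ^ K / q ^ K * (1 / (1 + t) ^ K)" by (simp add: power_mult_distrib power_divide)
      finally have "norm (ft (osc K s k) y) \<le> (2 ^ k) ^ n * (D * 4 ^ K / q ^ K * (1 / (1 + t) ^ K))"
        unfolding ftk by (intro mult_left_mono) auto
      also have "\<dots> = D * 4 ^ K * (1 / (1 + t) ^ K) * ((2 ^ k) ^ n / q ^ K)" by (simp add: mult_ac)
      also have "\<dots> \<le> D * 4 ^ K * (1 / (1 + t) ^ K) * (1 / R ^ n)"
      proof (intro mult_left_mono)
        have "(2 ^ k) ^ n / q ^ K = 2 powr (real k * (real n - e * real K))"
          unfolding pw q_def by (simp add: powr_powr powr_realpow[symmetric] powr_diff[symmetric] algebra_simps)
        also have "\<dots> \<le> 2 powr (real k * (- (real n * (s - 1 + e))))"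
          using K(2) by (intro powr_mono mult_left_mono) (auto simp: n_def algebra_simps)
        also have "\<dots> = 1 / R ^ n"
          unfolding R_def by (simp add: powr_powr powr_realpow[symmetric] powr_minus_divide[symmetric] algebra_simps)
        finally show "(2 ^ k) ^ n / q ^ K \<le> 1 / R ^ n" .
      qed (use D t in auto)
      finally show ?thesis by (simp add: mult_ac)
    qed
    \<comment> \<open>In exponents this says 0 <= s/2 + e. It places the far bound under the same
      majorant as the near one.\<close>
    have RM: "1 / R ^ n \<le> M"
    proof -
      have "1 / R ^ n = 2 powr (real k * (- (real n * (s - 1 + e))))"
        unfolding R_def by (simp add: powr_powr powr_realpow[symmetric] powr_minus_divide[symmetric] algebra_simps)
      also have "\<dots> \<le> M" unfolding M_def
      proof (intro powr_mono mult_left_mono)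
        have "real n * (- (s - 1 + e)) \<le> real n * (1 - s/2)" using s e by (intro mult_left_mono) auto
        then show "- (real n * (s - 1 + e)) \<le> real n * (1 - s/2)" by (simp only: mult_minus_right)
      qed auto
      finally show ?thesis .
    qed
    have "norm (ft (osc K s k) y) \<le> C * M * (1 + t) powr (- p)"
    proof (cases "t \<le> 1")
      case True
      have "1 \<le> 2 powr p * (1 + t) powr (- p)"
      proof -
        have "(1 + t) powr p \<le> 2 powr p" using True t p by (intro powr_mono2) auto
        then show ?thesis using t by (simp add: powr_minus field_simps)
      qed
      then have "C1 * M * 1 \<le> C1 * M * (2 powr p * (1 + t) powr (- p))" using C1 M by (intro mult_left_mono) auto
      with b1 have "norm (ft (osc K s k) y) \<le> C1 * 2 powr p * M * (1 + t) powr (- p)" by (simp add: mult_ac)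
      also have "\<dots> \<le> C * M * (1 + t) powr (- p)" using D M by (intro mult_right_mono) (auto simp: C_def)
      finally show ?thesis .
    next
      case False
      have "1 / (1 + t) ^ K \<le> (1 + t) powr (- p)"
      proof -
        have "1 / (1 + t) ^ K = (1 + t) powr (- real K)" using t by (simp add: powr_minus_divide powr_realpow)
        also have "\<dots> \<le> (1 + t) powr (- p)" using t p by (intro powr_mono) auto
        finally show ?thesis .
      qed
      then have "D * 4 ^ K / R ^ n * (1 / (1 + t) ^ K) \<le> D * 4 ^ K / R ^ n * (1 + t) powr (- p)"
        using D R by (intro mult_left_mono) auto
      also have "\<dots> = D * 4 ^ K * (1 / R ^ n) * (1 + t) powr (- p)" by simp
      also have "\<dots> \<le> C * M * (1 + t) powr (- p)"
        using D R RM C C1 M by (intro mult_right_mono mult_mono) (auto simp: C_def)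
      finally show ?thesis using b2 False by simp
    qed
    then show "norm (ft (osc K s k) y) \<le> C * 2 powr (real k * (real DIM('a) * (1 - s/2))) * (1 + norm y / 2 powr (real k * (s - 1 + e))) powr (- p)"
      by (simp add: M_def R_def t_def n_def)
    assume "norm y > 2 powr (real k * (s - 1 + e))"
    then have t1: "t > 1" using R by (simp add: t_def R_def[symmetric])
    have "(1 + t) ^ (2 * n) \<le> (1 + t) ^ K" using t K by (intro power_increasing) (auto simp: n_def)
    then have "1 / (1 + t) ^ K \<le> 1 / (1 + t) ^ (2 * n)"
      using t by (intro divide_left_mono) (auto intro!: mult_pos_pos zero_less_power add_pos_nonneg)
    then have "D * 4 ^ K / R ^ n * (1 / (1 + t) ^ K) \<le> C / R ^ n * (1 / (1 + t) ^ (2 * n))"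
      using D R t C1 C by (intro mult_mono divide_right_mono) (auto simp: C_def)
    with b2[OF t1] show "norm (ft (osc K s k) y) \<le>
      C / (2 powr (real k * (s - 1 + e))) ^ DIM('a) * (1 / (1 + norm y / 2 powr (real k * (s - 1 + e))) ^ (2 * DIM('a)))"
      by (simp add: R_def t_def n_def)
  qed
qed

text \<open>The phase is not smooth at 0, so cis - 1 is cut into shells of radius 2^(-j). A shell
  has volume 2^(-j n) and amplitude 2^(-j s), while its transform spreads over distance 2^j, which
  against the weight costs 2^(j p). The resulting geometric series converges exactly for p < n +
  s.\<close>

lemma kernel_low:
  assumes s: "s > 0" and p: "0 \<le> p" "p < real DIM('a) + s" "p \<le> real K"
  shows "\<exists>C\<ge>0. \<forall>y. norm (ft (osc K s 0 :: 'a::euclidean_space \<Rightarrow> complex) y) \<le> C * (1 + norm y) powr (- p)"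
proof -
  define n where "n = DIM('a)"
  obtain E0 where E0: "E0 \<ge> 0" "\<And>v. norm v \<le> 1 \<Longrightarrow> jet K v UNIV E0 (chi K :: 'a \<Rightarrow> real)"
    using chi_jet by blast
  obtain E where E: "E \<ge> 0" "\<And>l v. 0 \<le> l \<Longrightarrow> l \<le> 1 \<Longrightarrow> norm v \<le> 1/2 \<Longrightarrow>
    jet K v UNIV (E * l) (\<lambda>\<xi>::'a. (cis (l * norm \<xi> powr s) - 1) * complex_of_real (psi K \<xi>))"
    using osc_jet_low[of K s, where 'a='a] by blast
  define D where "D = (2 * real n) ^ K * (E * measure lborel (psi_supp :: 'a set))"
  have D: "D \<ge> 0" using E by (simp add: D_def)
  define D0 where "D0 = (2 * real n) ^ K * (E0 * measure lborel (cball (0::'a) (3/2)))"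
  have D0: "D0 \<ge> 0" using E0 by (simp add: D0_def)
  define z where "z = 2 powr (- (real n + s - p))"
  have z: "0 < z" "z < 1" using p by (auto simp: z_def n_def powr_less_one)
  define C where "C = D0 + D * 2 powr p * (1 / (1 - z))"
  have C: "C \<ge> 0" using D D0 z by (simp add: C_def)
  have conv: "1 / (1 + a) ^ K \<le> (1 + a) powr (- p)" if "a \<ge> 0" for a
  proof -
    have "1 / (1 + a) ^ K = (1 + a) powr (- real K)" using that by (simp add: powr_minus_divide powr_realpow)
    also have "\<dots> \<le> (1 + a) powr (- p)" using that p by (intro powr_mono) auto
    finally show ?thesis .
  qed
  define g where "g j \<xi> = (cis (norm \<xi> powr s) - 1) * complex_of_real (psi K ((2 ^ j) *\<^sub>R \<xi>))" for j :: nat and \<xi> :: 'a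
  have gm[measurable]: "g j \<in> borel_measurable borel" for j unfolding g_def by measurable
  have tele: "(\<Sum>j<m. psi K ((2 ^ j) *\<^sub>R \<xi>)) = chi K \<xi> - chi K ((2 ^ m) *\<^sub>R \<xi>)" for m and \<xi> :: 'a
    by (induction m) (auto simp: psi_def)
  have g0: "g j \<xi> = 0" if "\<xi> \<notin> cball 0 (3/2)" for j and \<xi> :: 'a
  proof -
    have "norm \<xi> > 3/2" using that by simp
    moreover have "norm \<xi> * 1 \<le> norm \<xi> * 2 ^ j" by (intro mult_left_mono) auto
    ultimately have "norm (2 ^ j *\<^sub>R \<xi>) > 3/2" by (simp add: mult.commute)
    then have "psi K (2 ^ j *\<^sub>R \<xi>) = 0" by (intro psi_supp(4)) auto
    then show ?thesis by (simp add: g_def)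
  qed
  have gb: "norm (g j \<xi>) \<le> 2" for j \<xi>
  proof -
    have "norm (cis (norm \<xi> powr s) - 1) \<le> 2" using norm_triangle_ineq4[of "cis (norm \<xi> powr s)" 1] by simp
    then show ?thesis using psi_bound[of K "2 ^ j *\<^sub>R \<xi>"] mult_mono[of "norm (cis (norm \<xi> powr s) - 1)" 2 "\<bar>psi K (2 ^ j *\<^sub>R \<xi>)\<bar>" 1]
      by (simp add: g_def norm_mult)
  qed
  have gi: "integrable lborel (g j)" for j
    by (rule integrable_bounded_support(1)[OF gm compact_cball gb g0])
  have chiC: "chi K \<xi> = 0" if "\<xi> \<notin> cball 0 (3/2)" for \<xi> :: 'a
  proof -
    have "(3/2)\<^sup>2 \<le> (norm \<xi>)\<^sup>2" using that by (intro power_mono) auto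
    then show ?thesis by (intro chi_eq_0) (simp add: power2_eq_square)
  qed
  have ci: "integrable lborel (\<lambda>\<xi>::'a. complex_of_real (chi K \<xi>))" by (rule integrable_of_real[OF chi_integrable])
  define u where "u m \<xi> = complex_of_real (chi K \<xi>) + (\<Sum>j<m. g j \<xi>)" for m and \<xi> :: 'a
  have um[measurable]: "u m \<in> borel_measurable borel" for m unfolding u_def by measurable
  \<comment> \<open>In closed form the partial sum has the oscillating factor replaced by 1 near the
    origin, on a ball of radius about 2^(-m); the pointwise limit restores it.\<close>
  have ueq: "u m \<xi> = complex_of_real (chi K \<xi>) + (cis (norm \<xi> powr s) - 1) * complex_of_real (chi K \<xi> - chi K ((2 ^ m) *\<^sub>R \<xi>))" for m \<xi>
    unfolding u_def g_def by (simp flip: tele sum_distrib_left of_real_sum)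
  have ulim: "(\<lambda>m. u m \<xi>) \<longlonglongrightarrow> osc K s 0 \<xi>" for \<xi>
  proof (cases "\<xi> = 0")
    case True
    then show ?thesis using s by (simp add: ueq osc_def)
  next
    case False
    obtain N where N: "2 / norm \<xi> < 2 ^ N" using real_arch_pow[of 2 "2 / norm \<xi>"] by auto
    have "u m \<xi> = osc K s 0 \<xi>" if "m \<ge> N" for m
    proof -
      have "(2::real) ^ N \<le> 2 ^ m" using that by (intro power_increasing) auto
      then have "2 / norm \<xi> \<le> 2 ^ m" using N by linarith
      then have "2 \<le> norm (2 ^ m *\<^sub>R \<xi>)" using False by (simp add: field_simps)
      then have "(norm (2 ^ m *\<^sub>R \<xi>))\<^sup>2 \<ge> 2" using power_mono[of 2 "norm (2 ^ m *\<^sub>R \<xi>)" 2] by simp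
      then have "chi K (2 ^ m *\<^sub>R \<xi>) = 0" by (rule chi_eq_0)
      then show ?thesis by (simp add: ueq osc_def algebra_simps)
    qed
    then show ?thesis by (intro tendsto_eventually) (auto simp: eventually_sequentially)
  qed
  have ftl: "(\<lambda>m. ft (u m) y) \<longlonglongrightarrow> ft (osc K s 0) y" for y
    unfolding ft_def
  proof (rule integral_dominated_convergence[where w="\<lambda>\<xi>. 5 * indicator (cball 0 (3/2)) \<xi>"])
    show "integrable lborel (\<lambda>\<xi>. 5 * indicator (cball (0::'a) (3/2)) \<xi> :: real)"
      using emeasure_compact_finite[of "cball (0::'a) (3/2)"] by (intro integrable_mult_right) auto
    show "AE \<xi> in lborel. norm (cis (y \<bullet> \<xi>) * u m \<xi>) \<le> 5 * indicator (cball 0 (3/2)) \<xi>" for m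
    proof (rule AE_I2)
      fix \<xi>
      show "norm (cis (y \<bullet> \<xi>) * u m \<xi>) \<le> 5 * indicator (cball 0 (3/2)) \<xi>"
      proof (cases "\<xi> \<in> cball 0 (3/2)")
        case True
        have "norm (u m \<xi>) \<le> norm (complex_of_real (chi K \<xi>)) + norm (cis (norm \<xi> powr s) - 1) * norm (complex_of_real (chi K \<xi> - chi K ((2 ^ m) *\<^sub>R \<xi>)))"
          unfolding ueq by (metis norm_mult norm_triangle_ineq)
        also have "\<dots> \<le> 1 + 2 * 1"
          using norm_triangle_ineq4[of "cis (norm \<xi> powr s)" 1] chi_le_1[of K \<xi>] chi_nonneg[of K \<xi>] chi_le_1[of K "2 ^ m *\<^sub>R \<xi>"] chi_nonneg[of K "2 ^ m *\<^sub>R \<xi>"]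
          by (intro add_mono mult_mono) (simp_all add: norm_of_real abs_le_iff del: of_real_diff)
        finally show ?thesis using True by (simp add: norm_mult)
      next
        case False
        then show ?thesis by (simp add: u_def chiC g0)
      qed
    qed
    show "AE \<xi> in lborel. (\<lambda>m. cis (y \<bullet> \<xi>) * u m \<xi>) \<longlonglongrightarrow> cis (y \<bullet> \<xi>) * osc K s 0 \<xi>"
      by (intro AE_I2 tendsto_intros ulim)
  qed measurable
  have ftg: "norm (ft (g j) y) \<le> D * 2 powr p * (1 + norm y) powr (- p) * z ^ j" for j y
  proof -
    define l where "l = 2 powr (- (real j * s))"
    have l: "0 \<le> l" "l \<le> 1" using s powr_mono[of "- (real j * s)" 0 2] by (auto simp: l_def)
    define v where "v = (\<lambda>\<xi>::'a. (cis (l * norm \<xi> powr s) - 1) * complex_of_real (psi K \<xi>))"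
    have vm[measurable]: "v \<in> borel_measurable borel" unfolding v_def by measurable
    define r where "r = (1::real) / 2 ^ j"
    have r: "0 < r" "r \<le> 1" by (auto simp: r_def)
    have rp: "r = 2 powr (- real j)" by (simp add: r_def powr_minus_divide powr_realpow)
    have "g j = (\<lambda>\<xi>. v ((1 / r) *\<^sub>R \<xi>))"
    proof
      fix \<xi> :: 'a
      have "l * norm ((1 / r) *\<^sub>R \<xi>) powr s = l * (norm \<xi> powr s * (2 ^ j) powr s)"
        by (simp add: powr_mult r_def mult.commute)
      also have "(2 ^ j) powr s = 1 / l" by (simp add: l_def powr_powr powr_minus_divide flip: powr_realpow)
      also have "l * (norm \<xi> powr s * (1 / l)) = norm \<xi> powr s" by (simp add: l_def)
      finally show "g j \<xi> = v ((1 / r) *\<^sub>R \<xi>)" by (simp add: g_def v_def r_def)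
    qed
    then have ftk: "norm (ft (g j) y) = r ^ n * norm (ft v (r *\<^sub>R y))"
      using ft_scale[OF vm r(1), of y] r by (simp add: norm_mult norm_power n_def)
    have jv: "jet K ((1/2) *\<^sub>R b) UNIV (E * l) v" if "b \<in> Basis" for b
      using E(2)[OF l, of "(1/2) *\<^sub>R b"] that by (simp add: v_def)
    have "(1 + 1/2 * norm (r *\<^sub>R y)) ^ K * norm (ft v (r *\<^sub>R y)) \<le> (2 * real DIM('a)) ^ K * (E * l * measure lborel (psi_supp :: 'a set))"
      by (rule ft_decay[OF vm psi_supp(1) _ jv]) (auto simp: v_def psi_supp(4))
    then have "(1 + 1/2 * norm (r *\<^sub>R y)) ^ K * norm (ft v (r *\<^sub>R y)) \<le> D * l" by (simp add: D_def n_def mult_ac)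
    then have "norm (ft v (r *\<^sub>R y)) \<le> D * l * (1 / (1 + 1/2 * norm (r *\<^sub>R y)) ^ K)"
      by (subst times_divide_eq_right, subst pos_le_divide_eq) (auto simp: mult.commute intro!: zero_less_power add_pos_nonneg)
    also have "\<dots> \<le> D * l * (1 + 1/2 * norm (r *\<^sub>R y)) powr (- p)"
      using D l by (intro mult_left_mono conv) auto
    also have "\<dots> \<le> D * l * (r / 2 * (1 + norm y)) powr (- p)"
    proof (intro mult_left_mono)
      have "r / 2 * (1 + norm y) \<le> 1 + 1/2 * norm (r *\<^sub>R y)" using r by (simp add: algebra_simps)
      then show "(1 + 1/2 * norm (r *\<^sub>R y)) powr (- p) \<le> (r / 2 * (1 + norm y)) powr (- p)"
        using r p by (intro powr_mono2') (auto intro!: mult_pos_pos add_pos_nonneg)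
    qed (use D l in auto)
    also have "\<dots> = D * l * (r powr (- p) * 2 powr p * (1 + norm y) powr (- p))"
      using r by (simp add: powr_mult powr_divide powr_minus_divide)
    finally have "norm (ft (g j) y) \<le> r ^ n * (D * l * (r powr (- p) * 2 powr p * (1 + norm y) powr (- p)))"
      unfolding ftk using r by (intro mult_left_mono) auto
    also have "\<dots> = D * 2 powr p * (1 + norm y) powr (- p) * (r ^ n * l * r powr (- p))" by simp
    also have "r ^ n * l * r powr (- p) = z ^ j"
      unfolding rp l_def z_def by (simp add: powr_powr powr_realpow[symmetric] powr_add[symmetric] algebra_simps)
    finally show ?thesis .
  qed
  have ft0: "norm (ft (\<lambda>\<xi>. complex_of_real (chi K \<xi>)) y) \<le> D0 * (1 + norm y) powr (- p)" for y :: 'a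
  proof -
    have "(1 + 1 * norm y) ^ K * norm (ft (\<lambda>\<xi>. complex_of_real (chi K \<xi>)) y) \<le> (2 * real DIM('a)) ^ K * (E0 * measure lborel (cball (0::'a) (3/2)))"
      by (rule ft_decay) (auto intro!: jet_of_real E0 simp: chiC)
    then have "(1 + norm y) ^ K * norm (ft (\<lambda>\<xi>. complex_of_real (chi K \<xi>)) y) \<le> D0" by (simp add: D0_def n_def)
    then have "norm (ft (\<lambda>\<xi>. complex_of_real (chi K \<xi>)) y) \<le> D0 * (1 / (1 + norm y) ^ K)"
      by (subst times_divide_eq_right, subst pos_le_divide_eq) (auto simp: mult.commute intro!: zero_less_power add_pos_nonneg)
    also have "\<dots> \<le> D0 * (1 + norm y) powr (- p)" using D0 by (intro mult_left_mono conv) auto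
    finally show ?thesis .
  qed
  show ?thesis
  proof (intro exI[of _ C] conjI allI C)
    fix y :: 'a
    have "norm (ft (u m) y) \<le> C * (1 + norm y) powr (- p)" for m
    proof -
      have "ft (u m) y = ft (\<lambda>\<xi>. complex_of_real (chi K \<xi>)) y + (\<Sum>j<m. ft (g j) y)"
        unfolding u_def using gi by (subst ft_add[OF ci]) (auto simp: ft_sum[OF gi])
      then have "norm (ft (u m) y) \<le> norm (ft (\<lambda>\<xi>. complex_of_real (chi K \<xi>)) y) + norm (\<Sum>j<m. ft (g j) y)"
        by (simp add: norm_triangle_ineq)
      also have "norm (\<Sum>j<m. ft (g j) y) \<le> (\<Sum>j<m. D * 2 powr p * (1 + norm y) powr (- p) * z ^ j)"
        by (intro sum_norm_le ftg)
      also have "\<dots> = D * 2 powr p * (1 + norm y) powr (- p) * (\<Sum>j<m. z ^ j)" by (simp add: sum_distrib_left)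
      also have "\<dots> \<le> D * 2 powr p * (1 + norm y) powr (- p) * (1 / (1 - z))"
      proof (intro mult_left_mono)
        have "(\<Sum>j<m. z ^ j) \<le> (\<Sum>j. z ^ j)" using z by (intro sum_le_suminf summable_geometric) auto
        then show "(\<Sum>j<m. z ^ j) \<le> 1 / (1 - z)" using z by (simp add: suminf_geometric)
      qed (use D in auto)
      finally show ?thesis using ft0[of y] by (simp add: C_def algebra_simps)
    qed
    then show "norm (ft (osc K s 0) y) \<le> C * (1 + norm y) powr (- p)"
      by (intro LIMSEQ_le_const2[OF tendsto_norm[OF ftl]]) auto
  qed
qed

section \<open>Locally square integrable functions and the trilinear estimate\<close>

text \<open>Value of the series over l of 2^p 2^(-p l) 2^(l n) with p = n + a: the dyadic ball
  number l has volume of order 2^(l n) and weight 2^(-p l).\<close>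

definition layer_const :: "nat \<Rightarrow> real \<Rightarrow> real"
  where "layer_const n a = 2 powr (real n + a) / (1 - 2 powr (- a))"

lemma layer_const_pos: "a > 0 \<Longrightarrow> layer_const n a > 0"
  by (simp add: layer_const_def powr_less_one)

lemma weight_le_layers:
  assumes p: "p \<ge> 0" and t: "t \<ge> 0"
  shows "\<exists>l::nat. t \<le> 2 ^ l \<and> (1 + t) powr (- p) \<le> 2 powr p * 2 powr (- (p * real l))"
proof -
  obtain N where N: "t < 2 ^ N" using real_arch_pow[of 2 t] by auto
  define l where "l = (LEAST l::nat. t \<le> 2 ^ l)"
  have l: "t \<le> 2 ^ l" unfolding l_def by (rule LeastI[of _ N]) (use N in simp)
  have "2 powr (real l - 1) \<le> 1 + t"
  proof (cases l)
    case 0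
    have "2 powr (- 1) \<le> (1::real)" by (simp add: powr_minus_divide)
    then show ?thesis using 0 t by simp
  next
    case (Suc m)
    have "\<not> t \<le> 2 ^ m" using not_less_Least[of m "\<lambda>l. t \<le> 2 ^ l"] Suc by (simp add: l_def[symmetric])
    then show ?thesis using Suc by (simp add: powr_realpow)
  qed
  then have "(1 + t) powr (- p) \<le> (2 powr (real l - 1)) powr (- p)"
    using p by (intro powr_mono2') auto
  also have "\<dots> = 2 powr p * 2 powr (- (p * real l))"
    by (simp add: powr_powr powr_add[symmetric] algebra_simps)
  finally show ?thesis using l by blast
qed

lemma cball_measurable[measurable]: "cball a r \<in> sets borel"
  by simp

text \<open>The weight is dominated by multiples of the indicator functions of the balls of radius
  2^l R. Each of these allows a growth (2^l R)^n, the weight decays like 2^(-l (n + a)), and a > 0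
  leaves a geometric series.\<close>

lemma layer_integral:
  fixes g :: "'a::euclidean_space \<Rightarrow> ennreal"
  assumes [measurable]: "g \<in> borel_measurable borel" and R: "R > 0" and A: "A \<ge> 0" and a: "a > 0"
    and g: "\<And>r. r \<ge> R \<Longrightarrow> (\<integral>\<^sup>+y\<in>cball c r. g y \<partial>lborel) \<le> ennreal (A * r ^ DIM('a))"
  shows "(\<integral>\<^sup>+y. ennreal ((1 + norm (y - c) / R) powr (- (real DIM('a) + a))) * g y \<partial>lborel) \<le>
    ennreal (layer_const DIM('a) a * (A * R ^ DIM('a)))"
proof -
  define n where "n = DIM('a)"
  define p where "p = real n + a"
  have p: "p \<ge> 0" using a by (simp add: p_def)
  define cf where "cf l = 2 powr p * 2 powr (- (p * real l))" for l :: nat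
  have cf: "cf l \<ge> 0" for l by (simp add: cf_def)
  define z where "z = 2 powr (- a)"
  have z: "0 < z" "z < 1" using a by (auto simp: z_def powr_less_one)
  have pt: "ennreal ((1 + norm (y - c) / R) powr (- p)) * g y \<le> (\<Sum>l. ennreal (cf l) * (g y * indicator (cball c (2 ^ l * R)) y))" for y
  proof -
    obtain l where l: "norm (y - c) / R \<le> 2 ^ l" "(1 + norm (y - c) / R) powr (- p) \<le> cf l"
      using weight_le_layers[OF p, of "norm (y - c) / R"] R by (auto simp: cf_def)
    have "y \<in> cball c (2 ^ l * R)" using l(1) R by (simp add: dist_norm norm_minus_commute field_simps)
    then have "ennreal ((1 + norm (y - c) / R) powr (- p)) * g y \<le> ennreal (cf l) * (g y * indicator (cball c (2 ^ l * R)) y)"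
      using l(2) by (auto intro!: mult_right_mono ennreal_leI)
    also have "\<dots> \<le> (\<Sum>l. ennreal (cf l) * (g y * indicator (cball c (2 ^ l * R)) y))"
      using sum_le_suminf[of "\<lambda>l. ennreal (cf l) * (g y * indicator (cball c (2 ^ l * R)) y)" "{l}"] by simp
    finally show ?thesis .
  qed
  have "(\<integral>\<^sup>+y. ennreal ((1 + norm (y - c) / R) powr (- p)) * g y \<partial>lborel) \<le>
     (\<integral>\<^sup>+y. (\<Sum>l. ennreal (cf l) * (g y * indicator (cball c (2 ^ l * R)) y)) \<partial>lborel)"
    by (intro nn_integral_mono pt)
  also have "\<dots> = (\<Sum>l. ennreal (cf l) * (\<integral>\<^sup>+y\<in>cball c (2 ^ l * R). g y \<partial>lborel))"
    by (simp add: nn_integral_suminf nn_integral_cmult)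
  also have "\<dots> \<le> (\<Sum>l. ennreal (2 powr p * (A * R ^ n) * z ^ l))"
  proof (intro suminf_le)
    fix l
    have "R \<le> 2 ^ l * R" using R by simp
    then have "ennreal (cf l) * (\<integral>\<^sup>+y\<in>cball c (2 ^ l * R). g y \<partial>lborel) \<le> ennreal (cf l) * ennreal (A * (2 ^ l * R) ^ n)"
      unfolding n_def by (intro mult_left_mono g) auto
    also have "\<dots> = ennreal (cf l * (A * (2 ^ l * R) ^ n))" using cf A R by (intro ennreal_mult[symmetric]) auto
    also have "cf l * (A * (2 ^ l * R) ^ n) = 2 powr p * (A * R ^ n) * (2 powr (- (p * real l)) * (2 ^ l) ^ n)"
      by (simp add: cf_def power_mult_distrib)
    also have "2 powr (- (p * real l)) * (2 ^ l) ^ n = z ^ l"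
      by (simp add: z_def p_def powr_powr powr_realpow[symmetric] powr_add[symmetric] algebra_simps)
    finally show "ennreal (cf l) * (\<integral>\<^sup>+y\<in>cball c (2 ^ l * R). g y \<partial>lborel) \<le> ennreal (2 powr p * (A * R ^ n) * z ^ l)" .
  qed auto
  also have "\<dots> = ennreal (\<Sum>l. 2 powr p * (A * R ^ n) * z ^ l)"
    using z A R by (intro suminf_ennreal2) (auto intro!: summable_mult summable_geometric)
  also have "(\<Sum>l. 2 powr p * (A * R ^ n) * z ^ l) = layer_const n a * (A * R ^ n)"
    using z by (subst suminf_mult) (auto simp: suminf_geometric layer_const_def p_def z_def intro!: summable_geometric)
  finally show ?thesis by (simp add: n_def p_def)
qed

text \<open>Mean squares over balls of radius at least R are O(B^2), with the volume of the unit
  ball absorbed in B. All larger radii are included because the dyadic layers of a decaying kernel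
  use them.\<close>

definition loc2 :: "real \<Rightarrow> real \<Rightarrow> ('a::euclidean_space \<Rightarrow> complex) \<Rightarrow> bool"
  where "loc2 R B G \<longleftrightarrow> G \<in> borel_measurable borel \<and>
    (\<forall>z r. r \<ge> R \<longrightarrow> (\<integral>\<^sup>+y\<in>cball z r. ennreal ((norm (G y))\<^sup>2) \<partial>lborel) \<le> ennreal (B\<^sup>2 * r ^ DIM('a)))"

lemma loc2_mono_R: "loc2 R B G \<Longrightarrow> R \<le> R' \<Longrightarrow> loc2 R' B G"
  by (auto simp: loc2_def)

lemma loc2_translate:
  assumes "loc2 R B G" shows "loc2 R B (\<lambda>y. G (y + a))"
proof -
  have [measurable]: "G \<in> borel_measurable borel" using assms by (simp add: loc2_def)
  have "(\<integral>\<^sup>+y\<in>cball z r. ennreal ((norm (G (y + a)))\<^sup>2) \<partial>lborel) = (\<integral>\<^sup>+y\<in>cball (z + a) r. ennreal ((norm (G y))\<^sup>2) \<partial>lborel)" for z r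
  proof -
    have "(\<integral>\<^sup>+y\<in>cball z r. ennreal ((norm (G (y + a)))\<^sup>2) \<partial>lborel)
      = (\<integral>\<^sup>+y. ennreal ((norm (G (y + a)))\<^sup>2) * indicator (cball (z + a) r) (y + a) \<partial>lborel)"
      by (intro nn_integral_cong) (auto simp: indicator_def dist_norm)
    then show ?thesis
      using nn_integral_lborel_translate[of "\<lambda>y. ennreal ((norm (G y))\<^sup>2) * indicator (cball (z + a) r) y" a] by simp
  qed
  then show ?thesis using assms by (auto simp: loc2_def)
qed

theorem trilinear_estimate:
  fixes G H :: "'a::euclidean_space \<Rightarrow> complex"
  assumes G: "loc2 R B1 G" and H: "loc2 R B2 H" and B: "B1 > 0" "B2 > 0" and R: "R > 0" and a: "a > 0" and M: "M \<ge> 0"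
    and [measurable]: "k \<in> borel_measurable borel"
    and k: "\<And>y. norm (k y :: complex) \<le> M * (1 + norm (y - c) / R) powr (- (real DIM('a) + a))"
  shows "(\<integral>\<^sup>+y. ennreal (norm (k y) * norm (G y) * norm (H y)) \<partial>lborel) \<le>
    ennreal (layer_const DIM('a) a * M * B1 * B2 * R ^ DIM('a))"
proof -
  have [measurable]: "G \<in> borel_measurable borel" "H \<in> borel_measurable borel" using G H by (auto simp: loc2_def)
  define g where "g y = ennreal (norm (G y) * norm (H y))" for y
  have [measurable]: "g \<in> borel_measurable borel" unfolding g_def by measurable
  have gb: "(\<integral>\<^sup>+y\<in>cball c r. g y \<partial>lborel) \<le> ennreal (B1 * B2 * r ^ DIM('a))" if r: "r \<ge> R" for r
  proof -
    \<comment> \<open>Weights with 4 \<alpha> \<beta> = 1, so that the product of the norms is at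
      most the weighted sum of squares, and balanced so that the two bounds add up to exactly B1 B2.
      This stands in for Cauchy-Schwarz.\<close>
    define \<alpha> \<beta> where "\<alpha> = B2 / (2 * B1)" and "\<beta> = B1 / (2 * B2)"
    have ab: "\<alpha> > 0" "\<beta> > 0" using B by (auto simp: \<alpha>_def \<beta>_def)
    have "norm (G y) * norm (H y) \<le> \<alpha> * (norm (G y))\<^sup>2 + \<beta> * (norm (H y))\<^sup>2" for y
    proof -
      have "0 \<le> (B2 * norm (G y) - B1 * norm (H y))\<^sup>2 / (2 * B1 * B2)" using B by simp
      also have "\<dots> = \<alpha> * (norm (G y))\<^sup>2 + \<beta> * (norm (H y))\<^sup>2 - norm (G y) * norm (H y)"
        using B by (simp add: \<alpha>_def \<beta>_def field_simps power2_eq_square)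
      finally show ?thesis by simp
    qed
    then have "(\<integral>\<^sup>+y\<in>cball c r. g y \<partial>lborel) \<le> (\<integral>\<^sup>+y. ennreal \<alpha> * (ennreal ((norm (G y))\<^sup>2) * indicator (cball c r) y) +
        ennreal \<beta> * (ennreal ((norm (H y))\<^sup>2) * indicator (cball c r) y) \<partial>lborel)"
      using ab by (intro nn_integral_mono) (auto simp: g_def indicator_def ennreal_mult[symmetric] ennreal_plus[symmetric] simp del: ennreal_plus intro!: ennreal_leI)
    also have "\<dots> = ennreal \<alpha> * (\<integral>\<^sup>+y\<in>cball c r. ennreal ((norm (G y))\<^sup>2) \<partial>lborel) + ennreal \<beta> * (\<integral>\<^sup>+y\<in>cball c r. ennreal ((norm (H y))\<^sup>2) \<partial>lborel)"
      by (simp add: nn_integral_add nn_integral_cmult)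
    also have "\<dots> \<le> ennreal \<alpha> * ennreal (B1\<^sup>2 * r ^ DIM('a)) + ennreal \<beta> * ennreal (B2\<^sup>2 * r ^ DIM('a))"
      using G H r by (intro add_mono mult_left_mono) (auto simp: loc2_def)
    also have "\<dots> = ennreal (\<alpha> * (B1\<^sup>2 * r ^ DIM('a)) + \<beta> * (B2\<^sup>2 * r ^ DIM('a)))"
      using ab r R by (simp add: ennreal_mult)
    also have "\<alpha> * (B1\<^sup>2 * r ^ DIM('a)) + \<beta> * (B2\<^sup>2 * r ^ DIM('a)) = B1 * B2 * r ^ DIM('a)"
      using B by (simp add: \<alpha>_def \<beta>_def field_simps power2_eq_square)
    finally show ?thesis .
  qed
  have "(\<integral>\<^sup>+y. ennreal (norm (k y) * norm (G y) * norm (H y)) \<partial>lborel) \<le>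
    (\<integral>\<^sup>+y. ennreal M * (ennreal ((1 + norm (y - c) / R) powr (- (real DIM('a) + a))) * g y) \<partial>lborel)"
  proof (intro nn_integral_mono)
    fix y
    have "norm (k y) * norm (G y) * norm (H y) \<le> M * ((1 + norm (y - c) / R) powr (- (real DIM('a) + a)) * (norm (G y) * norm (H y)))"
      using mult_right_mono[OF k[of y], of "norm (G y) * norm (H y)"] by (simp add: mult_ac)
    then show "ennreal (norm (k y) * norm (G y) * norm (H y)) \<le> ennreal M * (ennreal ((1 + norm (y - c) / R) powr (- (real DIM('a) + a))) * g y)"
      using M unfolding g_def by (simp add: ennreal_mult[symmetric] ennreal_leI)
  qed
  also have "\<dots> = ennreal M * (\<integral>\<^sup>+y. ennreal ((1 + norm (y - c) / R) powr (- (real DIM('a) + a))) * g y \<partial>lborel)"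
    by (rule nn_integral_cmult) measurable
  also have "\<dots> \<le> ennreal M * ennreal (layer_const DIM('a) a * (B1 * B2 * R ^ DIM('a)))"
    using B by (intro mult_left_mono layer_integral[OF _ R _ a gb]) auto
  also have "\<dots> = ennreal (layer_const DIM('a) a * M * B1 * B2 * R ^ DIM('a))"
    using M B R layer_const_pos[OF a, of "DIM('a)"] by (subst ennreal_mult[symmetric]) (auto simp: mult_ac)
  finally show ?thesis .
qed

lemma emeasure_cball_unit: "r \<ge> 0 \<Longrightarrow> emeasure lborel (cball (z::'a::euclidean_space) r) = ennreal (unit_ball_vol (real DIM('a)) * r ^ DIM('a))"
  by (rule emeasure_cball)

lemma loc2_bounded:
  fixes G :: "'a::euclidean_space \<Rightarrow> complex"
  assumes [measurable]: "G \<in> borel_measurable borel" and B: "\<And>y. norm (G y) \<le> B" and R: "R > 0"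
  shows "loc2 R (B * sqrt (unit_ball_vol (real DIM('a)))) G"
  unfolding loc2_def
proof (intro conjI allI impI)
  fix z :: 'a and r assume r: "r \<ge> R"
  have "B \<ge> 0" using B[of 0] norm_ge_zero order_trans by blast
  have "(\<integral>\<^sup>+y\<in>cball z r. ennreal ((norm (G y))\<^sup>2) \<partial>lborel) \<le> (\<integral>\<^sup>+y. ennreal (B\<^sup>2) * indicator (cball z r) y \<partial>lborel)"
    using B by (intro nn_integral_mono) (auto simp: indicator_def intro!: ennreal_leI power_mono)
  also have "\<dots> = ennreal (B\<^sup>2) * emeasure lborel (cball z r)" by (subst nn_integral_cmult_indicator) auto
  also have "\<dots> = ennreal ((B * sqrt (unit_ball_vol (real DIM('a))))\<^sup>2 * r ^ DIM('a))"
    using r R by (subst emeasure_cball_unit) (auto simp: ennreal_mult[symmetric] power_mult_distrib)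
  finally show "(\<integral>\<^sup>+y\<in>cball z r. ennreal ((norm (G y))\<^sup>2) \<partial>lborel) \<le> ennreal ((B * sqrt (unit_ball_vol (real DIM('a))))\<^sup>2 * r ^ DIM('a))" .
qed measurable

section \<open>Convolution operators and their local mean squares\<close>

definition conv :: "('a::euclidean_space \<Rightarrow> complex) \<Rightarrow> ('a \<Rightarrow> complex) \<Rightarrow> 'a \<Rightarrow> complex"
  where "conv k g x = (LINT w|lborel. k (x - w) * g w)"

lemma conv_measurable[measurable]:
  assumes [measurable]: "k \<in> borel_measurable borel" "g \<in> borel_measurable borel"
  shows "conv k g \<in> borel_measurable borel"
  unfolding conv_def[abs_def] by measurable

text \<open>Convolution with \<open>ft u\<close> is the Fourier multiplier u. No power of 2 pi
  appears, because \<open>ft u\<close> is the unnormalised inverse transform and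
  \<open>ft g (- \<xi>)\<close> the forward transform.\<close>

lemma conv_ft:
  fixes u g :: "'a::euclidean_space \<Rightarrow> complex"
  assumes u: "integrable lborel u" and g: "integrable lborel g"
  shows "conv (ft u) g x = ft (\<lambda>\<xi>. u \<xi> * ft g (- \<xi>)) x"
proof -
  have [measurable]: "u \<in> borel_measurable borel" "g \<in> borel_measurable borel" using u g by auto
  define v where "v \<xi> = cis (- (x \<bullet> \<xi>)) * u (- \<xi>)" for \<xi>
  have "integrable lborel (\<lambda>\<xi>. u (0 + (-1) *\<^sub>R \<xi>))" using u by (subst integrable_lborel_affine_iff) auto
  then have v: "integrable lborel v" unfolding v_def by (intro integrable_cis_mult) auto
  have "ft v w = ft u (x - w)" for w
  proof -
    have "ft u (x - w) = (LINT \<xi>|lborel. cis ((x - w) \<bullet> (0 - \<xi>)) * u (0 - \<xi>))"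
      unfolding ft_def by (rule integral_lborel_reflect[symmetric]) measurable
    also have "\<dots> = ft v w"
      unfolding ft_def v_def
    proof (intro Bochner_Integration.integral_cong refl)
      fix \<xi>
      have "cis ((x - w) \<bullet> (0 - \<xi>)) = cis (w \<bullet> \<xi>) * cis (- (x \<bullet> \<xi>))"
        by (simp add: cis_mult inner_diff_left)
      then show "cis ((x - w) \<bullet> (0 - \<xi>)) * u (0 - \<xi>) = cis (w \<bullet> \<xi>) * (cis (- (x \<bullet> \<xi>)) * u (- \<xi>))"
        by (simp add: mult.assoc)
    qed
    finally show ?thesis by simp
  qed
  then have "conv (ft u) g x = (LINT w|lborel. g w * ft v w)" by (simp add: conv_def mult.commute)
  also have "\<dots> = (LINT \<xi>|lborel. ft g \<xi> * v \<xi>)" by (rule ft_mult_formula[OF g v, symmetric])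
  also have "\<dots> = (LINT \<xi>|lborel. ft g (0 - \<xi>) * v (0 - \<xi>))"
    by (rule integral_lborel_reflect[symmetric]) (use v in measurable)
  also have "\<dots> = ft (\<lambda>\<xi>. u \<xi> * ft g (- \<xi>)) x"
    unfolding ft_def[of "\<lambda>\<xi>. u \<xi> * ft g (- \<xi>)"] by (simp add: v_def mult_ac)
  finally show ?thesis .
qed

lemma integrable_mult_ft:
  fixes u g :: "'a::euclidean_space \<Rightarrow> complex"
  assumes u: "integrable lborel u" and g: "integrable lborel g"
  shows "integrable lborel (\<lambda>\<xi>. u \<xi> * ft g (- \<xi>))"
proof (rule Bochner_Integration.integrable_bound)
  have [measurable]: "u \<in> borel_measurable borel" "g \<in> borel_measurable borel" using u g by auto
  show "integrable lborel (\<lambda>\<xi>. (LINT \<xi>|lborel. norm (g \<xi>)) * norm (u \<xi>))" using u by simp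
  show "AE \<xi> in lborel. norm (u \<xi> * ft g (- \<xi>)) \<le> norm ((LINT \<xi>|lborel. norm (g \<xi>)) * norm (u \<xi>))"
    using norm_ft_le[OF g] by (intro AE_I2) (auto simp: norm_mult mult.commute intro!: mult_left_mono)
  show "(\<lambda>\<xi>. u \<xi> * ft g (- \<xi>)) \<in> borel_measurable lborel" by measurable
qed

text \<open>Plancherel is applied twice, to the product and to g, hence the square of (2 pi)^n. The
  multiplier is bounded by 1 and costs nothing.\<close>

lemma conv_L2:
  fixes u g :: "'a::euclidean_space \<Rightarrow> complex"
  assumes u: "integrable lborel u" and g: "integrable lborel g" and u1: "\<And>\<xi>. norm (u \<xi>) \<le> 1"
  shows "(\<integral>\<^sup>+x. ennreal ((norm (conv (ft u) g x))\<^sup>2) \<partial>lborel) \<le>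
    ennreal ((2 * pi) ^ DIM('a) * (2 * pi) ^ DIM('a)) * (\<integral>\<^sup>+x. ennreal ((norm (g x))\<^sup>2) \<partial>lborel)"
proof -
  have [measurable]: "u \<in> borel_measurable borel" "g \<in> borel_measurable borel" using u g by auto
  let ?c = "ennreal ((2 * pi) ^ DIM('a))"
  have "(\<integral>\<^sup>+x. ennreal ((norm (conv (ft u) g x))\<^sup>2) \<partial>lborel) \<le> ?c * (\<integral>\<^sup>+\<xi>. ennreal ((norm (u \<xi> * ft g (- \<xi>)))\<^sup>2) \<partial>lborel)"
    unfolding conv_ft[OF u g] by (rule plancherel_inequality[OF integrable_mult_ft[OF u g]])
  also have "\<dots> \<le> ?c * (\<integral>\<^sup>+\<xi>. ennreal ((norm (ft g (0 - \<xi>)))\<^sup>2) \<partial>lborel)"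
  proof (intro mult_left_mono nn_integral_mono ennreal_leI power_mono)
    fix \<xi> show "norm (u \<xi> * ft g (- \<xi>)) \<le> norm (ft g (0 - \<xi>))"
      using u1[of \<xi>] by (simp add: norm_mult mult_left_le_one_le)
  qed auto
  also have "(\<integral>\<^sup>+\<xi>. ennreal ((norm (ft g (0 - \<xi>)))\<^sup>2) \<partial>lborel) = (\<integral>\<^sup>+\<xi>. ennreal ((norm (ft g \<xi>))\<^sup>2) \<partial>lborel)"
    by (rule nn_integral_lborel_reflect) measurable
  also have "?c * (\<integral>\<^sup>+\<xi>. ennreal ((norm (ft g \<xi>))\<^sup>2) \<partial>lborel) \<le> ?c * (?c * (\<integral>\<^sup>+x. ennreal ((norm (g x))\<^sup>2) \<partial>lborel))"
    by (intro mult_left_mono plancherel_inequality g) auto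
  also have "\<dots> = ennreal ((2 * pi) ^ DIM('a) * (2 * pi) ^ DIM('a)) * (\<integral>\<^sup>+x. ennreal ((norm (g x))\<^sup>2) \<partial>lborel)"
    by (subst ennreal_mult) (auto simp: mult.assoc)
  finally show ?thesis .
qed

text \<open>Serves two purposes: with S the exterior of a ball it treats the part of g far from x,
  and with S = UNIV it is the supremum bound by the L^1 norm of the kernel.\<close>

lemma norm_conv_le:
  fixes k g :: "'a::euclidean_space \<Rightarrow> complex"
  assumes [measurable]: "k \<in> borel_measurable borel" "g \<in> borel_measurable borel"
    and k: "(\<integral>\<^sup>+y. ennreal (norm (k y)) * indicator S y \<partial>lborel) \<le> ennreal T" and S[measurable]: "S \<in> sets borel"
    and T: "T \<ge> 0" and A: "A \<ge> 0" and g: "\<And>w. norm (g w) \<le> A" and g0: "\<And>w. x - w \<notin> S \<Longrightarrow> g w = 0"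
  shows "norm (conv k g x) \<le> A * T"
proof -
  have "ennreal (norm (conv k g x)) \<le> (\<integral>\<^sup>+w. ennreal (norm (k (x - w) * g w)) \<partial>lborel)"
    unfolding conv_def by (rule norm_integral_le_nn_integral)
  also have "\<dots> \<le> (\<integral>\<^sup>+w. ennreal A * (ennreal (norm (k (x - w))) * indicator S (x - w)) \<partial>lborel)"
  proof (intro nn_integral_mono)
    fix w
    show "ennreal (norm (k (x - w) * g w)) \<le> ennreal A * (ennreal (norm (k (x - w))) * indicator S (x - w))"
    proof (cases "x - w \<in> S")
      case True
      have "norm (k (x - w) * g w) \<le> A * norm (k (x - w))"
        using mult_left_mono[OF g[of w], of "norm (k (x - w))"] by (simp add: norm_mult mult.commute)
      then show ?thesis using True A by (simp add: ennreal_mult[symmetric] ennreal_leI)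
    qed (simp add: g0)
  qed
  also have "\<dots> = ennreal A * (\<integral>\<^sup>+w. ennreal (norm (k (x - w))) * indicator S (x - w) \<partial>lborel)"
    by (rule nn_integral_cmult) measurable
  also have "(\<integral>\<^sup>+w. ennreal (norm (k (x - w))) * indicator S (x - w) \<partial>lborel) = (\<integral>\<^sup>+y. ennreal (norm (k y)) * indicator S y \<partial>lborel)"
    by (rule nn_integral_lborel_reflect) measurable
  also have "ennreal A * \<dots> \<le> ennreal A * ennreal T" by (intro mult_left_mono k) auto
  also have "\<dots> = ennreal (A * T)" using A T by (simp add: ennreal_mult)
  finally show ?thesis using A T by (subst (asm) ennreal_le_iff) auto
qed

text \<open>The 2 comes from (a + b)^2 <= 2 a^2 + 2 b^2, the two powers of 2 pi from
  \<open>conv_L2\<close>, the 2^n from the doubled ball that carries the near part, and T from the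
  tail of the kernel.\<close>

definition local_const :: "nat \<Rightarrow> real \<Rightarrow> real"
  where "local_const n T = sqrt (2 * unit_ball_vol (real n) * (((2 * pi) ^ n * (2 * pi) ^ n) * 2 ^ n + T\<^sup>2))"

lemma loc2_conv:
  fixes u g :: "'a::euclidean_space \<Rightarrow> complex"
  assumes u: "integrable lborel u" and u1: "\<And>\<xi>. norm (u \<xi>) \<le> 1"
    and g: "integrable lborel g" and gA: "\<And>w. norm (g w) \<le> A"
    and T: "(\<integral>\<^sup>+y. ennreal (norm (ft u y)) * indicator {y. norm y > R} y \<partial>lborel) \<le> ennreal T" "T \<ge> 0" and R: "R > 0"
  shows "loc2 R (A * local_const DIM('a) T) (conv (ft u) g)"
  unfolding loc2_def
proof (intro conjI allI impI)
  have [measurable]: "u \<in> borel_measurable borel" "g \<in> borel_measurable borel" using u g by auto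
  have A: "A \<ge> 0" using gA[of 0] norm_ge_zero order_trans by blast
  show "conv (ft u) g \<in> borel_measurable borel" by measurable
  define V where "V = unit_ball_vol (real DIM('a))"
  have V: "V \<ge> 0" by (simp add: V_def)
  fix z :: 'a and r assume r: "r \<ge> R"
  then have r0: "r > 0" using R by simp
  \<comment> \<open>Cutting at twice the radius ensures norm (x - w) > r >= R for x in the ball and
    w in the support of g2, so only the tail of the kernel acts on g2.\<close>
  define g1 where "g1 w = indicator (cball z (2 * r)) w *\<^sub>R g w" for w
  define g2 where "g2 w = indicator (- cball z (2 * r)) w *\<^sub>R g w" for w
  have [measurable]: "cball z (2 * r) \<in> sets borel" "- cball z (2 * r) \<in> sets borel" by auto
  have g1i: "integrable lborel g1" unfolding g1_def by (rule integrable_mult_indicator[OF _ g]) auto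
  have g2i: "integrable lborel g2" unfolding g2_def by (rule integrable_mult_indicator[OF _ g]) auto
  have [measurable]: "g1 \<in> borel_measurable borel" "g2 \<in> borel_measurable borel" using g1i g2i by auto
  have g12: "g w = g1 w + g2 w" for w by (auto simp: g1_def g2_def indicator_def)
  have ub: "norm (ft u y) \<le> (LINT \<xi>|lborel. norm (u \<xi>))" for y by (rule norm_ft_le[OF u])
  have ci: "integrable lborel (\<lambda>w. ft u (x - w) * h w)" if h: "integrable lborel h" for x h
  proof (rule Bochner_Integration.integrable_bound)
    show "integrable lborel (\<lambda>w. (LINT \<xi>|lborel. norm (u \<xi>)) * norm (h w))" using h by simp
    show "AE w in lborel. norm (ft u (x - w) * h w) \<le> norm ((LINT \<xi>|lborel. norm (u \<xi>)) * norm (h w))"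
      using ub by (intro AE_I2) (auto simp: norm_mult intro!: mult_right_mono)
    show "(\<lambda>w. ft u (x - w) * h w) \<in> borel_measurable lborel" using h by measurable
  qed
  have split: "conv (ft u) g x = conv (ft u) g1 x + conv (ft u) g2 x" for x
    unfolding conv_def g12 distrib_left by (rule Bochner_Integration.integral_add[OF ci[OF g1i] ci[OF g2i]])
  have far: "norm (conv (ft u) g2 x) \<le> A * T" if x: "x \<in> cball z r" for x
  proof (rule norm_conv_le[OF _ _ T(1) _ T(2) A])
    fix w assume "x - w \<notin> {y. R < norm y}"
    then have "norm (x - w) \<le> r" using r by simp
    then have "dist z w \<le> 2 * r" using x dist_triangle[of z w x] by (simp add: dist_norm)
    then show "g2 w = 0" by (simp add: g2_def)
  next
    fix w show "norm (g2 w) \<le> A" using gA[of w] A by (simp add: g2_def indicator_def)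
  qed measurable
  have near: "(\<integral>\<^sup>+x. ennreal ((norm (conv (ft u) g1 x))\<^sup>2) \<partial>lborel) \<le> ennreal ((2 * pi) ^ DIM('a) * (2 * pi) ^ DIM('a) * (A\<^sup>2 * (V * (2 * r) ^ DIM('a))))"
  proof -
    have "(\<integral>\<^sup>+x. ennreal ((norm (g1 x))\<^sup>2) \<partial>lborel) \<le> (\<integral>\<^sup>+x. ennreal (A\<^sup>2) * indicator (cball z (2 * r)) x \<partial>lborel)"
      using gA by (intro nn_integral_mono) (auto simp: g1_def indicator_def intro!: ennreal_leI power_mono)
    also have "\<dots> = ennreal (A\<^sup>2) * emeasure lborel (cball z (2 * r))" by (subst nn_integral_cmult_indicator) auto
    also have "\<dots> = ennreal (A\<^sup>2 * (V * (2 * r) ^ DIM('a)))"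
      using r0 by (subst emeasure_cball_unit) (auto simp: V_def ennreal_mult[symmetric])
    finally have "ennreal ((2 * pi) ^ DIM('a) * (2 * pi) ^ DIM('a)) * (\<integral>\<^sup>+x. ennreal ((norm (g1 x))\<^sup>2) \<partial>lborel)
      \<le> ennreal ((2 * pi) ^ DIM('a) * (2 * pi) ^ DIM('a)) * ennreal (A\<^sup>2 * (V * (2 * r) ^ DIM('a)))" by (rule mult_left_mono) auto
    also have "\<dots> = ennreal ((2 * pi) ^ DIM('a) * (2 * pi) ^ DIM('a) * (A\<^sup>2 * (V * (2 * r) ^ DIM('a))))"
      using V r0 by (intro ennreal_mult[symmetric]) auto
    finally show ?thesis by (rule order_trans[OF conv_L2[OF u g1i u1]])
  qed
  have pt: "ennreal ((norm (conv (ft u) g x))\<^sup>2) * indicator (cball z r) x \<le> ennreal 2 * ennreal ((norm (conv (ft u) g1 x))\<^sup>2) + ennreal (2 * (A * T)\<^sup>2) * indicator (cball z r) x" for x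
  proof (cases "x \<in> cball z r")
    case True
    have "(norm (conv (ft u) g x))\<^sup>2 \<le> (norm (conv (ft u) g1 x) + norm (conv (ft u) g2 x))\<^sup>2"
      unfolding split by (intro power_mono norm_triangle_ineq) auto
    also have "\<dots> \<le> 2 * (norm (conv (ft u) g1 x))\<^sup>2 + 2 * (norm (conv (ft u) g2 x))\<^sup>2"
      using sum_squares_bound[of "norm (conv (ft u) g1 x)" "norm (conv (ft u) g2 x)"] by (simp add: power2_sum)
    also have "\<dots> \<le> 2 * (norm (conv (ft u) g1 x))\<^sup>2 + 2 * (A * T)\<^sup>2"
      using far[OF True] by (intro add_left_mono mult_left_mono power_mono) auto
    finally have "ennreal ((norm (conv (ft u) g x))\<^sup>2) \<le> ennreal (2 * (norm (conv (ft u) g1 x))\<^sup>2 + 2 * (A * T)\<^sup>2)" by (rule ennreal_leI)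
    also have "\<dots> = ennreal 2 * ennreal ((norm (conv (ft u) g1 x))\<^sup>2) + ennreal (2 * (A * T)\<^sup>2)"
      by (subst ennreal_plus) (auto simp: ennreal_mult)
    finally show ?thesis using True by simp
  qed simp
  have "(\<integral>\<^sup>+y\<in>cball z r. ennreal ((norm (conv (ft u) g y))\<^sup>2) \<partial>lborel) \<le>
     (\<integral>\<^sup>+x. ennreal 2 * ennreal ((norm (conv (ft u) g1 x))\<^sup>2) + ennreal (2 * (A * T)\<^sup>2) * indicator (cball z r) x \<partial>lborel)"
    by (intro nn_integral_mono pt)
  also have "\<dots> = ennreal 2 * (\<integral>\<^sup>+x. ennreal ((norm (conv (ft u) g1 x))\<^sup>2) \<partial>lborel) + ennreal (2 * (A * T)\<^sup>2) * emeasure lborel (cball z r)"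
    by (subst nn_integral_add) (auto simp: nn_integral_cmult nn_integral_cmult_indicator simp del: ennreal_numeral)
  also have "\<dots> \<le> ennreal 2 * ennreal ((2 * pi) ^ DIM('a) * (2 * pi) ^ DIM('a) * (A\<^sup>2 * (V * (2 * r) ^ DIM('a)))) + ennreal (2 * (A * T)\<^sup>2) * ennreal (V * r ^ DIM('a))"
    using r0 by (intro add_mono mult_left_mono near) (auto simp: emeasure_cball_unit V_def)
  also have "\<dots> = ennreal (2 * ((2 * pi) ^ DIM('a) * (2 * pi) ^ DIM('a) * (A\<^sup>2 * (V * (2 * r) ^ DIM('a)))) + 2 * (A * T)\<^sup>2 * (V * r ^ DIM('a)))"
    using V r0 by (subst (1 2) ennreal_mult[symmetric]) (auto simp: ennreal_plus[symmetric] simp del: ennreal_plus)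
  also have "2 * ((2 * pi) ^ DIM('a) * (2 * pi) ^ DIM('a) * (A\<^sup>2 * (V * (2 * r) ^ DIM('a)))) + 2 * (A * T)\<^sup>2 * (V * r ^ DIM('a)) = (A * local_const DIM('a) T)\<^sup>2 * r ^ DIM('a)"
    using V unfolding local_const_def V_def[symmetric] by (simp add: power_mult_distrib algebra_simps)
  finally show "(\<integral>\<^sup>+y\<in>cball z r. ennreal ((norm (conv (ft u) g y))\<^sup>2) \<partial>lborel) \<le> ennreal ((A * local_const DIM('a) T)\<^sup>2 * r ^ DIM('a))" .
qed

section \<open>Uniform bounds for dyadic triples\<close>

text \<open>For the kernel at frequency \<open>2 ^ k\<close>: \<open>kR\<close> is the radius outside of which it is negligible, \<open>kM\<close>
  bounds its supremum and \<open>kB\<close> its \<open>L\<^sup>1\<close> norm, up to constants. The radius should be \<open>2 powr (k * (s - 1))\<close>;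
  the \<open>e\<close> is room for rapid decay.\<close>

definition kR :: "real \<Rightarrow> real \<Rightarrow> nat \<Rightarrow> real"
  where "kR s e k = 2 powr (real k * (s - 1 + e))"

definition kM :: "nat \<Rightarrow> real \<Rightarrow> nat \<Rightarrow> real"
  where "kM n s k = 2 powr (real k * (real n * (1 - s/2)))"

definition kB :: "nat \<Rightarrow> real \<Rightarrow> real \<Rightarrow> nat \<Rightarrow> real"
  where "kB n s e k = 2 powr (real k * (real n * (s/2 + e)))"

lemma kR_pos[simp]: "kR s e k > 0" and kM_pos[simp]: "kM n s k > 0" and kB_pos[simp]: "kB n s e k > 0"
  by (simp_all add: kR_def kM_def kB_def)

lemma kR_nonzero[simp]: "kR s e k \<noteq> 0"
  by (simp add: kR_def)

lemma kR_power: "kR s e k ^ n = 2 powr (real k * (real n * (s - 1 + e)))"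
  by (simp add: kR_def powr_powr powr_realpow[symmetric] algebra_simps)

lemma kB_eq: "kM n s k * kR s e k ^ n = kB n s e k"
  unfolding kR_power kM_def kB_def powr_add[symmetric] by (simp add: algebra_simps)

text \<open>Brings the kernels of all frequencies, including k = 0, under one constant. K is chosen
  after e and above any prescribed K0, since the expansion of the symbol makes demands on K as
  well.\<close>

lemma osc_kernel:
  assumes s: "s > 0" "s \<noteq> 1" and e: "e > 0"
  shows "\<exists>K\<ge>K0. \<exists>a>0. \<exists>C\<ge>1.
    (\<forall>k y. norm (ft (osc K s k :: 'a::euclidean_space \<Rightarrow> complex) y) \<le> C * kM DIM('a) s k * (1 + norm y / kR s e k) powr (- (real DIM('a) + a))) \<and>
    (\<forall>k. (\<integral>\<^sup>+y. ennreal (norm (ft (osc K s k :: 'a \<Rightarrow> complex) y)) * indicator {y. norm y > kR s e k} y \<partial>lborel) \<le> ennreal C) \<and>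
    (\<forall>k. (\<integral>\<^sup>+y. ennreal (norm (ft (osc K s k :: 'a \<Rightarrow> complex) y)) \<partial>lborel) \<le> ennreal (C * kB DIM('a) s e k))"
proof -
  define n where "n = DIM('a)"
  have n: "n \<ge> 1" unfolding n_def by (simp add: Suc_le_eq)
  \<comment> \<open>The kernel at k = 0 allows a < s, and a < 1 keeps the exponent n + a below 2 n
    <= K.\<close>
  define a where "a = min s 1 / 2"
  have a: "a > 0" "a < s" "a < 1" using s by (auto simp: a_def min_def)
  define p where "p = real n + a"
  define K where "K = max (max (2 * n) K0) (nat \<lceil>real n * (s + e) / e\<rceil>)"
  have K: "2 * n \<le> K" "K0 \<le> K" by (auto simp: K_def)
  have K2: "real n * (s + e) \<le> e * real K"
  proof -
    have "real n * (s + e) / e \<le> real (nat \<lceil>real n * (s + e) / e\<rceil>)" by linarith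
    also have "\<dots> \<le> real K" by (simp add: K_def)
    finally show ?thesis using e by (simp add: field_simps)
  qed
  have p: "0 \<le> p" "p \<le> real K" "p < real n + s"
    using a n K by (auto simp: p_def)
  obtain C1 where C1: "C1 \<ge> 0" and C1k: "\<And>k y. k \<ge> 1 \<Longrightarrow>
    norm (ft (osc K s k :: 'a \<Rightarrow> complex) y) \<le> C1 * kM n s k * (1 + norm y / kR s e k) powr (- p)"
    and C1t: "\<And>k y. k \<ge> 1 \<Longrightarrow> norm y > kR s e k \<Longrightarrow> norm (ft (osc K s k :: 'a \<Rightarrow> complex) y) \<le>
      C1 / kR s e k ^ n * (1 / (1 + norm y / kR s e k) ^ (2 * n))"
    using kernel_high[OF s e K(1)[unfolded n_def] K2[unfolded n_def] p(1,2)] unfolding kM_def kR_def n_def by blast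
  obtain C0 where C0: "C0 \<ge> 0" "\<And>y. norm (ft (osc K s 0 :: 'a \<Rightarrow> complex) y) \<le> C0 * (1 + norm y) powr (- p)"
    using kernel_low[OF s(1) p(1) p(3)[unfolded n_def] p(2)] by blast
  obtain W where W: "W \<ge> 0" "\<And>N c \<mu>. 2 * n \<le> N \<Longrightarrow> \<mu> > 0 \<Longrightarrow>
    (\<integral>\<^sup>+x. ennreal (1 / (1 + \<mu> * norm (x - c :: 'a)) ^ N) \<partial>lborel) \<le> ennreal (W / \<mu> ^ n)"
    using nn_integral_weight[where 'a='a] unfolding n_def by blast
  define V where "V = unit_ball_vol (real n)"
  have V: "V \<ge> 0" by (simp add: V_def)
  define L where "L = layer_const n a * V"
  have L: "L \<ge> 0" using layer_const_pos[OF a(1), of n] V by (simp add: L_def)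
  define C2 where "C2 = max C0 C1"
  have C2: "C2 \<ge> 0" using C0 by (auto simp: C2_def)
  have kk: "norm (ft (osc K s k :: 'a \<Rightarrow> complex) y) \<le> C2 * kM n s k * (1 + norm y / kR s e k) powr (- p)" for k y
  proof (cases "k = 0")
    case True
    have "C0 * (1 + norm y) powr (- p) \<le> C2 * (1 + norm y) powr (- p)" by (intro mult_right_mono) (auto simp: C2_def)
    then show ?thesis using C0(2)[of y] True by (simp add: kM_def kR_def)
  next
    case False
    have "C1 * kM n s k * (1 + norm y / kR s e k) powr (- p) \<le> C2 * kM n s k * (1 + norm y / kR s e k) powr (- p)"
      by (intro mult_right_mono) (auto simp: C2_def less_imp_le)
    then show ?thesis using False by (intro order_trans[OF C1k]) auto
  qed
  have w1: "(\<integral>\<^sup>+y. ennreal ((1 + norm (y - 0 :: 'a) / R) powr (- p)) * 1 \<partial>lborel) \<le> ennreal (L * R ^ n)" if "R > 0" for R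
  proof -
    have "(\<integral>\<^sup>+y. ennreal ((1 + norm (y - 0 :: 'a) / R) powr (- p)) * 1 \<partial>lborel) \<le> ennreal (layer_const n a * (V * R ^ n))"
      unfolding p_def n_def
      by (rule layer_integral[OF _ that _ a(1)]) (use V that in \<open>auto simp: V_def n_def emeasure_cball_unit\<close>)
    then show ?thesis by (simp add: L_def mult.assoc)
  qed
  have l1: "(\<integral>\<^sup>+y. ennreal (norm (ft (osc K s k :: 'a \<Rightarrow> complex) y)) \<partial>lborel) \<le> ennreal (C2 * L * kB n s e k)" for k
  proof -
    have "(\<integral>\<^sup>+y. ennreal (norm (ft (osc K s k :: 'a \<Rightarrow> complex) y)) \<partial>lborel) \<le>
      (\<integral>\<^sup>+y. ennreal (C2 * kM n s k) * (ennreal ((1 + norm (y - 0 :: 'a) / kR s e k) powr (- p)) * 1) \<partial>lborel)"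
      using kk[of k] C2 by (intro nn_integral_mono) (auto simp: ennreal_mult[symmetric] less_imp_le intro!: ennreal_leI)
    also have "\<dots> = ennreal (C2 * kM n s k) * (\<integral>\<^sup>+y. (ennreal ((1 + norm (y - 0 :: 'a) / kR s e k) powr (- p)) * 1) \<partial>lborel)"
      by (rule nn_integral_cmult) measurable
    also have "\<dots> \<le> ennreal (C2 * kM n s k) * ennreal (L * kR s e k ^ n)" by (intro mult_left_mono w1) auto
    also have "\<dots> = ennreal (C2 * kM n s k * (L * kR s e k ^ n))" using C2 L by (intro ennreal_mult[symmetric]) (auto simp: less_imp_le)
    also have "C2 * kM n s k * (L * kR s e k ^ n) = C2 * L * kB n s e k" by (simp add: kB_eq[symmetric])
    finally show ?thesis .
  qed
  have tail: "(\<integral>\<^sup>+y. ennreal (norm (ft (osc K s k :: 'a \<Rightarrow> complex) y)) * indicator {y. norm y > kR s e k} y \<partial>lborel) \<le> ennreal (C2 * L + C1 * W)" for k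
  proof (cases "k = 0")
    \<comment> \<open>At k = 0 the quantities \<open>kR\<close>, \<open>kM\<close> and
      \<open>kB\<close> are all 1, so the whole L^1 norm is already a constant.\<close>
    case True
    have "(\<integral>\<^sup>+y. ennreal (norm (ft (osc K s k :: 'a \<Rightarrow> complex) y)) * indicator {y. norm y > kR s e k} y \<partial>lborel) \<le>
      (\<integral>\<^sup>+y. ennreal (norm (ft (osc K s k :: 'a \<Rightarrow> complex) y)) \<partial>lborel)"
      by (intro nn_integral_mono) (auto simp: indicator_def)
    also have "\<dots> \<le> ennreal (C2 * L * kB n s e k)" by (rule l1)
    also have "\<dots> \<le> ennreal (C2 * L + C1 * W)" using True C1 W by (intro ennreal_leI) (simp add: kB_def)
    finally show ?thesis .
  next
    case False
    have "(\<integral>\<^sup>+y. ennreal (norm (ft (osc K s k :: 'a \<Rightarrow> complex) y)) * indicator {y. norm y > kR s e k} y \<partial>lborel) \<le>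
      (\<integral>\<^sup>+y. ennreal (C1 / kR s e k ^ n) * ennreal (1 / (1 + (1 / kR s e k) * norm (y - 0 :: 'a)) ^ (2 * n)) \<partial>lborel)"
    proof (intro nn_integral_mono)
      fix y :: 'a
      show "ennreal (norm (ft (osc K s k) y)) * indicator {y. norm y > kR s e k} y \<le> ennreal (C1 / kR s e k ^ n) * ennreal (1 / (1 + (1 / kR s e k) * norm (y - 0)) ^ (2 * n))"
        using C1t[of k y] False C1 by (auto simp: indicator_def ennreal_mult[symmetric] less_imp_le intro!: ennreal_leI)
    qed
    also have "\<dots> = ennreal (C1 / kR s e k ^ n) * (\<integral>\<^sup>+y. ennreal (1 / (1 + (1 / kR s e k) * norm (y - 0 :: 'a)) ^ (2 * n)) \<partial>lborel)"
      by (rule nn_integral_cmult) measurable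
    also have "\<dots> \<le> ennreal (C1 / kR s e k ^ n) * ennreal (W / (1 / kR s e k) ^ n)"
      by (intro mult_left_mono W) auto
    also have "\<dots> = ennreal (C1 * W)"
      using C1 W by (subst ennreal_mult[symmetric]) (auto simp: less_imp_le power_one_over)
    also have "\<dots> \<le> ennreal (C2 * L + C1 * W)" using C2 L by (intro ennreal_leI) simp
    finally show ?thesis .
  qed
  define C where "C = max 1 (max C2 (C2 * L + C1 * W))"
  have "1 \<le> C" "C2 \<le> C" "C2 * L + C1 * W \<le> C" by (auto simp: C_def)
  moreover have "C2 * L \<le> C" using calculation(3) C1 W mult_nonneg_nonneg[of C1 W] by linarith
  moreover have "norm (ft (osc K s k :: 'a \<Rightarrow> complex) y) \<le> C * kM n s k * (1 + norm y / kR s e k) powr (- p)" for k y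
    using calculation(2) by (intro order_trans[OF kk] mult_right_mono) (auto simp: less_imp_le)
  moreover have "(\<integral>\<^sup>+y. ennreal (norm (ft (osc K s k :: 'a \<Rightarrow> complex) y)) * indicator {y. norm y > kR s e k} y \<partial>lborel) \<le> ennreal C" for k
    using calculation(3) by (intro order_trans[OF tail] ennreal_leI)
  moreover have "(\<integral>\<^sup>+y. ennreal (norm (ft (osc K s k :: 'a \<Rightarrow> complex) y)) \<partial>lborel) \<le> ennreal (C * kB n s e k)" for k
    using calculation(4) by (intro order_trans[OF l1] ennreal_leI mult_right_mono) (auto simp: less_imp_le)
  ultimately show ?thesis
    using K(2) a(1) unfolding p_def n_def
    by (intro exI[of _ K] conjI exI[of _ a] exI[of _ C]; simp)
qed

section \<open>Common radius and cost of a dyadic triple\<close>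

lemma kR_mono: "s - 1 + e \<ge> 0 \<Longrightarrow> k \<le> j \<Longrightarrow> kR s e k \<le> kR s e j"
  unfolding kR_def by (intro powr_mono mult_right_mono) auto

lemma kR_antimono: "s - 1 + e \<le> 0 \<Longrightarrow> k \<le> j \<Longrightarrow> kR s e j \<le> kR s e k"
  unfolding kR_def by (intro powr_mono mult_right_mono_neg) auto

text \<open>The exponent lost by a block, per unit of j. The addition 2 n e pays for the e in the
  radii and in \<open>kB\<close>, which enters at most twice.\<close>

definition loss :: "nat \<Rightarrow> real \<Rightarrow> real \<Rightarrow> real"
  where "loss n s e = - crit_order n s + 2 * real n * e"

text \<open>Each of the two factors is measured either on balls of radius at least \<open>R\<close>, without
  loss, or in the supremum norm, at the cost of the factor \<open>kB\<close>.\<close>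

lemma triple_exponent_sorted:
  assumes s: "s > 0" "s \<noteq> 1" and e: "e > 0" "s < 1 \<Longrightarrow> s + e < 1"
    and k: "k0 \<le> J" "k1 \<le> J" "k2 \<le> J" "k0 \<le> k2 + 3" "k1 \<le> k2"
  shows "\<exists>R>0. \<exists>b1 b2. (b1 = 1 \<and> kR s e k1 \<le> R \<or> b1 = kB n s e k1) \<and> (b2 = 1 \<and> kR s e k2 \<le> R \<or> b2 = kB n s e k2) \<and>
    kR s e k0 \<le> R \<and> kM n s k0 * b1 * b2 * R ^ n \<le> 8 ^ n * 2 powr (real J * loss n s e)"
proof (cases "s > 1")
  case True
  have p: "s - 1 + e \<ge> 0" using True e by simp
  \<comment> \<open>Here R is \<open>kR s e J\<close>, which covers all three radii, and neither
    factor costs anything. The split is the sign of 1 - s/2.\<close>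
  have x: "real k0 * (1 - s/2) + real J * (s - 1 + e) \<le> real J * (if s \<le> 2 then s/2 + 2 * e else s - 1 + 2 * e)"
  proof (cases "s \<le> 2")
    case True
    then have "real k0 * (1 - s/2) \<le> real J * (1 - s/2)" using k by (intro mult_right_mono) auto
    moreover have "real J * e \<ge> 0" using e by simp
    ultimately show ?thesis using True by (simp add: algebra_simps)
  next
    case False
    then have "real k0 * (1 - s/2) \<le> 0" by (intro mult_nonneg_nonpos) auto
    moreover have "real J * e \<ge> 0" using e by simp
    ultimately show ?thesis using False by (simp add: algebra_simps)
  qed
  have "kM n s k0 * kR s e J ^ n = 2 powr (real n * (real k0 * (1 - s/2) + real J * (s - 1 + e)))"
    unfolding kR_power kM_def powr_add[symmetric] by (simp add: algebra_simps)
  also have "\<dots> \<le> 2 powr (real n * (real J * (if s \<le> 2 then s/2 + 2 * e else s - 1 + 2 * e)))"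
    using x by (intro powr_mono mult_left_mono) auto
  also have "real n * (real J * (if s \<le> 2 then s/2 + 2 * e else s - 1 + 2 * e)) = real J * loss n s e"
    using True by (auto simp: loss_def crit_order_def algebra_simps)
  finally have "kM n s k0 * kR s e J ^ n \<le> 2 powr (real J * loss n s e)" .
  also have "\<dots> \<le> 8 ^ n * 2 powr (real J * loss n s e)" by (simp add: one_le_power)
  finally show ?thesis
    using kR_mono[OF p] k by (intro exI[of _ "kR s e J"] conjI exI[of _ 1]) auto
next
  case False
  then have s1: "s < 1" using s by simp
  have p: "s - 1 + e \<le> 0" using e(2)[OF s1] by simp
  define q where "q = 3/2 * s - s\<^sup>2 + 2 * e"
  have lq: "loss n s e = real n * q"
    using s1 by (simp add: loss_def crit_order_def q_def algebra_simps power2_eq_square)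
  have s2: "s\<^sup>2 \<le> s" using s1 s by (simp add: power2_eq_square mult_left_le_one_le)
  have q0: "q \<ge> 0" using s2 s e by (simp add: q_def)
  have fin: "2 powr (real n * t) \<le> 2 powr (real J * loss n s e)" if "t \<le> real k0 * q" for t
  proof -
    have "real k0 * q \<le> real J * q" using k q0 by (intro mult_right_mono) auto
    then have "real n * t \<le> real n * (real J * q)" using that by (intro mult_left_mono) auto
    then show ?thesis by (intro powr_mono) (auto simp: lq mult_ac)
  qed
  have one: "x \<le> 8 ^ n * x" if "x \<ge> 0" for x :: real
    using that mult_right_mono[of 1 "8 ^ n" x] by simp
  show ?thesis
  \<comment> \<open>Radii now decrease with frequency. If k0 is the lowest frequency, its own radius
    covers both factors.\<close>
  proof (cases "k1 \<ge> k0")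
    case True
    have "kM n s k0 * kR s e k0 ^ n = 2 powr (real n * (real k0 * (s/2 + e)))"
      unfolding kB_eq by (simp add: kB_def mult_ac)
    also have "\<dots> \<le> 2 powr (real J * loss n s e)"
    proof (rule fin, rule mult_left_mono)
      show "s/2 + e \<le> q" using s2 s e by (simp add: q_def)
    qed simp
    also have "\<dots> \<le> 8 ^ n * 2 powr (real J * loss n s e)" by (rule one) simp
    finally show ?thesis
      using kR_antimono[OF p] True k by (intro exI[of _ "kR s e k0"] conjI exI[of _ 1]) auto
  next
    case lt: False
    show ?thesis
    \<comment> \<open>Now k1 is the lowest frequency and has the largest radius. Above the threshold
      R is enlarged to it, at a cost of at most (1 - s/2) - (1 - s)^2 = 3 s/2 - s^2 per unit of k0,
      up to e; below the threshold the supremum bound for k1 costs at most (2 - s) s/2, which is no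
      larger since s^2 <= s.\<close>
    proof (cases "real k1 \<ge> (1 - s) * real k0")
      case True
      have "kM n s k0 * kR s e k1 ^ n = 2 powr (real n * (real k0 * (1 - s/2) + real k1 * (s - 1 + e)))"
        unfolding kR_power kM_def powr_add[symmetric] by (simp add: algebra_simps)
      also have "\<dots> \<le> 2 powr (real J * loss n s e)"
      proof (rule fin)
        have "real k1 * (s - 1 + e) \<le> ((1 - s) * real k0) * (s - 1 + e)" using True p by (intro mult_right_mono_neg) auto
        also have "\<dots> = real k0 * ((1 - s) * (s - 1) + (1 - s) * e)" by (simp add: algebra_simps)
        also have "\<dots> \<le> real k0 * ((1 - s) * (s - 1) + 2 * e)" using s s1 e by (intro mult_left_mono add_left_mono mult_right_mono) auto
        finally have "real k0 * (1 - s/2) + real k1 * (s - 1 + e) \<le> real k0 * (1 - s/2) + real k0 * ((1 - s) * (s - 1) + 2 * e)" by simp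
        also have "\<dots> = real k0 * q" by (simp add: q_def power2_eq_square algebra_simps)
        finally show "real k0 * (1 - s/2) + real k1 * (s - 1 + e) \<le> real k0 * q" .
      qed
      also have "\<dots> \<le> 8 ^ n * 2 powr (real J * loss n s e)" by (rule one) simp
      finally show ?thesis
        using kR_antimono[OF p] lt k by (intro exI[of _ "kR s e k1"] conjI exI[of _ 1]) auto
    next
      case False
      \<comment> \<open>From k0 <= k2 + 3 and 1 - s - e <= 1 the radii differ by at most 2^3; this
        is the source of 8^n in the bound.\<close>
      have R2: "kR s e k2 \<le> 8 * kR s e k0"
      proof -
        have "real k2 * (s - 1 + e) \<le> (real k0 - 3) * (s - 1 + e)" using p k by (intro mult_right_mono_neg) auto
        also have "\<dots> \<le> 3 + real k0 * (s - 1 + e)" using s e by (simp add: algebra_simps)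
        finally have "kR s e k2 \<le> 2 powr (3 + real k0 * (s - 1 + e))" unfolding kR_def by (intro powr_mono) auto
        also have "\<dots> = 8 * kR s e k0" unfolding kR_def powr_add by simp
        finally show ?thesis .
      qed
      have "kM n s k0 * kB n s e k1 * 1 * (8 * kR s e k0) ^ n = 8 ^ n * (kB n s e k0 * kB n s e k1)"
        unfolding kB_eq[symmetric, of n s e k0] power_mult_distrib by (simp add: mult_ac)
      also have "kB n s e k0 * kB n s e k1 = 2 powr (real n * (real k0 * (s/2 + e) + real k1 * (s/2 + e)))"
        unfolding kB_def powr_add[symmetric] by (simp add: algebra_simps)
      also have "\<dots> \<le> 2 powr (real J * loss n s e)"
      proof (rule fin)
        have "real k1 * (s/2 + e) \<le> ((1 - s) * real k0) * (s/2 + e)" using False s e by (intro mult_right_mono) auto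
        then have "real k0 * (s/2 + e) + real k1 * (s/2 + e) \<le> real k0 * (s/2 + e) + ((1 - s) * real k0) * (s/2 + e)"
          by (rule add_left_mono)
        also have "\<dots> = real k0 * ((2 - s) * (s/2 + e))"
        proof -
          have "x * t + ((1 - s) * x) * t = x * ((2 - s) * t)" for x t :: real by (simp add: algebra_simps)
          then show ?thesis .
        qed
        also have "\<dots> \<le> real k0 * q"
        proof (intro mult_left_mono)
          have "(2 - s) * (s/2 + e) = s - s\<^sup>2 / 2 + 2 * e - s * e" by (simp add: power2_eq_square field_simps)
          moreover have "s * e \<ge> 0" using s e by simp
          ultimately show "(2 - s) * (s/2 + e) \<le> q" using s2 by (simp add: q_def)
        qed auto
        finally show "real k0 * (s/2 + e) + real k1 * (s/2 + e) \<le> real k0 * q" .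
      qed
      finally have "kM n s k0 * kB n s e k1 * 1 * (8 * kR s e k0) ^ n \<le> 8 ^ n * 2 powr (real J * loss n s e)" by simp
      then show ?thesis
        using R2 by (intro exI[of _ "8 * kR s e k0"] conjI exI[of _ "kB n s e k1"] exI[of _ 1]) (auto intro: less_imp_le)
    qed
  qed
qed

lemma triple_exponent:
  assumes s: "s > 0" "s \<noteq> 1" and e: "e > 0" "s < 1 \<Longrightarrow> s + e < 1"
    and k: "k0 \<le> J" "k1 \<le> J" "k2 \<le> J" "k0 \<le> max k1 k2 + 3"
  shows "\<exists>R>0. \<exists>b1 b2. (b1 = 1 \<and> kR s e k1 \<le> R \<or> b1 = kB n s e k1) \<and> (b2 = 1 \<and> kR s e k2 \<le> R \<or> b2 = kB n s e k2) \<and>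
    kR s e k0 \<le> R \<and> kM n s k0 * b1 * b2 * R ^ n \<le> 8 ^ n * 2 powr (real J * loss n s e)"
proof (cases "k1 \<le> k2")
  case True
  then show ?thesis using triple_exponent_sorted[OF s e k(1,2,3)] k(4) by (simp add: max_def)
next
  case False
  then have "k0 \<le> k1 + 3" "k2 \<le> k1" using k(4) by auto
  from triple_exponent_sorted[OF s e k(1,3,2) this, of n]
  obtain R b1 b2 where "R > 0" "b1 = 1 \<and> kR s e k2 \<le> R \<or> b1 = kB n s e k2" "b2 = 1 \<and> kR s e k1 \<le> R \<or> b2 = kB n s e k1"
    "kR s e k0 \<le> R" "kM n s k0 * b1 * b2 * R ^ n \<le> 8 ^ n * 2 powr (real J * loss n s e)" by blast
  then show ?thesis
    by (intro exI[of _ R] conjI exI[of _ b2] exI[of _ b1]) (auto simp: mult_ac)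
qed

definition piece :: "nat \<Rightarrow> real \<Rightarrow> nat \<Rightarrow> ('a::euclidean_space \<Rightarrow> complex) \<Rightarrow> 'a \<Rightarrow> complex"
  where "piece K s k g = conv (ft (osc K s k)) g"

text \<open>Uniformity in the shifts b and c is essential, since the exponentials of the symbol
  expansion translate the factors arbitrarily. D is also independent of the frequencies and of the
  integrals of g and h.\<close>

theorem piece_triple_estimate:
  assumes s: "s > 0" "s \<noteq> 1" and e: "e > 0" "s < 1 \<Longrightarrow> s + e < 1"
  shows "\<exists>K\<ge>K0. \<exists>D\<ge>0. (\<forall>k. integrable lborel (ft (osc K s k :: 'a::euclidean_space \<Rightarrow> complex))) \<and>
    (\<forall>J k0 k1 k2 g h A1 A2. \<forall>x b c::'a. k0 \<le> J \<longrightarrow> k1 \<le> J \<longrightarrow> k2 \<le> J \<longrightarrow> k0 \<le> max k1 k2 + 3 \<longrightarrow>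
      integrable lborel g \<longrightarrow> integrable lborel h \<longrightarrow> A1 > 0 \<longrightarrow> A2 > 0 \<longrightarrow> (\<forall>w. norm (g w) \<le> A1) \<longrightarrow> (\<forall>w. norm (h w) \<le> A2) \<longrightarrow>
      (\<integral>\<^sup>+y. ennreal (norm (ft (osc K s k0) (x - y)) * norm (piece K s k1 g (y + b)) * norm (piece K s k2 h (y + c))) \<partial>lborel)
        \<le> ennreal (D * 2 powr (real J * loss DIM('a) s e) * A1 * A2))"
proof -
  define n where "n = DIM('a)"
  obtain K a C where K: "K \<ge> K0" and a: "a > 0" and C: "C \<ge> 1" and
    kb: "\<And>k y. norm (ft (osc K s k :: 'a \<Rightarrow> complex) y) \<le> C * kM n s k * (1 + norm y / kR s e k) powr (- (real n + a))" and
    tl: "\<And>k. (\<integral>\<^sup>+y. ennreal (norm (ft (osc K s k :: 'a \<Rightarrow> complex) y)) * indicator {y. norm y > kR s e k} y \<partial>lborel) \<le> ennreal C" and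
    l1: "\<And>k. (\<integral>\<^sup>+y. ennreal (norm (ft (osc K s k :: 'a \<Rightarrow> complex) y)) \<partial>lborel) \<le> ennreal (C * kB n s e k)"
    using osc_kernel[OF s e(1), of K0, where 'a='a] unfolding n_def by blast
  define V where "V = unit_ball_vol (real n)"
  have V: "V > 0" unfolding V_def by simp
  \<comment> \<open>One constant for both ways of measuring a factor: \<open>local_const\<close> for
    the mean square without loss, C sqrt V for the supremum bound that carries
    \<open>kB\<close>.\<close>
  define Q where "Q = max 1 (max (local_const n C) (C * sqrt V))"
  have Q: "Q \<ge> 1" "local_const n C \<le> Q" "C * sqrt V \<le> Q" by (auto simp: Q_def)
  have loc2_mono: "loc2 R B' G" if "loc2 R B G" "0 \<le> B" "B \<le> B'" "R > 0" for R B B' and G :: "'a \<Rightarrow> complex"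
  proof -
    have "ennreal (B\<^sup>2 * r ^ DIM('a)) \<le> ennreal (B'\<^sup>2 * r ^ DIM('a))" if "r \<ge> R" for r
      using \<open>R > 0\<close> \<open>0 \<le> B\<close> \<open>B \<le> B'\<close> that by (intro ennreal_leI mult_right_mono power_mono) auto
    then show ?thesis using that(1) unfolding loc2_def by (meson order_trans)
  qed
  have lc: "loc2 R (Q * A * b) (piece K s k g)"
    if g: "integrable lborel g" "\<And>w. norm (g w) \<le> A" "A > 0" and b: "b = 1 \<and> kR s e k \<le> R \<or> b = kB n s e k" and R: "R > 0" for R A b k and g :: "'a \<Rightarrow> complex"
    using b
  proof
    assume b: "b = 1 \<and> kR s e k \<le> R"
    have "loc2 (kR s e k) (A * local_const n C) (piece K s k g)"
      unfolding n_def piece_def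
      by (rule loc2_conv[OF osc_integrable norm_osc_le g(1,2) tl]) (use C in auto)
    then have "loc2 R (A * local_const n C) (piece K s k g)" by (rule loc2_mono_R) (use b in simp)
    then show ?thesis
      by (rule loc2_mono) (use b Q g R in \<open>auto simp: local_const_def mult.commute\<close>)
  next
    assume b: "b = kB n s e k"
    have "norm (piece K s k g x) \<le> A * (C * kB n s e k)" for x
      unfolding piece_def
      by (rule norm_conv_le[where S=UNIV]) (use l1[of k] C g in \<open>auto simp: less_imp_le\<close>)
    then have "loc2 R (A * (C * kB n s e k) * sqrt V) (piece K s k g)"
      unfolding V_def n_def by (intro loc2_bounded R) (use g in \<open>auto simp: piece_def\<close>)
    then show ?thesis
    proof (rule loc2_mono)
      show "A * (C * kB n s e k) * sqrt V \<le> Q * A * b"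
        using mult_right_mono[OF Q(3), of "A * kB n s e k"] g b by (simp add: mult_ac less_imp_le)
    qed (use C g V R in \<open>auto simp: less_imp_le\<close>)
  qed
  define D where "D = layer_const n a * C * Q * Q * 8 ^ n"
  have D: "D \<ge> 0" using layer_const_pos[OF a, of n] C Q by (simp add: D_def)
  have int: "integrable lborel (ft (osc K s k :: 'a \<Rightarrow> complex))" for k
    using l1[of k] by (intro integrableI_bounded) (auto simp: less_top[symmetric] top_unique)
  have main: "(\<integral>\<^sup>+y. ennreal (norm (ft (osc K s k0) (x - y)) * norm (piece K s k1 g (y + b)) * norm (piece K s k2 h (y + c))) \<partial>lborel)
        \<le> ennreal (D * 2 powr (real J * loss n s e) * A1 * A2)"
    if k: "k0 \<le> J" "k1 \<le> J" "k2 \<le> J" "k0 \<le> max k1 k2 + 3" and g: "integrable lborel g" and h: "integrable lborel h" and A: "A1 > 0" "A2 > 0" "\<forall>w. norm (g w) \<le> A1" "\<forall>w. norm (h w) \<le> A2"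
    for J k0 k1 k2 g h A1 A2 and x b c :: 'a
  proof -
    obtain R b1 b2 where R: "R > 0" and b1: "b1 = 1 \<and> kR s e k1 \<le> R \<or> b1 = kB n s e k1" and b2: "b2 = 1 \<and> kR s e k2 \<le> R \<or> b2 = kB n s e k2"
      and R0: "kR s e k0 \<le> R" and le: "kM n s k0 * b1 * b2 * R ^ n \<le> 8 ^ n * 2 powr (real J * loss n s e)"
      using triple_exponent[OF s e k, of n] by blast
    have bp: "b1 > 0" "b2 > 0" using b1 b2 by auto
    have kk: "norm (ft (osc K s k0) (x - y)) \<le> (C * kM n s k0) * (1 + norm (y - x) / R) powr (- (real DIM('a) + a))" for y
    proof -
      \<comment> \<open>Passing from the radius of the kernel to the larger R only weakens its
        decay, while the supremum \<open>kM\<close> is kept.\<close>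
      have "norm (y - x) / R \<le> norm (y - x) / kR s e k0" using R0 R by (intro divide_left_mono) (auto intro!: mult_pos_pos)
      then have "(1 + norm (x - y) / kR s e k0) powr (- (real n + a)) \<le> (1 + norm (y - x) / R) powr (- (real n + a))"
        using R a by (intro powr_mono2') (auto simp: norm_minus_commute intro!: add_pos_nonneg)
      then have "C * kM n s k0 * (1 + norm (x - y) / kR s e k0) powr (- (real n + a)) \<le> C * kM n s k0 * (1 + norm (y - x) / R) powr (- (real n + a))"
        using C by (intro mult_left_mono) (auto simp: less_imp_le)
      then show ?thesis using kb[of k0 "x - y"] by (simp add: n_def)
    qed
    have "(\<integral>\<^sup>+y. ennreal (norm (ft (osc K s k0) (x - y)) * norm (piece K s k1 g (y + b)) * norm (piece K s k2 h (y + c))) \<partial>lborel)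
      \<le> ennreal (layer_const DIM('a) a * (C * kM n s k0) * (Q * A1 * b1) * (Q * A2 * b2) * R ^ DIM('a))"
    proof (rule trilinear_estimate[OF loc2_translate[OF lc] loc2_translate[OF lc] _ _ R a _ _ kk])
      show "(\<lambda>y. ft (osc K s k0) (x - y)) \<in> borel_measurable borel" by measurable
    qed (use g h A b1 b2 R Q bp C in \<open>auto simp: less_imp_le\<close>)
    also have "\<dots> \<le> ennreal (D * 2 powr (real J * loss n s e) * A1 * A2)"
    proof (rule ennreal_leI)
      have "layer_const DIM('a) a * (C * kM n s k0) * (Q * A1 * b1) * (Q * A2 * b2) * R ^ DIM('a)
        = (layer_const n a * C * Q * Q * A1 * A2) * (kM n s k0 * b1 * b2 * R ^ n)" by (simp add: n_def mult_ac)
      also have "\<dots> \<le> (layer_const n a * C * Q * Q * A1 * A2) * (8 ^ n * 2 powr (real J * loss n s e))"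
        using layer_const_pos[OF a, of n] C Q A by (intro mult_left_mono le) auto
      also have "\<dots> = D * 2 powr (real J * loss n s e) * A1 * A2" by (simp add: D_def mult_ac)
      finally show "layer_const DIM('a) a * (C * kM n s k0) * (Q * A1 * b1) * (Q * A2 * b2) * R ^ DIM('a) \<le> D * 2 powr (real J * loss n s e) * A1 * A2" .
    qed
    finally show ?thesis .
  qed
  show ?thesis
    using K D int main unfolding n_def by (intro exI[of _ K] conjI exI[of _ D]) simp_all
qed

section \<open>Symbols as superpositions of exponentials\<close>

lemma jet_of_sequence:
  assumes "\<And>i x. i < k \<Longrightarrow> x \<in> S \<Longrightarrow> dder v (F i) (F (Suc i) x) x"
    and "\<And>i x. i \<le> k \<Longrightarrow> x \<in> S \<Longrightarrow> norm (F i x) \<le> C"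
  shows "jet k v S C (F 0)"
  using assms
proof (induction k arbitrary: F)
  case (Suc k)
  have "jet k v S C (F (Suc 0))"
    using Suc.IH[of "\<lambda>i. F (Suc i)"] Suc.prems by auto
  then show ?case using Suc.prems(1)[of 0] Suc.prems(2)[of 0] by (auto intro!: exI[of _ "F (Suc 0)"])
qed auto

lemma basis_list: "distinct (basis_list :: 'a::euclidean_space list)" "set (basis_list :: 'a list) = Basis"
proof -
  have "\<exists>bs::'a list. distinct bs \<and> set bs = Basis"
    using finite_distinct_list[OF finite_Basis] by blast
  then have "distinct (basis_list :: 'a list) \<and> set (basis_list :: 'a list) = Basis"
    unfolding basis_list_def by (rule someI_ex)
  then show "distinct (basis_list :: 'a list)" "set (basis_list :: 'a list) = Basis" by auto
qed

text \<open>Extracts the pure derivatives from the multi-index notation; the decay estimate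
  \<open>ft_decay\<close> asks for no others.\<close>

lemma multi_deriv_single:
  fixes b :: "'a::euclidean_space"
  assumes b: "b \<in> Basis"
  shows "multi_deriv (\<lambda>c. if c = b then i else 0) f = (partial_deriv b ^^ i) f"
proof -
  have 0: "foldr (\<lambda>c. partial_deriv c ^^ (if c = b then i else 0)) bs f = f" if "b \<notin> set bs" for bs
    using that by (induction bs) auto
  have "foldr (\<lambda>c. partial_deriv c ^^ (if c = b then i else 0)) bs f = (partial_deriv b ^^ i) f"
    if "distinct bs" "b \<in> set bs" for bs
    using that by (induction bs) (auto simp: 0)
  from this[of basis_list] show ?thesis using basis_list[where 'a='a] b by (simp add: multi_deriv_def)
qed

lemma multi_order_single: "b \<in> Basis \<Longrightarrow> multi_order (\<lambda>c. if c = b then i else 0) = i"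
  by (simp add: multi_order_def sum.delta)

lemma multi_deriv_zero: "multi_deriv (\<lambda>c. 0) f = f"
  using multi_deriv_single[of "SOME b. b \<in> Basis" 0 f] nonempty_Basis by (simp add: some_in_eq)

lemma smooth_fun_cont: "smooth_fun f \<Longrightarrow> continuous_on UNIV f"
  unfolding smooth_fun_def by (metis Ck_fun.simps(1))

lemma smooth_fun_partial: "smooth_fun f \<Longrightarrow> smooth_fun ((partial_deriv b ^^ i) f)"
proof (induction i)
  case (Suc i)
  then show ?case unfolding smooth_fun_def
    by (auto, metis Ck_fun.simps(2))
qed auto

lemma smooth_fun_dder:
  assumes "smooth_fun f" shows "dder b f (partial_deriv b f x) x"
proof -
  have "f differentiable (at x)" using assms unfolding smooth_fun_def by (metis Ck_fun.simps(2))
  then show ?thesis unfolding partial_deriv_def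
    by (intro dder_has_derivative) (simp add: frechet_derivative_works)
qed

lemma symbol_bounds:
  assumes "\<sigma> \<in> symbol_class m"
  shows "\<exists>C\<ge>0. \<forall>i\<le>K. \<forall>b\<in>Basis. \<forall>\<zeta>::'a::euclidean_space.
    norm ((partial_deriv b ^^ i) \<sigma> \<zeta>) \<le> C * (1 + norm \<zeta>) powr (m - real i)"
proof -
  have "\<exists>C. \<forall>\<zeta>. norm ((partial_deriv b ^^ i) \<sigma> \<zeta>) \<le> C * (1 + norm \<zeta>) powr (m - real i)" if "b \<in> Basis" for b i
  proof -
    have "\<forall>\<alpha>. \<exists>C. \<forall>\<zeta>. norm (multi_deriv \<alpha> \<sigma> \<zeta>) \<le> C * (1 + norm \<zeta>) powr (m - real (multi_order \<alpha>))"
      using assms by (simp add: symbol_class_def)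
    from spec[OF this, of "\<lambda>c. if c = b then i else 0"] show ?thesis
      by (simp only: multi_deriv_single[OF that] multi_order_single[OF that])
  qed
  then obtain c where c: "\<And>b i \<zeta>. b \<in> Basis \<Longrightarrow> norm ((partial_deriv b ^^ i) \<sigma> \<zeta>) \<le> c b i * (1 + norm \<zeta>) powr (m - real i)"
    by metis
  define C where "C = (\<Sum>b\<in>Basis. \<Sum>i\<le>K. \<bar>c b i\<bar>)"
  have "c b i \<le> C" if "b \<in> Basis" "i \<le> K" for b i
  proof -
    have "\<bar>c b i\<bar> \<le> (\<Sum>i\<le>K. \<bar>c b i\<bar>)" using that by (intro member_le_sum) auto
    also have "\<dots> \<le> C" unfolding C_def using that by (intro member_le_sum) (auto intro: sum_nonneg)
    finally show ?thesis by simp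
  qed
  then have "norm ((partial_deriv b ^^ i) \<sigma> \<zeta>) \<le> C * (1 + norm \<zeta>) powr (m - real i)" if "b \<in> Basis" "i \<le> K" for b i \<zeta>
    using that by (intro order_trans[OF c] mult_right_mono) auto
  moreover have "C \<ge> 0" unfolding C_def by (intro sum_nonneg) auto
  ultimately show ?thesis by (intro exI[of _ C]) auto
qed

section \<open>Dyadic pieces of a symbol\<close>

definition theta :: "nat \<Rightarrow> nat \<Rightarrow> 'a::euclidean_space \<Rightarrow> real"
  where "theta K j \<zeta> = (if j = 0 then chi K \<zeta> else psi K ((1 / 2 ^ j) *\<^sub>R \<zeta>))"

lemma theta_cont: "continuous_on UNIV (theta K j)"
  unfolding theta_def
  by (cases "j = 0")
     (auto intro!: continuous_intros continuous_on_compose2[OF chi_cont[of UNIV]] continuous_on_compose2[OF psi_cont[of UNIV]])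

lemma osc_theta: "osc K s k \<xi> = cis (norm \<xi> powr s) * complex_of_real (theta K k \<xi>)"
  by (simp add: osc_def theta_def)

lemma theta_sum: "(\<Sum>j\<le>m. theta K j \<zeta>) = chi K ((1 / 2 ^ m) *\<^sub>R \<zeta>)"
proof -
  have "(\<Sum>j\<le>m. theta K j \<zeta>) = theta K 0 \<zeta> + (\<Sum>j=1..m. theta K j \<zeta>)"
    by (simp add: atMost_atLeast0 sum.atLeast_Suc_atMost)
  also have "\<dots> = chi K \<zeta> + (\<Sum>j=1..m. psi K ((1 / 2 ^ j) *\<^sub>R \<zeta>))" by (simp add: theta_def)
  finally show ?thesis by (simp only: chi_psi_sum)
qed

lemma theta_eq_0: "norm \<zeta> \<ge> 3/2 * 2 ^ j \<Longrightarrow> theta K j \<zeta> = 0"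
  using osc_eq_0_high[of j \<zeta> K 1] by (simp add: osc_theta)

lemma powr_le_5:
  fixes t :: real
  assumes "1/4 \<le> t" "t \<le> 5" shows "t powr q \<le> 5 powr \<bar>q\<bar>"
proof -
  have "\<bar>ln t\<bar> \<le> ln 5"
  proof -
    have "ln t \<le> ln 5" using assms by simp
    moreover have "ln (1/5) \<le> ln t" using assms by (intro ln_mono) auto
    ultimately show ?thesis by (simp add: ln_div)
  qed
  then have "\<bar>q * ln t\<bar> \<le> \<bar>q\<bar> * ln 5" by (simp add: abs_mult mult_left_mono)
  then show ?thesis using assms by (auto simp: powr_def)
qed

text \<open>Dilation by 2^j multiplies the i-th derivative by 2^(j i), and the symbol estimate
  supplies 2^(j (m - i)). The powers cancel, so all derivatives of the rescaled pieces have size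
  2^(j m), uniformly in j.\<close>

lemma symbol_piece_jet:
  fixes \<sigma> :: "'a::euclidean_space \<Rightarrow> complex"
  assumes \<sigma>: "\<sigma> \<in> symbol_class m"
  shows "\<exists>E\<ge>0. \<forall>j. \<forall>b\<in>Basis. jet K ((1/2) *\<^sub>R b) UNIV (E * 2 powr (real j * m))
    (\<lambda>\<zeta>. \<sigma> (2 ^ j *\<^sub>R \<zeta>) * complex_of_real (theta K j (2 ^ j *\<^sub>R \<zeta>)))"
proof -
  have sm: "smooth_fun \<sigma>" using \<sigma> by (simp add: symbol_class_def)
  obtain C where C: "C \<ge> 0" "\<And>i b \<zeta>. i \<le> K \<Longrightarrow> b \<in> Basis \<Longrightarrow> norm ((partial_deriv b ^^ i) \<sigma> \<zeta>) \<le> C * (1 + norm \<zeta>) powr (m - real i)"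
    using symbol_bounds[OF \<sigma>, of K] by blast
  obtain E1 where E1: "E1 \<ge> 0" "\<And>v. norm v \<le> 1 \<Longrightarrow> jet K v UNIV E1 (chi K :: 'a \<Rightarrow> real)" using chi_jet by blast
  obtain E2 where E2: "E2 \<ge> 0" "\<And>v. norm v \<le> 1/2 \<Longrightarrow> jet K v UNIV E2 (psi K :: 'a \<Rightarrow> real)" using psi_jet by blast
  define C' where "C' = C * 5 powr (\<bar>m\<bar> + real K)"
  have C': "C' \<ge> 0" using C by (simp add: C'_def)
  define E where "E = 2 ^ K * C' * (E1 + E2)"
  have E: "E \<ge> 0" using C' E1 E2 by (simp add: E_def)
  have js: "jet K b S (C' * 2 powr (real j * m)) (\<lambda>\<zeta>. \<sigma> (2 ^ j *\<^sub>R \<zeta>))"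
    if b: "b \<in> Basis" and S: "\<And>\<zeta>. \<zeta> \<in> S \<Longrightarrow> norm \<zeta> \<le> 4" "\<And>\<zeta>. \<zeta> \<in> S \<Longrightarrow> 1/4 \<le> norm \<zeta> \<or> j = 0" for b j S
  proof -
    define r where "r = (2::real) ^ j"
    have r: "r \<ge> 1" "r > 0" by (auto simp: r_def)
    have rm: "2 powr (real j * m) = r powr m" by (simp add: r_def powr_powr flip: powr_realpow)
    define F where "F i \<zeta> = r ^ i *\<^sub>R (partial_deriv b ^^ i) \<sigma> (0 + r *\<^sub>R \<zeta>)" for i \<zeta>
    have "jet K b S (C' * 2 powr (real j * m)) (F 0)"
    proof (rule jet_of_sequence)
      fix i \<zeta>
      have "dder b ((partial_deriv b ^^ i) \<sigma>) ((partial_deriv b ^^ Suc i) \<sigma> (0 + r *\<^sub>R \<zeta>)) (0 + r *\<^sub>R \<zeta>)"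
        using smooth_fun_dder[OF smooth_fun_partial[OF sm]] by simp
      from dder_affine[OF dder_scaled[OF this]]
      have "dder b (\<lambda>\<zeta>. (partial_deriv b ^^ i) \<sigma> (0 + r *\<^sub>R \<zeta>)) (r *\<^sub>R (partial_deriv b ^^ Suc i) \<sigma> (0 + r *\<^sub>R \<zeta>)) \<zeta>" .
      then have "dder b (F i) (r ^ i *\<^sub>R (r *\<^sub>R (partial_deriv b ^^ Suc i) \<sigma> (0 + r *\<^sub>R \<zeta>))) \<zeta>"
        unfolding F_def dder_def by (rule bounded_linear.has_vector_derivative[OF bounded_linear_scaleR_right])
      then show "dder b (F i) (F (Suc i) \<zeta>) \<zeta>" by (simp add: F_def mult.commute)
    next
      fix i \<zeta> assume i: "i \<le> K" and \<zeta>: "\<zeta> \<in> S"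
      \<comment> \<open>Written so that 1 + norm (r \<zeta>) = r t with t between 1/4 and 5. For j =
        0 there is no inner cut-off, but then the summand 1/r = 1 provides the lower bound.\<close>
      define t where "t = 1 / r + norm \<zeta>"
      have t: "1/4 \<le> t" "t \<le> 5"
      proof -
        have "1 / r \<le> 1" using r by simp
        then show "t \<le> 5" using S(1)[OF \<zeta>] by (simp add: t_def)
        show "1/4 \<le> t" using S(2)[OF \<zeta>] r by (auto simp: t_def r_def intro: add_increasing)
      qed
      have "norm (F i \<zeta>) \<le> r ^ i * (C * (1 + norm (r *\<^sub>R \<zeta>)) powr (m - real i))"
        unfolding F_def using C(2)[OF i b, of "r *\<^sub>R \<zeta>"] r by (simp add: mult_left_mono)
      also have "1 + norm (r *\<^sub>R \<zeta>) = r * t" using r by (simp add: t_def field_simps)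
      also have "r ^ i * (C * (r * t) powr (m - real i)) = C * r powr m * t powr (m - real i)"
        using r t by (simp add: powr_mult powr_diff powr_realpow)
      also have "\<dots> \<le> C * r powr m * 5 powr (\<bar>m\<bar> + real K)"
      proof (intro mult_left_mono)
        have "t powr (m - real i) \<le> 5 powr \<bar>m - real i\<bar>" by (rule powr_le_5[OF t])
        also have "\<dots> \<le> 5 powr (\<bar>m\<bar> + real K)" using i by (intro powr_mono) auto
        finally show "t powr (m - real i) \<le> 5 powr (\<bar>m\<bar> + real K)" .
      qed (use C in auto)
      finally show "norm (F i \<zeta>) \<le> C' * 2 powr (real j * m)" unfolding C'_def rm by (simp add: mult_ac)
    qed
    moreover have "F 0 = (\<lambda>\<zeta>. \<sigma> (2 ^ j *\<^sub>R \<zeta>))" by (simp add: F_def fun_eq_iff r_def)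
    ultimately show ?thesis by simp
  qed
  have C'j: "0 \<le> C' * 2 powr (real j * m)" for j using C' by simp
  show ?thesis
  proof (intro exI[of _ E] conjI allI ballI E)
    fix j and b :: 'a assume b: "b \<in> Basis"
    let ?B = "C' * 2 powr (real j * m)"
    have le: "2 ^ K * ?B * E1 \<le> E * 2 powr (real j * m)" "2 ^ K * ?B * E2 \<le> E * 2 powr (real j * m)"
      using E1 E2 C' unfolding E_def by (auto simp: algebra_simps)
    show "jet K ((1/2) *\<^sub>R b) UNIV (E * 2 powr (real j * m)) (\<lambda>\<zeta>. \<sigma> (2 ^ j *\<^sub>R \<zeta>) * complex_of_real (theta K j (2 ^ j *\<^sub>R \<zeta>)))"
    proof (cases "j = 0")
      case True
      have 1: "jet K ((1/2) *\<^sub>R b) (ball 0 2) ?B (\<lambda>\<zeta>. \<sigma> (2 ^ j *\<^sub>R \<zeta>))"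
        by (rule jet_scale_dir[OF _ C'j js]) (use b True in auto)
      have "jet K ((1/2) *\<^sub>R b) UNIV E1 (chi K)" using E1(2) b by simp
      then have 2: "jet K ((1/2) *\<^sub>R b) (ball 0 2) E1 (\<lambda>\<zeta>. complex_of_real (chi K \<zeta>))"
        by (intro jet_of_real) (auto elim: jet_mono)
      have "jet K ((1/2) *\<^sub>R b) (ball 0 2) (E * 2 powr (real j * m)) (\<lambda>\<zeta>. \<sigma> (2 ^ j *\<^sub>R \<zeta>) * complex_of_real (chi K \<zeta>))"
        by (rule jet_mono[OF jet_mult[OF C'j 1 2] le(1)]) simp
      then have "jet K ((1/2) *\<^sub>R b) UNIV (E * 2 powr (real j * m)) (\<lambda>\<zeta>. \<sigma> (2 ^ j *\<^sub>R \<zeta>) * complex_of_real (chi K \<zeta>))"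
        by (rule jet_extend_zero[where S="ball 0 2" and K="cball 0 (3/2)", rotated 4])
           (use E theta_eq_0[where j=0 and K=K and 'a='a] in \<open>auto simp: theta_def\<close>)
      then show ?thesis using True by (simp add: theta_def)
    next
      case False
      let ?A = "annulus (1/4) 4"
      have 1: "jet K ((1/2) *\<^sub>R b) ?A ?B (\<lambda>\<zeta>. \<sigma> (2 ^ j *\<^sub>R \<zeta>))"
        by (rule jet_scale_dir[OF _ C'j js]) (use b in \<open>auto simp: annulus_def\<close>)
      have "jet K ((1/2) *\<^sub>R b) UNIV E2 (psi K)" using E2(2) b by simp
      then have 2: "jet K ((1/2) *\<^sub>R b) ?A E2 (\<lambda>\<zeta>. complex_of_real (psi K \<zeta>))"
        by (intro jet_of_real) (auto elim: jet_mono)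
      have "jet K ((1/2) *\<^sub>R b) ?A (E * 2 powr (real j * m)) (\<lambda>\<zeta>. \<sigma> (2 ^ j *\<^sub>R \<zeta>) * complex_of_real (psi K \<zeta>))"
        by (rule jet_mono[OF jet_mult[OF C'j 1 2] le(2)]) simp
      then have "jet K ((1/2) *\<^sub>R b) UNIV (E * 2 powr (real j * m)) (\<lambda>\<zeta>. \<sigma> (2 ^ j *\<^sub>R \<zeta>) * complex_of_real (psi K \<zeta>))"
        by (rule jet_extend_zero[OF open_annulus psi_supp(2,3), rotated])
           (use E in \<open>auto simp: psi_supp(4)\<close>)
      then show ?thesis using False by (simp add: theta_def)
    qed
  qed
qed

text \<open>Each piece is compactly supported, so inversion writes it as an integral of exponentials
  whose density is a multiple of its transform. The L^1 norm of a transform does not change when the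
  function is dilated; it is therefore estimated through the rescaled piece, where K derivatives
  give integrable decay.\<close>

theorem symbol_expansion:
  fixes \<sigma> :: "'a::euclidean_space \<Rightarrow> complex"
  assumes \<sigma>: "\<sigma> \<in> symbol_class m" and K: "2 * DIM('a) \<le> K"
  shows "\<exists>C\<ge>0. \<forall>j. \<exists>w. integrable lborel w \<and> (LINT q|lborel. norm (w q)) \<le> C * 2 powr (real j * m) \<and>
    (\<forall>\<zeta>. \<sigma> \<zeta> * complex_of_real (theta K j \<zeta>) = (LINT q|lborel. cis (- (q \<bullet> \<zeta>)) * w q))"
proof -
  define d where "d = DIM('a)"
  obtain E where E: "E \<ge> 0" "\<And>j b. b \<in> Basis \<Longrightarrow> jet K ((1/2) *\<^sub>R b) UNIV (E * 2 powr (real j * m))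
    (\<lambda>\<zeta>. \<sigma> (2 ^ j *\<^sub>R \<zeta>) * complex_of_real (theta K j (2 ^ j *\<^sub>R \<zeta>)))" using symbol_piece_jet[OF \<sigma>, of K] by blast
  obtain W where W: "W \<ge> 0" "\<And>N c \<mu>. 2 * d \<le> N \<Longrightarrow> \<mu> > 0 \<Longrightarrow>
    (\<integral>\<^sup>+x. ennreal (1 / (1 + \<mu> * norm (x - c :: 'a)) ^ N) \<partial>lborel) \<le> ennreal (W / \<mu> ^ d)"
    using nn_integral_weight[where 'a='a] unfolding d_def by blast
  define B where "B = (2 * real d) ^ K * (E * measure lborel (cball (0::'a) (3/2)))"
  have B: "B \<ge> 0" using E by (simp add: B_def)
  have c\<sigma>: "continuous_on UNIV \<sigma>" using \<sigma> smooth_fun_cont by (auto simp: symbol_class_def)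
  define P where "P = (2 * pi) ^ d"
  have P: "P > 0" by (simp add: P_def)
  show ?thesis
  proof (intro exI[of _ "B * W * 2 ^ d / P"] conjI allI)
    show "0 \<le> B * W * 2 ^ d / P" using B W P by simp
    fix j
    define r where "r = (2::real) ^ j"
    have r: "r > 0" by (simp add: r_def)
    define u where "u \<zeta> = \<sigma> \<zeta> * complex_of_real (theta K j \<zeta>)" for \<zeta>
    have cu: "continuous_on UNIV u" unfolding u_def
      by (intro continuous_intros c\<sigma> continuous_on_of_real theta_cont)
    have um[measurable]: "u \<in> borel_measurable borel" by (rule borel_measurable_continuous_onI[OF cu])
    have u0: "u \<zeta> = 0" if "\<zeta> \<notin> cball 0 (3/2 * r)" for \<zeta>
      unfolding u_def using theta_eq_0[of j \<zeta> K] that by (simp add: r_def)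
    define v where "v \<zeta> = u (r *\<^sub>R \<zeta>)" for \<zeta>
    have vm[measurable]: "v \<in> borel_measurable borel" unfolding v_def by measurable
    have uv: "u = (\<lambda>\<zeta>. v ((1/r) *\<^sub>R \<zeta>))" using r by (simp add: v_def)
    have v0: "v \<zeta> = 0" if "\<zeta> \<notin> cball 0 (3/2)" for \<zeta>
      unfolding v_def by (rule u0) (use that r in \<open>auto simp: mult.commute\<close>)
    define F where "F = B * 2 powr (real j * m)"
    have F: "F \<ge> 0" using B by (simp add: F_def)
    have dec: "norm (ft v y) \<le> F * (1 / (1 + 1/2 * norm y) ^ K)" for y
    proof -
      have "(1 + 1/2 * norm y) ^ K * norm (ft v y) \<le> (2 * real DIM('a)) ^ K * (E * 2 powr (real j * m) * measure lborel (cball (0::'a) (3/2)))"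
      proof (rule ft_decay[OF vm compact_cball v0])
        fix b :: 'a assume "b \<in> Basis"
        from E(2)[OF this, of j] show "jet K ((1/2) *\<^sub>R b) UNIV (E * 2 powr (real j * m)) v"
          by (simp only: v_def[abs_def] u_def r_def)
      qed auto
      then have "(1 + 1/2 * norm y) ^ K * norm (ft v y) \<le> F" by (simp add: F_def B_def d_def mult_ac)
      then show ?thesis
        by (subst times_divide_eq_right, subst pos_le_divide_eq) (auto simp: mult.commute intro!: zero_less_power add_pos_nonneg)
    qed
    have nn: "(\<integral>\<^sup>+y. ennreal (norm (ft u y)) \<partial>lborel) \<le> ennreal (F * W * 2 ^ d)"
    proof -
      have "(\<integral>\<^sup>+y. ennreal (norm (ft u y)) \<partial>lborel) \<le> (\<integral>\<^sup>+y. ennreal (r ^ d * F) * ennreal (1 / (1 + (r/2) * norm (y - 0 :: 'a)) ^ K) \<partial>lborel)"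
      proof (intro nn_integral_mono)
        fix y :: 'a
        have "norm (ft u y) = r ^ d * norm (ft v (r *\<^sub>R y))"
          unfolding uv using ft_scale[OF vm r, of y] r by (simp add: norm_mult norm_power d_def)
        also have "\<dots> \<le> r ^ d * (F * (1 / (1 + 1/2 * norm (r *\<^sub>R y)) ^ K))" using r by (intro mult_left_mono dec) auto
        also have "\<dots> = (r ^ d * F) * (1 / (1 + (r/2) * norm (y - 0 :: 'a)) ^ K)" using r by simp
        finally show "ennreal (norm (ft u y)) \<le> ennreal (r ^ d * F) * ennreal (1 / (1 + (r/2) * norm (y - 0 :: 'a)) ^ K)"
          using r F by (simp add: ennreal_mult[symmetric] ennreal_leI)
      qed
      also have "\<dots> = ennreal (r ^ d * F) * (\<integral>\<^sup>+y. ennreal (1 / (1 + (r/2) * norm (y - 0 :: 'a)) ^ K) \<partial>lborel)"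
        by (rule nn_integral_cmult) measurable
      also have "\<dots> \<le> ennreal (r ^ d * F) * ennreal (W / (r/2) ^ d)"
        using K r by (intro mult_left_mono W) (auto simp: d_def)
      also have "\<dots> = ennreal (F * W * 2 ^ d)"
        using r F W by (subst ennreal_mult[symmetric]) (auto simp: power_divide field_simps)
      finally show ?thesis .
    qed
    have fi: "integrable lborel (ft u)"
      using nn by (intro integrableI_bounded) (auto simp: less_top[symmetric] top_unique)
    obtain Bu where Bu: "\<And>\<zeta>. norm (u \<zeta>) \<le> Bu"
    proof -
      have "bounded (u ` cball 0 (3/2 * r))"
        by (intro compact_imp_bounded compact_continuous_image) (auto intro: continuous_on_subset[OF cu])
      then obtain Bu where Bu: "\<forall>x\<in>u ` cball 0 (3/2 * r). norm x \<le> Bu" unfolding bounded_iff by (rule exE)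
      have "norm (u \<zeta>) \<le> max Bu 0" for \<zeta>
        using Bu u0[of \<zeta>] by (cases "\<zeta> \<in> cball 0 (3/2 * r)") (auto simp: le_max_iff_disj)
      then show ?thesis by (rule that)
    qed
    have ui: "integrable lborel u" by (rule integrable_bounded_support(1)[OF um compact_cball Bu u0])
    define w where "w q = ft u q / complex_of_real P" for q
    have wi: "integrable lborel w" unfolding w_def using fi by simp
    have "(LINT q|lborel. norm (w q)) = (LINT q|lborel. norm (ft u q)) / P"
      using P by (simp add: w_def norm_divide)
    also have "(LINT q|lborel. norm (ft u q)) \<le> F * W * 2 ^ d"
      using nn F W by (subst (asm) nn_integral_eq_integral) (use fi in \<open>auto simp: ennreal_le_iff\<close>)
    finally have wb: "(LINT q|lborel. norm (w q)) \<le> B * W * 2 ^ d / P * 2 powr (real j * m)"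
      using P by (simp add: F_def divide_right_mono mult_ac)
    have "u \<zeta> = (LINT q|lborel. cis (- (q \<bullet> \<zeta>)) * w q)" for \<zeta>
    proof -
      have "(LINT q|lborel. cis (- (q \<bullet> \<zeta>)) * w q) = (LINT q|lborel. cis (- (q \<bullet> \<zeta>)) * ft u q) / complex_of_real P"
        by (simp add: w_def)
      also have "\<dots> = u \<zeta>" using fourier_inversion[OF ui fi cu Bu, of \<zeta>] P by (simp add: P_def d_def)
      finally show ?thesis by simp
    qed
    then show "\<exists>w. integrable lborel w \<and> (LINT q|lborel. norm (w q)) \<le> B * W * 2 ^ d / P * 2 powr (real j * m) \<and>
      (\<forall>\<zeta>. \<sigma> \<zeta> * complex_of_real (theta K j \<zeta>) = (LINT q|lborel. cis (- (q \<bullet> \<zeta>)) * w q))"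
      using wi wb by (intro exI[of _ w]) (auto simp: u_def)
  qed
qed

section \<open>The trilinear form and its transposes\<close>

lemma osc_minus: "osc K s k (- \<xi>) = osc K s k \<xi>"
proof -
  have "chi K (- \<xi>) = chi K \<xi>" for \<xi> :: 'a by (simp add: chi_def)
  moreover have "psi K (- \<xi>) = psi K \<xi>" for \<xi> :: 'a by (simp add: psi_def chi_def)
  ultimately show ?thesis by (simp add: osc_def)
qed

text \<open>The phase and the cut-offs are even, hence so is the kernel. Convolution with it is
  therefore its own transpose, the symmetry on which duality rests.\<close>

lemma ft_osc_even: "ft (osc K s k) (- y) = ft (osc K s k) (y :: 'a::euclidean_space)"
proof -
  have "ft (osc K s k) y = (LINT \<xi>|lborel. cis (y \<bullet> (0 - \<xi>)) * osc K s k (0 - \<xi>))"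
    unfolding ft_def by (rule integral_lborel_reflect[symmetric]) measurable
  also have "\<dots> = ft (osc K s k) (- y)"
    by (simp add: ft_def osc_minus)
  finally show ?thesis by simp
qed

lemma ft_osc_minus: "ft (osc K s k) (x - y) = ft (osc K s k) (y - x :: 'a::euclidean_space)"
  using ft_osc_even[of K s k "y - x"] by simp

lemma piece_measurable[measurable]: "g \<in> borel_measurable borel \<Longrightarrow> piece K s k g \<in> borel_measurable borel"
  unfolding piece_def by measurable

lemma mult_cnj_sgn: "z * cnj (sgn z) = complex_of_real (norm z)"
proof (cases "z = 0")
  case False
  have "z * cnj (sgn z) = (z * cnj z) / complex_of_real (norm z)" by (simp add: sgn_eq)
  also have "z * cnj z = complex_of_real (norm z) * complex_of_real (norm z)"
    unfolding complex_norm_square[symmetric] power2_eq_square by simp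
  finally show ?thesis using False by simp
qed simp

text \<open>The L^1 norm is tested against the conjugate sign of V on balls, and Fatou's lemma lets
  the ball grow. Such test functions are bounded with bounded support, hence integrable, as the
  trilinear estimate requires of its factors.\<close>

lemma nn_integral_dual:
  fixes V :: "'a::euclidean_space \<Rightarrow> complex"
  assumes [measurable]: "V \<in> borel_measurable borel" and V: "\<And>x. norm (V x) \<le> C"
    and B: "\<And>h N. h \<in> borel_measurable borel \<Longrightarrow> (\<And>x. norm (h x) \<le> 1) \<Longrightarrow> (\<And>x. x \<notin> cball 0 N \<Longrightarrow> h x = 0) \<Longrightarrow>
      ennreal (norm (LINT x|lborel. V x * h x)) \<le> B"
  shows "(\<integral>\<^sup>+x. ennreal (norm (V x)) \<partial>lborel) \<le> B"
proof -
  have ball: "(\<integral>\<^sup>+x. ennreal (norm (V x)) * indicator (cball 0 N) x \<partial>lborel) \<le> B" for N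
  proof -
    define h where "h x = cnj (sgn (V x)) * complex_of_real (indicator (cball 0 N) x)" for x
    have sg[measurable]: "(\<lambda>x. sgn (V x)) \<in> borel_measurable borel" unfolding sgn_div_norm by measurable
    have hm[measurable]: "h \<in> borel_measurable borel" unfolding h_def by measurable
    have h1: "norm (h x) \<le> 1" for x by (simp add: h_def norm_mult norm_sgn indicator_def)
    have h0: "h x = 0" if "x \<notin> cball 0 N" for x using that by (simp add: h_def)
    have eq: "V x * h x = complex_of_real (norm (V x) * indicator (cball 0 N) x)" for x
      using mult_cnj_sgn[of "V x"] by (simp add: h_def flip: mult.assoc)
    have "integrable lborel (\<lambda>x. complex_of_real (norm (V x) * indicator (cball 0 N) x))"
      by (rule integrable_bounded_support(1)[where K="cball 0 N" and C=C])
         (use V order_trans[OF norm_ge_zero V] in \<open>auto simp: indicator_def\<close>)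
    then have i: "integrable lborel (\<lambda>x. norm (V x) * indicator (cball 0 N) x)" by (simp only: complex_of_real_integrable_eq)
    have "(\<integral>\<^sup>+x. ennreal (norm (V x)) * indicator (cball 0 N) x \<partial>lborel) = (\<integral>\<^sup>+x. ennreal (norm (V x) * indicator (cball 0 N) x) \<partial>lborel)"
      by (intro nn_integral_cong) (simp add: indicator_def)
    also have "\<dots> = ennreal (LINT x|lborel. norm (V x) * indicator (cball 0 N) x)"
      by (rule nn_integral_eq_integral[OF i]) auto
    also have "(LINT x|lborel. norm (V x) * indicator (cball 0 N) x) = norm (LINT x|lborel. V x * h x)"
      unfolding eq integral_complex_of_real by (simp add: integral_nonneg_AE)
    also have "ennreal \<dots> \<le> B" by (rule B[OF hm h1 h0])
    finally show ?thesis .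
  qed
  have "(\<integral>\<^sup>+x. ennreal (norm (V x)) \<partial>lborel) = (\<integral>\<^sup>+x. liminf (\<lambda>N. ennreal (norm (V x)) * indicator (cball 0 (real N)) x) \<partial>lborel)"
  proof (intro nn_integral_cong)
    fix x :: 'a
    obtain N :: nat where N: "norm x \<le> real N" using real_arch_simple by blast
    have "(\<lambda>N. ennreal (norm (V x)) * indicator (cball 0 (real N)) x) \<longlonglongrightarrow> ennreal (norm (V x))"
      by (intro tendsto_eventually eventually_sequentiallyI[of N]) (use N in \<open>auto simp: indicator_def\<close>)
    then show "ennreal (norm (V x)) = liminf (\<lambda>N. ennreal (norm (V x)) * indicator (cball 0 (real N)) x)"
      using lim_imp_Liminf[OF sequentially_bot] by fastforce
  qed
  also have "\<dots> \<le> liminf (\<lambda>N. \<integral>\<^sup>+x. ennreal (norm (V x)) * indicator (cball 0 (real N)) x \<partial>lborel)"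
    by (rule nn_integral_liminf) measurable
  also have "\<dots> \<le> liminf (\<lambda>N::nat. B)"
    by (intro Liminf_mono always_eventually allI ball)
  finally show ?thesis by (simp only: Liminf_const[OF sequentially_bot])
qed

text \<open>The shifts a and b are the effect of one exponential of the symbol expansion on the two
  factors.\<close>

definition triple_op :: "nat \<Rightarrow> real \<Rightarrow> nat \<Rightarrow> nat \<Rightarrow> nat \<Rightarrow> ('a::euclidean_space \<Rightarrow> complex) \<Rightarrow> ('a \<Rightarrow> complex) \<Rightarrow> 'a \<Rightarrow> 'a \<Rightarrow> 'a \<Rightarrow> complex"
  where "triple_op K s k0 k1 k2 f g a b x =
    (LINT y|lborel. ft (osc K s k0) (x - y) * piece K s k1 f (y + a) * piece K s k2 g (y + b))"

lemma triple_op_commute: "triple_op K s k0 k1 k2 f g a b x = triple_op K s k0 k2 k1 g f b a x"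
  by (simp add: triple_op_def mult_ac)

lemma norm_triple_op_le:
  "ennreal (norm (triple_op K s k0 k1 k2 f g a b x)) \<le>
    (\<integral>\<^sup>+y. ennreal (norm (ft (osc K s k0) (x - y)) * norm (piece K s k1 f (y + a)) * norm (piece K s k2 g (y + b))) \<partial>lborel)"
  unfolding triple_op_def by (rule order_trans[OF norm_integral_le_nn_integral]) (simp add: norm_mult)

lemma triple_op_measurable[measurable]:
  assumes [measurable]: "f \<in> borel_measurable borel" "g \<in> borel_measurable borel"
    "\<alpha> \<in> borel_measurable M" "\<beta> \<in> borel_measurable M" "\<gamma> \<in> borel_measurable M"
  shows "(\<lambda>z. triple_op K s k0 k1 k2 f g (\<alpha> z) (\<beta> z) (\<gamma> z)) \<in> borel_measurable M"
  unfolding triple_op_def by measurable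

lemma norm_piece_le:
  fixes g :: "'a::euclidean_space \<Rightarrow> complex"
  assumes k: "integrable lborel (ft (osc K s k :: 'a \<Rightarrow> complex))" and [measurable]: "g \<in> borel_measurable borel"
    and g: "\<And>w. norm (g w) \<le> A"
  shows "norm (piece K s k g x) \<le> A * (LINT y|lborel. norm (ft (osc K s k :: 'a \<Rightarrow> complex) y))"
  unfolding piece_def
proof (rule norm_conv_le[where S=UNIV])
  show "(\<integral>\<^sup>+y. ennreal (norm (ft (osc K s k :: 'a \<Rightarrow> complex) y)) * indicator UNIV y \<partial>lborel) \<le> ennreal (LINT y|lborel. norm (ft (osc K s k :: 'a \<Rightarrow> complex) y))"
    using nn_integral_eq_integral[of lborel "\<lambda>y. norm (ft (osc K s k :: 'a \<Rightarrow> complex) y)"] k by simp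
  show "0 \<le> A" using g[of 0] norm_ge_zero order_trans by blast
qed (use g in \<open>auto intro: integral_nonneg_AE\<close>)

text \<open>After pairing with a bounded h, the outer kernel acts on h and forms its piece of
  frequency k0, while the kernel of k1 is taken out of the piece of f. For each point w in the
  argument of f there remains the form with outer kernel k1 and factors g and h, so the supremum
  estimate for the permuted triple applies; integration against the modulus of f produces its L^1
  norm.\<close>

theorem nn_integral_triple_op_le:
  fixes f g :: "'a::euclidean_space \<Rightarrow> complex"
  assumes ki: "\<And>k. integrable lborel (ft (osc K s k :: 'a \<Rightarrow> complex))"
    and fm[measurable]: "f \<in> borel_measurable borel" and gm[measurable]: "g \<in> borel_measurable borel"
    and fA: "\<And>w. norm (f w) \<le> A1" and gA: "\<And>w. norm (g w) \<le> A2"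
    and est: "\<And>h x b c. integrable lborel h \<Longrightarrow> (\<And>w. norm (h w) \<le> 1) \<Longrightarrow>
      (\<integral>\<^sup>+y. ennreal (norm (ft (osc K s k1) (x - y)) * norm (piece K s k2 g (y + b)) * norm (piece K s k0 h (y + c))) \<partial>lborel) \<le> ennreal B"
  shows "(\<integral>\<^sup>+x. ennreal (norm (triple_op K s k0 k1 k2 f g a b x)) \<partial>lborel) \<le> ennreal B * (\<integral>\<^sup>+w. ennreal (norm (f w)) \<partial>lborel)"
proof -
  \<comment> \<open>These norms depend on k. They provide absolute convergence for the interchange
    of integrals and do not enter the final bound.\<close>
  define N where "N k = (LINT y|lborel. norm (ft (osc K s k :: 'a \<Rightarrow> complex) y))" for k
  have N0: "N k \<ge> 0" for k unfolding N_def by (auto intro: integral_nonneg_AE)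
  have A0: "A1 \<ge> 0" "A2 \<ge> 0" using fA[of 0] gA[of 0] norm_ge_zero order_trans by blast+
  have P1: "norm (piece K s k1 f x) \<le> A1 * N k1" for x unfolding N_def by (rule norm_piece_le[OF ki fm fA])
  have P2: "norm (piece K s k2 g x) \<le> A2 * N k2" for x unfolding N_def by (rule norm_piece_le[OF ki gm gA])
  define Z where "Z = A1 * N k1 * (A2 * N k2)"
  have Z: "Z \<ge> 0" using A0 N0 by (simp add: Z_def)
  have PP: "norm (piece K s k1 f y) * norm (piece K s k2 g y') \<le> Z" for y y'
    unfolding Z_def using A0 N0 P1 P2 by (intro mult_mono) auto
  have shift: "integrable lborel (\<lambda>y. norm (ft (osc K s k0) (x - y)))" for x :: 'a
  proof -
    have "integrable lborel (\<lambda>y. norm (ft (osc K s k0) (x + (-1) *\<^sub>R y)))"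
      by (subst integrable_lborel_affine_iff[where f="\<lambda>y. norm (ft (osc K s k0) y)"]) (use ki in auto)
    then show ?thesis by simp
  qed
  have shiftN: "(LINT y|lborel. norm (ft (osc K s k0) (x - y))) = N k0" for x :: 'a
    using integral_lborel_affine[of "\<lambda>y. norm (ft (osc K s k0) y)" "-1" x] by (simp add: N_def)
  have yi: "integrable lborel (\<lambda>y. ft (osc K s k0) (x - y) * piece K s k1 f (y + a) * piece K s k2 g (y + b))" for x
  proof (rule Bochner_Integration.integrable_bound)
    show "integrable lborel (\<lambda>y. norm (ft (osc K s k0) (x - y)) * Z)" using shift by simp
    show "AE y in lborel. norm (ft (osc K s k0) (x - y) * piece K s k1 f (y + a) * piece K s k2 g (y + b)) \<le> norm (norm (ft (osc K s k0) (x - y)) * Z)"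
      using PP Z by (intro AE_I2) (auto simp: norm_mult mult.assoc intro!: mult_left_mono)
  qed measurable
  show ?thesis
  proof (rule nn_integral_dual[where C="N k0 * Z"])
    show "triple_op K s k0 k1 k2 f g a b \<in> borel_measurable borel"
      by (rule triple_op_measurable[OF fm gm, of "\<lambda>_. a" borel "\<lambda>_. b" "\<lambda>x. x"]) simp_all
    fix x
    have "norm (triple_op K s k0 k1 k2 f g a b x) \<le> (LINT y|lborel. norm (ft (osc K s k0) (x - y) * piece K s k1 f (y + a) * piece K s k2 g (y + b)))"
      unfolding triple_op_def by (rule integral_norm_bound)
    also have "\<dots> \<le> (LINT y|lborel. norm (ft (osc K s k0) (x - y)) * Z)"
      using integrable_norm[OF yi[of x]] shift PP
      by (intro integral_mono) (simp_all add: norm_mult mult.assoc mult_left_mono)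
    also have "\<dots> = N k0 * Z" by (simp add: shiftN)
    finally show "norm (triple_op K s k0 k1 k2 f g a b x) \<le> N k0 * Z" .
  next
    fix h :: "'a \<Rightarrow> complex" and r assume hm[measurable]: "h \<in> borel_measurable borel" and h1: "\<And>x. norm (h x) \<le> 1" and h0: "\<And>x. x \<notin> cball 0 r \<Longrightarrow> h x = 0"
    have hi: "integrable lborel h" by (rule integrable_bounded_support(1)[OF hm compact_cball h1 h0])
    define F where "F x y = ft (osc K s k0) (x - y) * piece K s k1 f (y + a) * piece K s k2 g (y + b) * h x" for x y
    have Fm[measurable]: "(\<lambda>(x, y). F x y) \<in> borel_measurable (lborel \<Otimes>\<^sub>M lborel)" unfolding F_def by measurable
    have Fi: "integrable (lborel \<Otimes>\<^sub>M lborel) (\<lambda>(x, y). F x y)"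
    proof (rule lborel_pair.Fubini_integrable)
      show "AE x in lborel. integrable lborel (\<lambda>y. case (x, y) of (x, y) \<Rightarrow> F x y)"
        using yi by (auto simp: F_def)
      show "integrable lborel (\<lambda>x. LINT y|lborel. norm (case (x, y) of (x, y) \<Rightarrow> F x y))"
      proof (rule Bochner_Integration.integrable_bound)
        show "integrable lborel (\<lambda>x. N k0 * Z * norm (h x))" using hi by simp
        show "AE x in lborel. norm (LINT y|lborel. norm (case (x, y) of (x, y) \<Rightarrow> F x y)) \<le> norm (N k0 * Z * norm (h x))"
        proof (rule AE_I2)
          fix x
          have "(LINT y|lborel. norm (F x y)) \<le> (LINT y|lborel. norm (ft (osc K s k0) (x - y)) * Z * norm (h x))"
          proof (rule integral_mono)
            show "integrable lborel (\<lambda>y. norm (F x y))" using yi[of x] by (auto simp: F_def intro!: integrable_norm)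
            show "integrable lborel (\<lambda>y. norm (ft (osc K s k0) (x - y)) * Z * norm (h x))" using shift by simp
            show "norm (F x y) \<le> norm (ft (osc K s k0) (x - y)) * Z * norm (h x)" for y
              using PP by (auto simp: F_def norm_mult mult.assoc[of _ "norm (piece K s k1 f _)"] intro!: mult_right_mono mult_left_mono)
          qed
          also have "\<dots> = N k0 * Z * norm (h x)" by (simp add: shiftN)
          finally show "norm (LINT y|lborel. norm (case (x, y) of (x, y) \<Rightarrow> F x y)) \<le> norm (N k0 * Z * norm (h x))"
            using N0 Z by (simp add: integral_nonneg_AE)
        qed
      qed measurable
    qed measurable
    have "(LINT x|lborel. triple_op K s k0 k1 k2 f g a b x * h x) = (LINT x|lborel. LINT y|lborel. F x y)"
      unfolding triple_op_def F_def by simp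
    also have "\<dots> = (LINT y|lborel. LINT x|lborel. F x y)" by (rule lborel_pair.Fubini_integral[OF Fi, symmetric])
    also have "\<dots> = (LINT y|lborel. piece K s k1 f (y + a) * piece K s k2 g (y + b) * piece K s k0 h y)"
    proof (intro Bochner_Integration.integral_cong refl)
      fix y
      have "(LINT x|lborel. F x y) = (LINT x|lborel. piece K s k1 f (y + a) * piece K s k2 g (y + b) * (ft (osc K s k0) (y - x) * h x))"
        unfolding F_def by (intro Bochner_Integration.integral_cong refl) (simp add: ft_osc_minus[of K s k0 _ y] mult_ac)
      then show "(LINT x|lborel. F x y) = piece K s k1 f (y + a) * piece K s k2 g (y + b) * piece K s k0 h y"
        by (simp add: piece_def conv_def)
    qed
    finally have "ennreal (norm (LINT x|lborel. triple_op K s k0 k1 k2 f g a b x * h x)) \<le>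
       (\<integral>\<^sup>+y. ennreal (norm (piece K s k1 f (y + a) * piece K s k2 g (y + b) * piece K s k0 h y)) \<partial>lborel)"
      by (simp only: norm_integral_le_nn_integral)
    also have "\<dots> \<le> (\<integral>\<^sup>+y. (\<integral>\<^sup>+w. ennreal (norm (f w)) * ennreal (norm (ft (osc K s k1) (y + a - w)) * norm (piece K s k2 g (y + b)) * norm (piece K s k0 h (y + 0))) \<partial>lborel) \<partial>lborel)"
    proof (intro nn_integral_mono)
      fix y
      define G where "G = norm (piece K s k2 g (y + b)) * norm (piece K s k0 h y)"
      have "ennreal (norm (piece K s k1 f (y + a) * piece K s k2 g (y + b) * piece K s k0 h y)) = ennreal (norm (piece K s k1 f (y + a))) * ennreal G"
        by (simp add: norm_mult G_def mult.assoc ennreal_mult)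
      also have "ennreal (norm (piece K s k1 f (y + a))) \<le> (\<integral>\<^sup>+w. ennreal (norm (ft (osc K s k1) (y + a - w) * f w)) \<partial>lborel)"
        unfolding piece_def conv_def by (rule norm_integral_le_nn_integral)
      also have "(\<integral>\<^sup>+w. ennreal (norm (ft (osc K s k1) (y + a - w) * f w)) \<partial>lborel) * ennreal G
        = (\<integral>\<^sup>+w. ennreal (norm (ft (osc K s k1) (y + a - w) * f w)) * ennreal G \<partial>lborel)"
        by (rule nn_integral_multc[symmetric]) measurable
      also have "\<dots> = (\<integral>\<^sup>+w. ennreal (norm (f w)) * ennreal (norm (ft (osc K s k1) (y + a - w)) * norm (piece K s k2 g (y + b)) * norm (piece K s k0 h (y + 0))) \<partial>lborel)"
        by (intro nn_integral_cong) (simp add: G_def norm_mult ennreal_mult[symmetric] mult_ac)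
      finally show "ennreal (norm (piece K s k1 f (y + a) * piece K s k2 g (y + b) * piece K s k0 h y)) \<le>
        (\<integral>\<^sup>+w. ennreal (norm (f w)) * ennreal (norm (ft (osc K s k1) (y + a - w)) * norm (piece K s k2 g (y + b)) * norm (piece K s k0 h (y + 0))) \<partial>lborel)"
        by (simp add: mult_right_mono)
    qed
    also have "\<dots> = (\<integral>\<^sup>+w. (\<integral>\<^sup>+y. ennreal (norm (f w)) * ennreal (norm (ft (osc K s k1) (y + a - w)) * norm (piece K s k2 g (y + b)) * norm (piece K s k0 h (y + 0))) \<partial>lborel) \<partial>lborel)"
      by (rule lborel_pair.Fubini') measurable
    also have "\<dots> \<le> (\<integral>\<^sup>+w. ennreal (norm (f w)) * ennreal B \<partial>lborel)"
    proof (intro nn_integral_mono)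
      fix w
      \<comment> \<open>Evenness brings the kernel into the form of the assumed estimate, with w - a
        in the place of x.\<close>
      have "ft (osc K s k1) (y + a - w) = ft (osc K s k1) (w - a - y)" for y
        using ft_osc_minus[of K s k1 "y + a" w] by (simp add: algebra_simps)
      then have "(\<integral>\<^sup>+y. ennreal (norm (f w)) * ennreal (norm (ft (osc K s k1) (y + a - w)) * norm (piece K s k2 g (y + b)) * norm (piece K s k0 h (y + 0))) \<partial>lborel)
        = (\<integral>\<^sup>+y. ennreal (norm (f w)) * ennreal (norm (ft (osc K s k1) (w - a - y)) * norm (piece K s k2 g (y + b)) * norm (piece K s k0 h (y + 0))) \<partial>lborel)" by (simp only:)
      also have "\<dots> = ennreal (norm (f w)) * (\<integral>\<^sup>+y. ennreal (norm (ft (osc K s k1) (w - a - y)) * norm (piece K s k2 g (y + b)) * norm (piece K s k0 h (y + 0))) \<partial>lborel)"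
        by (rule nn_integral_cmult) measurable
      also have "\<dots> \<le> ennreal (norm (f w)) * ennreal B" by (intro mult_left_mono est hi h1) auto
      finally show "(\<integral>\<^sup>+y. ennreal (norm (f w)) * ennreal (norm (ft (osc K s k1) (y + a - w)) * norm (piece K s k2 g (y + b)) * norm (piece K s k0 h (y + 0))) \<partial>lborel) \<le> ennreal (norm (f w)) * ennreal B" .
    qed
    also have "\<dots> = ennreal B * (\<integral>\<^sup>+w. ennreal (norm (f w)) \<partial>lborel)"
      by (subst nn_integral_multc) (auto simp: mult.commute)
    finally show "ennreal (norm (LINT x|lborel. triple_op K s k0 k1 k2 f g a b x * h x)) \<le> ennreal B * (\<integral>\<^sup>+w. ennreal (norm (f w)) \<partial>lborel)" .
  qed
qed

section \<open>Representation of the frequency-localised operators\<close>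

lemma fst_borel_measurable[measurable]: "fst \<in> borel_measurable (borel :: ('a::euclidean_space \<times> 'b::euclidean_space) measure)"
  and snd_borel_measurable[measurable]: "snd \<in> borel_measurable (borel :: ('a \<times> 'b) measure)"
  by (intro borel_measurable_continuous_onI continuous_intros)+

lemma Fubini_cis:
  fixes U :: "'c::euclidean_space \<Rightarrow> complex" and W :: "'d::euclidean_space \<Rightarrow> complex"
  assumes U: "integrable lborel U" and W: "integrable lborel W"
    and [measurable]: "(\<lambda>(p, q). \<phi> p q) \<in> borel_measurable (lborel \<Otimes>\<^sub>M lborel)"
  shows "(LINT p|lborel. U p * (LINT q|lborel. cis (\<phi> p q) * W q)) = (LINT q|lborel. W q * (LINT p|lborel. cis (\<phi> p q) * U p))"
proof -
  have [measurable]: "U \<in> borel_measurable borel" "W \<in> borel_measurable borel" using U W by auto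
  have "integrable (lborel \<Otimes>\<^sub>M lborel) (\<lambda>z. cis (case z of (p, q) \<Rightarrow> \<phi> p q) * (case z of (p, q) \<Rightarrow> U p * W q))"
    by (intro integrable_cis_mult integrable_lborel_pair_mult U W) measurable
  then have i: "integrable (lborel \<Otimes>\<^sub>M lborel) (\<lambda>(p, q). cis (\<phi> p q) * (U p * W q))"
    by (simp add: split_beta')
  have "(LINT p|lborel. U p * (LINT q|lborel. cis (\<phi> p q) * W q)) = (LINT p|lborel. (LINT q|lborel. cis (\<phi> p q) * (U p * W q)))"
    by (simp flip: integral_mult_right_zero add: mult_ac)
  also have "\<dots> = (LINT q|lborel. (LINT p|lborel. cis (\<phi> p q) * (U p * W q)))"
    by (rule lborel_pair.Fubini_integral[OF i, symmetric])
  also have "\<dots> = (LINT q|lborel. W q * (LINT p|lborel. cis (\<phi> p q) * U p))"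
    by (simp flip: integral_mult_right_zero add: mult_ac)
  finally show ?thesis .
qed

lemma
  fixes A :: "'a::euclidean_space \<Rightarrow> complex" and B :: "'b::euclidean_space \<Rightarrow> complex"
  assumes A: "integrable lborel A" and B: "integrable lborel B"
  shows integrable_lborel_prod_mult: "integrable lborel (\<lambda>p. A (fst p) * B (snd p))"
    and integral_lborel_prod_mult: "(LINT p|lborel. A (fst p) * B (snd p)) = (LINT x|lborel. A x) * (LINT y|lborel. B y)"
proof -
  have i: "integrable (lborel \<Otimes>\<^sub>M lborel) (\<lambda>(x, y). A x * B y)" by (rule integrable_lborel_pair_mult[OF A B])
  then show "integrable lborel (\<lambda>p. A (fst p) * B (snd p))" by (simp add: lborel_prod split_beta')
  have "(LINT p|lborel. A (fst p) * B (snd p)) = (LINT p|(lborel \<Otimes>\<^sub>M lborel). (case p of (x, y) \<Rightarrow> A x * B y))"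
    by (simp add: lborel_prod split_beta')
  also have "\<dots> = (LINT x|lborel. LINT y|lborel. A x * B y)"
    using lborel_pair.integral_fst'[OF i] by simp
  finally show "(LINT p|lborel. A (fst p) * B (snd p)) = (LINT x|lborel. A x) * (LINT y|lborel. B y)" by simp
qed

text \<open>Expanding \<Sigma> in exponentials leaves one factor that couples the two frequencies,
  the multiplier in \<xi> + \<eta>. Written as an integral over y by inversion it becomes an
  exponential too; for fixed q and y the double integral then splits into two convolutions,
  evaluated at x - y minus the components of q.\<close>

theorem localised_representation:
  fixes f g :: "'a::euclidean_space \<Rightarrow> complex" and w :: "'a \<times> 'a \<Rightarrow> complex"
  assumes s: "s > 0" and ki: "integrable lborel (ft (osc K s k0 :: 'a \<Rightarrow> complex))"
    and f: "integrable lborel f" and g: "integrable lborel g" and w: "integrable lborel w"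
    and \<Sigma>: "\<And>\<zeta>. \<Sigma> \<zeta> = (LINT q|lborel. cis (- (q \<bullet> \<zeta>)) * w q)"
  shows "(LINT p|lborel. cis (x \<bullet> (fst p + snd p)) * (osc K s k1 (fst p) * osc K s k2 (snd p) * osc K s k0 (fst p + snd p) * \<Sigma> p)
      * ft f (- fst p) * ft g (- snd p)) =
    (LINT q|lborel. w q * triple_op K s k0 k1 k2 f g (- fst q) (- snd q) x) / (2 * pi) ^ DIM('a)"
proof -
  have fm[measurable]: "f \<in> borel_measurable borel" and gm[measurable]: "g \<in> borel_measurable borel" using f g by auto
  define P where "P = complex_of_real ((2 * pi) ^ DIM('a))"
  have P: "P \<noteq> 0" by (simp add: P_def)
  let ?K0 = "ft (osc K s k0 :: 'a \<Rightarrow> complex)"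
  define A where "A \<xi> = osc K s k1 \<xi> * ft f (- \<xi>)" for \<xi>
  define B where "B \<eta> = osc K s k2 \<eta> * ft g (- \<eta>)" for \<eta>
  have A: "integrable lborel A" unfolding A_def by (rule integrable_mult_ft[OF osc_integrable f])
  have B: "integrable lborel B" unfolding B_def by (rule integrable_mult_ft[OF osc_integrable g])
  define U where "U p = A (fst p) * B (snd p)" for p
  have U: "integrable lborel U" unfolding U_def by (rule integrable_lborel_prod_mult[OF A B])
  define U' where "U' p = U p * osc K s k0 (fst p + snd p)" for p
  have U': "integrable lborel U'"
  proof (rule Bochner_Integration.integrable_bound[OF U])
    show "U' \<in> borel_measurable lborel" unfolding U'_def using U by measurable
    show "AE p in lborel. norm (U' p) \<le> norm (U p)"
      by (intro AE_I2) (auto simp: U'_def norm_mult norm_osc_le mult_left_le)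
  qed
  \<comment> \<open>The source of the divisor (2 pi)^n: only one of the three multipliers is
    inverted, the other two act as convolutions without constants.\<close>
  have inv: "osc K s k0 \<zeta> = (LINT y|lborel. cis (- (y \<bullet> \<zeta>)) * ?K0 y) / P" for \<zeta> :: 'a
    using fourier_inversion[OF osc_integrable ki osc_cont[OF s] norm_osc_le] P by (simp add: P_def)
  have "(LINT p|lborel. cis (x \<bullet> (fst p + snd p)) * (osc K s k1 (fst p) * osc K s k2 (snd p) * osc K s k0 (fst p + snd p) * \<Sigma> p)
      * ft f (- fst p) * ft g (- snd p)) = (LINT p|lborel. U' p * (LINT q|lborel. cis (x \<bullet> (fst p + snd p) - q \<bullet> p) * w q))"
  proof (intro Bochner_Integration.integral_cong refl)
    fix p :: "'a \<times> 'a"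
    have "(LINT q|lborel. cis (x \<bullet> (fst p + snd p) - q \<bullet> p) * w q) = (LINT q|lborel. cis (x \<bullet> (fst p + snd p)) * (cis (- (q \<bullet> p)) * w q))"
      by (simp add: cis_mult flip: mult.assoc)
    also have "\<dots> = cis (x \<bullet> (fst p + snd p)) * \<Sigma> p" by (simp add: \<Sigma>)
    finally show "cis (x \<bullet> (fst p + snd p)) * (osc K s k1 (fst p) * osc K s k2 (snd p) * osc K s k0 (fst p + snd p) * \<Sigma> p)
      * ft f (- fst p) * ft g (- snd p) = U' p * (LINT q|lborel. cis (x \<bullet> (fst p + snd p) - q \<bullet> p) * w q)"
      by (simp add: U'_def U_def A_def B_def mult_ac)
  qed
  also have "\<dots> = (LINT q|lborel. w q * (LINT p|lborel. cis (x \<bullet> (fst p + snd p) - q \<bullet> p) * U' p))"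
    by (rule Fubini_cis[OF U' w]) measurable
  also have "\<dots> = (LINT q|lborel. w q * (triple_op K s k0 k1 k2 f g (- fst q) (- snd q) x / P))"
  proof (intro Bochner_Integration.integral_cong refl arg_cong2[where f="(*)"])
    fix q :: "'a \<times> 'a"
    define Uq where "Uq p = cis (x \<bullet> (fst p + snd p) - q \<bullet> p) * U p" for p
    have Uq: "integrable lborel Uq" unfolding Uq_def by (intro integrable_cis_mult U) measurable
    have inner: "(LINT p|lborel. cis (- (y \<bullet> (fst p + snd p))) * Uq p) = piece K s k1 f (x - y + (- fst q)) * piece K s k2 g (x - y + (- snd q))" for y
    proof -
      have "(LINT p|lborel. cis (- (y \<bullet> (fst p + snd p))) * Uq p) =
        (LINT p|lborel. (cis ((x - y + (- fst q)) \<bullet> fst p) * A (fst p)) * (cis ((x - y + (- snd q)) \<bullet> snd p) * B (snd p)))"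
      proof (intro Bochner_Integration.integral_cong refl)
        fix p :: "'a \<times> 'a"
        have "cis (- (y \<bullet> (fst p + snd p))) * cis (x \<bullet> (fst p + snd p) - q \<bullet> p) = cis ((x - y + (- fst q)) \<bullet> fst p) * cis ((x - y + (- snd q)) \<bullet> snd p)"
          by (simp add: cis_mult inner_prod_def inner_add_left inner_add_right inner_diff_left algebra_simps)
        then show "cis (- (y \<bullet> (fst p + snd p))) * Uq p = (cis ((x - y + (- fst q)) \<bullet> fst p) * A (fst p)) * (cis ((x - y + (- snd q)) \<bullet> snd p) * B (snd p))"
          unfolding Uq_def U_def by (simp only: mult.assoc[symmetric]) (simp only: mult_ac)
      qed
      also have "\<dots> = ft A (x - y + (- fst q)) * ft B (x - y + (- snd q))"
        unfolding ft_def by (rule integral_lborel_prod_mult[OF integrable_cis_mult[OF A] integrable_cis_mult[OF B]]) measurable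
      finally show ?thesis
        unfolding piece_def conv_ft[OF osc_integrable f] conv_ft[OF osc_integrable g] A_def B_def .
    qed
    have U'inv: "cis (x \<bullet> (fst p + snd p) - q \<bullet> p) * U' p = Uq p * (LINT y|lborel. cis (- (y \<bullet> (fst p + snd p))) * ?K0 y) / P" for p
    proof -
      have "cis (x \<bullet> (fst p + snd p) - q \<bullet> p) * U' p = Uq p * osc K s k0 (fst p + snd p)"
        by (simp only: U'_def Uq_def mult.assoc)
      then show ?thesis by (subst (asm) inv[of "fst p + snd p"]) simp
    qed
    have "(LINT p|lborel. cis (x \<bullet> (fst p + snd p) - q \<bullet> p) * U' p) = (LINT p|lborel. Uq p * (LINT y|lborel. cis (- (y \<bullet> (fst p + snd p))) * ?K0 y)) / P"
      by (simp only: U'inv integral_divide_zero)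
    also have "(LINT p|lborel. Uq p * (LINT y|lborel. cis (- (y \<bullet> (fst p + snd p))) * ?K0 y)) =
      (LINT y|lborel. ?K0 y * (LINT p|lborel. cis (- (y \<bullet> (fst p + snd p))) * Uq p))"
      by (rule Fubini_cis[OF Uq ki]) measurable
    also have "\<dots> = (LINT y|lborel. ?K0 (x - (x - y)) * piece K s k1 f (x - y + (- fst q)) * piece K s k2 g (x - y + (- snd q)))"
      unfolding inner by (simp add: mult.assoc)
    also have "\<dots> = triple_op K s k0 k1 k2 f g (- fst q) (- snd q) x"
      unfolding triple_op_def by (rule integral_lborel_reflect) measurable
    finally show "(LINT p|lborel. cis (x \<bullet> (fst p + snd p) - q \<bullet> p) * U' p) = triple_op K s k0 k1 k2 f g (- fst q) (- snd q) x / P" .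
  qed
  also have "\<dots> = (LINT q|lborel. w q * triple_op K s k0 k1 k2 f g (- fst q) (- snd q) x) / P" by simp
  finally show ?thesis by (simp add: P_def)
qed

section \<open>Summation of the dyadic pieces\<close>

text \<open>The supports give 2^a / 2 < 2 * 3/2 * 2^(max b c), that is 2^a < 6 * 2^(max b c), and 6
  < 2^3.\<close>

lemma osc_index_le:
  assumes "osc K s a x \<noteq> 0" "osc K s b y \<noteq> 0" "osc K s c z \<noteq> 0" "norm x \<le> norm y + norm z"
  shows "a \<le> max b c + 3"
proof (cases "a = 0")
  case False
  have "2 ^ a / 2 < norm x" using osc_eq_0_low[of a x K s] assms(1) False by force
  moreover have "norm y < 3/2 * 2 ^ b" using osc_eq_0_high[of b y K s] assms(2) by force
  moreover have "norm z < 3/2 * 2 ^ c" using osc_eq_0_high[of c z K s] assms(3) by force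
  moreover have "(2::real) ^ b \<le> 2 ^ max b c" "(2::real) ^ c \<le> 2 ^ max b c" by (auto intro: power_increasing)
  ultimately have "2 ^ a / 2 < 3/2 * 2 ^ max b c + 3/2 * (2::real) ^ max b c" using assms(4) by linarith
  then have "(2::real) ^ a < 6 * 2 ^ max b c" by simp
  also have "\<dots> \<le> 2 ^ (max b c + 3)" by (simp add: power_add)
  finally have "a < max b c + 3" by (rule power_less_imp_less_exp[rotated]) simp
  then show ?thesis by simp
qed simp

definition local_op :: "nat \<Rightarrow> real \<Rightarrow> ('a::euclidean_space \<times> 'a \<Rightarrow> complex) \<Rightarrow> nat \<Rightarrow> nat \<Rightarrow> nat \<Rightarrow> nat \<Rightarrow>
    ('a \<Rightarrow> complex) \<Rightarrow> ('a \<Rightarrow> complex) \<Rightarrow> 'a \<Rightarrow> complex"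
  where "local_op K s \<sigma> j k0 k1 k2 f g x = (LINT p|lborel. cis (x \<bullet> (fst p + snd p)) *
    (osc K s k1 (fst p) * osc K s k2 (snd p) * osc K s k0 (fst p + snd p) * (\<sigma> p * complex_of_real (theta K j p)))
      * ft f (- fst p) * ft g (- snd p))"

text \<open>By the triangle inequality the largest frequency is comparable to the second largest.
  All three relations are recorded because each of the three bounds puts a different factor into the
  role of the outer kernel.\<close>

lemma local_op_eq_0:
  assumes "\<not> (k0 \<le> max k1 k2 + 3 \<and> k1 \<le> max k2 k0 + 3 \<and> k2 \<le> max k1 k0 + 3)"
  shows "local_op K s \<sigma> j k0 k1 k2 f g x = 0"
proof -
  have z: "osc K s k1 \<xi> * osc K s k2 \<eta> * osc K s k0 (\<xi> + \<eta>) = 0" for \<xi> \<eta> :: 'a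
  proof (rule ccontr)
    assume "osc K s k1 \<xi> * osc K s k2 \<eta> * osc K s k0 (\<xi> + \<eta>) \<noteq> 0"
    then have nz: "osc K s k1 \<xi> \<noteq> 0" "osc K s k2 \<eta> \<noteq> 0" "osc K s k0 (\<xi> + \<eta>) \<noteq> 0" by auto
    have "k0 \<le> max k1 k2 + 3" by (rule osc_index_le[OF nz(3,1,2) norm_triangle_ineq])
    moreover have "k1 \<le> max k2 k0 + 3"
      by (rule osc_index_le[OF nz(1,2,3)]) (use norm_triangle_ineq4[of "\<xi> + \<eta>" \<eta>] in simp)
    moreover have "k2 \<le> max k1 k0 + 3"
      by (rule osc_index_le[OF nz(2,1,3)]) (use norm_triangle_ineq4[of "\<xi> + \<eta>" \<xi>] in simp)
    ultimately show False using assms by blast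
  qed
  show ?thesis unfolding local_op_def z by simp
qed

text \<open>The density w of the symbol piece has mass O(2^(j m)) and each translated form loses
  2^(j loss), uniformly in the translation, so every bound passes through the integral over q. The
  bound S on the localised symbol is kept for the integrability of the blocks in
  \<open>full_op_bounds\<close>.\<close>

lemma local_op_bounds:
  fixes \<sigma> :: "'a::euclidean_space \<times> 'a \<Rightarrow> complex"
  assumes s: "s > 0" "s \<noteq> 1" and e: "e > 0" "s < 1 \<Longrightarrow> s + e < 1" and \<sigma>: "\<sigma> \<in> symbol_class m"
  shows "\<exists>K. \<exists>C\<ge>0. (\<forall>j. \<exists>S. \<forall>p. norm (\<sigma> p * complex_of_real (theta K j p)) \<le> S) \<and>
    (\<forall>j k0 k1 k2 f g A1 A2. k0 \<le> j + 3 \<longrightarrow> k1 \<le> j + 3 \<longrightarrow> k2 \<le> j + 3 \<longrightarrow>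
      integrable lborel f \<longrightarrow> integrable lborel g \<longrightarrow> A1 > 0 \<longrightarrow> A2 > 0 \<longrightarrow> (\<forall>w. norm (f w) \<le> A1) \<longrightarrow> (\<forall>w. norm (g w) \<le> A2) \<longrightarrow>
      (\<forall>x. ennreal (norm (local_op K s \<sigma> j k0 k1 k2 f g x)) \<le> ennreal (C * 2 powr (real j * (m + loss DIM('a) s e))) * ennreal A1 * ennreal A2) \<and>
      (\<integral>\<^sup>+x. ennreal (norm (local_op K s \<sigma> j k0 k1 k2 f g x)) \<partial>lborel) \<le>
        ennreal (C * 2 powr (real j * (m + loss DIM('a) s e))) * (\<integral>\<^sup>+x. ennreal (norm (f x)) \<partial>lborel) * ennreal A2 \<and>
      (\<integral>\<^sup>+x. ennreal (norm (local_op K s \<sigma> j k0 k1 k2 f g x)) \<partial>lborel) \<le>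
        ennreal (C * 2 powr (real j * (m + loss DIM('a) s e))) * ennreal A1 * (\<integral>\<^sup>+x. ennreal (norm (g x)) \<partial>lborel))"
proof -
  define L where "L = loss DIM('a) s e"
  obtain K D where K: "K \<ge> 2 * DIM('a \<times> 'a)" and D: "D \<ge> 0" and ki: "\<And>k. integrable lborel (ft (osc K s k :: 'a \<Rightarrow> complex))" and
    est: "\<And>J k0 k1 k2 g h A1 A2. \<And>x b c::'a. k0 \<le> J \<Longrightarrow> k1 \<le> J \<Longrightarrow> k2 \<le> J \<Longrightarrow> k0 \<le> max k1 k2 + 3 \<Longrightarrow>
      integrable lborel g \<Longrightarrow> integrable lborel h \<Longrightarrow> A1 > 0 \<Longrightarrow> A2 > 0 \<Longrightarrow> (\<forall>w. norm (g w) \<le> A1) \<Longrightarrow> (\<forall>w. norm (h w) \<le> A2) \<Longrightarrow>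
      (\<integral>\<^sup>+y. ennreal (norm (ft (osc K s k0) (x - y)) * norm (piece K s k1 g (y + b)) * norm (piece K s k2 h (y + c))) \<partial>lborel)
        \<le> ennreal (D * 2 powr (real J * L) * A1 * A2)"
    using piece_triple_estimate[OF s e, of "2 * DIM('a \<times> 'a)", where 'a='a] unfolding L_def by blast
  obtain C0 where C0: "C0 \<ge> 0" and ex: "\<And>j. \<exists>w. integrable lborel w \<and> (LINT q|lborel. norm (w q)) \<le> C0 * 2 powr (real j * m) \<and>
    (\<forall>\<zeta>. \<sigma> \<zeta> * complex_of_real (theta K j \<zeta>) = (LINT q|lborel. cis (- (q \<bullet> \<zeta>)) * w q))"
    using symbol_expansion[OF \<sigma> K] by blast
  \<comment> \<open>The power 2^(3 L) appears because the frequencies run up to j + 3 rather than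
    j.\<close>
  define C where "C = C0 * D * 2 powr (3 * L)"
  have C: "C \<ge> 0" using C0 D by (simp add: C_def)
  have Sb: "\<exists>S. \<forall>p. norm (\<sigma> p * complex_of_real (theta K j p)) \<le> S" for j
  proof -
    obtain w where w: "integrable lborel w" "\<And>\<zeta>. \<sigma> \<zeta> * complex_of_real (theta K j \<zeta>) = (LINT q|lborel. cis (- (q \<bullet> \<zeta>)) * w q)"
      using ex[of j] by blast
    have "norm (\<sigma> p * complex_of_real (theta K j p)) \<le> (LINT q|lborel. norm (w q))" for p
      unfolding w(2) using integral_norm_bound[of lborel "\<lambda>q. cis (- (q \<bullet> p)) * w q"] by (simp add: norm_mult)
    then show ?thesis by blast
  qed
  have main: "(\<forall>x. ennreal (norm (local_op K s \<sigma> j k0 k1 k2 f g x)) \<le> ennreal (C * 2 powr (real j * (m + L))) * ennreal A1 * ennreal A2) \<and>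
      (\<integral>\<^sup>+x. ennreal (norm (local_op K s \<sigma> j k0 k1 k2 f g x)) \<partial>lborel) \<le>
        ennreal (C * 2 powr (real j * (m + L))) * (\<integral>\<^sup>+x. ennreal (norm (f x)) \<partial>lborel) * ennreal A2 \<and>
      (\<integral>\<^sup>+x. ennreal (norm (local_op K s \<sigma> j k0 k1 k2 f g x)) \<partial>lborel) \<le>
        ennreal (C * 2 powr (real j * (m + L))) * ennreal A1 * (\<integral>\<^sup>+x. ennreal (norm (g x)) \<partial>lborel)"
    if k: "k0 \<le> j + 3" "k1 \<le> j + 3" "k2 \<le> j + 3" and f: "integrable lborel f" and g: "integrable lborel g"
      and A: "A1 > 0" "A2 > 0" and fA: "\<forall>w. norm (f w) \<le> A1" and gA: "\<forall>w. norm (g w) \<le> A2" for j k0 k1 k2 f g A1 A2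
  proof (cases "k0 \<le> max k1 k2 + 3 \<and> k1 \<le> max k2 k0 + 3 \<and> k2 \<le> max k1 k0 + 3")
    case False
    then show ?thesis by (simp add: local_op_eq_0)
  next
    case True
    have fm[measurable]: "f \<in> borel_measurable borel" and gm[measurable]: "g \<in> borel_measurable borel" using f g by auto
    define P where "P = (2 * pi) ^ DIM('a)"
    have P: "P \<ge> 1" unfolding P_def using pi_gt3 by (intro one_le_power) simp
    obtain w where w: "integrable lborel w" "(LINT q|lborel. norm (w q)) \<le> C0 * 2 powr (real j * m)"
      and ws: "\<And>\<zeta>. \<sigma> \<zeta> * complex_of_real (theta K j \<zeta>) = (LINT q|lborel. cis (- (q \<bullet> \<zeta>)) * w q)"
      using ex[of j] by blast
    have [measurable]: "w \<in> borel_measurable borel" using w by auto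
    have wn: "(\<integral>\<^sup>+q. ennreal (norm (w q)) \<partial>lborel) \<le> ennreal (C0 * 2 powr (real j * m))"
      using w by (subst nn_integral_eq_integral) (auto intro: ennreal_leI)
    define V where "V q x = triple_op K s k0 k1 k2 f g (- fst q) (- snd q) x" for q :: "'a \<times> 'a" and x
    have Vm[measurable]: "(\<lambda>(q, x). V q x) \<in> borel_measurable (lborel \<Otimes>\<^sub>M lborel)"
      "(\<lambda>(x, q). V q x) \<in> borel_measurable (lborel \<Otimes>\<^sub>M lborel)" "V q \<in> borel_measurable borel" "(\<lambda>q. V q x) \<in> borel_measurable borel" for q x
      unfolding V_def[abs_def] split_beta' by (intro triple_op_measurable[OF fm gm]; measurable)+
    have rep: "local_op K s \<sigma> j k0 k1 k2 f g x = (LINT q|lborel. w q * V q x) / P" for x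
      unfolding local_op_def V_def P_def
      by (subst localised_representation[OF s(1) ki f g w(1) ws]) simp
    have le: "ennreal (norm (local_op K s \<sigma> j k0 k1 k2 f g x)) \<le> (\<integral>\<^sup>+q. ennreal (norm (w q)) * ennreal (norm (V q x)) \<partial>lborel)" for x
    proof -
      have "norm (local_op K s \<sigma> j k0 k1 k2 f g x) \<le> norm (LINT q|lborel. w q * V q x)"
        unfolding rep using P mult_left_mono[of 1 P "norm (LINT q|lborel. w q * V q x)"] by (simp add: norm_divide pos_divide_le_eq)
      then have "ennreal (norm (local_op K s \<sigma> j k0 k1 k2 f g x)) \<le> ennreal (norm (LINT q|lborel. w q * V q x))" by (rule ennreal_leI)
      also have "\<dots> \<le> (\<integral>\<^sup>+q. ennreal (norm (w q * V q x)) \<partial>lborel)" by (rule norm_integral_le_nn_integral)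
      finally show ?thesis by (simp add: norm_mult ennreal_mult)
    qed
    define Q where "Q = D * 2 powr (real (j + 3) * L)"
    have Q: "Q \<ge> 0" using D by (simp add: Q_def)
    have CQ: "C0 * 2 powr (real j * m) * Q = C * 2 powr (real j * (m + L))"
      unfolding Q_def C_def by (simp add: powr_add[symmetric] algebra_simps)
    have CQ': "ennreal (C0 * 2 powr (real j * m)) * ennreal Q = ennreal (C * 2 powr (real j * (m + L)))"
      using C0 Q by (subst ennreal_mult[symmetric]) (auto simp: CQ)
    have sup: "ennreal (norm (V q x)) \<le> ennreal (Q * A1 * A2)" for q x
      unfolding V_def Q_def
      by (rule order_trans[OF norm_triple_op_le], rule est) (use k True f g A fA gA in auto)
    have f1: "(\<integral>\<^sup>+x. ennreal (norm (V q x)) \<partial>lborel) \<le> ennreal (Q * A2) * (\<integral>\<^sup>+x. ennreal (norm (f x)) \<partial>lborel)" for q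
      unfolding V_def
    proof (rule nn_integral_triple_op_le[OF ki fm gm])
      fix h :: "'a \<Rightarrow> complex" and x b c :: 'a
      assume "integrable lborel h" "\<And>w. norm (h w) \<le> 1"
      then show "(\<integral>\<^sup>+y. ennreal (norm (ft (osc K s k1) (x - y)) * norm (piece K s k2 g (y + b)) * norm (piece K s k0 h (y + c))) \<partial>lborel) \<le> ennreal (Q * A2)"
        using est[of k1 "j + 3" k2 k0 g h A2 1 x b c] k True g A gA by (simp add: Q_def)
    qed (use fA gA in auto)
    have g1: "(\<integral>\<^sup>+x. ennreal (norm (V q x)) \<partial>lborel) \<le> ennreal (Q * A1) * (\<integral>\<^sup>+x. ennreal (norm (g x)) \<partial>lborel)" for q
      unfolding V_def triple_op_commute[of K s k0 k1 k2]
    proof (rule nn_integral_triple_op_le[OF ki gm fm])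
      fix h :: "'a \<Rightarrow> complex" and x b c :: 'a
      assume "integrable lborel h" "\<And>w. norm (h w) \<le> 1"
      then show "(\<integral>\<^sup>+y. ennreal (norm (ft (osc K s k2) (x - y)) * norm (piece K s k1 f (y + b)) * norm (piece K s k0 h (y + c))) \<partial>lborel) \<le> ennreal (Q * A1)"
        using est[of k2 "j + 3" k1 k0 f h A1 1 x b c] k True f A fA by (simp add: Q_def)
    qed (use fA gA in auto)
    have gen: "(\<integral>\<^sup>+x. ennreal (norm (local_op K s \<sigma> j k0 k1 k2 f g x)) \<partial>lborel) \<le> ennreal (C0 * 2 powr (real j * m)) * Y"
      if Y: "\<And>q. (\<integral>\<^sup>+x. ennreal (norm (V q x)) \<partial>lborel) \<le> Y" for Y
    proof -
      have "(\<integral>\<^sup>+x. ennreal (norm (local_op K s \<sigma> j k0 k1 k2 f g x)) \<partial>lborel) \<le> (\<integral>\<^sup>+x. (\<integral>\<^sup>+q. ennreal (norm (w q)) * ennreal (norm (V q x)) \<partial>lborel) \<partial>lborel)"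
        by (intro nn_integral_mono le)
      also have "\<dots> = (\<integral>\<^sup>+q. (\<integral>\<^sup>+x. ennreal (norm (w q)) * ennreal (norm (V q x)) \<partial>lborel) \<partial>lborel)"
        by (rule lborel_pair.Fubini') measurable
      also have "\<dots> = (\<integral>\<^sup>+q. ennreal (norm (w q)) * (\<integral>\<^sup>+x. ennreal (norm (V q x)) \<partial>lborel) \<partial>lborel)"
        by (intro nn_integral_cong nn_integral_cmult) measurable
      also have "\<dots> \<le> (\<integral>\<^sup>+q. ennreal (norm (w q)) * Y \<partial>lborel)"
        by (intro nn_integral_mono mult_left_mono Y) auto
      also have "\<dots> = (\<integral>\<^sup>+q. ennreal (norm (w q)) \<partial>lborel) * Y" by (rule nn_integral_multc) measurable
      also have "\<dots> \<le> ennreal (C0 * 2 powr (real j * m)) * Y" by (intro mult_right_mono wn) auto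
      finally show ?thesis .
    qed
    have "ennreal (norm (local_op K s \<sigma> j k0 k1 k2 f g x)) \<le> ennreal (C * 2 powr (real j * (m + L))) * ennreal A1 * ennreal A2" for x
    proof -
      have "ennreal (norm (local_op K s \<sigma> j k0 k1 k2 f g x)) \<le> (\<integral>\<^sup>+q. ennreal (norm (w q)) * ennreal (norm (V q x)) \<partial>lborel)" by (rule le)
      also have "\<dots> \<le> (\<integral>\<^sup>+q. ennreal (norm (w q)) * ennreal (Q * A1 * A2) \<partial>lborel)"
        by (intro nn_integral_mono mult_left_mono sup) auto
      also have "\<dots> = (\<integral>\<^sup>+q. ennreal (norm (w q)) \<partial>lborel) * ennreal (Q * A1 * A2)" by (rule nn_integral_multc) measurable
      also have "\<dots> \<le> ennreal (C0 * 2 powr (real j * m)) * ennreal (Q * A1 * A2)" by (intro mult_right_mono wn) auto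
      also have "ennreal (Q * A1 * A2) = ennreal Q * ennreal A1 * ennreal A2" using Q A by (simp add: ennreal_mult)
      finally show ?thesis unfolding CQ'[symmetric] by (simp only: mult.assoc)
    qed
    moreover have "(\<integral>\<^sup>+x. ennreal (norm (local_op K s \<sigma> j k0 k1 k2 f g x)) \<partial>lborel) \<le>
        ennreal (C * 2 powr (real j * (m + L))) * (\<integral>\<^sup>+x. ennreal (norm (f x)) \<partial>lborel) * ennreal A2"
    proof -
      have "ennreal (Q * A2) = ennreal Q * ennreal A2" using Q A by (simp add: ennreal_mult)
      then show ?thesis using gen[OF f1] unfolding CQ'[symmetric] by (simp add: mult_ac)
    qed
    moreover have "(\<integral>\<^sup>+x. ennreal (norm (local_op K s \<sigma> j k0 k1 k2 f g x)) \<partial>lborel) \<le>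
        ennreal (C * 2 powr (real j * (m + L))) * ennreal A1 * (\<integral>\<^sup>+x. ennreal (norm (g x)) \<partial>lborel)"
    proof -
      have "ennreal (Q * A1) = ennreal Q * ennreal A1" using Q A by (simp add: ennreal_mult)
      then show ?thesis using gen[OF g1] unfolding CQ'[symmetric] by (simp add: mult_ac)
    qed
    ultimately show ?thesis by blast
  qed
  show ?thesis
    using C Sb main unfolding L_def by (intro exI[of _ K] exI[of _ C] conjI) simp_all
qed

text \<open>The cubic factor counts the triples of frequencies up to j + 3. It is absorbed by half
  of the exponential decay, through t^3 <= 27 exp t.\<close>

lemma summable_cubic_powr:
  assumes "c < 0"
  shows "summable (\<lambda>j. (real j + 4) ^ 3 * 2 powr (real j * c))"
proof -
  define d where "d = - c * ln 2 / 2"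
  have "c * ln 2 < 0" using assms by (intro mult_neg_pos) auto
  then have d: "d > 0" by (simp add: d_def)
  define z where "z = exp (- d)"
  have z: "0 < z" "z < 1" using d by (auto simp: z_def)
  show ?thesis
  proof (rule summable_comparison_test')
    show "summable (\<lambda>j. 27 / d ^ 3 * exp (4 * d) * z ^ j)"
      using z by (intro summable_mult summable_geometric) auto
    fix j :: nat assume "j \<ge> 0"
    define t where "t = d * (real j + 4)"
    have t: "t \<ge> 0" using d by (simp add: t_def)
    have "t ^ 3 \<le> 27 * exp t"
    proof -
      have "t / 3 \<le> exp (t / 3)" using exp_ge_add_one_self[of "t / 3"] by linarith
      then have "(t / 3) ^ 3 \<le> exp (t / 3) ^ 3" using t by (intro power_mono) auto
      also have "exp (t / 3) ^ 3 = exp t" by (simp flip: exp_of_nat_mult)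
      finally show ?thesis by (simp add: power_divide)
    qed
    moreover have "t ^ 3 = d ^ 3 * (real j + 4) ^ 3" by (simp only: t_def power_mult_distrib)
    ultimately have "(real j + 4) ^ 3 * d ^ 3 \<le> 27 * exp t" by (simp only: mult.commute)
    then have "(real j + 4) ^ 3 \<le> 27 * exp t / d ^ 3" by (subst pos_le_divide_eq) (use d in auto)
    then have "(real j + 4) ^ 3 \<le> 27 / d ^ 3 * exp t" by simp
    moreover have pe: "2 powr (real j * c) = exp (- (2 * d * real j))" by (simp add: powr_def d_def)
    ultimately have "(real j + 4) ^ 3 * exp (- (2 * d * real j)) \<le> 27 / d ^ 3 * exp t * exp (- (2 * d * real j))"
      by (intro mult_right_mono) auto
    also have "27 / d ^ 3 * exp t * exp (- (2 * d * real j)) = 27 / d ^ 3 * (exp t * exp (- (2 * d * real j)))" by simp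
    also have "exp t * exp (- (2 * d * real j)) = exp (4 * d) * z ^ j"
      by (simp add: t_def z_def exp_of_nat_mult[symmetric] exp_add[symmetric] algebra_simps)
    finally show "norm ((real j + 4) ^ 3 * 2 powr (real j * c)) \<le> 27 / d ^ 3 * exp (4 * d) * z ^ j"
      unfolding pe by (simp add: mult_ac)
  qed
qed

definition osc_symbol :: "real \<Rightarrow> ('a::euclidean_space \<times> 'a \<Rightarrow> complex) \<Rightarrow> 'a \<times> 'a \<Rightarrow> complex"
  where "osc_symbol s \<sigma> p = cis (norm (fst p) powr s + norm (snd p) powr s + norm (fst p + snd p) powr s) * \<sigma> p"

text \<open>The operator of the statement up to its factor (2 pi)^(-2 n), with \<open>ft\<close> at
  reflected points for the Fourier transform and Borel-Lebesgue measure in place of its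
  completion.\<close>

definition full_op :: "('a::euclidean_space \<times> 'a \<Rightarrow> complex) \<Rightarrow> ('a \<Rightarrow> complex) \<Rightarrow> ('a \<Rightarrow> complex) \<Rightarrow> 'a \<Rightarrow> complex"
  where "full_op \<tau> f g x = (LINT p|lborel. cis (x \<bullet> (fst p + snd p)) * \<tau> p * ft f (- fst p) * ft g (- snd p))"

text \<open>On the support of \<open>theta K j\<close> the norms of \<xi>, \<eta> and \<xi> + \<eta>
  are below 3 * 2^j < 2^(j + 3), where the cut-offs of index up to j + 3 add up to 1. The finite
  inner sums therefore reproduce the full phase, and the sum over j telescopes.\<close>

lemma osc_theta_sum:
  fixes p :: "'a::euclidean_space \<times> 'a"
  shows "(\<Sum>j\<le>N. \<Sum>k0\<le>j+3. \<Sum>k1\<le>j+3. \<Sum>k2\<le>j+3.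
      osc K s k1 (fst p) * osc K s k2 (snd p) * osc K s k0 (fst p + snd p) * (\<sigma> p * complex_of_real (theta K j p)))
    = osc_symbol s \<sigma> p * complex_of_real (chi K ((1 / 2 ^ N) *\<^sub>R p))"
proof -
  have one: "(\<Sum>k\<le>j+3. osc K s k \<xi>) = cis (norm \<xi> powr s)" if "norm \<xi> \<le> 2 ^ (j + 3)" for j and \<xi> :: 'a
  proof -
    have "norm ((1 / 2 ^ (j + 3)) *\<^sub>R \<xi>) \<le> 1" using that by (simp add: field_simps)
    then show ?thesis unfolding osc_sum by (simp add: chi_eq_1)
  qed
  have "(\<Sum>k0\<le>j+3. \<Sum>k1\<le>j+3. \<Sum>k2\<le>j+3.
      osc K s k1 (fst p) * osc K s k2 (snd p) * osc K s k0 (fst p + snd p) * (\<sigma> p * complex_of_real (theta K j p)))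
    = osc_symbol s \<sigma> p * complex_of_real (theta K j p)" for j
  proof (cases "theta K j p = 0")
    case False
    then have np: "norm p < 3/2 * 2 ^ j" using theta_eq_0[of j p K] by force
    have n1: "norm (fst p) < 3/2 * 2 ^ j" "norm (snd p) < 3/2 * 2 ^ j"
      using np norm_fst_le[of "fst p" "snd p"] norm_snd_le[of "snd p" "fst p"] by auto
    have "norm (fst p + snd p) \<le> norm (fst p) + norm (snd p)" by (rule norm_triangle_ineq)
    then have n3: "norm (fst p) \<le> 2 ^ (j + 3)" "norm (snd p) \<le> 2 ^ (j + 3)" "norm (fst p + snd p) \<le> 2 ^ (j + 3)"
    proof -
      have "(0::real) < 2 ^ j" by simp
      moreover have "(2::real) ^ (j + 3) = 8 * 2 ^ j" by (simp add: power_add)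
      ultimately show "norm (fst p) \<le> 2 ^ (j + 3)" "norm (snd p) \<le> 2 ^ (j + 3)" "norm (fst p + snd p) \<le> 2 ^ (j + 3)"
        using n1 \<open>norm (fst p + snd p) \<le> norm (fst p) + norm (snd p)\<close> by linarith+
    qed
    have "(\<Sum>k0\<le>j+3. \<Sum>k1\<le>j+3. \<Sum>k2\<le>j+3.
      osc K s k1 (fst p) * osc K s k2 (snd p) * osc K s k0 (fst p + snd p) * (\<sigma> p * complex_of_real (theta K j p)))
      = (\<Sum>k1\<le>j+3. osc K s k1 (fst p)) * (\<Sum>k2\<le>j+3. osc K s k2 (snd p)) * (\<Sum>k0\<le>j+3. osc K s k0 (fst p + snd p)) * (\<sigma> p * complex_of_real (theta K j p))"
      by (simp only: sum_distrib_right[symmetric] sum_distrib_left[symmetric])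
    also have "\<dots> = cis (norm (fst p) powr s) * cis (norm (snd p) powr s) * cis (norm (fst p + snd p) powr s) * (\<sigma> p * complex_of_real (theta K j p))"
      unfolding one[OF n3(1)] one[OF n3(2)] one[OF n3(3)] ..
    finally show ?thesis by (simp add: osc_symbol_def cis_mult mult.assoc[symmetric])
  qed simp
  then show ?thesis by (simp flip: theta_sum add: sum_distrib_left)
qed

text \<open>The dyadic sum up to N is the operator whose symbol is cut off at 2^N. Its bounds do not
  depend on N, because m + loss is negative, and they pass to the limit by dominated convergence and
  Fatou's lemma.\<close>

theorem full_op_bounds:
  fixes \<sigma> :: "'a::euclidean_space \<times> 'a \<Rightarrow> complex"
  assumes s: "s > 0" "s \<noteq> 1" and m: "m < crit_order DIM('a) s" and \<sigma>: "\<sigma> \<in> symbol_class m"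
  shows "\<exists>A\<ge>0. \<forall>f g A1 A2. integrable lborel f \<longrightarrow> integrable lborel g \<longrightarrow> A1 > 0 \<longrightarrow> A2 > 0 \<longrightarrow> (\<forall>w. norm (f w) \<le> A1) \<longrightarrow> (\<forall>w. norm (g w) \<le> A2) \<longrightarrow>
      (\<forall>x. ennreal (norm (full_op (osc_symbol s \<sigma>) f g x)) \<le> ennreal A * ennreal A1 * ennreal A2) \<and>
      (\<integral>\<^sup>+x. ennreal (norm (full_op (osc_symbol s \<sigma>) f g x)) \<partial>lborel) \<le> ennreal A * (\<integral>\<^sup>+x. ennreal (norm (f x)) \<partial>lborel) * ennreal A2 \<and>
      (\<integral>\<^sup>+x. ennreal (norm (full_op (osc_symbol s \<sigma>) f g x)) \<partial>lborel) \<le> ennreal A * ennreal A1 * (\<integral>\<^sup>+x. ennreal (norm (g x)) \<partial>lborel)"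
proof -
  define n where "n = DIM('a)"
  have n: "n > 0" by (simp add: n_def)
  define d where "d = crit_order n s - m"
  have d: "d > 0" using m by (simp add: d_def n_def)
  \<comment> \<open>Makes 2 n e <= d/2, so that at least half of the gap between m and the critical
    order survives, and keeps s + e < 1 when s < 1.\<close>
  define e where "e = min (d / (4 * real n)) (if s < 1 then (1 - s) / 2 else 1)"
  have e: "e > 0" "s < 1 \<Longrightarrow> s + e < 1" using d n by (auto simp: e_def min_def field_simps)
  have "e \<le> d / (4 * real n)" by (simp add: e_def)
  then have "2 * real n * e \<le> d / 2" using n by (simp add: field_simps)
  then have neg: "m + loss n s e < 0" using d by (simp add: loss_def d_def)
  define c where "c = m + loss n s e"
  obtain K C where C: "C \<ge> 0" and S: "\<And>j. \<exists>S. \<forall>p. norm (\<sigma> p * complex_of_real (theta K j p)) \<le> S" and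
    lb: "\<And>j k0 k1 k2 f g A1 A2. k0 \<le> j + 3 \<Longrightarrow> k1 \<le> j + 3 \<Longrightarrow> k2 \<le> j + 3 \<Longrightarrow>
      integrable lborel f \<Longrightarrow> integrable lborel g \<Longrightarrow> A1 > 0 \<Longrightarrow> A2 > 0 \<Longrightarrow> (\<forall>w. norm (f w) \<le> A1) \<Longrightarrow> (\<forall>w. norm (g w) \<le> A2) \<Longrightarrow>
      (\<forall>x. ennreal (norm (local_op K s \<sigma> j k0 k1 k2 f g x)) \<le> ennreal (C * 2 powr (real j * c)) * ennreal A1 * ennreal A2) \<and>
      (\<integral>\<^sup>+x. ennreal (norm (local_op K s \<sigma> j k0 k1 k2 f g x)) \<partial>lborel) \<le>
        ennreal (C * 2 powr (real j * c)) * (\<integral>\<^sup>+x. ennreal (norm (f x)) \<partial>lborel) * ennreal A2 \<and>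
      (\<integral>\<^sup>+x. ennreal (norm (local_op K s \<sigma> j k0 k1 k2 f g x)) \<partial>lborel) \<le>
        ennreal (C * 2 powr (real j * c)) * ennreal A1 * (\<integral>\<^sup>+x. ennreal (norm (g x)) \<partial>lborel)"
    using local_op_bounds[OF s e \<sigma>] unfolding c_def n_def by blast
  define A where "A = (\<Sum>j. C * ((real j + 4) ^ 3 * 2 powr (real j * c)))"
  have sm: "summable (\<lambda>j. C * ((real j + 4) ^ 3 * 2 powr (real j * c)))"
    by (intro summable_mult summable_cubic_powr) (use neg in \<open>simp add: c_def\<close>)
  have A: "A \<ge> 0" unfolding A_def using C by (intro suminf_nonneg[OF sm]) auto
  have sumA: "(\<Sum>j\<le>N. \<Sum>k0\<le>j+3. \<Sum>k1\<le>j+3. \<Sum>k2\<le>j+3. ennreal (C * 2 powr (real j * c)) * Y) \<le> ennreal A * Y" for N Y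
  proof -
    have "(\<Sum>j\<le>N. \<Sum>k0\<le>j+3. \<Sum>k1\<le>j+3. \<Sum>k2\<le>j+3. ennreal (C * 2 powr (real j * c)) * Y)
      = (\<Sum>j\<le>N. ennreal (C * ((real j + 4) ^ 3 * 2 powr (real j * c))) * Y)"
    proof (intro sum.cong refl)
      fix j
      have "(\<Sum>k0\<le>j+3. \<Sum>k1\<le>j+3. \<Sum>k2\<le>j+3. ennreal (C * 2 powr (real j * c)) * Y) = (of_nat (j + 4) * of_nat (j + 4) * of_nat (j + 4)) * (ennreal (C * 2 powr (real j * c)) * Y)"
        by (simp add: mult.assoc add.commute)
      also have "(of_nat (j + 4) * of_nat (j + 4) * of_nat (j + 4) :: ennreal) = ennreal ((real j + 4) ^ 3)"
      proof -
        have "(of_nat (j + 4) :: ennreal) = ennreal (real j + 4)"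
          by (metis ennreal_of_nat_eq_real_of_nat of_nat_add of_nat_numeral)
        moreover have "ennreal t * ennreal t * ennreal t = ennreal (t ^ 3)" if "t \<ge> 0" for t
          using that by (simp add: ennreal_mult power3_eq_cube)
        ultimately show ?thesis by (simp only:)
      qed
      also have "ennreal ((real j + 4) ^ 3) * (ennreal (C * 2 powr (real j * c)) * Y) = ennreal (C * ((real j + 4) ^ 3 * 2 powr (real j * c))) * Y"
        using C by (simp add: ennreal_mult mult_ac)
      finally show "(\<Sum>k0\<le>j+3. \<Sum>k1\<le>j+3. \<Sum>k2\<le>j+3. ennreal (C * 2 powr (real j * c)) * Y) = ennreal (C * ((real j + 4) ^ 3 * 2 powr (real j * c))) * Y" .
    qed
    also have "\<dots> = ennreal (\<Sum>j\<le>N. C * ((real j + 4) ^ 3 * 2 powr (real j * c))) * Y"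
      using C by (simp add: sum_distrib_right[symmetric] sum_ennreal)
    also have "\<dots> \<le> ennreal A * Y"
      unfolding A_def using C by (intro mult_right_mono ennreal_leI sum_le_suminf[OF sm]) auto
    finally show ?thesis .
  qed
  have \<sigma>c: "continuous_on UNIV \<sigma>" using \<sigma> smooth_fun_cont by (auto simp: symbol_class_def)
  then have \<sigma>m[measurable]: "\<sigma> \<in> borel_measurable borel" by (rule borel_measurable_continuous_onI)
  have theta_meas[measurable]: "(theta K j :: 'a \<times> 'a \<Rightarrow> real) \<in> borel_measurable borel" for j
    by (rule borel_measurable_continuous_onI[OF theta_cont])
  have \<tau>m[measurable]: "osc_symbol s \<sigma> \<in> borel_measurable borel" unfolding osc_symbol_def by measurable
  have main: "(\<forall>x. ennreal (norm (full_op (osc_symbol s \<sigma>) f g x)) \<le> ennreal A * ennreal A1 * ennreal A2) \<and>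
      (\<integral>\<^sup>+x. ennreal (norm (full_op (osc_symbol s \<sigma>) f g x)) \<partial>lborel) \<le> ennreal A * (\<integral>\<^sup>+x. ennreal (norm (f x)) \<partial>lborel) * ennreal A2 \<and>
      (\<integral>\<^sup>+x. ennreal (norm (full_op (osc_symbol s \<sigma>) f g x)) \<partial>lborel) \<le> ennreal A * ennreal A1 * (\<integral>\<^sup>+x. ennreal (norm (g x)) \<partial>lborel)"
    if f: "integrable lborel f" and g: "integrable lborel g" and AA: "A1 > 0" "A2 > 0" "\<forall>w. norm (f w) \<le> A1" "\<forall>w. norm (g w) \<le> A2" for f g A1 A2
  proof -
    have fm[measurable]: "f \<in> borel_measurable borel" and gm[measurable]: "g \<in> borel_measurable borel" using f g by auto
    let ?\<tau> = "osc_symbol s \<sigma>"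
    define I where "I x p = cis (x \<bullet> (fst p + snd p)) * ?\<tau> p * ft f (- fst p) * ft g (- snd p)" for x and p :: "'a \<times> 'a"
    have Im[measurable]: "I x \<in> borel_measurable borel" for x unfolding I_def by measurable
    define TN where "TN N x = (\<Sum>j\<le>N. \<Sum>k0\<le>j+3. \<Sum>k1\<le>j+3. \<Sum>k2\<le>j+3. local_op K s \<sigma> j k0 k1 k2 f g x)" for N x
    have lom[measurable]: "local_op K s \<sigma> j k0 k1 k2 f g \<in> borel_measurable borel" for j k0 k1 k2
      unfolding local_op_def[abs_def] by measurable
    have TNm[measurable]: "TN N \<in> borel_measurable borel" for N unfolding TN_def by measurable
    define H where "H j k0 k1 k2 x p = cis (x \<bullet> (fst p + snd p)) *
      (osc K s k1 (fst p) * osc K s k2 (snd p) * osc K s k0 (fst p + snd p) * (\<sigma> p * complex_of_real (theta K j p)))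
      * ft f (- fst p) * ft g (- snd p)" for j k0 k1 k2 x and p :: "'a \<times> 'a"
    \<comment> \<open>A single block is integrable since its cut-offs have compact support and its
      symbol piece is bounded, whereas the full integrand need not be integrable for f and g as
      general as here.\<close>
    have Hi: "integrable lborel (H j k0 k1 k2 x)" for j k0 k1 k2 x
    proof -
      obtain B where B: "\<And>p. norm (\<sigma> p * complex_of_real (theta K j p)) \<le> B" using S[of j] by blast
      have "integrable lborel (\<lambda>p. (osc K s k1 (fst p) * ft f (- fst p)) * (osc K s k2 (snd p) * ft g (- snd p)))"
        by (rule integrable_lborel_prod_mult[OF integrable_mult_ft[OF osc_integrable f] integrable_mult_ft[OF osc_integrable g]])
      then have "integrable lborel (\<lambda>p. B * norm ((osc K s k1 (fst p) * ft f (- fst p)) * (osc K s k2 (snd p) * ft g (- snd p))))"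
        by (intro integrable_mult_right integrable_norm)
      then show ?thesis
      proof (rule Bochner_Integration.integrable_bound)
        show "H j k0 k1 k2 x \<in> borel_measurable lborel" unfolding H_def by measurable
        show "AE p in lborel. norm (H j k0 k1 k2 x p) \<le> norm (B * norm ((osc K s k1 (fst p) * ft f (- fst p)) * (osc K s k2 (snd p) * ft g (- snd p))))"
        proof (rule AE_I2)
          fix p :: "'a \<times> 'a"
          have B0: "B \<ge> 0" using B[of p] norm_ge_zero order_trans by blast
          have "norm (H j k0 k1 k2 x p) = (norm (osc K s k0 (fst p + snd p)) * norm (\<sigma> p * complex_of_real (theta K j p))) * norm ((osc K s k1 (fst p) * ft f (- fst p)) * (osc K s k2 (snd p) * ft g (- snd p)))"
            by (simp add: H_def norm_mult mult_ac)
          also have "\<dots> \<le> (1 * B) * norm ((osc K s k1 (fst p) * ft f (- fst p)) * (osc K s k2 (snd p) * ft g (- snd p)))"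
            by (intro mult_right_mono mult_mono norm_osc_le B) auto
          finally show "norm (H j k0 k1 k2 x p) \<le> norm (B * norm ((osc K s k1 (fst p) * ft f (- fst p)) * (osc K s k2 (snd p) * ft g (- snd p))))"
            using B0 by simp
        qed
      qed
    qed
    have TN: "TN N x = (LINT p|lborel. I x p * complex_of_real (chi K ((1 / 2 ^ N) *\<^sub>R p)))" for N x
    proof -
      have "(LINT p|lborel. I x p * complex_of_real (chi K ((1 / 2 ^ N) *\<^sub>R p))) =
        (LINT p|lborel. (\<Sum>j\<le>N. \<Sum>k0\<le>j+3. \<Sum>k1\<le>j+3. \<Sum>k2\<le>j+3. H j k0 k1 k2 x p))"
      proof (intro Bochner_Integration.integral_cong refl)
        fix p :: "'a \<times> 'a"
        have "I x p * complex_of_real (chi K ((1 / 2 ^ N) *\<^sub>R p)) = cis (x \<bullet> (fst p + snd p)) * (?\<tau> p * complex_of_real (chi K ((1 / 2 ^ N) *\<^sub>R p))) * ft f (- fst p) * ft g (- snd p)"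
          by (simp add: I_def mult_ac)
        also have "\<dots> = (\<Sum>j\<le>N. \<Sum>k0\<le>j+3. \<Sum>k1\<le>j+3. \<Sum>k2\<le>j+3. H j k0 k1 k2 x p)"
          unfolding osc_theta_sum[symmetric] H_def by (simp only: sum_distrib_left sum_distrib_right)
        finally show "I x p * complex_of_real (chi K ((1 / 2 ^ N) *\<^sub>R p)) = (\<Sum>j\<le>N. \<Sum>k0\<le>j+3. \<Sum>k1\<le>j+3. \<Sum>k2\<le>j+3. H j k0 k1 k2 x p)" .
      qed
      also have "\<dots> = TN N x"
        unfolding TN_def local_op_def H_def[symmetric]
        by (simp add: Hi)
      finally show ?thesis by simp
    qed
    have lim: "ennreal (norm (full_op ?\<tau> f g x)) \<le> liminf (\<lambda>N. ennreal (norm (TN N x)))" for x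
    proof (cases "integrable lborel (I x)")
      case True
      have "(\<lambda>N. TN N x) \<longlonglongrightarrow> (LINT p|lborel. I x p)"
        unfolding TN
      proof (rule integral_dominated_convergence[where w="\<lambda>p. norm (I x p)"])
        show "AE p in lborel. (\<lambda>N. I x p * complex_of_real (chi K ((1 / 2 ^ N) *\<^sub>R p))) \<longlonglongrightarrow> I x p"
        proof (rule AE_I2)
          fix p :: "'a \<times> 'a"
          obtain N0 where N0: "norm p < 2 ^ N0" using real_arch_pow[of 2 "norm p"] by auto
          have "chi K ((1 / 2 ^ N) *\<^sub>R p) = 1" if "N \<ge> N0" for N
          proof -
            have "(2::real) ^ N0 \<le> 2 ^ N" using that by (intro power_increasing) auto
            then have "norm p \<le> 2 ^ N" using N0 by linarith
            then show ?thesis by (intro chi_eq_1) (simp add: field_simps)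
          qed
          then show "(\<lambda>N. I x p * complex_of_real (chi K ((1 / 2 ^ N) *\<^sub>R p))) \<longlonglongrightarrow> I x p"
            by (intro tendsto_eventually eventually_sequentiallyI[of N0]) simp
        qed
        show "AE p in lborel. norm (I x p * complex_of_real (chi K ((1 / 2 ^ N) *\<^sub>R p))) \<le> norm (I x p)" for N
          by (intro AE_I2) (simp add: norm_mult chi_nonneg chi_le_1 mult_left_le)
        show "integrable lborel (\<lambda>p. norm (I x p))" using True by simp
      qed measurable
      then have "(\<lambda>N. ennreal (norm (TN N x))) \<longlonglongrightarrow> ennreal (norm (LINT p|lborel. I x p))"
        by (intro tendsto_ennrealI tendsto_norm)
      from lim_imp_Liminf[OF sequentially_bot this] show ?thesis by (simp add: full_op_def I_def)
    next
      case False \<comment> \<open>the Bochner integral of a non-integrable function is \<open>0\<close>\<close>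
      then have "full_op ?\<tau> f g x = 0" unfolding full_op_def I_def[symmetric] by (rule not_integrable_integral_eq)
      then show ?thesis by simp
    qed
    have TNle: "ennreal (norm (TN N x)) \<le> (\<Sum>j\<le>N. \<Sum>k0\<le>j+3. \<Sum>k1\<le>j+3. \<Sum>k2\<le>j+3. ennreal (norm (local_op K s \<sigma> j k0 k1 k2 f g x)))" for N x
    proof -
      have "norm (TN N x) \<le> (\<Sum>j\<le>N. \<Sum>k0\<le>j+3. \<Sum>k1\<le>j+3. \<Sum>k2\<le>j+3. norm (local_op K s \<sigma> j k0 k1 k2 f g x))"
        unfolding TN_def by (intro sum_norm_le order_refl)
      then have "ennreal (norm (TN N x)) \<le> ennreal (\<Sum>j\<le>N. \<Sum>k0\<le>j+3. \<Sum>k1\<le>j+3. \<Sum>k2\<le>j+3. norm (local_op K s \<sigma> j k0 k1 k2 f g x))" by (rule ennreal_leI)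
      then show ?thesis by (simp add: sum_ennreal sum_nonneg)
    qed
    have supb: "ennreal (norm (full_op ?\<tau> f g x)) \<le> ennreal A * ennreal A1 * ennreal A2" for x
    proof -
      have "ennreal (norm (TN N x)) \<le> ennreal A * (ennreal A1 * ennreal A2)" for N
      proof -
        have "ennreal (norm (TN N x)) \<le> (\<Sum>j\<le>N. \<Sum>k0\<le>j+3. \<Sum>k1\<le>j+3. \<Sum>k2\<le>j+3. ennreal (C * 2 powr (real j * c)) * (ennreal A1 * ennreal A2))"
          using lb[OF _ _ _ f g AA] by (intro order_trans[OF TNle] sum_mono) (simp add: mult.assoc)
        then show ?thesis using sumA order_trans by blast
      qed
      then have "liminf (\<lambda>N. ennreal (norm (TN N x))) \<le> liminf (\<lambda>N::nat. ennreal A * (ennreal A1 * ennreal A2))"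
        by (intro Liminf_mono always_eventually allI)
      then show ?thesis using lim[of x] by (simp add: Liminf_const mult.assoc)
    qed
    have l1: "(\<integral>\<^sup>+x. ennreal (norm (full_op ?\<tau> f g x)) \<partial>lborel) \<le> ennreal A * Y"
      if Y: "\<And>j k0 k1 k2. k0 \<le> j + 3 \<Longrightarrow> k1 \<le> j + 3 \<Longrightarrow> k2 \<le> j + 3 \<Longrightarrow> (\<integral>\<^sup>+x. ennreal (norm (local_op K s \<sigma> j k0 k1 k2 f g x)) \<partial>lborel) \<le> ennreal (C * 2 powr (real j * c)) * Y" for Y
    proof -
      have "(\<integral>\<^sup>+x. ennreal (norm (TN N x)) \<partial>lborel) \<le> ennreal A * Y" for N
      proof -
        have "(\<integral>\<^sup>+x. ennreal (norm (TN N x)) \<partial>lborel) \<le> (\<integral>\<^sup>+x. (\<Sum>j\<le>N. \<Sum>k0\<le>j+3. \<Sum>k1\<le>j+3. \<Sum>k2\<le>j+3. ennreal (norm (local_op K s \<sigma> j k0 k1 k2 f g x))) \<partial>lborel)"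
          by (intro nn_integral_mono TNle)
        also have "\<dots> = (\<Sum>j\<le>N. \<Sum>k0\<le>j+3. \<Sum>k1\<le>j+3. \<Sum>k2\<le>j+3. (\<integral>\<^sup>+x. ennreal (norm (local_op K s \<sigma> j k0 k1 k2 f g x)) \<partial>lborel))"
          by (simp add: nn_integral_sum del: sum_ennreal)
        also have "\<dots> \<le> (\<Sum>j\<le>N. \<Sum>k0\<le>j+3. \<Sum>k1\<le>j+3. \<Sum>k2\<le>j+3. ennreal (C * 2 powr (real j * c)) * Y)"
          by (intro sum_mono Y) auto
        also have "\<dots> \<le> ennreal A * Y" by (rule sumA)
        finally show ?thesis .
      qed
      then have "liminf (\<lambda>N. \<integral>\<^sup>+x. ennreal (norm (TN N x)) \<partial>lborel) \<le> liminf (\<lambda>N::nat. ennreal A * Y)"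
        by (intro Liminf_mono always_eventually allI)
      moreover have "(\<integral>\<^sup>+x. ennreal (norm (full_op ?\<tau> f g x)) \<partial>lborel) \<le> (\<integral>\<^sup>+x. liminf (\<lambda>N. ennreal (norm (TN N x))) \<partial>lborel)"
        by (intro nn_integral_mono lim)
      moreover have "(\<integral>\<^sup>+x. liminf (\<lambda>N. ennreal (norm (TN N x))) \<partial>lborel) \<le> liminf (\<lambda>N. \<integral>\<^sup>+x. ennreal (norm (TN N x)) \<partial>lborel)"
        by (rule nn_integral_liminf) measurable
      ultimately show ?thesis by (simp add: Liminf_const)
    qed
    have "(\<integral>\<^sup>+x. ennreal (norm (full_op ?\<tau> f g x)) \<partial>lborel) \<le> ennreal A * ((\<integral>\<^sup>+x. ennreal (norm (f x)) \<partial>lborel) * ennreal A2)"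
      using lb[OF _ _ _ f g AA] by (intro l1) (simp add: mult.assoc)
    moreover have "(\<integral>\<^sup>+x. ennreal (norm (full_op ?\<tau> f g x)) \<partial>lborel) \<le> ennreal A * (ennreal A1 * (\<integral>\<^sup>+x. ennreal (norm (g x)) \<partial>lborel))"
      using lb[OF _ _ _ f g AA] by (intro l1) (simp add: mult.assoc)
    ultimately show ?thesis using supb by (simp add: mult.assoc)
  qed
  show ?thesis using A main by (intro exI[of _ A] conjI) simp_all
qed

section \<open>The multiplier theorem\<close>

lemma schwartz_cont: "f \<in> schwartz_class \<Longrightarrow> continuous_on UNIV f"
  by (simp add: schwartz_class_def smooth_fun_cont)

lemma schwartz_decay:
  assumes "f \<in> schwartz_class"
  shows "\<exists>C. \<forall>x::'a::euclidean_space. (1 + norm x) ^ N * norm (f x) \<le> C"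
proof -
  have "\<forall>\<alpha> (N::nat). \<exists>C. \<forall>x. (1 + norm x) ^ N * norm (multi_deriv \<alpha> f x) \<le> C"
    using assms by (simp add: schwartz_class_def)
  from spec[OF spec[OF this, of "\<lambda>c. 0"], of N] show ?thesis by (simp only: multi_deriv_zero)
qed

lemma schwartz_bounded:
  assumes "f \<in> schwartz_class" obtains A where "A > 0" "\<And>x::'a::euclidean_space. norm (f x) \<le> A"
proof -
  obtain C where C: "\<And>x. norm (f x) \<le> C" using schwartz_decay[OF assms, of 0] by auto
  have "norm (f x) \<le> \<bar>C\<bar> + 1" for x using C[of x] by linarith
  then show ?thesis by (intro that[of "\<bar>C\<bar> + 1"]) auto
qed

lemma schwartz_integrable:
  fixes f :: "'a::euclidean_space \<Rightarrow> complex"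
  assumes "f \<in> schwartz_class"
  shows "integrable lborel f"
proof -
  obtain C where C: "\<And>x. (1 + norm x) ^ (2 * DIM('a)) * norm (f x) \<le> C" using schwartz_decay[OF assms] by blast
  show ?thesis
  proof (rule Bochner_Integration.integrable_bound)
    show "integrable lborel (\<lambda>x::'a. C * (1 / (1 + norm x) ^ (2 * DIM('a))))"
      using integrable_weight[where 'a='a] by (intro integrable_mult_right)
    show "f \<in> borel_measurable lborel"
      using borel_measurable_continuous_onI[OF schwartz_cont[OF assms]] by simp
    show "AE x in lborel. norm (f x) \<le> norm (C * (1 / (1 + norm x) ^ (2 * DIM('a))))"
    proof (rule AE_I2)
      fix x :: 'a
      have p: "(1 + norm x) ^ (2 * DIM('a)) > 0" by (intro zero_less_power add_pos_nonneg) auto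
      have "norm (f x) \<le> C / (1 + norm x) ^ (2 * DIM('a))"
        using C[of x] by (subst pos_le_divide_eq[OF p]) (simp add: mult.commute)
      also have "\<dots> \<le> norm (C * (1 / (1 + norm x) ^ (2 * DIM('a))))"
        using abs_ge_self[of "C / (1 + norm x) ^ (2 * DIM('a))"] by simp
      finally show "norm (f x) \<le> norm (C * (1 / (1 + norm x) ^ (2 * DIM('a))))" .
    qed
  qed
qed

lemma fourier_eq_ft:
  assumes [measurable]: "f \<in> borel_measurable borel"
  shows "fourier f \<xi> = ft f (- \<xi>)"
  unfolding fourier_def ft_def by (subst integral_completion) auto

lemma bilinear_op_eq_full_op:
  fixes f g :: "'a::euclidean_space \<Rightarrow> complex"
  assumes [measurable]: "\<tau> \<in> borel_measurable borel" "f \<in> borel_measurable borel" "g \<in> borel_measurable borel"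
  shows "bilinear_op \<tau> f g x = (1 / (2 * pi) ^ (2 * DIM('a))) *\<^sub>R full_op \<tau> f g x"
proof -
  have "(LINT (\<xi>, \<eta>)|lebesgue. cis (x \<bullet> (\<xi> + \<eta>)) * \<tau> (\<xi>, \<eta>) * fourier f \<xi> * fourier g \<eta>)
    = (LINT p|lebesgue. cis (x \<bullet> (fst p + snd p)) * \<tau> p * ft f (- fst p) * ft g (- snd p))"
    by (intro Bochner_Integration.integral_cong) (auto simp: fourier_eq_ft)
  also have "\<dots> = full_op \<tau> f g x"
    unfolding full_op_def by (rule integral_completion) measurable
  finally show ?thesis by (simp add: bilinear_op_def)
qed

lemma norm_bilinear_op_le:
  fixes f g :: "'a::euclidean_space \<Rightarrow> complex"
  assumes "\<tau> \<in> borel_measurable borel" "f \<in> borel_measurable borel" "g \<in> borel_measurable borel"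
  shows "norm (bilinear_op \<tau> f g x) \<le> norm (full_op \<tau> f g x)"
proof -
  have "(1::real) \<le> (2 * pi) ^ (2 * DIM('a))" using pi_gt3 by (intro one_le_power) simp
  moreover define c where "c = 1 / (2 * pi) ^ (2 * DIM('a))"
  ultimately have "0 \<le> c" "c \<le> 1" by simp_all
  then show ?thesis unfolding bilinear_op_eq_full_op[OF assms] c_def[symmetric]
    by (simp add: mult_left_le_one_le)
qed

lemma L1_norm_lborel:
  assumes [measurable]: "f \<in> borel_measurable borel"
  shows "L1_norm f = (\<integral>\<^sup>+x. ennreal (norm (f x)) \<partial>lborel)"
  unfolding L1_norm_def by (rule nn_integral_completion)

lemma Linf_norm_le:
  assumes [measurable]: "f \<in> borel_measurable borel" and "\<And>x. ennreal (norm (f x)) \<le> c"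
  shows "Linf_norm f \<le> c"
  unfolding Linf_norm_def
  by (rule esssup_I) (use assms in \<open>auto intro: measurable_completion\<close>)

text \<open>For continuous f the set where the norm exceeds the essential supremum is open and null,
  hence empty. This turns the essential bound into the pointwise one used by the estimates.\<close>

lemma norm_le_Linf_norm:
  fixes f :: "'a::euclidean_space \<Rightarrow> complex"
  assumes f: "continuous_on UNIV f" shows "ennreal (norm (f x)) \<le> Linf_norm f"
proof (rule ccontr)
  assume x: "\<not> ennreal (norm (f x)) \<le> Linf_norm f"
  define S where "S = {x. Linf_norm f < ennreal (norm (f x))}"
  have "open S" unfolding S_def by (intro open_Collect_less continuous_intros f continuous_on_ennreal)
  moreover have "x \<in> S" using x by (simp add: S_def not_le)
  then have "S \<noteq> {}" by blast
  ultimately have "\<not> negligible S" by (rule open_not_negligible)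
  moreover have "AE x in lebesgue. ennreal (norm (f x)) \<le> Linf_norm f" unfolding Linf_norm_def by (rule esssup_AE)
  then have "S \<in> null_sets lebesgue"
    using \<open>open S\<close> by (subst AE_iff_null_sets) (auto simp: S_def not_le elim!: eventually_mono)
  ultimately show False by (simp add: negligible_iff_null_sets)
qed

text \<open>Covers the degenerate case of a vanishing supremum norm, which the bounds with positive
  A1 and A2 leave out.\<close>

lemma full_op_eq_0:
  assumes "(\<forall>w. f w = 0) \<or> (\<forall>w. g w = 0)"
  shows "full_op \<tau> f g x = 0"
proof -
  have "ft f \<xi> = 0" if "\<forall>w. f w = 0" for f :: "'a \<Rightarrow> complex" and \<xi> using that by (simp add: ft_def)
  then show ?thesis using assms by (auto simp: full_op_def)
qed

theorem oscillating_multiplier: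
  fixes \<sigma> :: "'a::euclidean_space \<times> 'a \<Rightarrow> complex"
  assumes s: "s > 0" "s \<noteq> 1" and m: "m < crit_order DIM('a) s" and \<sigma>: "\<sigma> \<in> symbol_class m"
  shows "bilinear_multiplier Linf_norm Linf_norm Linf_norm (osc_symbol s \<sigma>)"
    and "bilinear_multiplier L1_norm Linf_norm L1_norm (osc_symbol s \<sigma>)"
    and "bilinear_multiplier Linf_norm L1_norm L1_norm (osc_symbol s \<sigma>)"
proof -
  let ?\<tau> = "osc_symbol s \<sigma>"
  have \<sigma>m[measurable]: "\<sigma> \<in> borel_measurable borel"
    using \<sigma> smooth_fun_cont by (auto simp: symbol_class_def intro!: borel_measurable_continuous_onI)
  have \<tau>m[measurable]: "?\<tau> \<in> borel_measurable borel" unfolding osc_symbol_def by measurable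
  then have \<tau>l: "?\<tau> \<in> borel_measurable lebesgue" by (simp add: measurable_completion)
  have growth: "\<exists>c>0. \<exists>L. \<forall>\<xi> \<eta>. norm (?\<tau> (\<xi>, \<eta>)) \<le> c * (1 + norm \<xi> + norm \<eta>) powr L"
  proof -
    have "\<forall>\<alpha>. \<exists>C. \<forall>\<zeta>. norm (multi_deriv \<alpha> \<sigma> \<zeta>) \<le> C * (1 + norm \<zeta>) powr (m - real (multi_order \<alpha>))"
      using \<sigma> by (simp add: symbol_class_def)
    from spec[OF this, of "\<lambda>c. 0"] obtain C where C: "\<And>\<zeta>. norm (\<sigma> \<zeta>) \<le> C * (1 + norm \<zeta>) powr m"
      by (auto simp: multi_deriv_zero multi_order_def)
    have "norm (?\<tau> (\<xi>, \<eta>)) \<le> (\<bar>C\<bar> + 1) * (1 + norm \<xi> + norm \<eta>) powr \<bar>m\<bar>" for \<xi> \<eta>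
    proof -
      have "(1 + norm (\<xi>, \<eta>)) powr m \<le> (1 + norm (\<xi>, \<eta>)) powr \<bar>m\<bar>" by (intro powr_mono) auto
      also have "\<dots> \<le> (1 + norm \<xi> + norm \<eta>) powr \<bar>m\<bar>"
        using norm_Pair_le[of \<xi> \<eta>] by (intro powr_mono2) auto
      finally have "(1 + norm (\<xi>, \<eta>)) powr m \<le> (1 + norm \<xi> + norm \<eta>) powr \<bar>m\<bar>" .
      then have "C * (1 + norm (\<xi>, \<eta>)) powr m \<le> (\<bar>C\<bar> + 1) * (1 + norm \<xi> + norm \<eta>) powr \<bar>m\<bar>"
        by (intro mult_mono) auto
      then show ?thesis using C[of "(\<xi>, \<eta>)"] by (simp add: osc_symbol_def norm_mult)
    qed
    then show ?thesis by (intro exI[of _ "\<bar>C\<bar> + 1"] conjI exI[of _ "\<bar>m\<bar>"]) auto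
  qed
  obtain A where A: "A \<ge> 0" and Ab: "\<And>f g A1 A2. integrable lborel f \<Longrightarrow> integrable lborel g \<Longrightarrow> A1 > 0 \<Longrightarrow> A2 > 0 \<Longrightarrow> (\<forall>w. norm (f w) \<le> A1) \<Longrightarrow> (\<forall>w. norm (g w) \<le> A2) \<Longrightarrow>
      (\<forall>x. ennreal (norm (full_op ?\<tau> f g x)) \<le> ennreal A * ennreal A1 * ennreal A2) \<and>
      (\<integral>\<^sup>+x. ennreal (norm (full_op ?\<tau> f g x)) \<partial>lborel) \<le> ennreal A * (\<integral>\<^sup>+x. ennreal (norm (f x)) \<partial>lborel) * ennreal A2 \<and>
      (\<integral>\<^sup>+x. ennreal (norm (full_op ?\<tau> f g x)) \<partial>lborel) \<le> ennreal A * ennreal A1 * (\<integral>\<^sup>+x. ennreal (norm (g x)) \<partial>lborel)"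
    using full_op_bounds[OF s m \<sigma>] by blast
  \<comment> \<open>The definition of a multiplier asks for a positive constant, whereas A may be
    0.\<close>
  have le: "ennreal A * a * b \<le> ennreal (A + 1) * a * b" for a b
    by (intro mult_right_mono ennreal_leI) auto
  have Sm: "f \<in> borel_measurable borel" if "f \<in> schwartz_class" for f :: "'a \<Rightarrow> complex"
    by (rule borel_measurable_continuous_onI[OF schwartz_cont[OF that]])
  have bm: "bilinear_op ?\<tau> f g \<in> borel_measurable borel" if "f \<in> schwartz_class" "g \<in> schwartz_class" for f g :: "'a \<Rightarrow> complex"
  proof -
    have [measurable]: "f \<in> borel_measurable borel" "g \<in> borel_measurable borel" using Sm that by auto
    show ?thesis
      unfolding bilinear_op_eq_full_op[OF \<tau>m Sm[OF that(1)] Sm[OF that(2)], abs_def] full_op_def by measurable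
  qed
  \<comment> \<open>A finite essential supremum is a pointwise bound by continuity; it can be 0 only
    for the zero function.\<close>
  have bnd: "\<exists>a. Linf_norm f = ennreal a \<and> (\<forall>w. norm (f w) \<le> a) \<and> (a > 0 \<or> (\<forall>w. f w = 0))"
    if "f \<in> schwartz_class" "f \<in> space_of_norm Linf_norm" for f :: "'a \<Rightarrow> complex"
  proof -
    have fin: "Linf_norm f = ennreal (enn2real (Linf_norm f))"
      using that(2) by (simp add: space_of_norm_def less_top[symmetric])
    have b: "norm (f w) \<le> enn2real (Linf_norm f)" for w
      using norm_le_Linf_norm[OF schwartz_cont[OF that(1)], of w] by (subst (asm) fin) simp
    then have "enn2real (Linf_norm f) > 0 \<or> (\<forall>w. f w = 0)"
      by (metis enn2real_nonneg less_eq_real_def norm_le_zero_iff)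
    with fin b show ?thesis by (intro exI[of _ "enn2real (Linf_norm f)"]) blast
  qed
  have L1le: "L1_norm (bilinear_op ?\<tau> f g) \<le> (\<integral>\<^sup>+x. ennreal (norm (full_op ?\<tau> f g x)) \<partial>lborel)"
    if "f \<in> schwartz_class" "g \<in> schwartz_class" for f g :: "'a \<Rightarrow> complex"
    unfolding L1_norm_lborel[OF bm[OF that]]
    by (intro nn_integral_mono ennreal_leI norm_bilinear_op_le[OF \<tau>m Sm Sm] that)
  show "bilinear_multiplier Linf_norm Linf_norm Linf_norm ?\<tau>"
    unfolding bilinear_multiplier_def
  proof (intro conjI \<tau>l growth exI[of _ "A + 1"] ballI)
    show "A + 1 > 0" using A by simp
    fix f g :: "'a \<Rightarrow> complex" assume fg: "f \<in> schwartz_class \<inter> space_of_norm Linf_norm" "g \<in> schwartz_class \<inter> space_of_norm Linf_norm"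
    obtain a where a: "Linf_norm f = ennreal a" "\<forall>w. norm (f w) \<le> a" "a > 0 \<or> (\<forall>w. f w = 0)" using bnd[of f] fg by blast
    obtain b where b: "Linf_norm g = ennreal b" "\<forall>w. norm (g w) \<le> b" "b > 0 \<or> (\<forall>w. g w = 0)" using bnd[of g] fg by blast
    have "ennreal (norm (full_op ?\<tau> f g x)) \<le> ennreal A * ennreal a * ennreal b" for x
    proof (cases "a > 0 \<and> b > 0")
      case True
      then show ?thesis using Ab[of f g a b] a b fg schwartz_integrable by blast
    next
      case False
      then show ?thesis using a b by (subst full_op_eq_0) auto
    qed
    then have "ennreal (norm (bilinear_op ?\<tau> f g x)) \<le> ennreal (A + 1) * ennreal a * ennreal b" for x
      using norm_bilinear_op_le[OF \<tau>m Sm Sm, of f g x] fg le by (meson IntD1 ennreal_leI order_trans)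
    then show "Linf_norm (bilinear_op ?\<tau> f g) \<le> ennreal (A + 1) * Linf_norm f * Linf_norm g"
      unfolding a(1) b(1) using bm fg by (intro Linf_norm_le) auto
  qed
  show "bilinear_multiplier L1_norm Linf_norm L1_norm ?\<tau>"
    unfolding bilinear_multiplier_def
  proof (intro conjI \<tau>l growth exI[of _ "A + 1"] ballI)
    show "A + 1 > 0" using A by simp
    fix f g :: "'a \<Rightarrow> complex" assume fg: "f \<in> schwartz_class \<inter> space_of_norm L1_norm" "g \<in> schwartz_class \<inter> space_of_norm Linf_norm"
    \<comment> \<open>Some pointwise bound of f, needed to apply \<open>Ab\<close>; the estimate
      then used contains the L^1 norm of f and not a.\<close>
    obtain a where a: "a > 0" "\<And>w. norm (f w) \<le> a" using schwartz_bounded[of f] fg by blast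
    obtain b where b: "Linf_norm g = ennreal b" "\<forall>w. norm (g w) \<le> b" "b > 0 \<or> (\<forall>w. g w = 0)" using bnd[of g] fg by blast
    have "(\<integral>\<^sup>+x. ennreal (norm (full_op ?\<tau> f g x)) \<partial>lborel) \<le> ennreal A * L1_norm f * ennreal b"
    proof (cases "b > 0")
      case True
      then show ?thesis unfolding L1_norm_lborel[OF Sm[OF IntD1[OF fg(1)]]]
        using Ab[of f g a b] a b(2) fg schwartz_integrable by blast
    next
      case False
      then show ?thesis using b by (subst full_op_eq_0) auto
    qed
    then show "L1_norm (bilinear_op ?\<tau> f g) \<le> ennreal (A + 1) * L1_norm f * Linf_norm g"
      unfolding b(1) using L1le[of f g] fg le by (meson IntD1 order_trans)
  qed
  show "bilinear_multiplier Linf_norm L1_norm L1_norm ?\<tau>"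
    unfolding bilinear_multiplier_def
  proof (intro conjI \<tau>l growth exI[of _ "A + 1"] ballI)
    show "A + 1 > 0" using A by simp
    fix f g :: "'a \<Rightarrow> complex" assume fg: "f \<in> schwartz_class \<inter> space_of_norm Linf_norm" "g \<in> schwartz_class \<inter> space_of_norm L1_norm"
    obtain a where a: "Linf_norm f = ennreal a" "\<forall>w. norm (f w) \<le> a" "a > 0 \<or> (\<forall>w. f w = 0)" using bnd[of f] fg by blast
    obtain b where b: "b > 0" "\<And>w. norm (g w) \<le> b" using schwartz_bounded[of g] fg by blast
    have "(\<integral>\<^sup>+x. ennreal (norm (full_op ?\<tau> f g x)) \<partial>lborel) \<le> ennreal A * ennreal a * L1_norm g"
    proof (cases "a > 0")
      case True
      then show ?thesis unfolding L1_norm_lborel[OF Sm[OF IntD1[OF fg(2)]]]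
        using Ab[of f g a b] a(2) b fg schwartz_integrable by blast
    next
      case False
      then show ?thesis using a by (subst full_op_eq_0) auto
    qed
    then show "L1_norm (bilinear_op ?\<tau> f g) \<le> ennreal (A + 1) * Linf_norm f * L1_norm g"
      unfolding a(1) using L1le[of f g] fg le by (meson IntD1 order_trans)
  qed
qed

theorem theorem1p2:
  fixes s m :: real
    and \<sigma> :: "(real ^ 'n::finite) \<times> (real ^ 'n) \<Rightarrow> complex"
  assumes "s > 0" and "s \<noteq> 1"
    and "m < crit_order CARD('n) s"
    and "\<sigma> \<in> symbol_class m"
  defines "\<tau> \<equiv> \<lambda>(\<xi>, \<eta>).
    cis (norm \<xi> powr s + norm \<eta> powr s + norm (\<xi> + \<eta>) powr s) * \<sigma> (\<xi>, \<eta>)"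
  shows "bilinear_multiplier Linf_norm Linf_norm Linf_norm \<tau> \<and>
         bilinear_multiplier L1_norm Linf_norm L1_norm \<tau> \<and>
         bilinear_multiplier Linf_norm L1_norm L1_norm \<tau>"
proof -
  have "\<tau> = osc_symbol s \<sigma>" by (auto simp: \<tau>_def osc_symbol_def)
  moreover have "m < crit_order DIM(real ^ 'n) s" using assms(3) by simp
  ultimately show ?thesis using oscillating_multiplier[OF assms(1,2) _ assms(4)] by simp
qed

end
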